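(* Let $d\ge2$, let $\boldsymbol B$ be a standard $d$-dimensional Brownian motion with independent coordinates, $\boldsymbol B(0)=\boldsymbol 0$, let $\boldsymbol\alpha\in(0,\infty)^d$ and let $\boldsymbol\mu\in\mathbb{R}^d$ satisfy $\mu_i>0$ for $1\le i\le n$ and $\mu_j\le0$ for $n+1\le j\le d$, where $1\le n\le d$. Let $\tau_u=\inf\{t\ge0:\boldsymbol B(t)-\boldsymbol\mu t>\boldsymbol\alpha u\}$, $u>0$. (i) Suppose $n<d$ and the indices are arranged so that $\frac{|\mu_{n+1}|}{\alpha_{n+1}}\le\cdots\le\frac{|\mu_d|}{\alpha_d}$. With $p$, $k_p$, $t_0$, $K$ and $\mathcal H_{I_p}$ as defined in the context, as $u\to\infty$, $$\mathbb{P}\{\exists_{t\ge0}:\boldsymbol B(t)-\boldsymbol\mu t>\boldsymbol\alpha u\}\sim\frac{\mathcal H_{I_p}}{\sqrt{(2\pi t_0)^{k_p}}}\,u^{\frac{1-k_p}{2}}\,e^{-\frac{1}{2t_0}\sum_{j=1}^{k_p}(\alpha_j+\mu_jt_0)^2u}\int_{\mathbb{R}}e^{-\frac{\sum_{j=1}^{k_p}\alpha_j^2}{2t_0^3}x^2}\prod_{i\in K}\Psi\Big(\frac{\mu_i}{\sqrt{t_0}}x\Big)dx,$$ and for every $s\in\mathbb{R}$ $$\lim_{u\to\infty}\mathbb{P}\Big\{\frac{\tau_u-t_0u}{\sqrt{t_0^3(\sum_{j=1}^{k_p}\alpha_j^2)^{-1}u}}\le s\ \Big|\ \tau_u<\infty\Big\}=\frac{\int_{-\infty}^se^{-x^2/2}\prod_{i\in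 K}\Psi\big(\mu_it_0(\sum_{j=1}^{k_p}\alpha_j^2)^{-1/2}x\big)dx}{\int_{-\infty}^\infty e^{-x^2/2}\prod_{i\in K}\Psi\big(\mu_it_0(\sum_{j=1}^{k_p}\alpha_j^2)^{-1/2}x\big)dx}.$$ (ii) If $n=d$, then both relations hold with $k_p$ replaced by $d$, $I_p$ replaced by $\{1,\dots,d\}$, $t_0=\sqrt{\sum_{j=1}^d\alpha_j^2/\sum_{j=1}^d\mu_j^2}$ and $K=\emptyset$.
   Context: Vector inequalities are componentwise; $\boldsymbol a_I=(a_i)_{i\in I}$; $f\sim h$ means $f/h\to1$; $\Psi=1-\Phi$ with $\Phi$ the standard normal distribution function; a product over the empty set equals $1$; $\inf\emptyset=\infty$. For $n<d$: let $d=k_1>k_2>\cdots>k_l>k_{l+1}=n$ be such that for each $i=1,\dots,l$ the ratio $|\mu_j|/\alpha_j$ is constant over $k_{i+1}<j\le k_i$ and $\frac{|\mu_{k_l}|}{\alpha_{k_l}}<\frac{|\mu_{k_{l-1}}|}{\alpha_{k_{l-1}}}<\cdots<\frac{|\mu_{k_1}|}{\alpha_{k_1}}$. Put $t_0'=0$, $t_i'=\alpha_{k_i}/|\mu_{k_i}|$ for $i=1,\dots,l$ (with value $\infty$ if $\mu_{k_i}=0$), $t_{l+1}'=\infty$, and $I_i=\{1,\dots,k_i\}$, $i=1,\dots,l+1$. Let $t_0(i)=\sqrt{\sum_{j=1}^{k_i}\alpha_j^2/\sum_{j=1}^{k_i}\mu_j^2}$, $p=\min\{i\in\{1,\dots,l+1\}:t_{i-1}'\le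 t_0(i)<t_i'\}$, and $t_0=t_0(p)$. Set $K=\emptyset$ if $t_{p-1}'<t_0(p)<t_p'$, and $K=\{k_p+1,\dots,k_{p-1}\}$ if $t_{p-1}'=t_0(p)$. The constant is $$\mathcal H_{I_p}=\lim_{T\to\infty}\frac1T\int_{\mathbb{R}^{k_p}}e^{\sum_{j=1}^{k_p}(\alpha_jt_0^{-1}+\mu_j)x_j}\,\mathbb{P}\{\exists_{t\in[0,T]}:(\boldsymbol B(t)-\boldsymbol\mu t)_{I_p}>\boldsymbol x_{I_p}\}\,d\boldsymbol x_{I_p}$$ (and, in case (ii), the same expression with $k_p=d$, $I_p=\{1,\dots,d\}$). *)

theory Defs
  imports "HOL-Probability.Probability" "HOL-Library.Landau_Symbols"
begin

definition standard_BM :: "'w measure \<Rightarrow> (real \<Rightarrow> 'w \<Rightarrow> real) \<Rightarrow> bool" where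
  "standard_BM M W \<longleftrightarrow>
     prob_space M \<and>
     (\<forall>t\<ge>0. W t \<in> borel_measurable M) \<and>
     (\<forall>\<omega>\<in>space M. W 0 \<omega> = 0) \<and>
     (\<forall>\<omega>\<in>space M. continuous_on {0..} (\<lambda>t. W t \<omega>)) \<and>
     (\<forall>s t. 0 \<le> s \<and> s < t \<longrightarrow>
        distributed M lborel (\<lambda>\<omega>. W t \<omega> - W s \<omega>) (normal_density 0 (sqrt (t - s)))) \<and>
     (\<forall>m (t :: nat \<Rightarrow> real). 0 \<le> t 0 \<and> (\<forall>i<m. t i < t (Suc i)) \<longrightarrow>
        prob_space.indep_vars M (\<lambda>_. borel) (\<lambda>i \<omega>. W (t (Suc i)) \<omega> - W (t i) \<omega>) {..<m})"

text \<open>Vectors in $R^d$ are functions on \<^typ>\<open>nat\<close> of which only the values at the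
  indices $1,\dots,d$ matter, so that the leading $k$ coordinates can be selected for a
  variable $k$.  The coordinates are independent as processes, i.e. as random elements of the
  path space with index set $[0,\infty)$.\<close>

definition standard_BM_vec :: "'w measure \<Rightarrow> nat \<Rightarrow> (real \<Rightarrow> 'w \<Rightarrow> nat \<Rightarrow> real) \<Rightarrow> bool" where
  "standard_BM_vec M d B \<longleftrightarrow>
     (\<forall>j\<in>{1..d}. standard_BM M (\<lambda>t \<omega>. B t \<omega> j)) \<and>
     prob_space.indep_vars M (\<lambda>_. Pi\<^sub>M {0..} (\<lambda>_. borel))
       (\<lambda>j \<omega>. \<lambda>t\<in>{0..}. B t \<omega> j) {1..d}"

definition hit :: "(real \<Rightarrow> 'w \<Rightarrow> nat \<Rightarrow> real) \<Rightarrow> nat \<Rightarrow> (nat \<Rightarrow> real) \<Rightarrow> (nat \<Rightarrow> real) \<Rightarrow> real \<Rightarrow> 'w \<Rightarrow> bool"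
  where "hit B k \<mu> x t \<omega> \<longleftrightarrow> (\<forall>j\<in>{1..k}. B t \<omega> j - \<mu> j * t > x j)"

definition ruin_prob ::
    "'w measure \<Rightarrow> (real \<Rightarrow> 'w \<Rightarrow> nat \<Rightarrow> real) \<Rightarrow> nat \<Rightarrow> (nat \<Rightarrow> real) \<Rightarrow> (nat \<Rightarrow> real) \<Rightarrow> real \<Rightarrow> real"
  where "ruin_prob M B d \<alpha> \<mu> u =
     \<P>(\<omega> in M. \<exists>t\<ge>0. hit B d \<mu> (\<lambda>j. \<alpha> j * u) t \<omega>)"

text \<open>The infimum is taken in \<^typ>\<open>ereal\<close>, so that it is $\infty$ on the empty set.\<close>

definition ruin_time ::
    "(real \<Rightarrow> 'w \<Rightarrow> nat \<Rightarrow> real) \<Rightarrow> nat \<Rightarrow> (nat \<Rightarrow> real) \<Rightarrow> (nat \<Rightarrow> real) \<Rightarrow> real \<Rightarrow> 'w \<Rightarrow> ereal"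
  where "ruin_time B d \<alpha> \<mu> u \<omega> =
     Inf (ereal ` {t. 0 \<le> t \<and> hit B d \<mu> (\<lambda>j. \<alpha> j * u) t \<omega>})"

definition ratio_blocks ::
    "nat \<Rightarrow> nat \<Rightarrow> (nat \<Rightarrow> real) \<Rightarrow> (nat \<Rightarrow> real) \<Rightarrow> nat \<Rightarrow> (nat \<Rightarrow> nat) \<Rightarrow> bool" where
  "ratio_blocks n d \<alpha> \<mu> l k \<longleftrightarrow>
     1 \<le> l \<and> k 1 = d \<and> k (l + 1) = n \<and>
     (\<forall>i\<in>{1..l}. k (i + 1) < k i) \<and>
     (\<forall>i\<in>{1..l}. \<forall>j\<in>{k (i + 1)<..k i}. \<bar>\<mu> j\<bar> / \<alpha> j = \<bar>\<mu> (k i)\<bar> / \<alpha> (k i)) \<and>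
     (\<forall>i\<in>{1..<l}. \<bar>\<mu> (k (i + 1))\<bar> / \<alpha> (k (i + 1)) < \<bar>\<mu> (k i)\<bar> / \<alpha> (k i))"

definition t_opt :: "(nat \<Rightarrow> real) \<Rightarrow> (nat \<Rightarrow> real) \<Rightarrow> nat \<Rightarrow> real" where
  "t_opt \<alpha> \<mu> m = sqrt ((\<Sum>j=1..m. (\<alpha> j)\<^sup>2) / (\<Sum>j=1..m. (\<mu> j)\<^sup>2))"

definition t_crit ::
    "(nat \<Rightarrow> real) \<Rightarrow> (nat \<Rightarrow> real) \<Rightarrow> nat \<Rightarrow> (nat \<Rightarrow> nat) \<Rightarrow> nat \<Rightarrow> ereal" where
  "t_crit \<alpha> \<mu> l k i =
     (if i = 0 then 0
      else if i \<le> l \<and> \<mu> (k i) \<noteq> 0 then ereal (\<alpha> (k i) / \<bar>\<mu> (k i)\<bar>)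
      else \<infinity>)"

definition p_idx :: "(nat \<Rightarrow> real) \<Rightarrow> (nat \<Rightarrow> real) \<Rightarrow> nat \<Rightarrow> (nat \<Rightarrow> nat) \<Rightarrow> nat" where
  "p_idx \<alpha> \<mu> l k =
     Min {i \<in> {1..l + 1}.
            t_crit \<alpha> \<mu> l k (i - 1) \<le> ereal (t_opt \<alpha> \<mu> (k i)) \<and>
            ereal (t_opt \<alpha> \<mu> (k i)) < t_crit \<alpha> \<mu> l k i}"

definition K_set :: "(nat \<Rightarrow> real) \<Rightarrow> (nat \<Rightarrow> real) \<Rightarrow> nat \<Rightarrow> (nat \<Rightarrow> nat) \<Rightarrow> nat set" where
  "K_set \<alpha> \<mu> l k =
     (let p = p_idx \<alpha> \<mu> l k in
        if t_crit \<alpha> \<mu> l k (p - 1) = ereal (t_opt \<alpha> \<mu> (k p))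
        then {k p + 1..k (p - 1)} else {})"

text \<open>Here and below, \<open>m\<close> is the number of leading coordinates that are used.\<close>

definition H_quot ::
    "'w measure \<Rightarrow> (real \<Rightarrow> 'w \<Rightarrow> nat \<Rightarrow> real) \<Rightarrow> (nat \<Rightarrow> real) \<Rightarrow> (nat \<Rightarrow> real) \<Rightarrow> real \<Rightarrow> nat \<Rightarrow> real \<Rightarrow> ennreal"
  where "H_quot M B \<alpha> \<mu> t0 m T =
     (\<integral>\<^sup>+ x. ennreal (exp (\<Sum>j=1..m. (\<alpha> j / t0 + \<mu> j) * x j) *
                   \<P>(\<omega> in M. \<exists>t\<in>{0..T}. hit B m \<mu> x t \<omega>))
        \<partial>Pi\<^sub>M {1..m} (\<lambda>_. lborel)) / ennreal T"

definition H_const ::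
    "'w measure \<Rightarrow> (real \<Rightarrow> 'w \<Rightarrow> nat \<Rightarrow> real) \<Rightarrow> (nat \<Rightarrow> real) \<Rightarrow> (nat \<Rightarrow> real) \<Rightarrow> real \<Rightarrow> nat \<Rightarrow> real"
  where "H_const M B \<alpha> \<mu> t0 m = enn2real (Lim at_top (H_quot M B \<alpha> \<mu> t0 m))"

definition Psi :: "real \<Rightarrow> real" where
  "Psi x = 1 - cdf std_normal_distribution x"

definition ruin_approx ::
    "real \<Rightarrow> (nat \<Rightarrow> real) \<Rightarrow> (nat \<Rightarrow> real) \<Rightarrow> real \<Rightarrow> nat \<Rightarrow> nat set \<Rightarrow> real \<Rightarrow> real" where
  "ruin_approx H \<alpha> \<mu> t0 m K u =
     H / sqrt ((2 * pi * t0) ^ m) * u powr ((1 - real m) / 2) *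
     exp (- (1 / (2 * t0)) * (\<Sum>j=1..m. (\<alpha> j + \<mu> j * t0)\<^sup>2) * u) *
     (LBINT x. exp (- ((\<Sum>j=1..m. (\<alpha> j)\<^sup>2) / (2 * t0 ^ 3)) * x\<^sup>2) *
                 (\<Prod>i\<in>K. Psi (\<mu> i / sqrt t0 * x)))"

definition limit_weight ::
    "(nat \<Rightarrow> real) \<Rightarrow> (nat \<Rightarrow> real) \<Rightarrow> real \<Rightarrow> nat \<Rightarrow> nat set \<Rightarrow> real \<Rightarrow> real" where
  "limit_weight \<alpha> \<mu> t0 m K x =
     exp (- x\<^sup>2 / 2) * (\<Prod>i\<in>K. Psi (\<mu> i * t0 / sqrt (\<Sum>j=1..m. (\<alpha> j)\<^sup>2) * x))"

definition limit_cdf ::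
    "(nat \<Rightarrow> real) \<Rightarrow> (nat \<Rightarrow> real) \<Rightarrow> real \<Rightarrow> nat \<Rightarrow> nat set \<Rightarrow> real \<Rightarrow> real" where
  "limit_cdf \<alpha> \<mu> t0 m K s =
     (LBINT x:{..s}. limit_weight \<alpha> \<mu> t0 m K x) / (LBINT x. limit_weight \<alpha> \<mu> t0 m K x)"

definition scaled_ruin_time_cdf ::
    "'w measure \<Rightarrow> (real \<Rightarrow> 'w \<Rightarrow> nat \<Rightarrow> real) \<Rightarrow> nat \<Rightarrow> (nat \<Rightarrow> real) \<Rightarrow> (nat \<Rightarrow> real) \<Rightarrow> real \<Rightarrow> nat \<Rightarrow> real \<Rightarrow> real \<Rightarrow> real"
  where "scaled_ruin_time_cdf M B d \<alpha> \<mu> t0 m s u =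
     \<P>(\<omega> in M.
        (ruin_time B d \<alpha> \<mu> u \<omega> - ereal (t0 * u)) /
          ereal (sqrt (t0 ^ 3 / (\<Sum>j=1..m. (\<alpha> j)\<^sup>2) * u)) \<le> ereal s
        \<bar> ruin_time B d \<alpha> \<mu> u \<omega> < \<infinity>)"

text \<open>The first two conjuncts make explicit that the limit defining the constant exists and is
  positive and finite; without them \<^const>\<open>Lim\<close> and \<^const>\<open>enn2real\<close> would only give junk
  values.  Positivity also rules out the $0/0$ convention of \<^const>\<open>asymp_equiv\<close>.\<close>

definition ruin_asymptotics ::
    "'w measure \<Rightarrow> (real \<Rightarrow> 'w \<Rightarrow> nat \<Rightarrow> real) \<Rightarrow> nat \<Rightarrow> (nat \<Rightarrow> real) \<Rightarrow> (nat \<Rightarrow> real) \<Rightarrow> real \<Rightarrow> nat \<Rightarrow> nat set \<Rightarrow> bool"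
  where "ruin_asymptotics M B d \<alpha> \<mu> t0 m K \<longleftrightarrow>
     (H_quot M B \<alpha> \<mu> t0 m \<longlongrightarrow> ennreal (H_const M B \<alpha> \<mu> t0 m)) at_top \<and>
     0 < H_const M B \<alpha> \<mu> t0 m \<and>
     ruin_prob M B d \<alpha> \<mu> \<sim>[at_top] ruin_approx (H_const M B \<alpha> \<mu> t0 m) \<alpha> \<mu> t0 m K"

end

theory Submission
  imports Defs
begin

text \<open>Write \<open>X(t) = B(t) - \<mu> t\<close> and let \<open>\<lambda>\<^sub>j = \<alpha>\<^sub>j / t\<^sub>0 + \<mu>\<^sub>j\<close> for the \<open>m\<close> leading
  (active) coordinates.  The choice of \<open>t\<^sub>0\<close> makes \<open>exp (\<lambda> \<bullet> X(t))\<close> a martingale, so that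
  integrating the probability of a path event against \<open>exp (\<lambda> \<bullet> x) dx\<close> over the starting
  points \<open>- x\<close> gives a functional \<open>V\<close> that is invariant under time shifts.  Hence
  \<open>V(hit in (0, S + T)) - V(hit in (0, S))\<close> is the \<open>V\<close>-mass of a hit in \<open>(0, T)\<close> without a hit
  in \<open>(T, S + T)\<close>, which decreases in \<open>S\<close>; the limit for \<open>T = 1\<close> is the constant \<open>H\<close>, and
  \<open>V(hit in (0, T)) / T\<close> tends to \<open>H\<close> by Cesaro means.

  By the Markov property at time \<open>s\<close>, the probability of a hit in \<open>(s, s + T)\<close> is the integral over
  the position \<open>\<alpha> u - x\<close> of the Gaussian density times the probability that the corner \<open>x\<close> is hit
  in \<open>(0, T)\<close>.  For \<open>s = t\<^sub>0 u + y \<surd>u\<close> the suitably normalised density converges to a multiple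
  of \<open>exp (\<lambda> \<bullet> x - c y\<^sup>2)\<close>, and it is dominated uniformly in \<open>u\<close> by an integrable function of
  \<open>(x, y)\<close>; the remaining coordinates contribute the factors \<open>\<Psi>\<close> in the limit.  Averaging over
  \<open>s\<close> bounds the ruin probability from above by \<open>V(hit in (0, T)) / T\<close>, because every hit lies in
  windows of total measure \<open>T\<close>, and from below by the \<open>V\<close>-mass of a hit in \<open>(0, 1)\<close> without a
  later hit, because the windows that contain a last hit have total measure at most \<open>1\<close>.
  Both bounds agree as \<open>T\<close> tends to infinity, so no double sum has to be estimated.\<close>

section \<open>The Markov property of Brownian paths\<close>

text \<open>\<open>t0\<close> minimises (1/t) sum_j (\<alpha>_j + \<mu>_j t)^2 over t > 0, and
  stationarity reads sum_j \<alpha>_j^2 = t0^2 sum_j \<mu>_j^2. This balance acts twice: it is the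
  martingale condition for the exponential of \<open>\<lambda> \<bullet> X(t)\<close>, and it
  cancels the constant terms when the Gaussian density at the window start is rewritten in x, for
  every y and not only for y = 0. The obstacle is a majorant in (x, y) that does not depend on u.
  Gaussian decay in y is not uniform, because the variance s = t0 u + y sqrt u moves with y. The
  weaker factor 1 / (1 + y^2) is uniform, at the price of exp(eps |x_1|). With eps = \<lambda>_1 /
  2, half of the tilt remains for x_1 near minus infinity; near plus infinity the hitting
  probability beats every exponential, by the maximal inequality. Positivity of H cannot be read off
  from the mass of last hits. It comes from linear growth of V(hit in (0, T)), tested on a sparse
  lattice of times at which the overlaps sum to at most half of the total; the decay of the overlaps
  uses the drift \<mu>_1 > 0.\<close>

lemma standard_BM_D:
  assumes "standard_BM M W"
  shows "prob_space M" and "\<And>t. 0 \<le> t \<Longrightarrow> W t \<in> borel_measurable M"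
    and "\<And>\<omega>. \<omega> \<in> space M \<Longrightarrow> W 0 \<omega> = 0"
    and "\<And>\<omega>. \<omega> \<in> space M \<Longrightarrow> continuous_on {0..} (\<lambda>t. W t \<omega>)"
    and "\<And>s t. 0 \<le> s \<Longrightarrow> s < t \<Longrightarrow>
      distributed M lborel (\<lambda>\<omega>. W t \<omega> - W s \<omega>) (normal_density 0 (sqrt (t - s)))"
    and "\<And>m (t :: nat \<Rightarrow> real). 0 \<le> t 0 \<Longrightarrow> (\<And>i. i < m \<Longrightarrow> t i < t (Suc i)) \<Longrightarrow>
      prob_space.indep_vars M (\<lambda>_. borel) (\<lambda>i \<omega>. W (t (Suc i)) \<omega> - W (t i) \<omega>) {..<m}"
  using assms unfolding standard_BM_def by auto

text \<open>The same sigma-algebra as in \<open>standard_BM_vec\<close>. It carries no continuity,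
  and its events depend on countably many times only, so hitting events enter through a countable
  dense set of times.\<close>

definition path_space :: "(real \<Rightarrow> real) measure" where
  "path_space = Pi\<^sub>M {0..} (\<lambda>_. borel)"

text \<open>Brings the times of a cylinder set into the shape demanded by the independence clause of
  \<open>standard_BM\<close>. Time 0 is included because positions are recovered by summing
  increments from there.\<close>

lemma finite_pos_enumerate:
  fixes F :: "real set"
  assumes "finite F" "\<And>x. x \<in> F \<Longrightarrow> 0 < x"
  obtains N and t :: "nat \<Rightarrow> real" where "t 0 = 0" "\<And>i. i < N \<Longrightarrow> t i < t (Suc i)"
    "F \<union> {0} = t ` {..N}"
proof -
  define xs where "xs = sorted_list_of_set (insert 0 F)"
  have srt: "sorted_wrt (<) xs" and st: "set xs = insert 0 F"
    unfolding xs_def using assms by (auto simp del: sorted_list_of_set_insert_remove)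
  have ne: "xs \<noteq> []" using st by auto
  define N where "N = length xs - 1"
  have len: "length xs = Suc N" using ne by (simp add: N_def)
  have "xs ! 0 = 0"
  proof (rule ccontr)
    assume a: "xs ! 0 \<noteq> 0"
    from st obtain i where i: "i < length xs" "xs ! i = 0" by (metis in_set_conv_nth insertI1)
    with a have "0 < i" by (cases i) auto
    with srt i have "xs ! 0 < 0" by (metis sorted_wrt_nth_less)
    moreover have "xs ! 0 \<in> insert 0 F" using st ne by (metis length_greater_0_conv nth_mem)
    ultimately show False using assms(2) by force
  qed
  moreover have "xs ! i < xs ! Suc i" if "i < N" for i
    using srt that len by (simp add: sorted_wrt_nth_less)
  moreover have "F \<union> {0} = (!) xs ` {..N}"
  proof -
    have "set xs = (!) xs ` {..N}" using len by (auto simp: set_conv_nth less_Suc_eq_le)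
    then show ?thesis using st by auto
  qed
  ultimately show ?thesis using that[of "(!) xs" N] by auto
qed

text \<open>One use of the independence clause on the grid 0, s, s + t 1, ... separates
  \<open>W s\<close> from the later increments, whose laws depend only on the grid spacings.
  \<open>D\<close> and \<open>g\<close> leave open how the N(0, s) variable is realised, because
  later uses integrate over different coordinates.\<close>

lemma BM_increments_after:
  assumes W: "standard_BM M W" and s: "0 < s" and D: "prob_space D" and g: "g \<in> borel_measurable D"
    and Dg: "distr D borel g = density lborel (normal_density 0 (sqrt s))"
    and t: "t 0 = 0" "\<And>i. i < N \<Longrightarrow> t i < t (Suc i)"
    and A: "\<And>i. A i \<in> sets (borel :: real measure)"
  shows "emeasure M {\<omega>\<in>space M. W s \<omega> \<in> A 0 \<and> (\<forall>i<N. W (s + t (Suc i)) \<omega> - W (s + t i) \<omega> \<in> A (Suc i))}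
    = emeasure (D \<Otimes>\<^sub>M M) {x\<in>space (D \<Otimes>\<^sub>M M). g (fst x) \<in> A 0 \<and>
         (\<forall>i<N. W (t (Suc i)) (snd x) - W (t i) (snd x) \<in> A (Suc i))}"
proof -
  interpret prob_space M using standard_BM_D[OF W] by auto
  interpret D: prob_space D by fact
  note [measurable] = g A
  note dist = standard_BM_D(5)[OF W]
  have tpos: "0 \<le> t i" if "i \<le> N" for i
    using that
  proof (induction i)
    case (Suc i) then show ?case using t(2)[of i] by simp
  qed (simp add: t)
  have [measurable]: "W (t i) \<in> borel_measurable M" "W (s + t i) \<in> borel_measurable M" if "i \<le> N" for i
    using standard_BM_D(2)[OF W] tpos[OF that] s by auto
  \<comment> \<open>\<open>\<sigma>\<close> prepends time 0 to the shifted grid; as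
    \<open>t 0 = 0\<close> and the path starts at 0, \<open>X 0\<close> is \<open>W s\<close>
    itself.\<close>
  define \<sigma> where "\<sigma> i = (case i of 0 \<Rightarrow> 0 | Suc j \<Rightarrow> s + t j)" for i
  define X where "X = (\<lambda>i \<omega>. W (\<sigma> (Suc i)) \<omega> - W (\<sigma> i) \<omega>)"
  define Y where "Y = (\<lambda>i \<omega>. W (t (Suc i)) \<omega> - W (t i) \<omega>)"
  have \<sigma>: "\<sigma> i < \<sigma> (Suc i)" if "i < Suc N" for i
    using that t s by (auto simp: \<sigma>_def split: nat.splits)
  have indX: "indep_vars (\<lambda>_. borel) X {..<Suc N}"
    unfolding X_def by (rule standard_BM_D(6)[OF W]) (auto simp: \<sigma> \<sigma>_def[of 0])
  have indY: "indep_vars (\<lambda>_. borel) Y {..<N}"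
    unfolding Y_def by (rule standard_BM_D(6)[OF W]) (auto simp: t)
  have [measurable]: "X i \<in> borel_measurable M" if "i < Suc N" for i
    using indX that unfolding indep_vars_def by auto
  have [measurable]: "Y i \<in> borel_measurable M" if "i < N" for i
    using indY that unfolding indep_vars_def by auto
  have XY: "prob (X (Suc i) -` A (Suc i) \<inter> space M) = prob (Y i -` A (Suc i) \<inter> space M)" if i: "i < N" for i
  proof -
    have eqd: "t (Suc i) - t i = (s + t (Suc i)) - (s + t i)" by simp
    have a: "distributed M lborel (Y i) (normal_density 0 (sqrt (t (Suc i) - t i)))"
      unfolding Y_def using i by (intro dist) (auto simp: tpos t)
    have "distributed M lborel (\<lambda>\<omega>. W (s + t (Suc i)) \<omega> - W (s + t i) \<omega>)
        (normal_density 0 (sqrt ((s + t (Suc i)) - (s + t i))))"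
      using i s tpos[of i] by (intro dist) (auto simp: t)
    then have b: "distributed M lborel (X (Suc i)) (normal_density 0 (sqrt (t (Suc i) - t i)))"
      by (simp add: X_def \<sigma>_def)
    have "emeasure M (X (Suc i) -` A (Suc i) \<inter> space M) = emeasure M (Y i -` A (Suc i) \<inter> space M)"
      using A by (simp add: distributed_emeasure[OF a] distributed_emeasure[OF b])
    then show ?thesis by (simp add: measure_def)
  qed
  have W0: "W 0 \<omega> = 0" if "\<omega> \<in> space M" for \<omega> using standard_BM_D(3)[OF W] that .
  have X0: "prob (X 0 -` A 0 \<inter> space M) = measure D (g -` A 0 \<inter> space D)"
  proof -
    have b: "distributed M lborel (X 0) (normal_density 0 (sqrt s))"
      unfolding X_def using dist[of 0 s] s by (simp add: \<sigma>_def t)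
    have "emeasure M (X 0 -` A 0 \<inter> space M) = emeasure (distr D borel g) (A 0)"
      using A by (simp add: distributed_emeasure[OF b] Dg emeasure_density)
    then show ?thesis by (simp add: measure_def emeasure_distr)
  qed
  have set1: "{\<omega>\<in>space M. W s \<omega> \<in> A 0 \<and> (\<forall>i<N. W (s + t (Suc i)) \<omega> - W (s + t i) \<omega> \<in> A (Suc i))}
     = (\<Inter>i\<in>{..<Suc N}. X i -` A i \<inter> space M)"
    unfolding lessThan_Suc_eq_insert_0
    by (auto simp: X_def \<sigma>_def t W0)
  have "prob (\<Inter>i\<in>{..<Suc N}. X i -` A i \<inter> space M) = (\<Prod>i<Suc N. prob (X i -` A i \<inter> space M))"
    by (rule indep_varsD_finite[OF indX]) auto
  also have "\<dots> = measure D (g -` A 0 \<inter> space D) * (\<Prod>i<N. prob (Y i -` A (Suc i) \<inter> space M))"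
    unfolding prod.lessThan_Suc_shift X0 by (intro arg_cong2[where f="(*)"] refl prod.cong XY) auto
  also have "(\<Prod>i<N. prob (Y i -` A (Suc i) \<inter> space M)) = prob {\<omega>\<in>space M. \<forall>i<N. Y i \<omega> \<in> A (Suc i)}"
  proof (cases "N = 0")
    case True then show ?thesis by (simp add: prob_space)
  next
    case False
    have "(\<Prod>i<N. prob (Y i -` A (Suc i) \<inter> space M)) = prob (\<Inter>i\<in>{..<N}. Y i -` A (Suc i) \<inter> space M)"
      by (rule indep_varsD_finite[OF indY, symmetric]) (use False in auto)
    also have "(\<Inter>i\<in>{..<N}. Y i -` A (Suc i) \<inter> space M) = {\<omega>\<in>space M. \<forall>i<N. Y i \<omega> \<in> A (Suc i)}"
      using False by auto
    finally show ?thesis .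
  qed
  finally have 1: "prob {\<omega>\<in>space M. W s \<omega> \<in> A 0 \<and> (\<forall>i<N. W (s + t (Suc i)) \<omega> - W (s + t i) \<omega> \<in> A (Suc i))}
    = measure D (g -` A 0 \<inter> space D) * prob {\<omega>\<in>space M. \<forall>i<N. Y i \<omega> \<in> A (Suc i)}"
    unfolding set1 .
  have set2: "{x\<in>space (D \<Otimes>\<^sub>M M). g (fst x) \<in> A 0 \<and> (\<forall>i<N. W (t (Suc i)) (snd x) - W (t i) (snd x) \<in> A (Suc i))}
    = (g -` A 0 \<inter> space D) \<times> {\<omega>\<in>space M. \<forall>i<N. Y i \<omega> \<in> A (Suc i)}"
    by (auto simp: space_pair_measure Y_def)
  have [measurable]: "{\<omega>\<in>space M. \<forall>i<N. Y i \<omega> \<in> A (Suc i)} \<in> sets M"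
  proof -
    have "{\<omega>\<in>space M. \<forall>i\<in>{..<N}. Y i \<omega> \<in> A (Suc i)} \<in> sets M"
      by (intro sets.sets_Collect_finite_All) auto
    then show ?thesis by simp
  qed
  show ?thesis
    unfolding set2
    by (subst emeasure_pair_measure_Times) (auto simp: 1 emeasure_eq_measure D.emeasure_eq_measure ennreal_mult)
qed

text \<open>Cylinders determine a finite measure on the path space. A cylinder constrains positions
  at finitely many times; these are partial sums of increments, and the joint law of the increments
  is fixed by rectangles, which \<open>BM_increments_after\<close> handles.\<close>

lemma BM_Markov_path:
  assumes W: "standard_BM M W" and s: "0 < s" and D: "prob_space D" and g[measurable]: "g \<in> borel_measurable D"
    and Dg: "distr D borel g = density lborel (normal_density 0 (sqrt s))"
  shows "distr M path_space (\<lambda>\<omega>. \<lambda>t\<in>{0..}. W (s + t) \<omega>) =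
    distr (D \<Otimes>\<^sub>M M) path_space (\<lambda>x. \<lambda>t\<in>{0..}. g (fst x) + W t (snd x))" (is "?L = ?R")
proof -
  interpret prob_space M using standard_BM_D[OF W] by auto
  interpret D: prob_space D by fact
  interpret P: pair_prob_space D M ..
  have [measurable]: "W t \<in> borel_measurable M" if "0 \<le> t" for t
    using standard_BM_D(2)[OF W] that .
  have mL[measurable]: "(\<lambda>\<omega>. \<lambda>t\<in>{0..}. W (s + t) \<omega>) \<in> measurable M path_space"
    unfolding path_space_def by (rule measurable_restrict) (use s in auto)
  have mR[measurable]: "(\<lambda>x. \<lambda>t\<in>{0..}. g (fst x) + W t (snd x)) \<in> measurable (D \<Otimes>\<^sub>M M) path_space"
    unfolding path_space_def by (rule measurable_restrict) auto
  show ?thesis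
  proof (rule measure_eqI_PiM_infinite[where I = "{0..}" and M = "\<lambda>_. borel"])
    show "sets ?L = sets (Pi\<^sub>M {0..} (\<lambda>_. borel))" "sets ?R = sets (Pi\<^sub>M {0..} (\<lambda>_. borel))"
      by (simp_all add: path_space_def)
    show "finite_measure ?L" by (rule prob_space.finite_measure[OF prob_space_distr[OF mL]])
    fix A :: "real \<Rightarrow> real set" and J assume J: "finite J" "J \<subseteq> {0::real..}" and A0: "\<And>i. i \<in> J \<Longrightarrow> A i \<in> sets borel"
    \<comment> \<open>Time 0 is a grid point even when it is not in \<open>J\<close>;
      \<open>A'\<close> imposes nothing there.\<close>
    define A' where "A' t = (if t \<in> J then A t else UNIV)" for t
    have A'[measurable]: "A' t \<in> sets borel" for t using A0 by (auto simp: A'_def)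
    obtain N t where t: "t 0 = 0" "\<And>i. i < N \<Longrightarrow> t i < t (Suc i)" "(J - {0}) \<union> {0} = t ` {..N}"
    proof (rule finite_pos_enumerate[of "J - {0}"])
      show "0 < x" if "x \<in> J - {0}" for x using J that by force
    qed (use J in auto)
    have tpos: "0 \<le> t i" if "i \<le> N" for i
      using that
    proof (induction i)
      case (Suc i) then show ?case using t(2)[of i] by simp
    qed (simp add: t)
    let ?P = "Pi\<^sub>M {..N} (\<lambda>_. borel) :: (nat \<Rightarrow> real) measure"
    \<comment> \<open>The cylinder condition expressed in increment coordinates.\<close>
    define C where "C = {v\<in>space ?P. \<forall>i\<in>{..N}. (\<Sum>k\<le>i. v k) \<in> A' (t i)}"
    have C: "C \<in> sets ?P" unfolding C_def by measurable
    define Xv where "Xv = (\<lambda>\<omega>. \<lambda>i\<in>{..N}. case i of 0 \<Rightarrow> W s \<omega> | Suc j \<Rightarrow> W (s + t (Suc j)) \<omega> - W (s + t j) \<omega>)"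
    define Yv where "Yv = (\<lambda>x. \<lambda>i\<in>{..N}. case i of 0 \<Rightarrow> g (fst x) | Suc j \<Rightarrow> W (t (Suc j)) (snd x) - W (t j) (snd x))"
    have mX[measurable]: "Xv \<in> measurable M ?P" unfolding Xv_def
      by (rule measurable_restrict) (auto split: nat.splits simp: tpos s less_imp_le intro!: borel_measurable_diff)
    have mY[measurable]: "Yv \<in> measurable (D \<Otimes>\<^sub>M M) ?P" unfolding Yv_def
      by (rule measurable_restrict) (auto split: nat.splits simp: tpos intro!: borel_measurable_diff measurable_compose[OF measurable_snd])
    have eqd: "distr M ?P Xv = distr (D \<Otimes>\<^sub>M M) ?P Yv"
    proof (rule measure_eqI_PiM_finite[where I = "{..N}" and M = "\<lambda>_. borel" and A = "\<lambda>_. space ?P"])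
      fix B :: "nat \<Rightarrow> real set" assume B0: "\<And>i. i \<in> {..N} \<Longrightarrow> B i \<in> sets borel"
      define B' where "B' i = (if i \<le> N then B i else UNIV)" for i
      have B': "B' i \<in> sets borel" for i using B0 by (auto simp: B'_def)
      have PB: "Pi\<^sub>E {..N} B \<in> sets ?P" using B0 by (intro sets_PiM_I_finite) auto
      have all: "(\<forall>i\<le>N. Q i) \<longleftrightarrow> Q 0 \<and> (\<forall>i<N. Q (Suc i))" for Q
        by (metis Suc_le_eq le0 not0_implies_Suc)
      have 1: "Xv -` Pi\<^sub>E {..N} B \<inter> space M = {\<omega>\<in>space M. W s \<omega> \<in> B' 0 \<and> (\<forall>i<N. W (s + t (Suc i)) \<omega> - W (s + t i) \<omega> \<in> B' (Suc i))}"
        by (auto simp: Xv_def PiE_iff Ball_def all B'_def)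
      have 2: "Yv -` Pi\<^sub>E {..N} B \<inter> space (D \<Otimes>\<^sub>M M) = {x\<in>space (D \<Otimes>\<^sub>M M). g (fst x) \<in> B' 0 \<and> (\<forall>i<N. W (t (Suc i)) (snd x) - W (t i) (snd x) \<in> B' (Suc i))}"
        by (auto simp: Yv_def PiE_iff Ball_def all B'_def)
      show "emeasure (distr M ?P Xv) (Pi\<^sub>E {..N} B) = emeasure (distr (D \<Otimes>\<^sub>M M) ?P Yv) (Pi\<^sub>E {..N} B)"
        using BM_increments_after[OF W s D g Dg t(1,2) B', of N]
        by (simp add: emeasure_distr PB 1 2)
    next
      show "range (\<lambda>_. space ?P) \<subseteq> prod_algebra {..N} (\<lambda>_. borel)"
        by (auto simp: space_PiM intro!: prod_algebraI_finite)
    qed (auto simp: space_PiM emeasure_distr)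
    have sumX: "(\<Sum>k\<le>i. Xv \<omega> k) = W (s + t i) \<omega>" if "i \<le> N" for i \<omega>
      using that
    proof (induction i)
      case (Suc i) then show ?case by (simp add: Xv_def)
    qed (simp add: Xv_def t)
    have sumY: "(\<Sum>k\<le>i. Yv x k) = g (fst x) + W (t i) (snd x)" if "i \<le> N" "snd x \<in> space M" for i x
      using that
    proof (induction i)
      case (Suc i) then show ?case by (simp add: Yv_def)
    qed (simp add: Yv_def t standard_BM_D(3)[OF W])
    have all: "(\<forall>u\<in>J. P u \<in> A u) \<longleftrightarrow> (\<forall>i\<in>{..N}. P (t i) \<in> A' (t i))" for P
    proof -
      have "(\<forall>u\<in>J. P u \<in> A u) \<longleftrightarrow> (\<forall>u\<in>(J - {0}) \<union> {0}. P u \<in> A' u)" by (auto simp: A'_def)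
      then show ?thesis unfolding t(3) by simp
    qed
    have Jle: "0 \<le> u" if "u \<in> J" for u using J that by auto
    let ?E = "prod_emb {0..} (\<lambda>_. borel) J (Pi\<^sub>E J A)"
    have E: "?E \<in> sets path_space" unfolding path_space_def using J A0 by (intro sets_PiM_I) auto
    have 1: "(\<lambda>\<omega>. \<lambda>t\<in>{0..}. W (s + t) \<omega>) -` ?E \<inter> space M = Xv -` C \<inter> space M"
    proof -
      have "(\<lambda>t\<in>{0..}. W (s + t) \<omega>) \<in> ?E \<longleftrightarrow> Xv \<omega> \<in> C" if "\<omega> \<in> space M" for \<omega>
      proof -
        have "(\<lambda>t\<in>{0..}. W (s + t) \<omega>) \<in> ?E \<longleftrightarrow> (\<forall>u\<in>J. W (s + u) \<omega> \<in> A u)"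
          using J by (auto simp: prod_emb_def space_PiM PiE_iff Jle)
        also have "\<dots> \<longleftrightarrow> Xv \<omega> \<in> C"
          unfolding all C_def using measurable_space[OF mX that] by (auto simp: sumX)
        finally show ?thesis .
      qed
      then show ?thesis by auto
    qed
    have 2: "(\<lambda>x. \<lambda>t\<in>{0..}. g (fst x) + W t (snd x)) -` ?E \<inter> space (D \<Otimes>\<^sub>M M) = Yv -` C \<inter> space (D \<Otimes>\<^sub>M M)"
    proof -
      have "(\<lambda>t\<in>{0..}. g (fst x) + W t (snd x)) \<in> ?E \<longleftrightarrow> Yv x \<in> C" if x: "x \<in> space (D \<Otimes>\<^sub>M M)" for x
      proof -
        have x2: "snd x \<in> space M" using x by (auto simp: space_pair_measure)
        have "(\<lambda>t\<in>{0..}. g (fst x) + W t (snd x)) \<in> ?E \<longleftrightarrow> (\<forall>u\<in>J. g (fst x) + W u (snd x) \<in> A u)"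
          using J by (auto simp: prod_emb_def space_PiM PiE_iff Jle)
        also have "\<dots> \<longleftrightarrow> Yv x \<in> C"
          unfolding all C_def using measurable_space[OF mY x] by (auto simp: sumY x2)
        finally show ?thesis .
      qed
      then show ?thesis by auto
    qed
    have "emeasure ?L ?E = emeasure (distr M ?P Xv) C"
      using E C by (simp add: emeasure_distr 1)
    also have "\<dots> = emeasure (distr (D \<Otimes>\<^sub>M M) ?P Yv) C" by (simp add: eqd)
    also have "\<dots> = emeasure ?R ?E"
      using E C by (simp add: emeasure_distr 2)
    finally show "emeasure ?L ?E = emeasure ?R ?E" .
  qed
qed

declare One_nat_def [simp del]

section \<open>The Markov property of the vector process\<close>

definition paths_space :: "nat \<Rightarrow> (nat \<Rightarrow> real \<Rightarrow> real) measure" where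
  "paths_space d = Pi\<^sub>M {1..d} (\<lambda>_. path_space)"

text \<open>The dimension is a parameter because the locale is instantiated with all
  \<open>d\<close> coordinates, with the \<open>m\<close> leading ones, and with a single coordinate
  inside the tail bound.\<close>

locale bm_vec = prob_space M for M :: "'w measure" +
  fixes B :: "real \<Rightarrow> 'w \<Rightarrow> nat \<Rightarrow> real" and d :: nat
  assumes BM: "standard_BM_vec M d B" and d1: "1 \<le> d"
begin

lemma BM_component: "j \<in> {1..d} \<Longrightarrow> standard_BM M (\<lambda>t \<omega>. B t \<omega> j)"
  using BM unfolding standard_BM_vec_def by auto

lemma B_measurable[measurable]: "0 \<le> t \<Longrightarrow> j \<in> {1..d} \<Longrightarrow> (\<lambda>\<omega>. B t \<omega> j) \<in> borel_measurable M"
  using standard_BM_D(2)[OF BM_component] .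

lemma B_0: "\<omega> \<in> space M \<Longrightarrow> j \<in> {1..d} \<Longrightarrow> B 0 \<omega> j = 0"
  using standard_BM_D(3)[OF BM_component] .

lemma B_cont: "\<omega> \<in> space M \<Longrightarrow> j \<in> {1..d} \<Longrightarrow> continuous_on {0..} (\<lambda>t. B t \<omega> j)"
  using standard_BM_D(4)[OF BM_component] .

lemma indep_image_paths:
  assumes f: "\<And>j. j \<in> {1..d} \<Longrightarrow> f j \<in> measurable path_space path_space"
    and A: "\<And>j. j \<in> {1..d} \<Longrightarrow> A j \<in> sets path_space"
  shows "emeasure M {\<omega>\<in>space M. \<forall>j\<in>{1..d}. f j (\<lambda>t\<in>{0..}. B t \<omega> j) \<in> A j} =
    (\<Prod>j\<in>{1..d}. emeasure M {\<omega>\<in>space M. f j (\<lambda>t\<in>{0..}. B t \<omega> j) \<in> A j})"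
proof -
  have "indep_vars (\<lambda>_. path_space) (\<lambda>j \<omega>. \<lambda>t\<in>{0..}. B t \<omega> j) {1..d}"
    using BM unfolding standard_BM_vec_def path_space_def by auto
  then have ind: "indep_vars (\<lambda>_. path_space) (\<lambda>j \<omega>. f j (\<lambda>t\<in>{0..}. B t \<omega> j)) {1..d}"
    by (rule indep_vars_compose2) (use f in auto)
  let ?X = "\<lambda>j \<omega>. f j (\<lambda>t\<in>{0..}. B t \<omega> j)"
  have "prob (\<Inter>j\<in>{1..d}. ?X j -` A j \<inter> space M) = (\<Prod>j\<in>{1..d}. prob (?X j -` A j \<inter> space M))"
    by (rule indep_varsD_finite[OF ind]) (use A d1 in auto)
  moreover have "(\<Inter>j\<in>{1..d}. ?X j -` A j \<inter> space M) = {\<omega>\<in>space M. \<forall>j\<in>{1..d}. ?X j \<omega> \<in> A j}"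
    using d1 by auto
  moreover have "?X j -` A j \<inter> space M = {\<omega>\<in>space M. ?X j \<omega> \<in> A j}" for j by auto
  ultimately show ?thesis by (simp add: emeasure_eq_measure prod_ennreal)
qed

lemma measurable_shift_path: "0 \<le> s \<Longrightarrow> (\<lambda>b. \<lambda>t\<in>{0..}. c + b (s + t)) \<in> measurable path_space path_space"
  unfolding path_space_def
  by (intro measurable_restrict borel_measurable_add borel_measurable_const measurable_component_singleton) auto

lemma measurable_translated_paths [measurable]:
  assumes [measurable]: "\<And>j. j \<in> {1..d} \<Longrightarrow> g j \<in> borel_measurable (D j)"
  shows "(\<lambda>x. \<lambda>j\<in>{1..d}. \<lambda>t\<in>{0..}. g j (fst x j) + B t (snd x) j) \<in> measurable (Pi\<^sub>M {1..d} D \<Otimes>\<^sub>M M) (paths_space d)"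
  unfolding paths_space_def path_space_def
proof (intro measurable_restrict borel_measurable_add)
  fix j and t :: real assume j: "j \<in> {1..d}" and "t \<in> {0..}"
  show "(\<lambda>x. B t (snd x) j) \<in> borel_measurable (Pi\<^sub>M {1..d} D \<Otimes>\<^sub>M M)"
    by (rule measurable_compose[OF measurable_snd B_measurable]) (use j \<open>t \<in> {0..}\<close> in auto)
  have "(\<lambda>x. fst x j) \<in> measurable (Pi\<^sub>M {1..d} D \<Otimes>\<^sub>M M) (D j)"
    by (rule measurable_compose[OF measurable_fst measurable_component_singleton]) (use j in auto)
  then show "(\<lambda>x. g j (fst x j)) \<in> borel_measurable (Pi\<^sub>M {1..d} D \<Otimes>\<^sub>M M)"
    by (rule measurable_compose[OF _ assms[OF j]])
qed

lemma measurable_shifted_paths [measurable]: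
  "0 \<le> s \<Longrightarrow> (\<lambda>\<omega>. \<lambda>j\<in>{1..d}. \<lambda>t\<in>{0..}. B (s + t) \<omega> j) \<in> measurable M (paths_space d)"
  unfolding paths_space_def path_space_def by (intro measurable_restrict B_measurable) auto

text \<open>Both sides equal one product measure: the left one because the coordinates are
  independent as processes, the right one by Fubini, using that independence for each fixed starting
  point. \<open>BM_Markov_path\<close> identifies the factors.\<close>

lemma Markov_paths:
  assumes s: "0 < s" and D: "\<And>j. prob_space (D j)"
    and g[measurable]: "\<And>j. j \<in> {1..d} \<Longrightarrow> g j \<in> borel_measurable (D j)"
    and Dg: "\<And>j. j \<in> {1..d} \<Longrightarrow> distr (D j) borel (g j) = density lborel (normal_density 0 (sqrt s))"
  shows "distr M (paths_space d) (\<lambda>\<omega>. \<lambda>j\<in>{1..d}. \<lambda>t\<in>{0..}. B (s + t) \<omega> j) =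
    distr (Pi\<^sub>M {1..d} D \<Otimes>\<^sub>M M) (paths_space d) (\<lambda>x. \<lambda>j\<in>{1..d}. \<lambda>t\<in>{0..}. g j (fst x j) + B t (snd x) j)"
    (is "?L = ?R")
proof -
  interpret D: product_prob_space D "{1..d}"
    unfolding product_prob_space_def product_sigma_finite_def product_prob_space_axioms_def
    using D by (simp add: prob_space_imp_sigma_finite)
  interpret PD: prob_space "Pi\<^sub>M {1..d} D" by (rule prob_space_PiM) (rule D)
  interpret PDM: pair_prob_space "Pi\<^sub>M {1..d} D" M ..
  \<comment> \<open>The product measure needs a probability measure at every natural number, so
    indices outside \<open>{1..d}\<close> are sent to coordinate 1.\<close>
  define i where "i j = (if j \<in> {1..d} then j else 1)" for j
  have i: "i j \<in> {1..d}" for j using d1 by (auto simp: i_def)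
  define N where "N j = distr M path_space (\<lambda>\<omega>. \<lambda>t\<in>{0..}. B (s + t) \<omega> (i j))" for j
  have mN: "(\<lambda>\<omega>. \<lambda>t\<in>{0..}. B (s + t) \<omega> (i j)) \<in> measurable M path_space" for j
    unfolding path_space_def using i[of j] s by (intro measurable_restrict B_measurable) auto
  have "prob_space (N j)" for j unfolding N_def by (rule prob_space_distr[OF mN])
  then interpret N: product_sigma_finite N
    unfolding product_sigma_finite_def by (simp add: prob_space_imp_sigma_finite)
  have setsN: "sets (N j) = sets path_space" for j by (simp add: N_def)
  have setsP: "sets (Pi\<^sub>M {1..d} N) = sets (paths_space d)"
    unfolding paths_space_def by (rule sets_PiM_cong) (auto simp: setsN)
  have paths_eq: "(\<lambda>t\<in>{0..}. c + B (s' + t) \<omega> j) = (\<lambda>b. \<lambda>t\<in>{0..}. c + b (s' + t)) (\<lambda>t\<in>{0..}. B t \<omega> j)"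
    if "0 \<le> s'" for c s' \<omega> j
    using that by (auto simp: restrict_def)
  have "?L = Pi\<^sub>M {1..d} N"
  proof (rule N.PiM_eqI)
    fix A assume A: "\<And>j. j \<in> {1..d} \<Longrightarrow> A j \<in> sets (N j)"
    have A': "Pi\<^sub>E {1..d} A \<in> sets (paths_space d)"
      unfolding paths_space_def using A by (intro sets_PiM_I_finite) (auto simp: setsN)
    have "emeasure ?L (Pi\<^sub>E {1..d} A) = emeasure M {\<omega>\<in>space M. \<forall>j\<in>{1..d}. (\<lambda>t\<in>{0..}. 0 + B (s + t) \<omega> j) \<in> A j}"
      using s A' by (subst emeasure_distr) (auto intro!: arg_cong[where f="emeasure M"] simp: PiE_iff)
    also have "\<dots> = (\<Prod>j\<in>{1..d}. emeasure M {\<omega>\<in>space M. (\<lambda>t\<in>{0..}. 0 + B (s + t) \<omega> j) \<in> A j})"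
      unfolding paths_eq[OF less_imp_le[OF s]]
    proof (rule indep_image_paths)
      show "(\<lambda>b. \<lambda>t\<in>{0..}. 0 + b (s + t)) \<in> measurable path_space path_space"
        by (rule measurable_shift_path) (use s in simp)
    qed (use A setsN in auto)
    also have "\<dots> = (\<Prod>j\<in>{1..d}. emeasure (N j) (A j))"
    proof (rule prod.cong[OF refl])
      fix j assume j: "j \<in> {1..d}"
      then have "i j = j" by (simp add: i_def)
      then show "emeasure M {\<omega>\<in>space M. (\<lambda>t\<in>{0..}. 0 + B (s + t) \<omega> j) \<in> A j} = emeasure (N j) (A j)"
        unfolding N_def using A[OF j] mN[of j]
        by (subst emeasure_distr) (auto simp: setsN intro!: arg_cong[where f="emeasure M"])
    qed
    finally show "emeasure ?L (Pi\<^sub>E {1..d} A) = (\<Prod>j\<in>{1..d}. emeasure (N j) (A j))" .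
  qed (auto simp: setsP)
  moreover have "?R = Pi\<^sub>M {1..d} N"
  proof (rule N.PiM_eqI)
    fix A assume A: "\<And>j. j \<in> {1..d} \<Longrightarrow> A j \<in> sets (N j)"
    have A': "Pi\<^sub>E {1..d} A \<in> sets (paths_space d)"
      unfolding paths_space_def using A by (intro sets_PiM_I_finite) (auto simp: setsN)
    let ?G = "\<lambda>x. \<lambda>j\<in>{1..d}. \<lambda>t\<in>{0..}. g j (fst x j) + B t (snd x) j"
    let ?E = "?G -` Pi\<^sub>E {1..d} A \<inter> space (Pi\<^sub>M {1..d} D \<Otimes>\<^sub>M M)"
    have mE: "?E \<in> sets (Pi\<^sub>M {1..d} D \<Otimes>\<^sub>M M)"
      by (rule measurable_sets[OF measurable_translated_paths A']) (rule g)
    let ?h = "\<lambda>j w. emeasure M {\<omega>\<in>space M. (\<lambda>t\<in>{0..}. g j w + B t \<omega> j) \<in> A j}"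
    have m1: "(\<lambda>x. \<lambda>t\<in>{0..}. g j (fst x) + B t (snd x) j) \<in> measurable (D j \<Otimes>\<^sub>M M) path_space" if j: "j \<in> {1..d}" for j
      unfolding path_space_def
    proof (intro measurable_restrict borel_measurable_add)
      fix t :: real assume t: "t \<in> {0..}"
      show "(\<lambda>x. g j (fst x)) \<in> borel_measurable (D j \<Otimes>\<^sub>M M)"
        by (rule measurable_compose[OF measurable_fst g[OF j]])
      show "(\<lambda>x. B t (snd x) j) \<in> borel_measurable (D j \<Otimes>\<^sub>M M)"
        by (rule measurable_compose[OF measurable_snd B_measurable]) (use t j in auto)
    qed
    have m2: "{x\<in>space (D j \<Otimes>\<^sub>M M). (\<lambda>t\<in>{0..}. g j (fst x) + B t (snd x) j) \<in> A j} \<in> sets (D j \<Otimes>\<^sub>M M)" if j: "j \<in> {1..d}" for j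
      using measurable_sets[OF m1[OF j], of "A j"] A[OF j] by (simp add: setsN vimage_def Int_def conj_commute)
    have h_eq: "?h j w = emeasure M (Pair w -` {x\<in>space (D j \<Otimes>\<^sub>M M). (\<lambda>t\<in>{0..}. g j (fst x) + B t (snd x) j) \<in> A j})"
      if "w \<in> space (D j)" for j w
      using that by (intro arg_cong[where f="emeasure M"]) (auto simp: space_pair_measure)
    have mh: "?h j \<in> borel_measurable (D j)" if j: "j \<in> {1..d}" for j
      by (subst measurable_cong[OF h_eq], assumption, rule measurable_emeasure_Pair[OF m2[OF j]])
    have "emeasure ?R (Pi\<^sub>E {1..d} A) = emeasure (Pi\<^sub>M {1..d} D \<Otimes>\<^sub>M M) ?E"
      using A' g by (subst emeasure_distr) auto
    also have "\<dots> = (\<integral>\<^sup>+ w. emeasure M (Pair w -` ?E) \<partial>Pi\<^sub>M {1..d} D)"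
      by (rule emeasure_pair_measure_alt[OF mE])
    also have "\<dots> = (\<integral>\<^sup>+ w. (\<Prod>j\<in>{1..d}. ?h j (w j)) \<partial>Pi\<^sub>M {1..d} D)"
    proof (rule nn_integral_cong)
      fix w assume w: "w \<in> space (Pi\<^sub>M {1..d} D)"
      have "emeasure M (Pair w -` ?E) = emeasure M {\<omega>\<in>space M. \<forall>j\<in>{1..d}. (\<lambda>t\<in>{0..}. g j (w j) + B (0 + t) \<omega> j) \<in> A j}"
        using w by (intro arg_cong[where f="emeasure M"]) (auto simp: space_pair_measure PiE_iff)
      also have "\<dots> = (\<Prod>j\<in>{1..d}. emeasure M {\<omega>\<in>space M. (\<lambda>t\<in>{0..}. g j (w j) + B (0 + t) \<omega> j) \<in> A j})"
        unfolding paths_eq[OF order_refl]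
      proof (rule indep_image_paths)
        show "(\<lambda>b. \<lambda>t\<in>{0..}. g j (w j) + b (0 + t)) \<in> measurable path_space path_space" for j
          by (rule measurable_shift_path) simp
      qed (use A setsN in auto)
      finally show "emeasure M (Pair w -` ?E) = (\<Prod>j\<in>{1..d}. ?h j (w j))" by simp
    qed
    also have "\<dots> = (\<Prod>j\<in>{1..d}. integral\<^sup>N (D j) (?h j))"
      by (rule D.product_nn_integral_prod) (auto intro: mh)
    also have "\<dots> = (\<Prod>j\<in>{1..d}. emeasure (N j) (A j))"
    proof (rule prod.cong[OF refl])
      fix j assume j: "j \<in> {1..d}"
      have "integral\<^sup>N (D j) (?h j) = (\<integral>\<^sup>+w. emeasure M (Pair w -` {x\<in>space (D j \<Otimes>\<^sub>M M). (\<lambda>t\<in>{0..}. g j (fst x) + B t (snd x) j) \<in> A j}) \<partial>D j)"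
        by (rule nn_integral_cong[OF h_eq])
      also have "\<dots> = emeasure (D j \<Otimes>\<^sub>M M) {x\<in>space (D j \<Otimes>\<^sub>M M). (\<lambda>t\<in>{0..}. g j (fst x) + B t (snd x) j) \<in> A j}"
        by (rule emeasure_pair_measure_alt[OF m2[OF j], symmetric])
      also have "\<dots> = emeasure (distr (D j \<Otimes>\<^sub>M M) path_space (\<lambda>x. \<lambda>t\<in>{0..}. g j (fst x) + B t (snd x) j)) (A j)"
        using A[OF j] m1[OF j] by (subst emeasure_distr) (auto simp: setsN intro!: arg_cong[where f="emeasure (D j \<Otimes>\<^sub>M M)"])
      also have "\<dots> = emeasure (N j) (A j)"
        using BM_Markov_path[OF BM_component[OF j] s D g[OF j] Dg[OF j]] j by (simp add: N_def i_def)
      finally show "integral\<^sup>N (D j) (?h j) = emeasure (N j) (A j)" .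
    qed
    finally show "emeasure ?R (Pi\<^sub>E {1..d} A) = (\<Prod>j\<in>{1..d}. emeasure (N j) (A j))" .
  qed (auto simp: setsP)
  ultimately show ?thesis by simp
qed

lemma
  assumes g: "\<And>j. j \<in> {1..d} \<Longrightarrow> g j \<in> borel_measurable (D j)"
    and E: "E \<in> sets (paths_space d)"
  shows measurable_emeasure_translated:
      "(\<lambda>w. emeasure M {\<omega>\<in>space M. (\<lambda>j\<in>{1..d}. \<lambda>t\<in>{0..}. g j (w j) + B t \<omega> j) \<in> E}) \<in> borel_measurable (Pi\<^sub>M {1..d} D)"
    and emeasure_distr_translated:
      "emeasure (distr (Pi\<^sub>M {1..d} D \<Otimes>\<^sub>M M) (paths_space d) (\<lambda>x. \<lambda>j\<in>{1..d}. \<lambda>t\<in>{0..}. g j (fst x j) + B t (snd x) j)) E =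
       (\<integral>\<^sup>+ w. emeasure M {\<omega>\<in>space M. (\<lambda>j\<in>{1..d}. \<lambda>t\<in>{0..}. g j (w j) + B t \<omega> j) \<in> E} \<partial>Pi\<^sub>M {1..d} D)"
proof -
  let ?G = "\<lambda>x. \<lambda>j\<in>{1..d}. \<lambda>t\<in>{0..}. g j (fst x j) + B t (snd x) j"
  let ?E = "?G -` E \<inter> space (Pi\<^sub>M {1..d} D \<Otimes>\<^sub>M M)"
  note mG = measurable_translated_paths[of g D, OF g]
  have mE: "?E \<in> sets (Pi\<^sub>M {1..d} D \<Otimes>\<^sub>M M)"
    by (rule measurable_sets[OF mG E])
  have eq: "emeasure M (Pair w -` ?E) = emeasure M {\<omega>\<in>space M. (\<lambda>j\<in>{1..d}. \<lambda>t\<in>{0..}. g j (w j) + B t \<omega> j) \<in> E}"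
    if "w \<in> space (Pi\<^sub>M {1..d} D)" for w
    using that by (intro arg_cong[where f="emeasure M"]) (auto simp: space_pair_measure)
  show "(\<lambda>w. emeasure M {\<omega>\<in>space M. (\<lambda>j\<in>{1..d}. \<lambda>t\<in>{0..}. g j (w j) + B t \<omega> j) \<in> E}) \<in> borel_measurable (Pi\<^sub>M {1..d} D)"
    by (subst measurable_cong[OF eq[symmetric]], assumption, rule measurable_emeasure_Pair[OF mE])
  have "emeasure (distr (Pi\<^sub>M {1..d} D \<Otimes>\<^sub>M M) (paths_space d) ?G) E = emeasure (Pi\<^sub>M {1..d} D \<Otimes>\<^sub>M M) ?E"
    by (rule emeasure_distr[OF mG E])
  also have "\<dots> = (\<integral>\<^sup>+ w. emeasure M (Pair w -` ?E) \<partial>Pi\<^sub>M {1..d} D)"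
    by (rule emeasure_pair_measure_alt[OF mE])
  also have "\<dots> = (\<integral>\<^sup>+ w. emeasure M {\<omega>\<in>space M. (\<lambda>j\<in>{1..d}. \<lambda>t\<in>{0..}. g j (w j) + B t \<omega> j) \<in> E} \<partial>Pi\<^sub>M {1..d} D)"
    by (rule nn_integral_cong[OF eq])
  finally show "emeasure (distr (Pi\<^sub>M {1..d} D \<Otimes>\<^sub>M M) (paths_space d) ?G) E =
     (\<integral>\<^sup>+ w. emeasure M {\<omega>\<in>space M. (\<lambda>j\<in>{1..d}. \<lambda>t\<in>{0..}. g j (w j) + B t \<omega> j) \<in> E} \<partial>Pi\<^sub>M {1..d} D)" .
qed

text \<open>\<open>D\<close> and \<open>g\<close> are chosen afresh in each application: N(-\<mu>_j
  s, s) variables for the shift invariance of \<open>V\<close>; for windows, the remaining level of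
  the leading coordinates and standard normals for the others.\<close>

lemma Markov_emeasure:
  assumes s: "0 < s" and D: "\<And>j. prob_space (D j)"
    and g: "\<And>j. j \<in> {1..d} \<Longrightarrow> g j \<in> borel_measurable (D j)"
    and Dg: "\<And>j. j \<in> {1..d} \<Longrightarrow> distr (D j) borel (g j) = density lborel (normal_density 0 (sqrt s))"
    and E: "E \<in> sets (paths_space d)"
  shows "emeasure M {\<omega>\<in>space M. (\<lambda>j\<in>{1..d}. \<lambda>t\<in>{0..}. B (s + t) \<omega> j) \<in> E} =
     (\<integral>\<^sup>+ w. emeasure M {\<omega>\<in>space M. (\<lambda>j\<in>{1..d}. \<lambda>t\<in>{0..}. g j (w j) + B t \<omega> j) \<in> E} \<partial>Pi\<^sub>M {1..d} D)"
proof -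
  have "emeasure M {\<omega>\<in>space M. (\<lambda>j\<in>{1..d}. \<lambda>t\<in>{0..}. B (s + t) \<omega> j) \<in> E}
     = emeasure (distr M (paths_space d) (\<lambda>\<omega>. \<lambda>j\<in>{1..d}. \<lambda>t\<in>{0..}. B (s + t) \<omega> j)) E"
    using E measurable_shifted_paths[OF less_imp_le[OF s]]
    by (subst emeasure_distr) (auto intro!: arg_cong[where f="emeasure M"])
  also have "\<dots> = emeasure (distr (Pi\<^sub>M {1..d} D \<Otimes>\<^sub>M M) (paths_space d)
      (\<lambda>x. \<lambda>j\<in>{1..d}. \<lambda>t\<in>{0..}. g j (fst x j) + B t (snd x) j)) E"
    by (rule arg_cong[where f="\<lambda>N. emeasure N E"], rule Markov_paths[OF s D g Dg])
  also have "\<dots> = (\<integral>\<^sup>+ w. emeasure M {\<omega>\<in>space M. (\<lambda>j\<in>{1..d}. \<lambda>t\<in>{0..}. g j (w j) + B t \<omega> j) \<in> E} \<partial>Pi\<^sub>M {1..d} D)"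
    by (rule emeasure_distr_translated[OF g E])
  finally show ?thesis .
qed

end

section \<open>The maximal inequality\<close>

text \<open>Completing the square: the tilt by exp(c x) moves the mean by c \<sigma>^2 and leaves a
  constant.\<close>

lemma normal_mgf:
  assumes "0 < \<sigma>"
  shows "(\<integral>\<^sup>+x. ennreal (exp (c * x) * normal_density \<mu> \<sigma> x) \<partial>lborel) = ennreal (exp (c * \<mu> + c\<^sup>2 * \<sigma>\<^sup>2 / 2))"
proof -
  have eq: "exp (c * x) * normal_density \<mu> \<sigma> x = exp (c * \<mu> + c\<^sup>2 * \<sigma>\<^sup>2 / 2) * normal_density (\<mu> + c * \<sigma>\<^sup>2) \<sigma> x" for x
  proof -
    have "c * x + - (x - \<mu>)\<^sup>2 / (2 * \<sigma>\<^sup>2) = (c * \<mu> + c\<^sup>2 * \<sigma>\<^sup>2 / 2) + - (x - (\<mu> + c * \<sigma>\<^sup>2))\<^sup>2 / (2 * \<sigma>\<^sup>2)"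
      using assms by (simp add: field_simps power2_eq_square) 
    then show ?thesis unfolding normal_density_def by (simp add: exp_add[symmetric])
  qed
  interpret prob_space "density lborel (normal_density (\<mu> + c * \<sigma>\<^sup>2) \<sigma>)"
    by (rule prob_space_normal_density) fact
  have 1: "(\<integral>\<^sup>+x. ennreal (normal_density (\<mu> + c * \<sigma>\<^sup>2) \<sigma> x) \<partial>lborel) = 1"
    using emeasure_space_1 by (simp add: emeasure_density)
  show ?thesis
    unfolding eq by (subst ennreal_mult) (auto simp: nn_integral_cmult 1)
qed

lemma normal_symmetric:
  assumes "0 < \<sigma>"
  shows "emeasure (density lborel (normal_density 0 \<sigma>)) {y..} = emeasure (density lborel (normal_density 0 \<sigma>)) {..- y}"
proof -
  have "emeasure (density lborel (normal_density 0 \<sigma>)) {y..} = (\<integral>\<^sup>+x. ennreal (normal_density 0 \<sigma> x) * indicator {y..} x \<partial>lborel)"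
    by (simp add: emeasure_density)
  also have "\<dots> = (\<integral>\<^sup>+x. ennreal (normal_density 0 \<sigma> (- x)) * indicator {y..} (- x) \<partial>lborel)"
    using nn_integral_real_affine[where c = "-1" and t = 0 and f="\<lambda>x. ennreal (normal_density 0 \<sigma> x) * indicator {y..} x"] by simp
  also have "\<dots> = (\<integral>\<^sup>+x. ennreal (normal_density 0 \<sigma> x) * indicator {..- y} x \<partial>lborel)"
    by (intro nn_integral_cong) (auto simp: normal_density_def indicator_def)
  finally show ?thesis by (simp add: emeasure_density)
qed

text \<open>By symmetry of the normal law. It serves as the restart step of the maximal inequality:
  a path that is already above the level stays there with probability at least one half.\<close>

lemma BM_half:
  assumes W: "standard_BM M W" and t: "0 \<le> t" and y: "y \<le> 0"
  shows "1 \<le> 2 * emeasure M {\<omega>\<in>space M. W t \<omega> \<ge> y}"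
proof -
  interpret prob_space M using standard_BM_D[OF W] by auto
  note [measurable] = standard_BM_D(2)[OF W t]
  note W0 = standard_BM_D(3)[OF W]
  show ?thesis
  proof (cases "t = 0")
    case True
    then have "{\<omega>\<in>space M. W t \<omega> \<ge> y} = space M" using W0 y by auto
    then show ?thesis by (simp add: emeasure_space_1)
  next
    case False
    then have t: "0 < t" using t by simp
    let ?D = "density lborel (normal_density 0 (sqrt t))"
    interpret D: prob_space ?D by (rule prob_space_normal_density) (use t in simp)
    have dist: "distributed M lborel (\<lambda>\<omega>. W t \<omega> - W 0 \<omega>) (normal_density 0 (sqrt t))"
      using standard_BM_D(5)[OF W, of 0 t] t by simp
    have "emeasure ?D {0..} = emeasure M ((\<lambda>\<omega>. W t \<omega> - W 0 \<omega>) -` {0..} \<inter> space M)"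
      by (simp add: distributed_emeasure[OF dist] emeasure_density)
    also have "\<dots> \<le> emeasure M {\<omega>\<in>space M. W t \<omega> \<ge> y}"
      using W0 y by (intro emeasure_mono) auto
    finally have 1: "emeasure ?D {0..} \<le> emeasure M {\<omega>\<in>space M. W t \<omega> \<ge> y}" .
    have "1 = emeasure ?D (space ?D)" by (rule D.emeasure_space_1[symmetric])
    also have "space ?D = {0..} \<union> {..-0::real}" by auto
    also have "emeasure ?D \<dots> \<le> emeasure ?D {0..} + emeasure ?D {..-0}"
      by (rule emeasure_subadditive) auto
    also have "\<dots> = 2 * emeasure ?D {0..}"
      using normal_symmetric[of "sqrt t" 0] t by (simp add: mult_2)
    also have "\<dots> \<le> 2 * emeasure M {\<omega>\<in>space M. W t \<omega> \<ge> y}" by (intro mult_left_mono 1) auto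
    finally show ?thesis .
  qed
qed

lemma BM_Markov_emeasure:
  assumes W: "standard_BM M W" and s: "0 < s" and E: "E \<in> sets path_space"
  shows "emeasure M {\<omega>\<in>space M. (\<lambda>t\<in>{0..}. W (s + t) \<omega>) \<in> E} =
     (\<integral>\<^sup>+ z. emeasure M {\<omega>\<in>space M. (\<lambda>t\<in>{0..}. z + W t \<omega>) \<in> E} \<partial>density lborel (normal_density 0 (sqrt s)))"
proof -
  interpret prob_space M using standard_BM_D[OF W] by auto
  let ?D = "density lborel (normal_density 0 (sqrt s))"
  have D: "prob_space ?D" by (rule prob_space_normal_density) (use s in simp)
  have [measurable]: "W t \<in> borel_measurable M" if "0 \<le> t" for t
    using standard_BM_D(2)[OF W] that .
  have m1: "(\<lambda>\<omega>. \<lambda>t\<in>{0..}. W (s + t) \<omega>) \<in> measurable M path_space"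
    unfolding path_space_def by (rule measurable_restrict) (use s in auto)
  have m2: "(\<lambda>x. \<lambda>t\<in>{0..}. fst x + W t (snd x)) \<in> measurable (?D \<Otimes>\<^sub>M M) path_space"
    unfolding path_space_def by (rule measurable_restrict) auto
  have eq: "distr M path_space (\<lambda>\<omega>. \<lambda>t\<in>{0..}. W (s + t) \<omega>) = distr (?D \<Otimes>\<^sub>M M) path_space (\<lambda>x. \<lambda>t\<in>{0..}. fst x + W t (snd x))"
    using BM_Markov_path[OF W s D, of "\<lambda>x. x"] by (simp add: distr_id2)
  let ?F = "(\<lambda>x. \<lambda>t\<in>{0..}. fst x + W t (snd x)) -` E \<inter> space (?D \<Otimes>\<^sub>M M)"
  have "emeasure M {\<omega>\<in>space M. (\<lambda>t\<in>{0..}. W (s + t) \<omega>) \<in> E} = emeasure (?D \<Otimes>\<^sub>M M) ?F"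
    using arg_cong[OF eq, where f="\<lambda>M. emeasure M E"] E m1 m2
    by (simp add: emeasure_distr vimage_def Int_def conj_commute)
  also have "\<dots> = (\<integral>\<^sup>+ z. emeasure M (Pair z -` ?F) \<partial>?D)"
    by (rule emeasure_pair_measure_alt) (rule measurable_sets[OF m2 E])
  also have "\<dots> = (\<integral>\<^sup>+ z. emeasure M {\<omega>\<in>space M. (\<lambda>t\<in>{0..}. z + W t \<omega>) \<in> E} \<partial>?D)"
    by (intro nn_integral_cong arg_cong[where f="emeasure M"]) (auto simp: space_pair_measure)
  finally show ?thesis .
qed

text \<open>Induction on the number of grid points, with the Markov property at the first one and no
  stopping times. If the first value z exceeds x, \<open>BM_half\<close> applies; otherwise the
  induction hypothesis applies to the level x - z. Integrating over z restores the value at the last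
  grid point.\<close>

lemma Levy_maximal_grid:
  assumes W: "standard_BM M W" and \<delta>: "0 < \<delta>"
  shows "emeasure M {\<omega>\<in>space M. \<exists>k\<in>{1..N}. W (real k * \<delta>) \<omega> > x} \<le> 2 * emeasure M {\<omega>\<in>space M. W (real N * \<delta>) \<omega> \<ge> x}"
proof (induction N arbitrary: x)
  case (Suc N)
  interpret prob_space M using standard_BM_D[OF W] by auto
  have [measurable]: "W t \<in> borel_measurable M" if "0 \<le> t" for t
    using standard_BM_D(2)[OF W] that .
  let ?D = "density lborel (normal_density 0 (sqrt \<delta>))"
  define E where "E = {b\<in>space path_space. \<exists>k\<in>{..N}. b (real k * \<delta>) > x}"
  define E2 where "E2 = {b\<in>space path_space. b (real N * \<delta>) \<ge> x}"
  have [measurable]: "(\<lambda>b. b (real k * \<delta>)) \<in> borel_measurable path_space" for k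
    unfolding path_space_def by (rule measurable_component_singleton) (use \<delta> in auto)
  have E: "E \<in> sets path_space" unfolding E_def using \<delta> by measurable
  have E2: "E2 \<in> sets path_space" unfolding E2_def using \<delta> by measurable
  have sp: "(\<lambda>t\<in>{0..}. h t) \<in> space path_space" for h
    by (auto simp: path_space_def space_PiM)
  have nn: "0 \<le> real k * \<delta>" for k using \<delta> by simp
  have Suc_ex: "(\<exists>k\<in>{1..Suc N}. P k) \<longleftrightarrow> (\<exists>k\<in>{..N}. P (Suc k))" for P
    by (metis Suc_le_mono atLeastAtMost_iff atMost_iff le0 not0_implies_Suc not_one_le_zero One_nat_def)
  have "{\<omega>\<in>space M. \<exists>k\<in>{1..Suc N}. W (real k * \<delta>) \<omega> > x} = {\<omega>\<in>space M. (\<lambda>t\<in>{0..}. W (\<delta> + t) \<omega>) \<in> E}"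
    unfolding Suc_ex E_def by (auto simp: sp nn distrib_right)
  also have "emeasure M \<dots> = (\<integral>\<^sup>+ z. emeasure M {\<omega>\<in>space M. (\<lambda>t\<in>{0..}. z + W t \<omega>) \<in> E} \<partial>?D)"
    by (rule BM_Markov_emeasure[OF W \<delta> E])
  also have "\<dots> \<le> (\<integral>\<^sup>+ z. 2 * emeasure M {\<omega>\<in>space M. (\<lambda>t\<in>{0..}. z + W t \<omega>) \<in> E2} \<partial>?D)"
  proof (rule nn_integral_mono)
    fix z :: real
    have eq2: "{\<omega>\<in>space M. (\<lambda>t\<in>{0..}. z + W t \<omega>) \<in> E2} = {\<omega>\<in>space M. W (real N * \<delta>) \<omega> \<ge> x - z}"
      by (auto simp: E2_def sp nn)
    show "emeasure M {\<omega>\<in>space M. (\<lambda>t\<in>{0..}. z + W t \<omega>) \<in> E} \<le> 2 * emeasure M {\<omega>\<in>space M. (\<lambda>t\<in>{0..}. z + W t \<omega>) \<in> E2}"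
    proof (cases "z > x")
      case True
      have "emeasure M {\<omega>\<in>space M. (\<lambda>t\<in>{0..}. z + W t \<omega>) \<in> E} \<le> 1" by (rule emeasure_le_1)
      also have "\<dots> \<le> 2 * emeasure M {\<omega>\<in>space M. (\<lambda>t\<in>{0..}. z + W t \<omega>) \<in> E2}"
        unfolding eq2 by (rule BM_half[OF W nn]) (use True in simp)
      finally show ?thesis .
    next
      case False
      have "(\<exists>k\<in>{..N}. z + W (real k * \<delta>) \<omega> > x) \<longleftrightarrow> (\<exists>k\<in>{1..N}. W (real k * \<delta>) \<omega> > x - z)" if "\<omega> \<in> space M" for \<omega>
      proof -
        have "k \<ge> 1" if "z + W (real k * \<delta>) \<omega> > x" for k
          using that False standard_BM_D(3)[OF W \<open>\<omega> \<in> space M\<close>] by (cases k) auto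
        then show ?thesis by (auto simp: algebra_simps)
      qed
      then have "{\<omega>\<in>space M. (\<lambda>t\<in>{0..}. z + W t \<omega>) \<in> E} = {\<omega>\<in>space M. \<exists>k\<in>{1..N}. W (real k * \<delta>) \<omega> > x - z}"
        by (auto simp: E_def sp nn)
      then show ?thesis unfolding eq2 using Suc.IH by simp
    qed
  qed
  also have "\<dots> = 2 * (\<integral>\<^sup>+ z. emeasure M {\<omega>\<in>space M. (\<lambda>t\<in>{0..}. z + W t \<omega>) \<in> E2} \<partial>?D)"
  proof (rule nn_integral_cmult)
    have e3: "{\<omega>\<in>space M. (\<lambda>t\<in>{0..}. z + W t \<omega>) \<in> E2} = Pair z -` {y\<in>space (?D \<Otimes>\<^sub>M M). W (real N * \<delta>) (snd y) \<ge> x - fst y}" for z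
      by (auto simp: E2_def sp nn space_pair_measure)
    have [measurable]: "W (real N * \<delta>) \<in> borel_measurable M" using nn by simp
    show "(\<lambda>z. emeasure M {\<omega>\<in>space M. (\<lambda>t\<in>{0..}. z + W t \<omega>) \<in> E2}) \<in> borel_measurable ?D"
      unfolding e3 by (rule measurable_emeasure_Pair) measurable
  qed
  also have "\<dots> = 2 * emeasure M {\<omega>\<in>space M. (\<lambda>t\<in>{0..}. W (\<delta> + t) \<omega>) \<in> E2}"
    by (simp only: BM_Markov_emeasure[OF W \<delta> E2])
  also have "{\<omega>\<in>space M. (\<lambda>t\<in>{0..}. W (\<delta> + t) \<omega>) \<in> E2} = {\<omega>\<in>space M. W (real (Suc N) * \<delta>) \<omega> \<ge> x}"
    by (auto simp: E2_def sp nn distrib_right)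
  finally show ?case .
qed simp

text \<open>By continuity an exceedance at t persists shortly after t, so every sufficiently fine
  grid sees it, and the grid bound does not depend on the mesh.\<close>

lemma Levy_maximal:
  assumes W: "standard_BM M W" and T: "0 < T"
  shows "emeasure M {\<omega>\<in>space M. \<exists>t\<in>{0<..<T}. W t \<omega> > x} \<le> 2 * emeasure M {\<omega>\<in>space M. W T \<omega> \<ge> x}"
proof -
  interpret prob_space M using standard_BM_D[OF W] by auto
  have mW[measurable]: "W t \<in> borel_measurable M" if "0 \<le> t" for t
    using standard_BM_D(2)[OF W] that .
  define A where "A n = {\<omega>\<in>space M. \<exists>k\<in>{1..Suc n}. W (real k * (T / real (Suc n))) \<omega> > x}" for n
  have A: "A n \<in> sets M" for n
  proof -
    have [measurable]: "W (real k * (T / real (Suc n))) \<in> borel_measurable M" for k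
      by (rule mW) (use T in simp)
    show ?thesis unfolding A_def by measurable
  qed
  \<comment> \<open>The grids are not nested, so the lower limit of the grid events takes the place
    of an increasing union.\<close>
  define C where "C n = (\<Inter>m\<in>{n..}. A m)" for n
  have C: "C n \<in> sets M" for n unfolding C_def using A by (intro sets.countable_INT') auto
  have "{\<omega>\<in>space M. \<exists>t\<in>{0<..<T}. W t \<omega> > x} \<subseteq> (\<Union>n. C n)"
  proof safe
    fix \<omega> t assume \<omega>: "\<omega> \<in> space M" and t: "t \<in> {0<..<T}" "W t \<omega> > x"
    have "continuous_on {0..} (\<lambda>t. W t \<omega>)" by (rule standard_BM_D(4)[OF W \<omega>])
    then have "((\<lambda>t. W t \<omega>) \<longlongrightarrow> W t \<omega>) (at t within {0..})"
      using t by (auto simp: continuous_on_def)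
    then have "eventually (\<lambda>t'. W t' \<omega> > x) (at t within {0..})"
      by (rule order_tendstoD) (use t in simp)
    then obtain e where e: "e > 0" "\<And>t'. t' \<ge> 0 \<Longrightarrow> t' \<noteq> t \<Longrightarrow> dist t' t < e \<Longrightarrow> W t' \<omega> > x"
      unfolding eventually_at by (auto simp: zero_less_dist_iff)
    obtain n where n: "T / e < real n" using reals_Archimedean2 by blast
    have "\<omega> \<in> A m" if "n \<le> m" for m
    proof -
      define \<delta> where "\<delta> = T / real (Suc m)"
      have \<delta>: "0 < \<delta>" using T by (simp add: \<delta>_def)
      have "T < e * real n" using n e by (simp add: field_simps)
      also have "\<dots> \<le> e * real (Suc m)" using that e by simp
      finally have \<delta>e: "\<delta> < e" by (simp add: \<delta>_def field_simps)
      \<comment> \<open>The index of the first grid point at or after t; it lies in [t, t +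
        \<delta>), and t < T keeps it within the grid.\<close>
      define k where "k = nat \<lceil>t / \<delta>\<rceil>"
      have k1: "t / \<delta> \<le> real k" "real k < t / \<delta> + 1"
        using t \<delta> by (auto simp: k_def) linarith+
      have k2: "t \<le> real k * \<delta>" "real k * \<delta> < t + \<delta>" using k1 \<delta> by (auto simp: field_simps)
      have "k \<ge> 1" using k2(1) t by (cases k) auto
      moreover have "k \<le> Suc m"
      proof -
        have "t * real (Suc m) < T * real (Suc m)" using t by (intro mult_strict_right_mono) auto
        then have "t / \<delta> < real (Suc m)" using T by (simp add: \<delta>_def field_simps del: of_nat_Suc)
        then have "\<lceil>t / \<delta>\<rceil> \<le> int (Suc m)" by (simp add: ceiling_le_iff)
        then show ?thesis by (simp add: k_def nat_le_iff)
      qed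
      moreover have "W (real k * \<delta>) \<omega> > x"
      proof (cases "real k * \<delta> = t")
        case True then show ?thesis using t by simp
      next
        case False
        then show ?thesis using k2 \<delta>e t by (intro e(2)) (auto simp: dist_real_def)
      qed
      ultimately show ?thesis unfolding A_def \<delta>_def[symmetric] using \<omega> by auto
    qed
    then show "\<omega> \<in> (\<Union>n. C n)" unfolding C_def by auto
  qed
  then have "emeasure M {\<omega>\<in>space M. \<exists>t\<in>{0<..<T}. W t \<omega> > x} \<le> emeasure M (\<Union>n. C n)"
    by (rule emeasure_mono) (use C in auto)
  also have "\<dots> = (SUP n. emeasure M (C n))"
  proof (rule SUP_emeasure_incseq[symmetric])
    show "incseq C" unfolding C_def incseq_def by force
  qed (use C in auto)
  also have "\<dots> \<le> 2 * emeasure M {\<omega>\<in>space M. W T \<omega> \<ge> x}"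
  proof (rule SUP_least)
    fix n
    have "emeasure M (C n) \<le> emeasure M (A n)" by (rule emeasure_mono[OF _ A]) (auto simp: C_def)
    also have "\<dots> \<le> 2 * emeasure M {\<omega>\<in>space M. W (real (Suc n) * (T / real (Suc n))) \<omega> \<ge> x}"
      unfolding A_def by (rule Levy_maximal_grid[OF W]) (use T in simp)
    finally show "emeasure M (C n) \<le> 2 * emeasure M {\<omega>\<in>space M. W T \<omega> \<ge> x}" by (simp del: of_nat_Suc)
  qed
  finally show ?thesis .
qed

text \<open>The exponential Markov inequality; \<open>b\<close> stays free so that tails of any
  exponential rate can be extracted.\<close>

lemma BM_Chernoff:
  assumes W: "standard_BM M W" and T: "0 < T" and b: "0 \<le> b"
  shows "emeasure M {\<omega>\<in>space M. W T \<omega> \<ge> x} \<le> ennreal (exp (b\<^sup>2 * T / 2 - b * x))"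
proof -
  interpret prob_space M using standard_BM_D[OF W] by auto
  have [measurable]: "W T \<in> borel_measurable M" 
    using standard_BM_D(2)[OF W] T by simp
  have dist: "distributed M lborel (\<lambda>\<omega>. W T \<omega> - W 0 \<omega>) (normal_density 0 (sqrt T))"
    using standard_BM_D(5)[OF W, of 0 T] T by simp
  have "emeasure M {\<omega>\<in>space M. W T \<omega> \<ge> x} = (\<integral>\<^sup>+\<omega>. indicator {\<omega>\<in>space M. W T \<omega> \<ge> x} \<omega> \<partial>M)"
    by simp
  also have "\<dots> \<le> (\<integral>\<^sup>+\<omega>. ennreal (exp (b * (W T \<omega> - W 0 \<omega>) - b * x)) \<partial>M)"
  proof (rule nn_integral_mono)
    fix \<omega> assume "\<omega> \<in> space M"
    then have "W 0 \<omega> = 0" by (rule standard_BM_D(3)[OF W])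
    moreover have "b * x \<le> b * W T \<omega>" if "x \<le> W T \<omega>" using that b by (rule mult_left_mono)
    ultimately show "indicator {\<omega>\<in>space M. W T \<omega> \<ge> x} \<omega> \<le> ennreal (exp (b * (W T \<omega> - W 0 \<omega>) - b * x))"
      by (auto simp: indicator_def)
  qed
  also have "\<dots> = (\<integral>\<^sup>+z. ennreal (normal_density 0 (sqrt T) z) * ennreal (exp (b * z - b * x)) \<partial>lborel)"
    by (rule distributed_nn_integral[OF dist, symmetric]) simp
  also have "\<dots> = (\<integral>\<^sup>+z. ennreal (exp (- b * x)) * ennreal (exp (b * z) * normal_density 0 (sqrt T) z) \<partial>lborel)"
    by (intro nn_integral_cong) (simp add: ennreal_mult[symmetric] exp_diff exp_minus field_simps)
  also have "\<dots> = ennreal (exp (- b * x)) * ennreal (exp (b * 0 + b\<^sup>2 * (sqrt T)\<^sup>2 / 2))"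
    by (subst nn_integral_cmult) (use T in \<open>auto simp: normal_mgf\<close>)
  also have "\<dots> = ennreal (exp (b\<^sup>2 * T / 2 - b * x))"
    using T by (simp add: ennreal_mult[symmetric] exp_add[symmetric])
  finally show ?thesis .
qed

section \<open>Hitting events\<close>

text \<open>Rational times suffice for open sets of times, because a strict hit persists for a short time.\<close>

definition phits :: "(nat \<Rightarrow> real) \<Rightarrow> nat \<Rightarrow> real set \<Rightarrow> nat \<Rightarrow> (nat \<Rightarrow> real) \<Rightarrow> (nat \<Rightarrow> real \<Rightarrow> real) set" where
  "phits \<mu> d U k c = {h\<in>space (paths_space d). \<exists>q\<in>\<rat> \<inter> U. \<forall>j\<in>{1..k}. h j q > c j + \<mu> j * q}"

lemma path_component_measurable:
  assumes "j \<in> {1..d}" "0 \<le> q"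
  shows "(\<lambda>h. h j q) \<in> borel_measurable (paths_space d)"
proof -
  have 1: "(\<lambda>h. h j) \<in> measurable (paths_space d) path_space"
    unfolding paths_space_def by (rule measurable_component_singleton) fact
  have 2: "(\<lambda>b. b q) \<in> borel_measurable path_space"
    unfolding path_space_def by (rule measurable_component_singleton) (use assms in simp)
  show ?thesis by (rule measurable_compose[OF 1 2])
qed

lemma sets_phits:
  assumes "k \<le> d" "U \<subseteq> {0..}"
  shows "phits \<mu> d U k c \<in> sets (paths_space d)"
proof -
  have "{h\<in>space (paths_space d). \<exists>q\<in>\<rat> \<inter> U. \<forall>j\<in>{1..k}. h j q > c j + \<mu> j * q} \<in> sets (paths_space d)"
  proof (rule sets.sets_Collect_countable_Ex')
    show "countable (\<rat> \<inter> U)" using countable_rat by (rule countable_subset[rotated]) auto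
  next
    fix q assume q: "q \<in> \<rat> \<inter> U"
    show "{h\<in>space (paths_space d). \<forall>j\<in>{1..k}. h j q > c j + \<mu> j * q} \<in> sets (paths_space d)"
    proof (rule sets.sets_Collect_finite_All)
      fix j assume j: "j \<in> {1..k}"
      have [measurable]: "(\<lambda>h. h j q) \<in> borel_measurable (paths_space d)"
        by (rule path_component_measurable) (use j q assms in auto)
      show "{h\<in>space (paths_space d). h j q > c j + \<mu> j * q} \<in> sets (paths_space d)" by measurable
    qed simp
  qed
  then show ?thesis by (simp add: phits_def)
qed

lemma restrict_paths_in_space: "(\<lambda>j\<in>{1..d}. \<lambda>t\<in>{0..}. h j t) \<in> space (paths_space d)"
  by (auto simp: paths_space_def path_space_def space_PiM)

context bm_vec
begin

lemma hit_open:
  assumes \<omega>: "\<omega> \<in> space M" and k: "k \<le> d" and t: "0 \<le> t" "hit B k \<mu> x t \<omega>"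
  obtains e where "0 < e" "\<And>t'. 0 \<le> t' \<Longrightarrow> \<bar>t' - t\<bar> < e \<Longrightarrow> hit B k \<mu> x t' \<omega>"
proof -
  have "\<forall>\<^sub>F t' in at t within {0..}. \<forall>j\<in>{1..k}. B t' \<omega> j - \<mu> j * t' > x j"
  proof (rule eventually_ball_finite)
    show "\<forall>j\<in>{1..k}. \<forall>\<^sub>F t' in at t within {0..}. B t' \<omega> j - \<mu> j * t' > x j"
    proof
      fix j assume j: "j \<in> {1..k}"
      have "continuous_on {0..} (\<lambda>t. B t \<omega> j - \<mu> j * t)"
        by (intro continuous_intros B_cont[OF \<omega>]) (use j k in auto)
      then have "((\<lambda>t. B t \<omega> j - \<mu> j * t) \<longlongrightarrow> B t \<omega> j - \<mu> j * t) (at t within {0..})"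
        using t by (auto simp: continuous_on_def)
      then show "\<forall>\<^sub>F t' in at t within {0..}. B t' \<omega> j - \<mu> j * t' > x j"
        by (rule order_tendstoD) (use t j in \<open>auto simp: hit_def\<close>)
    qed
  qed simp
  then obtain e where e: "e > 0" "\<And>t'. t' \<ge> 0 \<Longrightarrow> t' \<noteq> t \<Longrightarrow> dist t' t < e \<Longrightarrow> hit B k \<mu> x t' \<omega>"
    unfolding eventually_at hit_def by auto
  show ?thesis
    by (rule that[of e]) (use e t in \<open>auto simp: dist_real_def\<close>)
qed

text \<open>The offset \<open>s\<close> is arbitrary because a path restarted at a possibly
  irrational \<open>s\<close> is observed at rational times q after the restart, that is, at s +
  q.\<close>

lemma hit_rational:
  assumes \<omega>: "\<omega> \<in> space M" and k: "k \<le> d" and U: "open U" "U \<subseteq> {0<..}"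
  shows "(\<exists>t\<in>U. hit B k \<mu> x t \<omega>) \<longleftrightarrow> (\<exists>q\<in>\<rat>. s + q \<in> U \<and> hit B k \<mu> x (s + q) \<omega>)"
proof
  assume "\<exists>t\<in>U. hit B k \<mu> x t \<omega>"
  then obtain t where t: "t \<in> U" "hit B k \<mu> x t \<omega>" by auto
  have t0: "0 < t" using t U by auto
  obtain e where e: "0 < e" "\<And>t'. 0 \<le> t' \<Longrightarrow> \<bar>t' - t\<bar> < e \<Longrightarrow> hit B k \<mu> x t' \<omega>"
    using hit_open[OF \<omega> k _ t(2)] t0 by auto
  obtain e' where e': "0 < e'" "\<And>t'. \<bar>t' - t\<bar> < e' \<Longrightarrow> t' \<in> U"
    using U(1) t(1) unfolding open_dist by (auto simp: dist_real_def)
  obtain q where q: "q \<in> \<rat>" "t - s < q" "q < t - s + min e e'"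
    using Rats_dense_in_real[of "t - s" "t - s + min e e'"] e e' by auto
  have "s + q \<in> U" by (rule e'(2)) (use q in auto)
  moreover have "hit B k \<mu> x (s + q) \<omega>" by (rule e(2)) (use q t0 in auto)
  ultimately show "\<exists>q\<in>\<rat>. s + q \<in> U \<and> hit B k \<mu> x (s + q) \<omega>" using q by auto
qed auto

text \<open>Links the closed time interval of \<open>H_quot\<close> with the open windows used
  everywhere else: a strict hit can be moved off an end point.\<close>

lemma hit_closed_interval:
  assumes \<omega>: "\<omega> \<in> space M" and k: "k \<le> d" and T: "0 \<le> a" "a < T"
  shows "(\<exists>t\<in>{a..T}. hit B k \<mu> x t \<omega>) \<longleftrightarrow> (\<exists>t\<in>{a<..<T}. hit B k \<mu> x t \<omega>)"
proof
  assume "\<exists>t\<in>{a..T}. hit B k \<mu> x t \<omega>"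
  then obtain t where t: "t \<in> {a..T}" "hit B k \<mu> x t \<omega>" by auto
  obtain e where e: "0 < e" "\<And>t'. 0 \<le> t' \<Longrightarrow> \<bar>t' - t\<bar> < e \<Longrightarrow> hit B k \<mu> x t' \<omega>"
    using hit_open[OF \<omega> k _ t(2)] t T by auto
  \<comment> \<open>The move is to the right, except at t = T, where it has to be to the
    left.\<close>
  define t' where "t' = (if t < T then t + min (e / 2) ((T - t) / 2) else t - min (e / 2) ((t - a) / 2))"
  have "t' \<in> {a<..<T}" "\<bar>t' - t\<bar> < e"
    using t e T by (auto simp: t'_def min_def field_simps)
  then show "\<exists>t\<in>{a<..<T}. hit B k \<mu> x t \<omega>" using e(2)[of t'] T by force
qed auto

text \<open>Both the time set and the levels may depend on a parameter. The uses take as parameter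
  the starting level x in \<open>V\<close>, the normal coordinates of the inactive part, and the
  start of the window.\<close>

lemma hit_measurable:
  assumes W[measurable]: "W \<in> measurable N M" and k: "k \<le> d"
    and U: "\<And>q. {y\<in>space N. q \<in> U y} \<in> sets N" "\<And>y. y \<in> space N \<Longrightarrow> open (U y)" "\<And>y. y \<in> space N \<Longrightarrow> U y \<subseteq> {0<..}"
    and f: "\<And>j. j \<in> {1..k} \<Longrightarrow> (\<lambda>y. f y j) \<in> borel_measurable N"
  shows "{y\<in>space N. \<exists>t\<in>U y. hit B k \<mu> (f y) t (W y)} \<in> sets N"
proof -
  have eq: "{y\<in>space N. \<exists>t\<in>U y. hit B k \<mu> (f y) t (W y)} =
    {y\<in>space N. \<exists>q\<in>\<rat> \<inter> {0..}. q \<in> U y \<and> (\<forall>j\<in>{1..k}. B q (W y) j - \<mu> j * q > f y j)}"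
    (is "?L = ?R")
  proof -
    have "(\<exists>t\<in>U y. hit B k \<mu> (f y) t (W y)) \<longleftrightarrow> (\<exists>q\<in>\<rat> \<inter> {0..}. q \<in> U y \<and> (\<forall>j\<in>{1..k}. B q (W y) j - \<mu> j * q > f y j))"
      if y: "y \<in> space N" for y
    proof -
      have "U y \<subseteq> {0<..}" using U(3) y .
      then have "0 \<le> q" if "q \<in> U y" for q using that by force
      then show ?thesis
        unfolding hit_rational[OF measurable_space[OF W y] k U(2,3)[OF y], where s = 0] by (auto simp: hit_def)
    qed
    then show ?thesis by auto
  qed
  show ?thesis unfolding eq
  proof (rule sets.sets_Collect_countable_Ex')
    show "countable (\<rat> \<inter> {0::real..})" using countable_rat by (rule countable_subset[rotated]) auto
  next
    fix q :: real assume q: "q \<in> \<rat> \<inter> {0..}"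
    have "{y\<in>space N. \<forall>j\<in>{1..k}. B q (W y) j - \<mu> j * q > f y j} \<in> sets N"
    proof (rule sets.sets_Collect_finite_All)
      fix j assume j: "j \<in> {1..k}"
      have [measurable]: "(\<lambda>y. B q (W y) j) \<in> borel_measurable N"
        by (rule measurable_compose[OF W B_measurable]) (use j k q in auto)
      note [measurable] = f[OF j]
      show "{y\<in>space N. B q (W y) j - \<mu> j * q > f y j} \<in> sets N" by measurable
    qed simp
    then show "{y\<in>space N. q \<in> U y \<and> (\<forall>j\<in>{1..k}. B q (W y) j - \<mu> j * q > f y j)} \<in> sets N"
      using U(1)[of q] by (rule sets.sets_Collect_conj)
  qed
qed

lemma sets_hit: "k \<le> d \<Longrightarrow> open U \<Longrightarrow> U \<subseteq> {0<..} \<Longrightarrow> {\<omega>\<in>space M. \<exists>t\<in>U. hit B k \<mu> x t \<omega>} \<in> sets M"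
  using hit_measurable[of "\<lambda>\<omega>. \<omega>" M k "\<lambda>_. U" "\<lambda>_. x" \<mu>] by auto

lemma translated_in_phits:
  assumes \<omega>: "\<omega> \<in> space M" and k: "k \<le> d" and U: "open U" "U \<subseteq> {0<..}"
  shows "(\<lambda>j\<in>{1..d}. \<lambda>t\<in>{0..}. z j + B t \<omega> j) \<in> phits \<mu> d U k c \<longleftrightarrow> (\<exists>t\<in>U. hit B k \<mu> (\<lambda>j. c j - z j) t \<omega>)"
proof -
  have "(\<forall>j\<in>{1..k}. (\<lambda>j\<in>{1..d}. \<lambda>t\<in>{0..}. z j + B t \<omega> j) j q > c j + \<mu> j * q) \<longleftrightarrow> hit B k \<mu> (\<lambda>j. c j - z j) q \<omega>"
    if "q \<in> U" for q
    using that U k by (force simp: hit_def)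
  then show ?thesis
    unfolding hit_rational[OF \<omega> k U, where s = 0] phits_def by (auto simp: restrict_paths_in_space)
qed

lemma shifted_in_phits:
  assumes \<omega>: "\<omega> \<in> space M" and k: "k \<le> d" and s: "0 \<le> s" and U: "open U" "U \<subseteq> {0<..}"
  shows "(\<lambda>j\<in>{1..d}. \<lambda>t\<in>{0..}. B (s + t) \<omega> j) \<in> phits \<mu> d U k c \<longleftrightarrow> (\<exists>t\<in>(+) s ` U. hit B k \<mu> (\<lambda>j. c j - \<mu> j * s) t \<omega>)"
proof -
  have U': "open ((+) s ` U)" "(+) s ` U \<subseteq> {0<..}" using U s by (auto intro: open_translation)
  have "(\<forall>j\<in>{1..k}. (\<lambda>j\<in>{1..d}. \<lambda>t\<in>{0..}. B (s + t) \<omega> j) j q > c j + \<mu> j * q) \<longleftrightarrow> hit B k \<mu> (\<lambda>j. c j - \<mu> j * s) (s + q) \<omega>"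
    if "q \<in> U" for q
    using that U k by (force simp: hit_def algebra_simps)
  then show ?thesis
    unfolding hit_rational[OF \<omega> k U', where s = s] phits_def by (auto simp: restrict_paths_in_space)
qed

text \<open>A hit forces every coordinate to climb, so k one-dimensional bounds hold for the same
  probability. Their geometric mean decays in the sum of the positive parts, without any appeal to
  independence.\<close>

lemma hit_tail:
  assumes k: "1 \<le> k" "k \<le> d" and T: "0 < T" and b: "0 \<le> b"
  obtains C where "0 < C"
    "\<And>x. prob {\<omega>\<in>space M. \<exists>t\<in>{0<..<T}. hit B k \<mu> x t \<omega>} \<le> C * exp (- b * (\<Sum>j=1..k. max 0 (x j)))"
proof -
  \<comment> \<open>The rate per coordinate is k times too large, because the k-th root taken at the
    end divides it by k.\<close>
  define b' where "b' = b * real k"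
  have b': "0 \<le> b'" using b by (simp add: b'_def)
  define C where "C = (\<Sum>j=1..k. 2 * exp (b'\<^sup>2 * T / 2 + b' * (\<bar>\<mu> j\<bar> * T))) + 1"
  have C1: "1 \<le> C" by (simp add: C_def sum_nonneg)
  have "prob {\<omega>\<in>space M. \<exists>t\<in>{0<..<T}. hit B k \<mu> x t \<omega>} \<le> C * exp (- b * (\<Sum>j=1..k. max 0 (x j)))" for x
  proof -
    let ?p = "prob {\<omega>\<in>space M. \<exists>t\<in>{0<..<T}. hit B k \<mu> x t \<omega>}"
    have pj: "?p \<le> C * exp (- b' * max 0 (x j))" if j: "j \<in> {1..k}" for j
    proof (cases "0 \<le> x j")
      case False
      have "?p \<le> C" using C1 prob_le_1 order_trans by blast
      then show ?thesis using False by simp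
    next
      case True
      have jd: "j \<in> {1..d}" using j k by auto
      have [measurable]: "{\<omega>\<in>space M. \<exists>t\<in>{0<..<T}. B t \<omega> j > x j - \<bar>\<mu> j\<bar> * T} \<in> sets M"
      proof -
        \<comment> \<open>Measurability is obtained by viewing coordinate j as a one-dimensional
          motion with drift 0.\<close>
        have eq: "{\<omega>\<in>space M. \<exists>t\<in>{0<..<T}. B t \<omega> j > x j - \<bar>\<mu> j\<bar> * T} = {\<omega>\<in>space M. \<exists>t\<in>{0<..<T}. hit (\<lambda>t \<omega> i. B t \<omega> j) 1 (\<lambda>_. 0) (\<lambda>i. x j - \<bar>\<mu> j\<bar> * T) t \<omega>}"
          by (auto simp: hit_def)
        have ind: "prob_space.indep_vars M (\<lambda>_. Pi\<^sub>M {0..} (\<lambda>_. borel)) (\<lambda>i \<omega>. \<lambda>t\<in>{0..}. B t \<omega> j) {1..1::nat}"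
        proof -
          have r: "random_variable path_space (\<lambda>\<omega>. \<lambda>t\<in>{0..}. B t \<omega> j)"
            unfolding path_space_def using jd by (intro measurable_restrict B_measurable) auto
          show ?thesis
            unfolding indep_vars_def2
            using r measurable_sets[OF r] by (auto simp: path_space_def indep_sets_def subset_singleton_iff)
        qed
        interpret Bj: bm_vec M "\<lambda>t \<omega> i. B t \<omega> j" 1
          by unfold_locales (use BM_component[OF jd] ind in \<open>auto simp: standard_BM_vec_def\<close>)
        show ?thesis unfolding eq by (rule Bj.sets_hit) (auto simp: open_greaterThanLessThan)
      qed
      have sub: "{\<omega>\<in>space M. \<exists>t\<in>{0<..<T}. hit B k \<mu> x t \<omega>} \<subseteq> {\<omega>\<in>space M. \<exists>t\<in>{0<..<T}. B t \<omega> j > x j - \<bar>\<mu> j\<bar> * T}"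
      proof safe
        fix \<omega> t assume t: "t \<in> {0<..<T}" "hit B k \<mu> x t \<omega>"
        have "- \<bar>\<mu> j\<bar> * T \<le> - \<bar>\<mu> j\<bar> * t" using t by (simp add: mult_left_mono)
        also have "\<dots> \<le> \<mu> j * t" using t abs_ge_minus_self[of "\<mu> j"] by (intro mult_right_mono) auto
        finally have "- \<bar>\<mu> j\<bar> * T \<le> \<mu> j * t" .
        moreover have "x j < B t \<omega> j - \<mu> j * t" using t(2) j by (simp add: hit_def)
        ultimately have "x j - \<bar>\<mu> j\<bar> * T < B t \<omega> j" by simp
        then show "\<exists>t\<in>{0<..<T}. B t \<omega> j > x j - \<bar>\<mu> j\<bar> * T" using t by auto
      qed
      have "emeasure M {\<omega>\<in>space M. \<exists>t\<in>{0<..<T}. hit B k \<mu> x t \<omega>} \<le> emeasure M {\<omega>\<in>space M. \<exists>t\<in>{0<..<T}. B t \<omega> j > x j - \<bar>\<mu> j\<bar> * T}"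
        by (rule emeasure_mono[OF sub]) measurable
      also have "\<dots> \<le> 2 * emeasure M {\<omega>\<in>space M. B T \<omega> j \<ge> x j - \<bar>\<mu> j\<bar> * T}"
        by (rule Levy_maximal[OF BM_component[OF jd] T])
      also have "\<dots> \<le> 2 * ennreal (exp (b'\<^sup>2 * T / 2 - b' * (x j - \<bar>\<mu> j\<bar> * T)))"
        by (intro mult_left_mono BM_Chernoff[OF BM_component[OF jd] T b']) auto
      also have "\<dots> = ennreal (2 * exp (b'\<^sup>2 * T / 2 - b' * (x j - \<bar>\<mu> j\<bar> * T)))"
        by (simp add: ennreal_mult)
      finally have "?p \<le> 2 * exp (b'\<^sup>2 * T / 2 - b' * (x j - \<bar>\<mu> j\<bar> * T))"
        by (simp add: emeasure_eq_measure)
      also have "\<dots> = (2 * exp (b'\<^sup>2 * T / 2 + b' * (\<bar>\<mu> j\<bar> * T))) * exp (- b' * max 0 (x j))"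
        using True by (simp add: exp_add[symmetric] algebra_simps)
      also have "\<dots> \<le> C * exp (- b' * max 0 (x j))"
      proof (rule mult_right_mono)
        show "2 * exp (b'\<^sup>2 * T / 2 + b' * (\<bar>\<mu> j\<bar> * T)) \<le> C"
          unfolding C_def using member_le_sum[of j "{1..k}" "\<lambda>j. 2 * exp (b'\<^sup>2 * T / 2 + b' * (\<bar>\<mu> j\<bar> * T))"] j by simp
      qed simp
      finally show ?thesis .
    qed
    \<comment> \<open>The k coordinate bounds are multiplied; comparing k-th powers then gives the
      geometric mean.\<close>
    have "?p ^ k = (\<Prod>j=1..k. ?p)" by simp
    also have "\<dots> \<le> (\<Prod>j=1..k. C * exp (- b' * max 0 (x j)))" by (rule prod_mono) (use pj in auto)
    also have "\<dots> = C ^ k * exp (\<Sum>j=1..k. - b' * max 0 (x j))" by (simp add: prod.distrib exp_sum)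
    also have "(\<Sum>j=1..k. - b' * max 0 (x j)) = real k * (- b * (\<Sum>j=1..k. max 0 (x j)))"
      by (simp add: b'_def sum_distrib_left sum_negf algebra_simps)
    also have "C ^ k * exp \<dots> = (C * exp (- b * (\<Sum>j=1..k. max 0 (x j)))) ^ k"
      by (simp only: power_mult_distrib exp_of_nat_mult)
    finally show ?thesis
      by (subst (asm) power_mono_iff) (use k C1 in auto)
  qed
  then show ?thesis using that[of C] C1 by auto
qed

end

section \<open>Product measures with Lebesgue factors\<close>

lemma product_sigma_finite_lborel: "product_sigma_finite (\<lambda>_. lborel :: real measure)"
  unfolding product_sigma_finite_def by (simp add: lborel.sigma_finite_measure_axioms)

lemma nn_integral_PiM_lborel_translate:
  fixes f :: "('i \<Rightarrow> real) \<Rightarrow> ennreal"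
  assumes I: "finite I" and f: "f \<in> borel_measurable (Pi\<^sub>M I (\<lambda>_. lborel))"
  shows "(\<integral>\<^sup>+x. f (\<lambda>j\<in>I. x j - w j) \<partial>Pi\<^sub>M I (\<lambda>_. lborel)) = (\<integral>\<^sup>+x. f x \<partial>Pi\<^sub>M I (\<lambda>_. lborel))"
proof -
  interpret product_sigma_finite "\<lambda>_. lborel :: real measure" by (rule product_sigma_finite_lborel)
  let ?P = "Pi\<^sub>M I (\<lambda>_. lborel :: real measure)" and ?t = "\<lambda>x. \<lambda>j\<in>I. x j - w j"
  have t: "?t \<in> measurable ?P ?P" by measurable
  have "distr ?P ?P ?t = ?P"
  proof (rule PiM_eqI[OF I])
    fix A :: "'i \<Rightarrow> real set" assume A: "\<And>i. i \<in> I \<Longrightarrow> A i \<in> sets lborel"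
    have vi: "?t -` Pi\<^sub>E I A \<inter> space ?P = Pi\<^sub>E I (\<lambda>j. (\<lambda>y. y - w j) -` A j)"
      by (auto simp: space_PiM PiE_iff)
    have mA: "(\<lambda>y. y - w j) -` A j \<in> sets lborel" if "j \<in> I" for j
      using measurable_sets[of "\<lambda>y. y - w j" borel borel "A j"] A[OF that] by simp
    have "emeasure (distr ?P ?P ?t) (Pi\<^sub>E I A) = (\<Prod>j\<in>I. emeasure lborel ((\<lambda>y. y - w j) -` A j))"
      using A I mA by (subst emeasure_distr[OF t]) (auto simp: vi emeasure_PiM intro!: sets_PiM_I_finite)
    also have "\<dots> = (\<Prod>j\<in>I. emeasure lborel (A j))"
    proof (rule prod.cong[OF refl])
      fix j assume j: "j \<in> I"
      have "emeasure lborel (A j) = emeasure (distr lborel borel ((+) (- w j))) (A j)"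
        by (simp add: lborel_distr_plus)
      also have "\<dots> = emeasure lborel ((\<lambda>y. y - w j) -` A j)"
        using A[OF j] by (subst emeasure_distr) (auto intro!: arg_cong[where f="emeasure lborel"])
      finally show "emeasure lborel ((\<lambda>y. y - w j) -` A j) = emeasure lborel (A j)" ..
    qed
    finally show "emeasure (distr ?P ?P ?t) (Pi\<^sub>E I A) = (\<Prod>j\<in>I. emeasure lborel (A j))" .
  qed simp
  then have "(\<integral>\<^sup>+x. f x \<partial>?P) = (\<integral>\<^sup>+x. f x \<partial>distr ?P ?P ?t)" by simp
  also have "\<dots> = (\<integral>\<^sup>+x. f (?t x) \<partial>?P)" by (rule nn_integral_distr[OF t]) (use f in simp)
  finally show ?thesis ..
qed

lemma PiM_density_lborel:
  fixes \<rho> :: "'i \<Rightarrow> real \<Rightarrow> ennreal"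
  assumes I: "finite I" and \<rho>[measurable]: "\<And>j. \<rho> j \<in> borel_measurable borel" and D: "\<And>j. prob_space (density lborel (\<rho> j))"
  shows "Pi\<^sub>M I (\<lambda>j. density lborel (\<rho> j)) = density (Pi\<^sub>M I (\<lambda>_. lborel)) (\<lambda>x. \<Prod>j\<in>I. \<rho> j (x j))"
proof -
  interpret L: product_sigma_finite "\<lambda>_. lborel :: real measure" by (rule product_sigma_finite_lborel)
  interpret D: product_sigma_finite "\<lambda>j. density lborel (\<rho> j)"
    unfolding product_sigma_finite_def using D by (simp add: prob_space_imp_sigma_finite)
  show ?thesis
  proof (rule D.PiM_eqI[symmetric, OF I])
    show "sets (density (Pi\<^sub>M I (\<lambda>_. lborel)) (\<lambda>x. \<Prod>j\<in>I. \<rho> j (x j))) = sets (Pi\<^sub>M I (\<lambda>j. density lborel (\<rho> j)))"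
      by (simp cong: sets_PiM_cong)
    fix A :: "'i \<Rightarrow> real set" assume A: "\<And>i. i \<in> I \<Longrightarrow> A i \<in> sets (density lborel (\<rho> i))"
    have PA: "Pi\<^sub>E I A \<in> sets (Pi\<^sub>M I (\<lambda>_. lborel))" using A I by (intro sets_PiM_I_finite) auto
    have "emeasure (density (Pi\<^sub>M I (\<lambda>_. lborel)) (\<lambda>x. \<Prod>j\<in>I. \<rho> j (x j))) (Pi\<^sub>E I A)
      = (\<integral>\<^sup>+x. (\<Prod>j\<in>I. \<rho> j (x j)) * indicator (Pi\<^sub>E I A) x \<partial>Pi\<^sub>M I (\<lambda>_. lborel))"
      using PA by (rule emeasure_density[rotated]) measurable
    also have "\<dots> = (\<integral>\<^sup>+x. (\<Prod>j\<in>I. \<rho> j (x j) * indicator (A j) (x j)) \<partial>Pi\<^sub>M I (\<lambda>_. lborel))"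
    proof (rule nn_integral_cong)
      fix x assume x: "x \<in> space (Pi\<^sub>M I (\<lambda>_. lborel :: real measure))"
      have "indicator (Pi\<^sub>E I A) x = (\<Prod>j\<in>I. indicator (A j) (x j) :: ennreal)"
        using x I by (auto simp: indicator_def space_PiM PiE_iff prod_eq_1_iff split: if_splits)
      then show "(\<Prod>j\<in>I. \<rho> j (x j)) * indicator (Pi\<^sub>E I A) x = (\<Prod>j\<in>I. \<rho> j (x j) * indicator (A j) (x j))"
        by (simp add: prod.distrib)
    qed
    also have "\<dots> = (\<Prod>j\<in>I. \<integral>\<^sup>+x. \<rho> j x * indicator (A j) x \<partial>lborel)"
      by (rule L.product_nn_integral_prod[OF I]) (use A in auto)
    also have "\<dots> = (\<Prod>j\<in>I. emeasure (density lborel (\<rho> j)) (A j))"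
      by (rule prod.cong[OF refl]) (use A in \<open>auto simp: emeasure_density\<close>)
    finally show "emeasure (density (Pi\<^sub>M I (\<lambda>_. lborel)) (\<lambda>x. \<Prod>j\<in>I. \<rho> j (x j))) (Pi\<^sub>E I A)
      = (\<Prod>j\<in>I. emeasure (density lborel (\<rho> j)) (A j))" .
  qed
qed

lemma distr_normal_affine:
  assumes "0 < \<sigma>" "a \<noteq> 0"
  shows "distr (density lborel (normal_density m \<sigma>)) borel (\<lambda>w. b + a * w) = density lborel (normal_density (b + a * m) (\<bar>a\<bar> * \<sigma>))"
proof -
  let ?N = "density lborel (normal_density m \<sigma>)"
  interpret prob_space ?N by (rule prob_space_normal_density) fact
  have "distributed ?N lborel (\<lambda>w. w) (normal_density m \<sigma>)"
    unfolding distributed_def by (auto simp: distr_id2)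
  from normal_density_affine[OF this assms, of b]
  have "distr ?N lborel (\<lambda>w. b + a * w) = density lborel (normal_density (b + a * m) (\<bar>a\<bar> * \<sigma>))"
    unfolding distributed_def by simp
  moreover have "distr ?N lborel (\<lambda>w. b + a * w) = distr ?N borel (\<lambda>w. b + a * w)"
    by (rule distr_cong) auto
  ultimately show ?thesis by simp
qed

lemma nn_integral_exp_neg_halfline:
  assumes "0 < (l::real)"
  shows "(\<integral>\<^sup>+x. ennreal (exp (l * x)) * indicator {..<0} x \<partial>lborel) = ennreal (1 / l)"
proof -
  have "(\<integral>\<^sup>+x. ennreal (exp (l * x)) * indicator {..<0} x \<partial>lborel) = (\<integral>\<^sup>+x. ennreal (exp (l * (- x))) * indicator {..<0} (- x) \<partial>lborel)"
    using nn_integral_real_affine[where c = "-1" and t = 0 and f="\<lambda>x. ennreal (exp (l * x)) * indicator {..<0} x"] by simp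
  also have "\<dots> = (\<integral>\<^sup>+x. ennreal (1 / l) * ennreal (exponential_density l x) \<partial>lborel)"
  proof (rule nn_integral_cong_AE)
    have "AE x in lborel. x \<noteq> (0::real)" by (rule AE_lborel_singleton)
    then show "AE x in lborel. ennreal (exp (l * (- x))) * indicator {..<0} (- x) = ennreal (1 / l) * ennreal (exponential_density l x)"
    proof eventually_elim
      case (elim x)
      then show ?case using assms
        by (auto simp: indicator_def exponential_density_def ennreal_mult[symmetric] mult.commute)
    qed
  qed
  also have "\<dots> = ennreal (1 / l) * (\<integral>\<^sup>+x. ennreal (exponential_density l x) \<partial>lborel)"
    by (rule nn_integral_cmult) simp
  also have "(\<integral>\<^sup>+x. ennreal (exponential_density l x) \<partial>lborel) = 1"
    using prob_space.emeasure_space_1[OF prob_space_exponential_density[OF assms]] by (simp add: emeasure_density)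
  finally show ?thesis by simp
qed

lemma nn_integral_two_sided_exp_finite:
  assumes "0 < (l::real)" "l < b"
  shows "(\<integral>\<^sup>+x. ennreal (exp (l * x - b * max 0 x)) \<partial>lborel) < \<infinity>"
proof -
  have "(\<integral>\<^sup>+x. ennreal (exp (l * x - b * max 0 x)) \<partial>lborel) \<le>
     (\<integral>\<^sup>+x. (ennreal (exp (l * x)) * indicator {..<0} x + ennreal (exp ((b - l) * (- x))) * indicator {..<0} (- x)) + indicator {0} x \<partial>lborel)"
    by (rule nn_integral_mono) (auto simp: indicator_def algebra_simps)
  also have "\<dots> = (\<integral>\<^sup>+x. ennreal (exp (l * x)) * indicator {..<0} x \<partial>lborel) + (\<integral>\<^sup>+x. ennreal (exp ((b - l) * (- x))) * indicator {..<0} (- x) \<partial>lborel)"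
    by (simp add: nn_integral_add)
  also have "(\<integral>\<^sup>+x. ennreal (exp ((b - l) * (- x))) * indicator {..<0} (- x) \<partial>lborel) = (\<integral>\<^sup>+x. ennreal (exp ((b - l) * x)) * indicator {..<0} x \<partial>lborel)"
    using nn_integral_real_affine[where c = "-1" and t = 0 and f="\<lambda>x. ennreal (exp ((b - l) * x)) * indicator {..<0} x"] by simp
  finally have "(\<integral>\<^sup>+x. ennreal (exp (l * x - b * max 0 x)) \<partial>lborel) \<le> ennreal (1 / l) + ennreal (1 / (b - l))"
    using assms by (simp add: nn_integral_exp_neg_halfline)
  also have "\<dots> < \<infinity>" by simp
  finally show ?thesis .
qed

lemma nn_integral_prod_exp_finite:
  assumes I: "finite I" and l: "\<And>j. j \<in> I \<Longrightarrow> 0 < l j \<and> l j < b"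
  shows "(\<integral>\<^sup>+x. ennreal (exp (\<Sum>j\<in>I. l j * x j - b * max 0 (x j))) \<partial>Pi\<^sub>M I (\<lambda>_. lborel)) < \<infinity>"
proof -
  interpret product_sigma_finite "\<lambda>_. lborel :: real measure" by (rule product_sigma_finite_lborel)
  have "(\<integral>\<^sup>+x. ennreal (exp (\<Sum>j\<in>I. l j * x j - b * max 0 (x j))) \<partial>Pi\<^sub>M I (\<lambda>_. lborel))
     = (\<integral>\<^sup>+x. (\<Prod>j\<in>I. ennreal (exp (l j * x j - b * max 0 (x j)))) \<partial>Pi\<^sub>M I (\<lambda>_. lborel))"
    using I by (simp add: exp_sum prod_ennreal)
  also have "\<dots> = (\<Prod>j\<in>I. \<integral>\<^sup>+x. ennreal (exp (l j * x - b * max 0 x)) \<partial>lborel)"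
    by (rule product_nn_integral_prod[OF I]) measurable
  also have "\<dots> < \<infinity>"
  proof -
    have "(\<integral>\<^sup>+x. ennreal (exp (l j * x - b * max 0 x)) \<partial>lborel) \<noteq> top" if "j \<in> I" for j
      using nn_integral_two_sided_exp_finite[of "l j" b] l[OF that] by (simp only: infinity_ennreal_def less_top)
    then have "(\<Prod>j\<in>I. \<integral>\<^sup>+x. ennreal (exp (l j * x - b * max 0 x)) \<partial>lborel) \<noteq> top"
      unfolding ennreal_prod_eq_top by blast
    then show ?thesis unfolding infinity_ennreal_def less_top .
  qed
  finally show ?thesis .
qed

section \<open>The tilted volume functional\<close>

text \<open>\<open>l_eq\<close> says that the exponential of sum_j l_j (B_j(t) - \<mu>_j t) has
  expectation 1 at all times. Positivity of \<open>l\<close> makes the weight in \<open>V\<close>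
  integrable on the negative orthant, where a hit is immediate.\<close>

locale tilted_bm = bm_vec M B d for M :: "'w measure" and B d +
  fixes \<mu> l :: "nat \<Rightarrow> real"
  assumes l_pos: "\<And>j. j \<in> {1..d} \<Longrightarrow> 0 < l j"
    and l_eq: "(\<Sum>j=1..d. (l j)\<^sup>2) = 2 * (\<Sum>j=1..d. l j * \<mu> j)"
begin

abbreviation "LB \<equiv> Pi\<^sub>M {1..d} (\<lambda>_. lborel :: real measure)"

definition V :: "((nat \<Rightarrow> real) \<Rightarrow> 'w \<Rightarrow> bool) \<Rightarrow> ennreal" where
  "V Q = (\<integral>\<^sup>+x. ennreal (exp (\<Sum>j=1..d. l j * x j)) * emeasure M {\<omega>\<in>space M. Q x \<omega>} \<partial>LB)"

definition Hit :: "real set \<Rightarrow> (nat \<Rightarrow> real) \<Rightarrow> 'w \<Rightarrow> bool" where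
  "Hit U x \<omega> \<longleftrightarrow> (\<exists>t\<in>U. hit B d \<mu> x t \<omega>)"

text \<open>\<open>V\<close> is defined for arbitrary predicates; joint measurability is carried
  separately and asked for only where additivity or monotonicity of \<open>V\<close> is
  used.\<close>

definition meas :: "((nat \<Rightarrow> real) \<Rightarrow> 'w \<Rightarrow> bool) \<Rightarrow> bool" where
  "meas Q \<longleftrightarrow> {y\<in>space (LB \<Otimes>\<^sub>M M). Q (fst y) (snd y)} \<in> sets (LB \<Otimes>\<^sub>M M)"

lemma V_cong: "(\<And>x \<omega>. \<omega> \<in> space M \<Longrightarrow> Q x \<omega> \<longleftrightarrow> Q' x \<omega>) \<Longrightarrow> V Q = V Q'"
  unfolding V_def by (intro nn_integral_cong arg_cong2[where f="(*)"] refl arg_cong[where f="emeasure M"]) auto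

lemma meas_pointwise:
  assumes "meas Q" "x \<in> space LB"
  shows "{\<omega>\<in>space M. Q x \<omega>} \<in> sets M"
proof -
  have "Pair x -` {y\<in>space (LB \<Otimes>\<^sub>M M). Q (fst y) (snd y)} \<in> sets M"
    by (rule sets_Pair1) (use assms in \<open>simp add: meas_def\<close>)
  also have "Pair x -` {y\<in>space (LB \<Otimes>\<^sub>M M). Q (fst y) (snd y)} = {\<omega>\<in>space M. Q x \<omega>}"
    using assms(2) by (auto simp: space_pair_measure)
  finally show ?thesis .
qed

lemma meas_emeasure:
  assumes "meas Q"
  shows "(\<lambda>x. emeasure M {\<omega>\<in>space M. Q x \<omega>}) \<in> borel_measurable LB"
proof -
  have "emeasure M (Pair x -` {y\<in>space (LB \<Otimes>\<^sub>M M). Q (fst y) (snd y)}) = emeasure M {\<omega>\<in>space M. Q x \<omega>}"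
    if "x \<in> space LB" for x
    using that by (intro arg_cong[where f="emeasure M"]) (auto simp: space_pair_measure)
  then show ?thesis
    using measurable_emeasure_Pair[of "{y\<in>space (LB \<Otimes>\<^sub>M M). Q (fst y) (snd y)}" LB] assms
    by (subst measurable_cong[symmetric]) (auto simp: meas_def)
qed

lemma meas_weighted:
  assumes "meas Q"
  shows "(\<lambda>x. ennreal (exp (\<Sum>j=1..d. l j * x j)) * emeasure M {\<omega>\<in>space M. Q x \<omega>}) \<in> borel_measurable LB"
proof -
  note [measurable] = meas_emeasure[OF assms]
  show ?thesis by measurable
qed

lemma meas_Hit: "open U \<Longrightarrow> U \<subseteq> {0<..} \<Longrightarrow> meas (Hit U)"
  unfolding meas_def Hit_def by (rule hit_measurable) auto

lemma meas_conj: "meas P \<Longrightarrow> meas Q \<Longrightarrow> meas (\<lambda>x \<omega>. P x \<omega> \<and> Q x \<omega>)"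
  unfolding meas_def by (rule sets.sets_Collect_conj)
lemma meas_disj: "meas P \<Longrightarrow> meas Q \<Longrightarrow> meas (\<lambda>x \<omega>. P x \<omega> \<or> Q x \<omega>)"
  unfolding meas_def by (rule sets.sets_Collect_disj)
lemma meas_not: "meas P \<Longrightarrow> meas (\<lambda>x \<omega>. \<not> P x \<omega>)"
  unfolding meas_def by (rule sets.sets_Collect_neg)

lemma V_split:
  assumes "meas P" "meas Q"
  shows "V P = V (\<lambda>x \<omega>. P x \<omega> \<and> Q x \<omega>) + V (\<lambda>x \<omega>. P x \<omega> \<and> \<not> Q x \<omega>)"
proof -
  have 1: "emeasure M {\<omega>\<in>space M. P x \<omega>} = emeasure M {\<omega>\<in>space M. P x \<omega> \<and> Q x \<omega>} + emeasure M {\<omega>\<in>space M. P x \<omega> \<and> \<not> Q x \<omega>}"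
    if x: "x \<in> space LB" for x
    by (subst plus_emeasure) (auto intro!: arg_cong[where f="emeasure M"] meas_pointwise meas_conj meas_not assms x)
  show ?thesis unfolding V_def
    by (subst nn_integral_add[symmetric])
       (auto simp: 1 distrib_left intro!: nn_integral_cong meas_weighted meas_conj meas_not assms)
qed

lemma V_mono: "(\<And>x \<omega>. \<omega> \<in> space M \<Longrightarrow> P x \<omega> \<Longrightarrow> Q x \<omega>) \<Longrightarrow> meas Q \<Longrightarrow> V P \<le> V Q"
  unfolding V_def by (intro nn_integral_mono mult_left_mono emeasure_mono meas_pointwise) auto

lemma sets_affine_preimage:
  assumes E: "E \<in> sets (paths_space d)"
  shows "{h\<in>space (paths_space d). (\<lambda>j\<in>{1..d}. \<lambda>t\<in>{0..}. h j t + a j t) \<in> E} \<in> sets (paths_space d)"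
proof -
  have "(\<lambda>h. \<lambda>j\<in>{1..d}. \<lambda>t\<in>{0..}. h j t + a j t) \<in> measurable (paths_space d) (paths_space d)"
    unfolding paths_space_def[of d] path_space_def
    by (intro measurable_restrict borel_measurable_add borel_measurable_const path_component_measurable[unfolded paths_space_def path_space_def]) auto
  from measurable_sets[OF this E] show ?thesis by (simp add: vimage_def Int_def conj_commute)
qed

text \<open>By the Markov property the shifted path is a fresh path started from an independent
  Gaussian vector w. After Fubini, Lebesgue measure absorbs the translation by w and leaves the
  factor exp(l . w), whose mean is 1 by \<open>l_eq\<close>.\<close>

lemma V_shift:
  assumes s: "0 < s" and E: "E \<in> sets (paths_space d)"
  shows "V (\<lambda>x \<omega>. (\<lambda>j\<in>{1..d}. \<lambda>t\<in>{0..}. B (s + t) \<omega> j - \<mu> j * (s + t) - x j) \<in> E) =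
     V (\<lambda>x \<omega>. (\<lambda>j\<in>{1..d}. \<lambda>t\<in>{0..}. B t \<omega> j - \<mu> j * t - x j) \<in> E)"
proof -
  interpret L: product_sigma_finite "\<lambda>_. lborel :: real measure" by (rule product_sigma_finite_lborel)
  interpret LB: sigma_finite_measure LB by (rule L.sigma_finite) simp
  \<comment> \<open>The mean carries the drift up to time s. Where the Markov property asks for a
    centred variable, \<open>\<mu> j * s\<close> is added back.\<close>
  define D where "D j = density lborel (normal_density (- \<mu> j * s) (sqrt s))" for j :: nat
  have pD: "prob_space (D j)" for j unfolding D_def by (rule prob_space_normal_density) (use s in simp)
  interpret D: product_sigma_finite D
    unfolding product_sigma_finite_def using pD by (simp add: prob_space_imp_sigma_finite)
  interpret PD: prob_space "Pi\<^sub>M {1..d} D" by (rule prob_space_PiM) (rule pD)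
  interpret PP: pair_sigma_finite LB "Pi\<^sub>M {1..d} D" ..
  define E' where "E' = {h\<in>space (paths_space d). (\<lambda>j\<in>{1..d}. \<lambda>t\<in>{0..}. h j t + (- \<mu> j * t)) \<in> E}"
  have E': "E' \<in> sets (paths_space d)" unfolding E'_def by (rule sets_affine_preimage[OF E])
  define p where "p y = emeasure M {\<omega>\<in>space M. (\<lambda>j\<in>{1..d}. \<lambda>t\<in>{0..}. - y j + B t \<omega> j) \<in> E'}" for y
  have p[measurable]: "p \<in> borel_measurable LB"
    unfolding p_def by (rule measurable_emeasure_translated[OF _ E']) simp
  have p_alt: "p y = emeasure M {\<omega>\<in>space M. (\<lambda>j\<in>{1..d}. \<lambda>t\<in>{0..}. B t \<omega> j - \<mu> j * t - y j) \<in> E}" for y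
    unfolding p_def E'_def
    by (intro arg_cong[where f="emeasure M"] Collect_cong conj_cong refl)
       (auto simp: restrict_paths_in_space cong: restrict_cong intro!: arg_cong[where f="\<lambda>h. h \<in> E"] simp: fun_eq_iff)
  have LHS: "emeasure M {\<omega>\<in>space M. (\<lambda>j\<in>{1..d}. \<lambda>t\<in>{0..}. B (s + t) \<omega> j - \<mu> j * (s + t) - x j) \<in> E} =
     (\<integral>\<^sup>+w. p (\<lambda>j\<in>{1..d}. x j - w j) \<partial>Pi\<^sub>M {1..d} D)" for x
  proof -
    define F where "F = {h\<in>space (paths_space d). (\<lambda>j\<in>{1..d}. \<lambda>t\<in>{0..}. h j t + (- \<mu> j * (s + t) - x j)) \<in> E}"
    have F: "F \<in> sets (paths_space d)" unfolding F_def by (rule sets_affine_preimage[OF E])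
    have "{\<omega>\<in>space M. (\<lambda>j\<in>{1..d}. \<lambda>t\<in>{0..}. B (s + t) \<omega> j - \<mu> j * (s + t) - x j) \<in> E}
       = {\<omega>\<in>space M. (\<lambda>j\<in>{1..d}. \<lambda>t\<in>{0..}. B (s + t) \<omega> j) \<in> F}"
      unfolding F_def
      by (intro Collect_cong conj_cong refl)
         (auto simp: restrict_paths_in_space intro!: arg_cong[where f="\<lambda>h. h \<in> E"] simp: fun_eq_iff)
    also have "emeasure M \<dots> = (\<integral>\<^sup>+ w. emeasure M {\<omega>\<in>space M. (\<lambda>j\<in>{1..d}. \<lambda>t\<in>{0..}. (\<mu> j * s + 1 * w j) + B t \<omega> j) \<in> F} \<partial>Pi\<^sub>M {1..d} D)"
    proof (rule Markov_emeasure[OF s pD _ _ F])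
      show "distr (D j) borel (\<lambda>w. \<mu> j * s + 1 * w) = density lborel (normal_density 0 (sqrt s))" for j
        unfolding D_def using distr_normal_affine[of "sqrt s" 1 "- \<mu> j * s" "\<mu> j * s"] s by simp
    qed (simp add: D_def)
    also have "\<dots> = (\<integral>\<^sup>+w. p (\<lambda>j\<in>{1..d}. x j - w j) \<partial>Pi\<^sub>M {1..d} D)"
      unfolding p_alt F_def
      by (intro nn_integral_cong arg_cong[where f="emeasure M"] Collect_cong conj_cong refl)
         (auto simp: restrict_paths_in_space algebra_simps intro!: arg_cong[where f="\<lambda>h. h \<in> E"] simp: fun_eq_iff)
    finally show ?thesis .
  qed
  have setsD: "sets (Pi\<^sub>M {1..d} D) = sets LB" by (rule sets_PiM_cong) (auto simp: D_def)
  have mdiff[measurable]: "(\<lambda>z. \<lambda>j\<in>{1..d}. fst z j - snd z j) \<in> measurable (LB \<Otimes>\<^sub>M Pi\<^sub>M {1..d} D) LB"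
  proof (rule measurable_restrict)
    fix j assume j: "j \<in> {1..d}"
    have "(\<lambda>z. fst z j) \<in> borel_measurable (LB \<Otimes>\<^sub>M Pi\<^sub>M {1..d} D)"
      using j by (intro measurable_compose[OF measurable_fst]) auto
    moreover have "(\<lambda>w. w j) \<in> borel_measurable (Pi\<^sub>M {1..d} D)"
      using measurable_component_singleton[OF j, of D] by (simp add: D_def)
    then have "(\<lambda>z. snd z j) \<in> borel_measurable (LB \<Otimes>\<^sub>M Pi\<^sub>M {1..d} D)"
      by (rule measurable_compose[OF measurable_snd])
    ultimately show "(\<lambda>z. fst z j - snd z j) \<in> measurable (LB \<Otimes>\<^sub>M Pi\<^sub>M {1..d} D) lborel"
      by simp
  qed
  have mp: "(\<lambda>z. p (\<lambda>j\<in>{1..d}. fst z j - snd z j)) \<in> borel_measurable (LB \<Otimes>\<^sub>M Pi\<^sub>M {1..d} D)"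
    by (rule measurable_compose[OF mdiff p])
  let ?e = "\<lambda>x. ennreal (exp (\<Sum>j=1..d. l j * x j))"
  have me[measurable]: "?e \<in> borel_measurable LB" by measurable
  have mw: "(\<lambda>w. p (\<lambda>j\<in>{1..d}. x j - w j)) \<in> borel_measurable (Pi\<^sub>M {1..d} D)" if "x \<in> space LB" for x
    using measurable_compose[OF measurable_Pair1'[OF that] mp] by simp
  have "V (\<lambda>x \<omega>. (\<lambda>j\<in>{1..d}. \<lambda>t\<in>{0..}. B (s + t) \<omega> j - \<mu> j * (s + t) - x j) \<in> E)
     = (\<integral>\<^sup>+x. ?e x * (\<integral>\<^sup>+w. p (\<lambda>j\<in>{1..d}. x j - w j) \<partial>Pi\<^sub>M {1..d} D) \<partial>LB)"
    unfolding V_def LHS ..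
  also have "\<dots> = (\<integral>\<^sup>+x. (\<integral>\<^sup>+w. ?e x * p (\<lambda>j\<in>{1..d}. x j - w j) \<partial>Pi\<^sub>M {1..d} D) \<partial>LB)"
    by (intro nn_integral_cong nn_integral_cmult[symmetric] mw)
  also have "\<dots> = (\<integral>\<^sup>+w. (\<integral>\<^sup>+x. ?e x * p (\<lambda>j\<in>{1..d}. x j - w j) \<partial>LB) \<partial>Pi\<^sub>M {1..d} D)"
  proof (rule PP.Fubini'[symmetric])
    have "(\<lambda>z. ?e (fst z) * p (\<lambda>j\<in>{1..d}. fst z j - snd z j)) \<in> borel_measurable (LB \<Otimes>\<^sub>M Pi\<^sub>M {1..d} D)"
      by (intro borel_measurable_times_ennreal mp measurable_compose[OF measurable_fst me])
    then show "(\<lambda>(x, w). ?e x * p (\<lambda>j\<in>{1..d}. x j - w j)) \<in> borel_measurable (LB \<Otimes>\<^sub>M Pi\<^sub>M {1..d} D)"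
      by (simp add: case_prod_beta)
  qed
  also have "\<dots> = (\<integral>\<^sup>+w. ?e w * (\<integral>\<^sup>+x. ?e x * p x \<partial>LB) \<partial>Pi\<^sub>M {1..d} D)"
  proof (rule nn_integral_cong)
    fix w
    have "(\<integral>\<^sup>+x. ?e x * p (\<lambda>j\<in>{1..d}. x j - w j) \<partial>LB) = (\<integral>\<^sup>+x. ?e w * (?e (\<lambda>j\<in>{1..d}. x j - w j) * p (\<lambda>j\<in>{1..d}. x j - w j)) \<partial>LB)"
    proof (rule nn_integral_cong)
      fix x :: "nat \<Rightarrow> real"
      have "?e x = ?e w * ?e (\<lambda>j\<in>{1..d}. x j - w j)"
        by (simp add: ennreal_mult[symmetric] exp_add[symmetric] sum.distrib[symmetric] algebra_simps)
      then show "?e x * p (\<lambda>j\<in>{1..d}. x j - w j) = ?e w * (?e (\<lambda>j\<in>{1..d}. x j - w j) * p (\<lambda>j\<in>{1..d}. x j - w j))"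
        by (simp add: mult.assoc)
    qed
    also have "\<dots> = (\<integral>\<^sup>+x. ?e w * (?e x * p x) \<partial>LB)"
      by (rule nn_integral_PiM_lborel_translate[where f = "\<lambda>x. ?e w * (?e x * p x)"]) (simp, measurable)
    also have "\<dots> = ?e w * (\<integral>\<^sup>+x. ?e x * p x \<partial>LB)" by (rule nn_integral_cmult) measurable
    finally show "(\<integral>\<^sup>+x. ?e x * p (\<lambda>j\<in>{1..d}. x j - w j) \<partial>LB) = ?e w * (\<integral>\<^sup>+x. ?e x * p x \<partial>LB)" .
  qed
  also have "\<dots> = (\<integral>\<^sup>+w. ?e w \<partial>Pi\<^sub>M {1..d} D) * (\<integral>\<^sup>+x. ?e x * p x \<partial>LB)"
    by (rule nn_integral_multc) (use me measurable_cong_sets[OF setsD refl] in blast)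
  also have "(\<integral>\<^sup>+w. ?e w \<partial>Pi\<^sub>M {1..d} D) = (\<integral>\<^sup>+w. (\<Prod>j\<in>{1..d}. ennreal (exp (l j * w j))) \<partial>Pi\<^sub>M {1..d} D)"
    by (simp add: exp_sum prod_ennreal)
  also have "\<dots> = (\<Prod>j\<in>{1..d}. \<integral>\<^sup>+w. ennreal (exp (l j * w)) \<partial>D j)"
    by (rule D.product_nn_integral_prod) (auto simp: D_def)
  also have "\<dots> = (\<Prod>j\<in>{1..d}. ennreal (exp (s * ((l j)\<^sup>2 / 2 - l j * \<mu> j))))"
  proof (rule prod.cong[OF refl])
    fix j
    have "(\<integral>\<^sup>+w. ennreal (exp (l j * w)) \<partial>D j) = (\<integral>\<^sup>+w. ennreal (normal_density (- \<mu> j * s) (sqrt s) w) * ennreal (exp (l j * w)) \<partial>lborel)"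
      unfolding D_def by (rule nn_integral_density) auto
    also have "\<dots> = (\<integral>\<^sup>+w. ennreal (exp (l j * w) * normal_density (- \<mu> j * s) (sqrt s) w) \<partial>lborel)"
      by (intro nn_integral_cong) (simp add: ennreal_mult[symmetric] mult.commute)
    also have "\<dots> = ennreal (exp (l j * (- \<mu> j * s) + (l j)\<^sup>2 * (sqrt s)\<^sup>2 / 2))"
      by (rule normal_mgf) (use s in simp)
    also have "l j * (- \<mu> j * s) + (l j)\<^sup>2 * (sqrt s)\<^sup>2 / 2 = s * ((l j)\<^sup>2 / 2 - l j * \<mu> j)"
      using s by (simp add: algebra_simps)
    finally show "(\<integral>\<^sup>+w. ennreal (exp (l j * w)) \<partial>D j) = ennreal (exp (s * ((l j)\<^sup>2 / 2 - l j * \<mu> j)))" .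
  qed
  also have "\<dots> = ennreal (exp (s * ((\<Sum>j=1..d. (l j)\<^sup>2) / 2 - (\<Sum>j=1..d. l j * \<mu> j))))"
    by (simp add: prod_ennreal exp_sum[symmetric] sum_distrib_left[symmetric] sum_subtractf sum_divide_distrib[symmetric])
  also have "\<dots> = 1" by (simp add: l_eq)
  also have "1 * (\<integral>\<^sup>+x. ?e x * p x \<partial>LB) = V (\<lambda>x \<omega>. (\<lambda>j\<in>{1..d}. \<lambda>t\<in>{0..}. B t \<omega> j - \<mu> j * t - x j) \<in> E)"
    unfolding mult_1 V_def p_alt ..
  finally show ?thesis .
qed

lemma V_Hit_shift:
  assumes s: "0 < s" and U: "open U" "U \<subseteq> {0<..}"
  shows "V (Hit ((+) s ` U)) = V (Hit U)"
proof -
  have U': "open ((+) s ` U)" "(+) s ` U \<subseteq> {0<..}" using U s by (auto intro: open_translation)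
  have U0: "0 \<le> q" if "q \<in> U" for q using U(2) that by force
  \<comment> \<open>Drift and level are already subtracted from the path to which \<open>?E\<close>
    is applied, hence the zeros.\<close>
  let ?E = "phits (\<lambda>_. 0) d U d (\<lambda>_. 0)"
  have E: "?E \<in> sets (paths_space d)" by (rule sets_phits) (use U in auto)
  have "V (Hit ((+) s ` U)) = V (\<lambda>x \<omega>. (\<lambda>j\<in>{1..d}. \<lambda>t\<in>{0..}. B (s + t) \<omega> j - \<mu> j * (s + t) - x j) \<in> ?E)"
  proof (rule V_cong)
    fix x \<omega> assume \<omega>: "\<omega> \<in> space M"
    show "Hit ((+) s ` U) x \<omega> \<longleftrightarrow> (\<lambda>j\<in>{1..d}. \<lambda>t\<in>{0..}. B (s + t) \<omega> j - \<mu> j * (s + t) - x j) \<in> ?E"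
      unfolding Hit_def hit_rational[OF \<omega> order_refl U', where s = s] phits_def
      by (auto simp: restrict_paths_in_space hit_def U0)
  qed
  also have "\<dots> = V (\<lambda>x \<omega>. (\<lambda>j\<in>{1..d}. \<lambda>t\<in>{0..}. B t \<omega> j - \<mu> j * t - x j) \<in> ?E)"
    by (rule V_shift[OF s E])
  also have "\<dots> = V (Hit U)"
  proof (rule V_cong)
    fix x \<omega> assume \<omega>: "\<omega> \<in> space M"
    show "(\<lambda>j\<in>{1..d}. \<lambda>t\<in>{0..}. B t \<omega> j - \<mu> j * t - x j) \<in> ?E \<longleftrightarrow> Hit U x \<omega>"
      unfolding Hit_def hit_rational[OF \<omega> order_refl U, where s = 0] phits_def
      by (auto simp: restrict_paths_in_space hit_def U0)
  qed
  finally show ?thesis .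
qed

lemma V_Hit_finite:
  assumes T: "0 < T"
  shows "V (Hit {0<..<T}) < \<infinity>"
proof -
  \<comment> \<open>Larger than every single l_j, so the tail bound beats the tilt in each
    coordinate.\<close>
  define b where "b = (\<Sum>j=1..d. l j) + 1"
  have lb: "l j < b" if "j \<in> {1..d}" for j
    using member_le_sum[of j "{1..d}" l] l_pos that by (force simp: b_def less_imp_le)
  have b: "0 \<le> b" using lb[of 1] l_pos[of 1] d1 by force
  obtain C where C: "0 < C" "\<And>x. prob {\<omega>\<in>space M. \<exists>t\<in>{0<..<T}. hit B d \<mu> x t \<omega>} \<le> C * exp (- b * (\<Sum>j=1..d. max 0 (x j)))"
    using hit_tail[OF d1 order_refl T b, of \<mu>] by blast
  have "V (Hit {0<..<T}) \<le> (\<integral>\<^sup>+x. ennreal C * ennreal (exp (\<Sum>j\<in>{1..d}. l j * x j - b * max 0 (x j))) \<partial>LB)"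
    unfolding V_def
  proof (rule nn_integral_mono)
    fix x :: "nat \<Rightarrow> real"
    have "ennreal (exp (\<Sum>j=1..d. l j * x j)) * emeasure M {\<omega>\<in>space M. Hit {0<..<T} x \<omega>}
      \<le> ennreal (exp (\<Sum>j=1..d. l j * x j)) * ennreal (C * exp (- b * (\<Sum>j=1..d. max 0 (x j))))"
      by (intro mult_left_mono) (use C(2)[of x] in \<open>auto simp: emeasure_eq_measure Hit_def intro!: ennreal_leI\<close>)
    also have "\<dots> = ennreal C * ennreal (exp (\<Sum>j\<in>{1..d}. l j * x j - b * max 0 (x j)))"
      using C(1) by (simp add: ennreal_mult[symmetric] sum_subtractf sum_distrib_left[symmetric] exp_diff exp_minus field_simps)
    finally show "ennreal (exp (\<Sum>j=1..d. l j * x j)) * emeasure M {\<omega>\<in>space M. Hit {0<..<T} x \<omega>} \<le> \<dots>" .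
  qed
  also have "\<dots> = ennreal C * (\<integral>\<^sup>+x. ennreal (exp (\<Sum>j\<in>{1..d}. l j * x j - b * max 0 (x j))) \<partial>LB)"
    by (rule nn_integral_cmult) measurable
  also have "\<dots> < \<infinity>"
    using nn_integral_prod_exp_finite[of "{1..d}" l b] l_pos lb by (auto simp: ennreal_mult_less_top)
  finally show ?thesis .
qed

end

section \<open>Existence and positivity of the constant\<close>

lemma Cesaro_mean:
  fixes a :: "nat \<Rightarrow> real"
  assumes a: "a \<longlonglongrightarrow> L"
  shows "(\<lambda>n. (\<Sum>k<n. a k) / real n) \<longlonglongrightarrow> L"
proof (rule LIMSEQ_I)
  fix e :: real assume e: "0 < e"
  obtain N where N: "\<And>k. N \<le> k \<Longrightarrow> \<bar>a k - L\<bar> < e / 2"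
    using LIMSEQ_D[OF a, of "e / 2"] e by auto
  define C where "C = (\<Sum>k<N. \<bar>a k - L\<bar>)"
  obtain m where m: "2 * C / e < real m" using reals_Archimedean2 by blast
  have C0: "0 \<le> C" by (simp add: C_def sum_nonneg)
  show "\<exists>n0. \<forall>n\<ge>n0. norm ((\<Sum>k<n. a k) / real n - L) < e"
  proof (intro exI allI impI)
    fix n assume n: "n \<ge> max (Suc m) N"
    then have n0: "0 < n" by simp
    have "(\<Sum>k<n. a k) / real n - L = (\<Sum>k<n. a k - L) / real n"
      using n0 by (simp add: sum_subtractf field_simps)
    moreover have "\<bar>\<Sum>k<n. a k - L\<bar> \<le> C + real n * (e / 2)"
    proof -
      have "\<bar>\<Sum>k<n. a k - L\<bar> \<le> (\<Sum>k<n. \<bar>a k - L\<bar>)" by (rule sum_abs)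
      also have "(\<Sum>k<n. \<bar>a k - L\<bar>) = C + (\<Sum>k\<in>{N..<n}. \<bar>a k - L\<bar>)"
      proof -
        have "{..<n} = {..<N} \<union> {N..<n}" using n by auto
        then show ?thesis unfolding C_def by (simp add: sum.union_disjoint ivl_disj_int)
      qed
      also have "(\<Sum>k\<in>{N..<n}. \<bar>a k - L\<bar>) \<le> (\<Sum>k\<in>{N..<n}. e / 2)"
        by (rule sum_mono) (use N in \<open>auto intro: less_imp_le\<close>)
      also have "\<dots> \<le> real n * (e / 2)" using e n by (simp add: mult_right_mono)
      finally show ?thesis by simp
    qed
    moreover have "C < real n * (e / 2)"
    proof -
      have "C < real m * e / 2" using m e by (simp add: field_simps)
      also have "\<dots> \<le> real n * (e / 2)" using n e by simp
      finally show ?thesis .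
    qed
    ultimately have "\<bar>\<Sum>k<n. a k - L\<bar> < real n * e" by linarith
    then show "norm ((\<Sum>k<n. a k) / real n - L) < e"
      using \<open>(\<Sum>k<n. a k) / real n - L = (\<Sum>k<n. a k - L) / real n\<close> n0
      by (simp add: field_simps)
  qed
qed

lemma image_add_open_interval: "(+) s ` {a<..<b} = {s + a<..<s + (b::real)}"
proof (intro set_eqI iffI)
  fix x assume "x \<in> {s + a<..<s + b}"
  then have "x - s \<in> {a<..<b}" "x = s + (x - s)" by auto
  then show "x \<in> (+) s ` {a<..<b}" by blast
qed auto

context tilted_bm
begin

lemma V_disj_le:
  assumes "meas P" "meas Q"
  shows "V (\<lambda>x \<omega>. P x \<omega> \<or> Q x \<omega>) \<le> V P + V Q"
proof -
  have "V (\<lambda>x \<omega>. P x \<omega> \<or> Q x \<omega>) = V (\<lambda>x \<omega>. (P x \<omega> \<or> Q x \<omega>) \<and> Q x \<omega>) + V (\<lambda>x \<omega>. (P x \<omega> \<or> Q x \<omega>) \<and> \<not> Q x \<omega>)"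
    by (rule V_split) (auto intro!: meas_disj assms)
  also have "\<dots> \<le> V Q + V P" by (intro add_mono V_mono assms) auto
  finally show ?thesis by (simp add: add.commute)
qed

lemma meas_hit: "0 \<le> t \<Longrightarrow> meas (\<lambda>x \<omega>. hit B d \<mu> x t \<omega>)"
  unfolding meas_def hit_def
proof (rule sets.sets_Collect_finite_All)
  fix j assume t: "0 \<le> t" and j: "j \<in> {1..d}"
  have [measurable]: "(\<lambda>y. B t (snd y) j) \<in> borel_measurable (LB \<Otimes>\<^sub>M M)"
    by (rule measurable_compose[OF measurable_snd B_measurable]) (use t j in auto)
  have [measurable]: "(\<lambda>y. fst y j) \<in> borel_measurable (LB \<Otimes>\<^sub>M M)"
    using j by (intro measurable_compose[OF measurable_fst]) auto
  show "{y\<in>space (LB \<Otimes>\<^sub>M M). fst y j < B t (snd y) j - \<mu> j * t} \<in> sets (LB \<Otimes>\<^sub>M M)" by measurable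
qed simp

lemma meas_finite_ex: "finite K \<Longrightarrow> (\<And>k. k \<in> K \<Longrightarrow> meas (Q k)) \<Longrightarrow> meas (\<lambda>x \<omega>. \<exists>k\<in>K. Q k x \<omega>)"
  unfolding meas_def by (rule sets.sets_Collect_finite_Ex) auto

lemma V_finite_ex_le:
  assumes "finite K" "\<And>k. k \<in> K \<Longrightarrow> meas (Q k)"
  shows "V (\<lambda>x \<omega>. \<exists>k\<in>K. Q k x \<omega>) \<le> (\<Sum>k\<in>K. V (Q k))"
  using assms
proof (induction K rule: finite_induct)
  case empty
  then show ?case by (simp add: V_def)
next
  case (insert k K)
  have "V (\<lambda>x \<omega>. \<exists>k\<in>insert k K. Q k x \<omega>) = V (\<lambda>x \<omega>. Q k x \<omega> \<or> (\<exists>k\<in>K. Q k x \<omega>))"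
    by (rule V_cong) auto
  also have "\<dots> \<le> V (Q k) + V (\<lambda>x \<omega>. \<exists>k\<in>K. Q k x \<omega>)"
    by (rule V_disj_le) (use insert in \<open>auto intro!: meas_finite_ex\<close>)
  also have "\<dots> \<le> V (Q k) + (\<Sum>k\<in>K. V (Q k))" by (intro add_left_mono insert.IH) (use insert in auto)
  finally show ?case using insert by simp
qed

definition G :: ennreal where
  "G = V (\<lambda>x \<omega>. Hit {0<..<1} x \<omega> \<and> \<not> Hit {1<..} x \<omega>)"

definition H :: real where "H = enn2real G"

lemma open_time_intervals:
  "open {a<..<b::real}" "open {a<..}" "0 \<le> a \<Longrightarrow> {a<..<b} \<subseteq> {0<..}" "0 \<le> a \<Longrightarrow> {a<..} \<subseteq> {0<..}"
  by auto

lemmas meas_Hit_intervals = meas_Hit[OF open_time_intervals(1,3)] meas_Hit[OF open_time_intervals(2,4)]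

lemma G_finite: "G < \<infinity>"
proof -
  have "G \<le> V (Hit {0<..<1})" unfolding G_def
    by (rule V_mono) (auto intro: meas_Hit_intervals)
  then show ?thesis using V_Hit_finite[of 1] by auto
qed

lemma G_eq_H: "G = ennreal H"
  using G_finite by (simp add: H_def)

text \<open>Split according to a hit in (T, T + S), whose mass is that of (0, S) by shift
  invariance. What remains has its hits in (0, T]; a hit exactly at T would persist beyond T, so it
  is excluded as well.\<close>

lemma V_Hit_step:
  assumes T: "0 < T" and S: "0 < S"
  shows "V (Hit {0<..<T + S}) = V (\<lambda>x \<omega>. Hit {0<..<T} x \<omega> \<and> \<not> Hit {T<..<T+S} x \<omega>) + V (Hit {0<..<S})"
proof -
  have "V (Hit {0<..<T + S}) = V (\<lambda>x \<omega>. Hit {0<..<T + S} x \<omega> \<and> Hit {T<..<T+S} x \<omega>)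
     + V (\<lambda>x \<omega>. Hit {0<..<T + S} x \<omega> \<and> \<not> Hit {T<..<T+S} x \<omega>)"
    by (rule V_split) (use T in \<open>auto intro!: meas_Hit_intervals\<close>)
  also have "V (\<lambda>x \<omega>. Hit {0<..<T + S} x \<omega> \<and> Hit {T<..<T+S} x \<omega>) = V (Hit ((+) T ` {0<..<S}))"
    using T by (intro V_cong) (auto simp: Hit_def image_add_open_interval)
  also have "\<dots> = V (Hit {0<..<S})" by (rule V_Hit_shift[OF T]) auto
  also have "V (\<lambda>x \<omega>. Hit {0<..<T + S} x \<omega> \<and> \<not> Hit {T<..<T+S} x \<omega>) = V (\<lambda>x \<omega>. Hit {0<..<T} x \<omega> \<and> \<not> Hit {T<..<T+S} x \<omega>)"
  proof (rule V_cong)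
    fix x \<omega> assume \<omega>: "\<omega> \<in> space M"
    have "Hit {0<..<T} x \<omega>" if h: "Hit {0<..<T + S} x \<omega>" and n: "\<not> Hit {T<..<T+S} x \<omega>"
    proof -
      obtain t where t: "0 < t" "t < T + S" "hit B d \<mu> x t \<omega>" using h by (auto simp: Hit_def)
      obtain e where e: "0 < e" "\<And>t'. 0 \<le> t' \<Longrightarrow> \<bar>t' - t\<bar> < e \<Longrightarrow> hit B d \<mu> x t' \<omega>"
        using hit_open[OF \<omega> order_refl _ t(3)] t(1) by auto
      have "\<not> T \<le> t"
      proof
        assume "T \<le> t"
        define t' where "t' = t + min (e / 2) ((T + S - t) / 2)"
        have "t < t'" "t' < t + e" "t' < T + S" using e t by (auto simp: t'_def min_def field_simps)
        then have "Hit {T<..<T+S} x \<omega>" unfolding Hit_def using e(2)[of t'] t \<open>T \<le> t\<close> by (intro bexI[of _ t']) auto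
        then show False using n by simp
      qed
      then show ?thesis using t by (auto simp: Hit_def)
    qed
    then show "(Hit {0<..<T + S} x \<omega> \<and> \<not> Hit {T<..<T+S} x \<omega>) \<longleftrightarrow> (Hit {0<..<T} x \<omega> \<and> \<not> Hit {T<..<T+S} x \<omega>)"
      using S by (auto simp: Hit_def)
  qed
  finally show ?thesis by (simp add: add.commute)
qed

text \<open>Continuity from above at each x, then dominated convergence in x with the finite mass of
  a hit in (0, 1) as majorant.\<close>

lemma G_limit: "(\<lambda>n. V (\<lambda>x \<omega>. Hit {0<..<1} x \<omega> \<and> \<not> Hit {1<..<1 + real n} x \<omega>)) \<longlonglongrightarrow> G"
  unfolding G_def V_def
proof (rule nn_integral_dominated_convergence[where w = "\<lambda>x. ennreal (exp (\<Sum>j=1..d. l j * x j)) * emeasure M {\<omega>\<in>space M. Hit {0<..<1} x \<omega>}"])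
  show "(\<integral>\<^sup>+x. ennreal (exp (\<Sum>j=1..d. l j * x j)) * emeasure M {\<omega>\<in>space M. Hit {0<..<1} x \<omega>} \<partial>LB) < \<infinity>"
    using V_Hit_finite[of 1] by (simp add: V_def)
  show "AE x in LB. ennreal (exp (\<Sum>j=1..d. l j * x j)) * emeasure M {\<omega>\<in>space M. Hit {0<..<1} x \<omega> \<and> \<not> Hit {1<..<1 + real n} x \<omega>}
     \<le> ennreal (exp (\<Sum>j=1..d. l j * x j)) * emeasure M {\<omega>\<in>space M. Hit {0<..<1} x \<omega>}" for n
    by (intro AE_I2 mult_left_mono emeasure_mono meas_pointwise[OF meas_Hit_intervals(1)]) auto
  show "AE x in LB. (\<lambda>n. ennreal (exp (\<Sum>j=1..d. l j * x j)) * emeasure M {\<omega>\<in>space M. Hit {0<..<1} x \<omega> \<and> \<not> Hit {1<..<1 + real n} x \<omega>})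
     \<longlonglongrightarrow> ennreal (exp (\<Sum>j=1..d. l j * x j)) * emeasure M {\<omega>\<in>space M. Hit {0<..<1} x \<omega> \<and> \<not> Hit {1<..} x \<omega>}"
  proof (rule AE_I2)
    fix x assume x: "x \<in> space LB"
    have "(\<lambda>n. emeasure M {\<omega>\<in>space M. Hit {0<..<1} x \<omega> \<and> \<not> Hit {1<..<1 + real n} x \<omega>})
      \<longlonglongrightarrow> emeasure M (\<Inter>n. {\<omega>\<in>space M. Hit {0<..<1} x \<omega> \<and> \<not> Hit {1<..<1 + real n} x \<omega>})"
    proof (rule Lim_emeasure_decseq)
      show "range (\<lambda>n. {\<omega>\<in>space M. Hit {0<..<1} x \<omega> \<and> \<not> Hit {1<..<1 + real n} x \<omega>}) \<subseteq> sets M"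
        using x by (auto intro!: meas_pointwise meas_conj meas_not meas_Hit_intervals)
      show "decseq (\<lambda>n. {\<omega>\<in>space M. Hit {0<..<1} x \<omega> \<and> \<not> Hit {1<..<1 + real n} x \<omega>})"
        by (auto simp: decseq_def Hit_def)
    qed simp
    also have "(\<Inter>n. {\<omega>\<in>space M. Hit {0<..<1} x \<omega> \<and> \<not> Hit {1<..<1 + real n} x \<omega>}) = {\<omega>\<in>space M. Hit {0<..<1} x \<omega> \<and> \<not> Hit {1<..} x \<omega>}"
    proof -
      have "(\<forall>n. \<not> Hit {1<..<1 + real n} x \<omega>) \<longleftrightarrow> \<not> Hit {1<..} x \<omega>" for \<omega>
      proof -
        have "\<exists>n. t < 1 + real n" for t using reals_Archimedean2[of "t - 1"] by (simp add: algebra_simps)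
        then show ?thesis unfolding Hit_def by (metis greaterThanLessThan_iff greaterThan_iff)
      qed
      then show ?thesis by blast
    qed
    finally show "(\<lambda>n. ennreal (exp (\<Sum>j=1..d. l j * x j)) * emeasure M {\<omega>\<in>space M. Hit {0<..<1} x \<omega> \<and> \<not> Hit {1<..<1 + real n} x \<omega>})
     \<longlonglongrightarrow> ennreal (exp (\<Sum>j=1..d. l j * x j)) * emeasure M {\<omega>\<in>space M. Hit {0<..<1} x \<omega> \<and> \<not> Hit {1<..} x \<omega>}"
      by (intro tendsto_mult_ennreal tendsto_const) auto
  qed
qed (auto intro!: meas_weighted meas_conj meas_not meas_Hit_intervals)

definition R :: "real \<Rightarrow> real" where "R T = enn2real (V (Hit {0<..<T}))"

lemma V_Hit_R: "0 < T \<Longrightarrow> V (Hit {0<..<T}) = ennreal (R T)"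
  unfolding R_def using V_Hit_finite[of T] by simp

lemma R_mono: "0 < S \<Longrightarrow> S \<le> T \<Longrightarrow> R S \<le> R T"
proof -
  assume S: "0 < S" "S \<le> T"
  have "V (Hit {0<..<S}) \<le> V (Hit {0<..<T})"
    by (rule V_mono) (use S in \<open>auto simp: Hit_def intro!: meas_Hit_intervals\<close>)
  then show ?thesis unfolding R_def using V_Hit_finite[of T] S by (intro enn2real_mono) auto
qed

text \<open>\<open>V_Hit_step\<close> with T = 1 and S = n identifies R(n + 1) - R(n) with the
  sequence of \<open>G_limit\<close>; the sum telescopes and the means converge.\<close>

lemma R_nat: "(\<lambda>n. R (real n) / real n) \<longlonglongrightarrow> H"
proof -
  define a where "a n = enn2real (V (\<lambda>x \<omega>. Hit {0<..<1} x \<omega> \<and> \<not> Hit {1<..<1 + real n} x \<omega>))" for n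
  have a_fin: "V (\<lambda>x \<omega>. Hit {0<..<1} x \<omega> \<and> \<not> Hit {1<..<1 + real n} x \<omega>) = ennreal (a n)" for n
  proof -
    have "V (\<lambda>x \<omega>. Hit {0<..<1} x \<omega> \<and> \<not> Hit {1<..<1 + real n} x \<omega>) \<le> V (Hit {0<..<1})"
      by (rule V_mono) (auto intro: meas_Hit_intervals)
    then show ?thesis unfolding a_def using V_Hit_finite[of 1] by auto
  qed
  have aH: "a \<longlonglongrightarrow> H"
    unfolding a_def H_def using G_limit G_finite by (intro tendsto_enn2real) auto
  have step: "R (real (Suc n)) = a n + R (real n)" for n
  \<comment> \<open>For n = 0 the interval (1, 1) is empty, so \<open>a 0\<close> is the whole mass
    of a hit in (0, 1), and R 0 = 0.\<close>
  proof (cases "n = 0")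
    case True
    then show ?thesis by (simp add: a_def R_def) (simp add: Hit_def V_def)
  next
    case False
    have "ennreal (R (real (Suc n))) = ennreal (a n) + ennreal (R (real n))"
      using V_Hit_step[of 1 "real n"] False by (simp add: V_Hit_R a_fin add.commute)
    then show ?thesis by (simp add: a_def R_def ennreal_plus[symmetric] del: ennreal_plus of_nat_Suc)
  qed
  have "R (real n) = (\<Sum>k<n. a k)" for n
  proof (induction n)
    case 0 then show ?case by (simp add: R_def Hit_def V_def)
  next
    case (Suc n) then show ?case using step[of n] by simp
  qed
  then show ?thesis using Cesaro_mean[OF aH] by simp
qed

text \<open>Monotonicity of \<open>R\<close> squeezes T between its floor and the next integer; the
  quotient of the two tends to 1.\<close>

lemma R_limit: "((\<lambda>T. R T / T) \<longlongrightarrow> H) at_top"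
proof -
  define N where "N T = nat \<lfloor>T\<rfloor>" for T :: real
  have N: "filterlim N at_top at_top" unfolding N_def
    by (rule filterlim_compose[OF filterlim_nat_sequentially filterlim_floor_sequentially])
  have 1: "(\<lambda>n. (R (real n) / real n) * (real n / real (Suc n))) \<longlonglongrightarrow> H * 1"
    by (intro tendsto_mult R_nat LIMSEQ_n_over_Suc_n)
  have 2: "(\<lambda>n. (R (real (Suc n)) / real (Suc n)) * (real (Suc n) / real n)) \<longlonglongrightarrow> H * 1"
    by (intro tendsto_mult LIMSEQ_Suc_n_over_n LIMSEQ_Suc[OF R_nat])
  have ev: "\<forall>\<^sub>F T in at_top. 1 \<le> (T::real)" by (rule eventually_ge_at_top)
  have NT: "real (N T) \<le> T" "T < real (Suc (N T))" "1 \<le> N T" if "1 \<le> T" for T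
    using that by (auto simp: N_def le_nat_iff le_floor_iff) linarith+
  show ?thesis
  proof (rule tendsto_sandwich)
    show "\<forall>\<^sub>F T in at_top. (R (real (N T)) / real (N T)) * (real (N T) / real (Suc (N T))) \<le> R T / T"
      using ev
    proof eventually_elim
      case (elim T)
      have "(R (real (N T)) / real (N T)) * (real (N T) / real (Suc (N T))) = R (real (N T)) / real (Suc (N T))"
        using NT[OF elim] by simp
      also have "\<dots> \<le> R T / T"
        using NT[OF elim] elim by (intro frac_le R_mono) (auto simp: R_def)
      finally show ?case .
    qed
    show "\<forall>\<^sub>F T in at_top. R T / T \<le> (R (real (Suc (N T))) / real (Suc (N T))) * (real (Suc (N T)) / real (N T))"
      using ev
    proof eventually_elim
      case (elim T)
      have "R T / T \<le> R (real (Suc (N T))) / real (N T)"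
        using NT[OF elim] elim by (intro frac_le R_mono) (auto simp: R_def)
      also have "\<dots> = (R (real (Suc (N T))) / real (Suc (N T))) * (real (Suc (N T)) / real (N T))"
        using NT[OF elim] by (simp del: of_nat_Suc)
      finally show ?case .
    qed
    show "((\<lambda>T. (R (real (N T)) / real (N T)) * (real (N T) / real (Suc (N T)))) \<longlongrightarrow> H) at_top"
      using filterlim_compose[OF 1 N] by (simp del: of_nat_Suc)
    show "((\<lambda>T. (R (real (Suc (N T))) / real (Suc (N T))) * (real (Suc (N T)) / real (N T))) \<longlongrightarrow> H) at_top"
      using filterlim_compose[OF 2 N] by (simp del: of_nat_Suc)
  qed
qed

section \<open>Positivity of the constant by a sparse lattice of times\<close>

lemma V_neg_orthant:
  assumes g: "\<And>j. j \<in> {1..d} \<Longrightarrow> 0 < g j"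
  shows "(\<integral>\<^sup>+x. ennreal (exp (\<Sum>j=1..d. g j * x j)) * indicator {x. \<forall>j\<in>{1..d}. x j < 0} x \<partial>LB) = ennreal (\<Prod>j=1..d. 1 / g j)"
proof -
  interpret L: product_sigma_finite "\<lambda>_. lborel :: real measure" by (rule product_sigma_finite_lborel)
  have "(\<integral>\<^sup>+x. ennreal (exp (\<Sum>j=1..d. g j * x j)) * indicator {x. \<forall>j\<in>{1..d}. x j < 0} x \<partial>LB)
    = (\<integral>\<^sup>+x. (\<Prod>j\<in>{1..d}. ennreal (exp (g j * x j)) * indicator {..<0} (x j)) \<partial>LB)"
  proof (rule nn_integral_cong)
    fix x :: "nat \<Rightarrow> real"
    have "(indicator {x. \<forall>j\<in>{1..d}. x j < 0} x :: ennreal) = (\<Prod>j\<in>{1..d}. indicator {..<0} (x j))"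
      by (auto simp: indicator_def prod_eq_1_iff split: if_splits)
    then show "ennreal (exp (\<Sum>j=1..d. g j * x j)) * indicator {x. \<forall>j\<in>{1..d}. x j < 0} x
       = (\<Prod>j\<in>{1..d}. ennreal (exp (g j * x j)) * indicator {..<0} (x j))"
      by (simp add: prod.distrib exp_sum prod_ennreal)
  qed
  also have "\<dots> = (\<Prod>j\<in>{1..d}. \<integral>\<^sup>+x. ennreal (exp (g j * x)) * indicator {..<0} x \<partial>lborel)"
    by (rule L.product_nn_integral_prod) auto
  also have "\<dots> = (\<Prod>j\<in>{1..d}. ennreal (1 / g j))"
    by (rule prod.cong[OF refl nn_integral_exp_neg_halfline[OF g]])
  also have "\<dots> = ennreal (\<Prod>j=1..d. 1 / g j)" by (rule prod_ennreal) (use g in \<open>auto intro: less_imp_le\<close>)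
  finally show ?thesis .
qed

lemma sets_orthant:
  "{h\<in>space (paths_space d). \<forall>j\<in>{1..d}. h j q > 0} \<in> sets (paths_space d)" if "0 \<le> q"
proof (rule sets.sets_Collect_finite_All)
  fix j assume j: "j \<in> {1..d}"
  have [measurable]: "(\<lambda>h. h j q) \<in> borel_measurable (paths_space d)"
    by (rule path_component_measurable) (use j that in auto)
  show "{h\<in>space (paths_space d). h j q > 0} \<in> sets (paths_space d)" by measurable
qed simp

text \<open>Shift invariance for hits at fixed times, with time 0 allowed; the open time sets of
  \<open>V_Hit_shift\<close> exclude it.\<close>

lemma V_hit_shift:
  assumes s: "0 < s" and K: "finite K" "\<And>k. k \<in> K \<Longrightarrow> 0 \<le> k"
  shows "V (\<lambda>x \<omega>. \<exists>k\<in>K. hit B d \<mu> x (s + k) \<omega>) = V (\<lambda>x \<omega>. \<exists>k\<in>K. hit B d \<mu> x k \<omega>)"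
proof -
  define E where "E = {h\<in>space (paths_space d). \<exists>k\<in>K. \<forall>j\<in>{1..d}. h j k > 0}"
  have E: "E \<in> sets (paths_space d)"
    unfolding E_def by (rule sets.sets_Collect_finite_Ex[OF sets_orthant]) (use K in auto)
  have "V (\<lambda>x \<omega>. \<exists>k\<in>K. hit B d \<mu> x (s + k) \<omega>) = V (\<lambda>x \<omega>. (\<lambda>j\<in>{1..d}. \<lambda>t\<in>{0..}. B (s + t) \<omega> j - \<mu> j * (s + t) - x j) \<in> E)"
    by (rule V_cong) (auto simp: E_def restrict_paths_in_space hit_def K)
  also have "\<dots> = V (\<lambda>x \<omega>. (\<lambda>j\<in>{1..d}. \<lambda>t\<in>{0..}. B t \<omega> j - \<mu> j * t - x j) \<in> E)"
    by (rule V_shift[OF s E])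
  also have "\<dots> = V (\<lambda>x \<omega>. \<exists>k\<in>K. hit B d \<mu> x k \<omega>)"
    by (rule V_cong) (auto simp: E_def restrict_paths_in_space hit_def K)
  finally show ?thesis .
qed

lemma V_hit_shift2:
  assumes s: "0 < s" and r: "0 \<le> r"
  shows "V (\<lambda>x \<omega>. hit B d \<mu> x s \<omega> \<and> hit B d \<mu> x (s + r) \<omega>) = V (\<lambda>x \<omega>. hit B d \<mu> x 0 \<omega> \<and> hit B d \<mu> x r \<omega>)"
proof -
  define E where "E = {h\<in>space (paths_space d). \<forall>j\<in>{1..d}. h j 0 > 0} \<inter> {h\<in>space (paths_space d). \<forall>j\<in>{1..d}. h j r > 0}"
  have E: "E \<in> sets (paths_space d)"
    unfolding E_def by (intro sets.Int sets_orthant) (use r in auto)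
  have "V (\<lambda>x \<omega>. hit B d \<mu> x s \<omega> \<and> hit B d \<mu> x (s + r) \<omega>) = V (\<lambda>x \<omega>. (\<lambda>j\<in>{1..d}. \<lambda>t\<in>{0..}. B (s + t) \<omega> j - \<mu> j * (s + t) - x j) \<in> E)"
    by (rule V_cong) (auto simp: E_def restrict_paths_in_space hit_def r)
  also have "\<dots> = V (\<lambda>x \<omega>. (\<lambda>j\<in>{1..d}. \<lambda>t\<in>{0..}. B t \<omega> j - \<mu> j * t - x j) \<in> E)"
    by (rule V_shift[OF s E])
  also have "\<dots> = V (\<lambda>x \<omega>. hit B d \<mu> x 0 \<omega> \<and> hit B d \<mu> x r \<omega>)"
    by (rule V_cong) (auto simp: E_def restrict_paths_in_space hit_def r)
  finally show ?thesis .
qed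

lemma hit_0: "\<omega> \<in> space M \<Longrightarrow> hit B d \<mu> x 0 \<omega> \<longleftrightarrow> (\<forall>j\<in>{1..d}. x j < 0)"
  by (auto simp: hit_def B_0)

lemma V_hit_0: "V (\<lambda>x \<omega>. hit B d \<mu> x 0 \<omega>) = ennreal (\<Prod>j=1..d. 1 / l j)"
proof -
  have "V (\<lambda>x \<omega>. hit B d \<mu> x 0 \<omega>) = (\<integral>\<^sup>+x. ennreal (exp (\<Sum>j=1..d. l j * x j)) * indicator {x. \<forall>j\<in>{1..d}. x j < 0} x \<partial>LB)"
    unfolding V_def
  proof (intro nn_integral_cong arg_cong2[where f="(*)"] refl)
    fix x :: "nat \<Rightarrow> real"
    have "{\<omega>\<in>space M. hit B d \<mu> x 0 \<omega>} = (if \<forall>j\<in>{1..d}. x j < 0 then space M else {})"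
      by (auto simp: hit_0)
    then show "emeasure M {\<omega>\<in>space M. hit B d \<mu> x 0 \<omega>} = indicator {x. \<forall>j\<in>{1..d}. x j < 0} x"
      by (simp add: emeasure_space_1 indicator_def)
  qed
  also have "\<dots> = ennreal (\<Prod>j=1..d. 1 / l j)" by (rule V_neg_orthant[OF l_pos])
  finally show ?thesis .
qed

text \<open>A hit at 0 confines x to the negative orthant. The hit at r is bounded through
  coordinate 1 alone by Chernoff; its factor exp(-b x_1) lowers the weight of that coordinate to l_1
  - b, still positive, and the remaining factor decays exponentially in r once b < 2
  \<mu>_1.\<close>

lemma V_hit_0_r:
  assumes r: "0 < r" and b: "0 < b" "b < l 1"
  shows "V (\<lambda>x \<omega>. hit B d \<mu> x 0 \<omega> \<and> hit B d \<mu> x r \<omega>) \<le>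
     ennreal (exp (r * (b\<^sup>2 / 2 - b * \<mu> 1)) * (\<Prod>j=1..d. 1 / (if j = 1 then l 1 - b else l j)))"
proof -
  have 1: "1 \<in> {1..d}" using d1 by simp
  let ?g = "\<lambda>j. if j = 1 then l 1 - b else l j"
  have "V (\<lambda>x \<omega>. hit B d \<mu> x 0 \<omega> \<and> hit B d \<mu> x r \<omega>) \<le>
     (\<integral>\<^sup>+x. ennreal (exp (r * (b\<^sup>2 / 2 - b * \<mu> 1))) * (ennreal (exp (\<Sum>j=1..d. ?g j * x j)) * indicator {x. \<forall>j\<in>{1..d}. x j < 0} x) \<partial>LB)"
    unfolding V_def
  proof (rule nn_integral_mono)
    fix x :: "nat \<Rightarrow> real"
    show "ennreal (exp (\<Sum>j=1..d. l j * x j)) * emeasure M {\<omega>\<in>space M. hit B d \<mu> x 0 \<omega> \<and> hit B d \<mu> x r \<omega>}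
      \<le> ennreal (exp (r * (b\<^sup>2 / 2 - b * \<mu> 1))) * (ennreal (exp (\<Sum>j=1..d. ?g j * x j)) * indicator {x. \<forall>j\<in>{1..d}. x j < 0} x)"
    proof (cases "\<forall>j\<in>{1..d}. x j < 0")
      case False
      then have e: "{\<omega>\<in>space M. hit B d \<mu> x 0 \<omega> \<and> hit B d \<mu> x r \<omega>} = {}" by (auto simp: hit_0)
      show ?thesis unfolding e by simp
    next
      case True
      have [measurable]: "(\<lambda>\<omega>. B r \<omega> 1) \<in> borel_measurable M" using r 1 by (intro B_measurable) auto
      have "emeasure M {\<omega>\<in>space M. hit B d \<mu> x 0 \<omega> \<and> hit B d \<mu> x r \<omega>} \<le> emeasure M {\<omega>\<in>space M. B r \<omega> 1 \<ge> x 1 + \<mu> 1 * r}"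
        using 1 by (intro emeasure_mono) (force simp: hit_def)+
      also have "\<dots> \<le> ennreal (exp (b\<^sup>2 * r / 2 - b * (x 1 + \<mu> 1 * r)))"
        by (rule BM_Chernoff[OF BM_component[OF 1] r]) (use b in simp)
      finally have e: "emeasure M {\<omega>\<in>space M. hit B d \<mu> x 0 \<omega> \<and> hit B d \<mu> x r \<omega>} \<le> ennreal (exp (b\<^sup>2 * r / 2 - b * (x 1 + \<mu> 1 * r)))" .
      have s: "(\<Sum>j=1..d. ?g j * x j) = (\<Sum>j=1..d. l j * x j) - b * x 1"
      proof -
        have "(\<Sum>j=1..d. ?g j * x j) = (\<Sum>j=1..d. l j * x j - (if j = 1 then b * x 1 else 0))"
          by (rule sum.cong) (auto simp: algebra_simps)
        also have "\<dots> = (\<Sum>j=1..d. l j * x j) - b * x 1" using d1 by (simp add: sum_subtractf)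
        finally show ?thesis .
      qed
      have "ennreal (exp (\<Sum>j=1..d. l j * x j)) * emeasure M {\<omega>\<in>space M. hit B d \<mu> x 0 \<omega> \<and> hit B d \<mu> x r \<omega>}
        \<le> ennreal (exp (\<Sum>j=1..d. l j * x j)) * ennreal (exp (b\<^sup>2 * r / 2 - b * (x 1 + \<mu> 1 * r)))"
        by (rule mult_left_mono[OF e]) simp
      also have "\<dots> = ennreal (exp (r * (b\<^sup>2 / 2 - b * \<mu> 1))) * ennreal (exp (\<Sum>j=1..d. ?g j * x j))"
        unfolding s by (simp add: ennreal_mult[symmetric] exp_add[symmetric] algebra_simps)
      finally show ?thesis using True by simp
    qed
  qed
  also have "\<dots> = ennreal (exp (r * (b\<^sup>2 / 2 - b * \<mu> 1))) * (\<integral>\<^sup>+x. ennreal (exp (\<Sum>j=1..d. ?g j * x j)) * indicator {x. \<forall>j\<in>{1..d}. x j < 0} x \<partial>LB)"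
  proof (rule nn_integral_cmult)
    have [measurable]: "{x\<in>space LB. \<forall>j\<in>{1..d}. x j < 0} \<in> sets LB"
    proof (rule sets.sets_Collect_finite_All)
      fix j assume [measurable]: "j \<in> {1..d}"
      show "{x\<in>space LB. x j < 0} \<in> sets LB" by measurable
    qed simp
    have "(\<lambda>x. ennreal (exp (\<Sum>j=1..d. ?g j * x j)) * indicator {x\<in>space LB. \<forall>j\<in>{1..d}. x j < 0} x) \<in> borel_measurable LB" by measurable
    also have "?this \<longleftrightarrow> (\<lambda>x. ennreal (exp (\<Sum>j=1..d. ?g j * x j)) * indicator {x. \<forall>j\<in>{1..d}. x j < 0} x) \<in> borel_measurable LB"
      by (rule measurable_cong) (auto simp: indicator_def)
    finally show "(\<lambda>x. ennreal (exp (\<Sum>j=1..d. ?g j * x j)) * indicator {x. \<forall>j\<in>{1..d}. x j < 0} x) \<in> borel_measurable LB" .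
  qed
  also have "\<dots> = ennreal (exp (r * (b\<^sup>2 / 2 - b * \<mu> 1))) * ennreal (\<Prod>j=1..d. 1 / ?g j)"
    by (subst V_neg_orthant) (use l_pos b in auto)
  also have "\<dots> = ennreal (exp (r * (b\<^sup>2 / 2 - b * \<mu> 1)) * (\<Prod>j=1..d. 1 / ?g j))"
  proof (rule ennreal_mult[symmetric])
    show "0 \<le> (\<Prod>j=1..d. 1 / ?g j)"
      by (rule prod_nonneg) (use l_pos b in \<open>auto simp: less_imp_le\<close>)
  qed simp
  finally show ?thesis .
qed

text \<open>Every time has hitting mass v. On a lattice of large spacing \<Delta> the overlaps of
  one time with all later ones add up to at most v/2, so N lattice times have mass at least N v/2.
  Hence R grows linearly and H is at least v / (2 \<Delta>).\<close>

lemma H_pos: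
  assumes \<mu>1: "0 < \<mu> 1"
  shows "0 < H"
proof -
  have l1: "0 < l 1" using l_pos d1 by simp
  \<comment> \<open>b < l_1 keeps the orthant integral of \<open>V_hit_0_r\<close> finite, and b <
    \<mu>_1 makes its decay rate \<kappa> positive.\<close>
  define b where "b = min (l 1) (\<mu> 1) / 2"
  have b: "0 < b" "b < l 1" "b < \<mu> 1" using l1 \<mu>1 by (auto simp: b_def min_def)
  define \<kappa> where "\<kappa> = b * \<mu> 1 - b\<^sup>2 / 2"
  have \<kappa>: "0 < \<kappa>"
  proof -
    have "b * b < b * \<mu> 1" using b by (intro mult_strict_left_mono) auto
    moreover have "0 < b * b" using b by simp
    ultimately show ?thesis by (simp add: \<kappa>_def power2_eq_square)
  qed
  define v where "v = (\<Prod>j=1..d. 1 / l j)"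
  have v: "0 < v" unfolding v_def using l_pos by (intro prod_pos) auto
  define w where "w = (\<Prod>j=1..d. 1 / (if j = 1 then l 1 - b else l j))"
  have w: "0 < w" unfolding w_def using l_pos b by (intro prod_pos) auto
  \<comment> \<open>For q at most \<delta>, the value 1/2 bounds the geometric series by 2, and v /
    (4 w) brings the total overlap below v/2.\<close>
  define \<delta> where "\<delta> = min (1/2) (v / (4 * w))"
  have \<delta>: "0 < \<delta>" "\<delta> \<le> 1/2" "\<delta> \<le> v / (4 * w)" using v w by (auto simp: \<delta>_def)
  \<comment> \<open>Solves exp(- \<kappa> \<Delta>) = \<delta> / e, so that q stays below
    \<delta>.\<close>
  define \<Delta> where "\<Delta> = (1 - ln \<delta>) / \<kappa>"
  have \<Delta>: "0 < \<Delta>"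
  proof -
    have "ln \<delta> < 0" using \<delta> by (intro ln_less_zero) auto
    then show ?thesis using \<kappa> by (simp add: \<Delta>_def)
  qed
  define q where "q = exp (- (\<kappa> * \<Delta>))"
  have q: "0 < q" "q \<le> \<delta>"
  proof -
    have "q = exp (ln \<delta> - 1)" using \<kappa> by (simp add: q_def \<Delta>_def)
    also have "\<dots> \<le> exp (ln \<delta>)" by simp
    finally show "q \<le> \<delta>" using \<delta> by simp
  qed (simp add: q_def)
  have geom: "(\<Sum>k=1..N. w * q ^ k) \<le> v / 2" for N
  proof -
    have "(\<Sum>k=1..N. w * q ^ k) = w * q * (\<Sum>k<N. q ^ k)"
      by (simp add: sum_distrib_left sum.atLeast1_atMost_eq mult.assoc One_nat_def)
    also have "\<dots> \<le> w * q * 2"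
    proof (rule mult_left_mono)
      have "(\<Sum>k<N. q ^ k) = (1 - q ^ N) / (1 - q)" using q \<delta> by (subst sum_gp_strict) auto
      also have "\<dots> \<le> 1 / (1/2)" using q \<delta> by (intro frac_le) auto
      finally show "(\<Sum>k<N. q ^ k) \<le> 2" by simp
    qed (use w q in auto)
    also have "\<dots> \<le> w * (v / (4 * w)) * 2" using w q \<delta> by (intro mult_right_mono mult_left_mono) auto
    also have "\<dots> = v / 2" using w by simp
    finally show ?thesis .
  qed
  define F where "F N = V (\<lambda>x \<omega>. \<exists>k\<in>(\<lambda>k. real k * \<Delta>) ` {1..N}. hit B d \<mu> x k \<omega>)" for N
  have nn: "0 \<le> real k * \<Delta>" for k using \<Delta> by simp
  \<comment> \<open>Of the first N + 1 lattice times, the first is split off; the others are the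
    first N shifted by \<Delta>. The overlap is moved to the right-hand side, which avoids
    subtraction in \<open>ennreal\<close>.\<close>
  have Fstep: "F N + ennreal v \<le> F (Suc N) + ennreal (v / 2)" for N
  proof -
    let ?P = "\<lambda>x \<omega>. hit B d \<mu> x \<Delta> \<omega>"
    let ?R = "\<lambda>x \<omega>. \<exists>k\<in>(\<lambda>k. real k * \<Delta>) ` {1..N}. hit B d \<mu> x (\<Delta> + k) \<omega>"
    have mP: "meas ?P" by (rule meas_hit) (use \<Delta> in simp)
    have mR: "meas ?R" by (rule meas_finite_ex[OF _ meas_hit]) (use \<Delta> in auto)
    have VP: "V ?P = ennreal v"
      using V_hit_shift[OF \<Delta>, of "{0}"] V_hit_0 by (simp add: v_def)
    have VR: "V ?R = F N" unfolding F_def by (rule V_hit_shift[OF \<Delta>]) (auto simp: nn)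
    have PR: "V (\<lambda>x \<omega>. ?P x \<omega> \<and> ?R x \<omega>) \<le> ennreal (v / 2)"
    proof -
      have "V (\<lambda>x \<omega>. ?P x \<omega> \<and> ?R x \<omega>) = V (\<lambda>x \<omega>. \<exists>k\<in>{1..N}. hit B d \<mu> x \<Delta> \<omega> \<and> hit B d \<mu> x (\<Delta> + real k * \<Delta>) \<omega>)"
        by (rule V_cong) auto
      also have "\<dots> \<le> (\<Sum>k=1..N. V (\<lambda>x \<omega>. hit B d \<mu> x \<Delta> \<omega> \<and> hit B d \<mu> x (\<Delta> + real k * \<Delta>) \<omega>))"
        by (rule V_finite_ex_le) (use \<Delta> nn in \<open>auto intro!: meas_conj meas_hit add_nonneg_nonneg\<close>)
      also have "\<dots> \<le> (\<Sum>k=1..N. ennreal (w * q ^ k))"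
      proof (rule sum_mono)
        fix k assume k: "k \<in> {1..N}"
        have "V (\<lambda>x \<omega>. hit B d \<mu> x \<Delta> \<omega> \<and> hit B d \<mu> x (\<Delta> + real k * \<Delta>) \<omega>) = V (\<lambda>x \<omega>. hit B d \<mu> x 0 \<omega> \<and> hit B d \<mu> x (real k * \<Delta>) \<omega>)"
          by (rule V_hit_shift2[OF \<Delta> nn])
        also have "\<dots> \<le> ennreal (exp (real k * \<Delta> * (b\<^sup>2 / 2 - b * \<mu> 1)) * w)"
          unfolding w_def by (rule V_hit_0_r) (use k \<Delta> b in auto)
        also have "exp (real k * \<Delta> * (b\<^sup>2 / 2 - b * \<mu> 1)) = q ^ k"
          by (simp add: q_def \<kappa>_def exp_of_nat_mult[symmetric] algebra_simps)
        finally show "V (\<lambda>x \<omega>. hit B d \<mu> x \<Delta> \<omega> \<and> hit B d \<mu> x (\<Delta> + real k * \<Delta>) \<omega>) \<le> ennreal (w * q ^ k)"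
          by (simp add: mult.commute)
      qed
      also have "\<dots> = ennreal (\<Sum>k=1..N. w * q ^ k)" using w q by (intro sum_ennreal) auto
      also have "\<dots> \<le> ennreal (v / 2)" by (rule ennreal_leI[OF geom])
      finally show ?thesis .
    qed
    have "F (Suc N) = V (\<lambda>x \<omega>. ?P x \<omega> \<or> ?R x \<omega>)"
    proof -
      have "{1..Suc N} = insert 1 (Suc ` {1..N})"
        unfolding image_Suc_atLeastAtMost by (auto simp: One_nat_def)
      then have "(\<lambda>k. real k * \<Delta>) ` {1..Suc N} = insert \<Delta> ((+) \<Delta> ` (\<lambda>k. real k * \<Delta>) ` {1..N})"
        by (simp add: image_image distrib_right del: image_Suc_atLeastAtMost)
      then show ?thesis unfolding F_def by simp
    qed
    also have "\<dots> = V (\<lambda>x \<omega>. (?P x \<omega> \<or> ?R x \<omega>) \<and> ?R x \<omega>) + V (\<lambda>x \<omega>. (?P x \<omega> \<or> ?R x \<omega>) \<and> \<not> ?R x \<omega>)"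
      by (rule V_split[OF meas_disj[OF mP mR] mR])
    also have "V (\<lambda>x \<omega>. (?P x \<omega> \<or> ?R x \<omega>) \<and> ?R x \<omega>) = F N" unfolding VR[symmetric] by (rule V_cong) blast
    also have "V (\<lambda>x \<omega>. (?P x \<omega> \<or> ?R x \<omega>) \<and> \<not> ?R x \<omega>) = V (\<lambda>x \<omega>. ?P x \<omega> \<and> \<not> ?R x \<omega>)" by (rule V_cong) blast
    finally have F: "F (Suc N) = F N + V (\<lambda>x \<omega>. ?P x \<omega> \<and> \<not> ?R x \<omega>)" .
    have "F N + ennreal v = F N + (V (\<lambda>x \<omega>. ?P x \<omega> \<and> ?R x \<omega>) + V (\<lambda>x \<omega>. ?P x \<omega> \<and> \<not> ?R x \<omega>))"
      unfolding VP[symmetric] V_split[OF mP mR] ..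
    also have "\<dots> = F (Suc N) + V (\<lambda>x \<omega>. ?P x \<omega> \<and> ?R x \<omega>)" unfolding F by (simp add: ac_simps)
    also have "\<dots> \<le> F (Suc N) + ennreal (v / 2)" by (rule add_left_mono[OF PR])
    finally show ?thesis .
  qed
  have Flow: "ennreal (real N * (v / 2)) \<le> F N" for N
  proof (induction N)
    case (Suc N)
    have "ennreal (real (Suc N) * (v / 2)) + ennreal (v / 2) = ennreal (real N * (v / 2)) + ennreal v"
    proof -
      have "real (Suc N) * (v / 2) + v / 2 = real N * (v / 2) + v" by (simp add: field_simps)
      then show ?thesis using v by (simp add: ennreal_plus[symmetric] del: ennreal_plus of_nat_Suc)
    qed
    also have "\<dots> \<le> F N + ennreal v" by (rule add_right_mono[OF Suc])
    also have "\<dots> \<le> F (Suc N) + ennreal (v / 2)" by (rule Fstep)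
    finally have "ennreal (v / 2) + ennreal (real (Suc N) * (v / 2)) \<le> ennreal (v / 2) + F (Suc N)" by (simp only: add.commute)
    then show ?case by (rule ennreal_add_left_cancel_le[THEN iffD1, THEN disjE]) auto
  qed simp
  have Rlow: "real N * (v / 2) \<le> R (real (Suc N) * \<Delta>)" for N
  proof -
    have "ennreal (real N * (v / 2)) \<le> F N" by (rule Flow)
    also have "\<dots> \<le> V (Hit {0<..<real (Suc N) * \<Delta>})"
      unfolding F_def
    proof (rule V_mono)
      fix x \<omega> assume "\<exists>k\<in>(\<lambda>k. real k * \<Delta>) ` {1..N}. hit B d \<mu> x k \<omega>"
      then obtain k where "k \<in> {1..N}" "hit B d \<mu> x (real k * \<Delta>) \<omega>" by auto
      then show "Hit {0<..<real (Suc N) * \<Delta>} x \<omega>"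
        unfolding Hit_def using \<Delta> by (intro bexI[of _ "real k * \<Delta>"]) auto
    qed (auto intro: meas_Hit_intervals)
    also have "\<dots> = ennreal (R (real (Suc N) * \<Delta>))" by (rule V_Hit_R) (use \<Delta> in simp)
    finally show ?thesis using \<Delta> by (subst (asm) ennreal_le_iff) (auto simp: R_def)
  qed
  have lim: "filterlim (\<lambda>N. real (Suc N) * \<Delta>) at_top sequentially"
    using \<Delta> by (intro filterlim_at_top_mult_tendsto_pos[OF tendsto_const] filterlim_compose[OF filterlim_real_sequentially filterlim_Suc]) auto
  have 1: "(\<lambda>N. R (real (Suc N) * \<Delta>) / (real (Suc N) * \<Delta>)) \<longlonglongrightarrow> H"
    by (rule filterlim_compose[OF R_limit lim])
  have 2: "(\<lambda>N. (v / (2 * \<Delta>)) * (real N / real (Suc N))) \<longlonglongrightarrow> (v / (2 * \<Delta>)) * 1"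
    by (intro tendsto_mult tendsto_const LIMSEQ_n_over_Suc_n)
  have "(v / (2 * \<Delta>)) * 1 \<le> H"
  proof (rule LIMSEQ_le[OF 2 1], intro exI allI impI)
    fix N
    have "(v / (2 * \<Delta>)) * (real N / real (Suc N)) = (real N * (v / 2)) / (real (Suc N) * \<Delta>)"
      using \<Delta> by (simp add: ac_simps del: of_nat_Suc)
    also have "\<dots> \<le> R (real (Suc N) * \<Delta>) / (real (Suc N) * \<Delta>)"
      using \<Delta> Rlow[of N] by (intro divide_right_mono) auto
    finally show "(v / (2 * \<Delta>)) * (real N / real (Suc N)) \<le> R (real (Suc N) * \<Delta>) / (real (Suc N) * \<Delta>)" .
  qed
  moreover have "0 < v / (2 * \<Delta>)" using v \<Delta> by simp
  ultimately show ?thesis by linarith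
qed

lemma H_quot_limit:
  assumes l: "\<And>j. j \<in> {1..d} \<Longrightarrow> l j = \<alpha> j / t0 + \<mu> j"
  shows "(H_quot M B \<alpha> \<mu> t0 d \<longlongrightarrow> ennreal H) at_top" and "H_const M B \<alpha> \<mu> t0 d = H"
proof -
  have eq: "H_quot M B \<alpha> \<mu> t0 d T = ennreal (R T / T)" if T: "0 < T" for T
  proof -
    have "(\<integral>\<^sup>+ x. ennreal (exp (\<Sum>j=1..d. (\<alpha> j / t0 + \<mu> j) * x j) *
                   \<P>(\<omega> in M. \<exists>t\<in>{0..T}. hit B d \<mu> x t \<omega>)) \<partial>LB) = V (Hit {0<..<T})"
      unfolding V_def
    proof (intro nn_integral_cong)
      fix x :: "nat \<Rightarrow> real"
      have "{\<omega>\<in>space M. \<exists>t\<in>{0..T}. hit B d \<mu> x t \<omega>} = {\<omega>\<in>space M. Hit {0<..<T} x \<omega>}"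
        unfolding Hit_def by (intro Collect_cong conj_cong refl hit_closed_interval[OF _ order_refl order_refl T])
      moreover have "(\<Sum>j=1..d. (\<alpha> j / t0 + \<mu> j) * x j) = (\<Sum>j=1..d. l j * x j)" by (rule sum.cong) (auto simp: l)
      ultimately show "ennreal (exp (\<Sum>j=1..d. (\<alpha> j / t0 + \<mu> j) * x j) * \<P>(\<omega> in M. \<exists>t\<in>{0..T}. hit B d \<mu> x t \<omega>))
         = ennreal (exp (\<Sum>j=1..d. l j * x j)) * emeasure M {\<omega>\<in>space M. Hit {0<..<T} x \<omega>}"
        by (simp add: ennreal_mult emeasure_eq_measure)
    qed
    moreover have "0 \<le> R T" by (simp add: R_def)
    ultimately show ?thesis unfolding H_quot_def using T by (simp add: V_Hit_R divide_ennreal)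
  qed
  have "((\<lambda>T. ennreal (R T / T)) \<longlongrightarrow> ennreal H) at_top" by (intro tendsto_ennrealI R_limit)
  then show lim: "(H_quot M B \<alpha> \<mu> t0 d \<longlongrightarrow> ennreal H) at_top"
  proof (rule Lim_transform_eventually)
    show "\<forall>\<^sub>F T in at_top. ennreal (R T / T) = H_quot M B \<alpha> \<mu> t0 d T"
      using eventually_gt_at_top[of "0::real"] by eventually_elim (simp add: eq)
  qed
  have "Lim at_top (H_quot M B \<alpha> \<mu> t0 d) = ennreal H" by (rule tendsto_Lim[OF _ lim]) simp
  then show "H_const M B \<alpha> \<mu> t0 d = H" unfolding H_const_def by (simp add: H_def)
qed

end

section \<open>The Gaussian kernel\<close>

lemma power_le_exp_mult:
  fixes Z \<epsilon> :: real
  assumes "0 < \<epsilon>" "0 \<le> Z" "0 < N"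
  shows "Z ^ N \<le> (real N / \<epsilon>) ^ N * exp (\<epsilon> * Z)"
proof -
  have "\<epsilon> * Z / real N \<le> exp (\<epsilon> * Z / real N)" using exp_ge_add_one_self[of "\<epsilon> * Z / real N"] by linarith
  then have "(\<epsilon> * Z / real N) ^ N \<le> exp (\<epsilon> * Z / real N) ^ N" using assms by (intro power_mono) auto
  also have "\<dots> = exp (\<epsilon> * Z)" using assms by (simp add: exp_of_nat_mult[symmetric])
  finally have "(real N / \<epsilon>) ^ N * (\<epsilon> * Z / real N) ^ N \<le> (real N / \<epsilon>) ^ N * exp (\<epsilon> * Z)"
    using assms by (intro mult_left_mono) auto
  also have "(real N / \<epsilon>) ^ N * (\<epsilon> * Z / real N) ^ N = Z ^ N"
    using assms by (simp add: power_mult_distrib[symmetric])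
  finally show ?thesis .
qed

text \<open>With s the variance, v the rescaled y and q the distance of the Gaussian in standard
  deviations, all of u/s, s/u and y^2 are polynomially bounded in Z = 1 + |x| + q, uniformly in u.
  The polynomial is absorbed by exp(eps Z), and the part exp(eps q) of that by exp(- q^2 /
  2).\<close>

lemma kernel_domination:
  fixes T a t0 \<epsilon> :: real
  assumes T: "0 < T" and a: "0 < a" and t0: "0 < t0" and \<epsilon>: "0 < \<epsilon>"
  obtains C where "0 < C" "\<And>u y x. 1 \<le> u \<Longrightarrow> T \<le> t0 * u + y * sqrt u \<Longrightarrow>
    sqrt (u / (t0 * u + y * sqrt u)) ^ m * (1 + y\<^sup>2) * exp (- (x + a * (y * sqrt u / t0))\<^sup>2 / (2 * (t0 * u + y * sqrt u)))
      \<le> C * exp (\<epsilon> * \<bar>x\<bar>)"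
proof -
  define \<kappa> where "\<kappa> = t0 / a"
  define c1 where "c1 = 1 / t0 + 1 / (a * T) + 1 / (a * sqrt T)"
  define c2 where "c2 = 2 * t0 + 2 * \<kappa> + \<kappa>\<^sup>2"
  define c3 where "c3 = 1 + 2 * \<kappa>\<^sup>2 * (1 + c2)"
  \<comment> \<open>Degree m + 4: m from the root factor bounded in \<open>b4\<close>, and 4 from
    \<open>b3\<close>. The factor exp(eps + eps^2 / 2) in \<open>C\<close> pays for the 1 in Z and
    for the maximum of eps q - q^2 / 2 over q.\<close>
  define C0 where "C0 = (1 + c1) ^ m * c3 * (real (m + 4) / \<epsilon>) ^ (m + 4)"
  define C where "C = C0 * exp (\<epsilon> + \<epsilon>\<^sup>2 / 2)"
  have \<kappa>: "0 < \<kappa>" using t0 a by (simp add: \<kappa>_def)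
  have c1: "0 < c1" using T a t0 by (simp add: c1_def add_pos_pos)
  have c2: "0 < c2" using t0 \<kappa> by (simp add: c2_def add_pos_pos)
  have c3: "0 < c3" using c2 by (simp add: c3_def add_pos_nonneg)
  have C0: "0 < C0" unfolding C0_def using c1 c3 \<epsilon> by (intro mult_pos_pos zero_less_power) auto
  show ?thesis
  proof (rule that)
    show "0 < C" using C0 by (simp add: C_def)
    fix u y x :: real assume u: "1 \<le> u" and s0: "T \<le> t0 * u + y * sqrt u"
    define s where "s = t0 * u + y * sqrt u"
    define v where "v = y * sqrt u / t0"
    define q where "q = \<bar>x + a * v\<bar> / sqrt s"
    have s: "T \<le> s" "0 < s" using s0 T by (auto simp: s_def)
    have su: "0 < sqrt s" "sqrt s * sqrt s = s" using s by auto
    have q0: "0 \<le> q" using s by (simp add: q_def)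
    have qs: "q * sqrt s = \<bar>x + a * v\<bar>" using su by (simp add: q_def)
    have s_uv: "s = t0 * (u + v)" using t0 by (simp add: s_def v_def field_simps)
    define Z where "Z = 1 + \<bar>x\<bar> + q"
    have Z: "1 \<le> Z" "\<bar>x\<bar> \<le> Z" "q \<le> Z" using q0 by (auto simp: Z_def)
    have av: "a * \<bar>v\<bar> \<le> \<bar>x\<bar> + q * sqrt s"
    proof -
      have "a * \<bar>v\<bar> = \<bar>a * v\<bar>" using a by (simp add: abs_mult)
      then show ?thesis unfolding qs by linarith
    qed
    \<comment> \<open>From u = s / t0 - v with |v| controlled by |x| + q sqrt s; the lower bound T
      on s takes care of the negative powers of s.\<close>
    have b1: "u / s \<le> c1 * Z"
    proof -
      have "u = s / t0 - v" using t0 by (simp add: s_uv)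
      then have "u / s = 1 / t0 - v / s" using s by (simp add: field_simps)
      also have "\<dots> \<le> 1 / t0 + \<bar>v\<bar> / s"
      proof -
        have "- v / s \<le> \<bar>v\<bar> / s" using s by (intro divide_right_mono) auto
        then show ?thesis by simp
      qed
      also have "\<bar>v\<bar> / s \<le> ((\<bar>x\<bar> + q * sqrt s) / a) / s"
      proof (rule divide_right_mono)
        show "\<bar>v\<bar> \<le> (\<bar>x\<bar> + q * sqrt s) / a" using av a by (simp add: pos_le_divide_eq mult.commute)
      qed (use s in simp)
      also have "((\<bar>x\<bar> + q * sqrt s) / a) / s = \<bar>x\<bar> * (1 / (a * s)) + q * (1 / (a * sqrt s))"
      proof -
        have "q * sqrt s / (a * s) = q * sqrt s / (a * (sqrt s * sqrt s))" by (simp only: su(2))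
        also have "\<dots> = q / (a * sqrt s)" using su(1) by (simp del: real_sqrt_mult_self)
        finally show ?thesis by (simp add: add_divide_distrib)
      qed
      also have "\<dots> \<le> Z * (1 / (a * T)) + Z * (1 / (a * sqrt T))"
        using s T a Z q0 by (intro add_mono mult_mono frac_le mult_left_mono) auto
      also have "1 / t0 + (Z * (1 / (a * T)) + Z * (1 / (a * sqrt T))) \<le> c1 * Z"
        using Z t0 by (simp add: c1_def algebra_simps divide_right_mono)
      finally show ?thesis by simp
    qed
    \<comment> \<open>The term with sqrt s is split by 2 a b <= a^2 + b^2, and the resulting s/2 is
      moved to the left.\<close>
    have b2: "s / u \<le> c2 * Z\<^sup>2"
    proof -
      have "a * v \<le> a * \<bar>v\<bar>" using a by simp
      then have "a * v \<le> \<bar>x\<bar> + q * sqrt s" using av by linarith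
      then have "\<kappa> * (a * v) \<le> \<kappa> * (\<bar>x\<bar> + q * sqrt s)" using \<kappa> by (intro mult_left_mono) auto
      moreover have "\<kappa> * (a * v) = t0 * v" using a by (simp add: \<kappa>_def)
      moreover have "s = t0 * u + t0 * v" by (simp add: s_uv distrib_left)
      ultimately have "s \<le> t0 * u + \<kappa> * \<bar>x\<bar> + \<kappa> * q * sqrt s" by (simp add: distrib_left)
      moreover have "\<kappa> * q * sqrt s \<le> s / 2 + (\<kappa> * q)\<^sup>2 / 2"
        using sum_squares_bound[of "\<kappa> * q" "sqrt s"] s by (simp add: algebra_simps)
      ultimately have "s \<le> 2 * t0 * u + 2 * \<kappa> * \<bar>x\<bar> + \<kappa>\<^sup>2 * q\<^sup>2" by (simp add: power_mult_distrib)
      also have "\<dots> \<le> (2 * t0 * 1 + 2 * \<kappa> * \<bar>x\<bar> + \<kappa>\<^sup>2 * q\<^sup>2) * u"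
      proof -
        have "2 * \<kappa> * \<bar>x\<bar> + \<kappa>\<^sup>2 * q\<^sup>2 \<le> (2 * \<kappa> * \<bar>x\<bar> + \<kappa>\<^sup>2 * q\<^sup>2) * u"
          using mult_left_mono[OF u, of "2 * \<kappa> * \<bar>x\<bar> + \<kappa>\<^sup>2 * q\<^sup>2"] \<kappa> by simp
        then show ?thesis by (simp add: algebra_simps)
      qed
      also have "\<dots> \<le> (2 * t0 * Z\<^sup>2 + 2 * \<kappa> * Z\<^sup>2 + \<kappa>\<^sup>2 * Z\<^sup>2) * u"
      proof (intro mult_right_mono add_mono mult_left_mono)
        show "1 \<le> Z\<^sup>2" using Z by simp
        show "\<bar>x\<bar> \<le> Z\<^sup>2" using Z mult_mono[of 1 Z "\<bar>x\<bar>" Z] by (simp add: power2_eq_square)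
        show "q\<^sup>2 \<le> Z\<^sup>2" using Z q0 by (intro power_mono) auto
      qed (use \<kappa> t0 u in auto)
      finally have "s \<le> (c2 * Z\<^sup>2) * u" by (simp add: c2_def algebra_simps)
      then show ?thesis using u by (simp add: pos_divide_le_eq)
    qed
    \<comment> \<open>y^2 is t0^2 v^2 / u; squaring the bound on |v| produces q^2 s / u, where
      \<open>b2\<close> enters and raises the degree to 4.\<close>
    have b3: "1 + y\<^sup>2 \<le> c3 * Z ^ 4"
    proof -
      have yv: "y\<^sup>2 = t0\<^sup>2 * v\<^sup>2 / u" using t0 u by (simp add: v_def power_mult_distrib power_divide)
      have "(a * \<bar>v\<bar>)\<^sup>2 \<le> (\<bar>x\<bar> + q * sqrt s)\<^sup>2" using av a by (intro power_mono) auto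
      also have "\<dots> \<le> 2 * (x\<^sup>2 + (q * sqrt s)\<^sup>2)"
        using sum_squares_bound[of "\<bar>x\<bar>" "q * sqrt s"] by (simp add: power2_sum)
      also have "(q * sqrt s)\<^sup>2 = q\<^sup>2 * s" using s by (simp add: power_mult_distrib)
      finally have "a\<^sup>2 * v\<^sup>2 \<le> 2 * (x\<^sup>2 + q\<^sup>2 * s)" by (simp add: power_mult_distrib)
      then have "\<kappa>\<^sup>2 * (a\<^sup>2 * v\<^sup>2) \<le> \<kappa>\<^sup>2 * (2 * (x\<^sup>2 + q\<^sup>2 * s))" by (intro mult_left_mono) auto
      moreover have "\<kappa>\<^sup>2 * (a\<^sup>2 * v\<^sup>2) = t0\<^sup>2 * v\<^sup>2" using a by (simp add: \<kappa>_def power_divide)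
      ultimately have "t0\<^sup>2 * v\<^sup>2 \<le> 2 * \<kappa>\<^sup>2 * (x\<^sup>2 + q\<^sup>2 * s)" by (simp only: mult.left_commute mult.assoc)
      then have "y\<^sup>2 \<le> 2 * \<kappa>\<^sup>2 * (x\<^sup>2 + q\<^sup>2 * s) / u" unfolding yv using u by (intro divide_right_mono) auto
      also have "\<dots> = 2 * \<kappa>\<^sup>2 * (x\<^sup>2 / u + q\<^sup>2 * (s / u))"
        by (simp only: times_divide_eq_right[symmetric] add_divide_distrib)
      also have "\<dots> \<le> 2 * \<kappa>\<^sup>2 * (Z ^ 4 + Z\<^sup>2 * (c2 * Z\<^sup>2))"
      proof (intro mult_left_mono add_mono mult_mono b2)
        have "x\<^sup>2 / u \<le> x\<^sup>2 / 1" using u by (intro divide_left_mono) auto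
        also have "x\<^sup>2 / 1 \<le> Z\<^sup>2" using Z power_mono[of "\<bar>x\<bar>" Z 2] by simp
        also have "\<dots> \<le> Z ^ 4" using Z by (intro power_increasing) auto
        finally show "x\<^sup>2 / u \<le> Z ^ 4" .
        show "q\<^sup>2 \<le> Z\<^sup>2" using Z q0 by (intro power_mono) auto
      qed (use s u in auto)
      also have "\<dots> = 2 * \<kappa>\<^sup>2 * (1 + c2) * Z ^ 4" by (simp add: algebra_simps power2_eq_square power4_eq_xxxx)
      finally have "y\<^sup>2 \<le> 2 * \<kappa>\<^sup>2 * (1 + c2) * Z ^ 4" .
      moreover have "1 \<le> Z ^ 4" using Z by simp
      ultimately show ?thesis by (simp add: c3_def distrib_right)
    qed
    have b4: "sqrt (u / s) \<le> (1 + c1) * Z"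
    proof -
      have r: "1 \<le> (1 + c1) * Z" using c1 Z mult_mono[of 1 "1 + c1" 1 Z] by simp
      have "u / s \<le> (1 + c1) * Z" using b1 Z by (simp add: distrib_right)
      also have "\<dots> \<le> ((1 + c1) * Z)\<^sup>2" using r mult_left_mono[OF r, of "(1 + c1) * Z"] by (simp add: power2_eq_square)
      finally show ?thesis using r by (intro real_le_lsqrt) auto
    qed
    have ex: "exp (- (x + a * v)\<^sup>2 / (2 * s)) = exp (- (q\<^sup>2 / 2))"
    proof -
      have "q\<^sup>2 = (x + a * v)\<^sup>2 / s" using s by (simp add: q_def power_divide)
      then show ?thesis by simp
    qed
    have "sqrt (u / s) ^ m * (1 + y\<^sup>2) * exp (- (x + a * v)\<^sup>2 / (2 * s))
       \<le> ((1 + c1) * Z) ^ m * (c3 * Z ^ 4) * exp (- (q\<^sup>2 / 2))"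
      unfolding ex using b3 b4 u s c1 c3 Z by (intro mult_mono power_mono) (auto intro!: mult_nonneg_nonneg)
    also have "\<dots> = (1 + c1) ^ m * c3 * Z ^ (m + 4) * exp (- (q\<^sup>2 / 2))" by (simp add: power_mult_distrib power_add)
    also have "\<dots> \<le> (1 + c1) ^ m * c3 * ((real (m + 4) / \<epsilon>) ^ (m + 4) * exp (\<epsilon> * Z)) * exp (- (q\<^sup>2 / 2))"
      using \<epsilon> Z c1 c3 by (intro mult_right_mono mult_left_mono power_le_exp_mult) auto
    also have "\<dots> = C0 * (exp (\<epsilon> * Z) * exp (- (q\<^sup>2 / 2)))" by (simp add: C0_def)
    also have "\<dots> \<le> C0 * (exp (\<epsilon> + \<epsilon>\<^sup>2 / 2) * exp (\<epsilon> * \<bar>x\<bar>))"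
    proof (rule mult_left_mono)
      have "0 \<le> (\<epsilon> - q)\<^sup>2" by simp
      then have "\<epsilon> * q - q\<^sup>2 / 2 \<le> \<epsilon>\<^sup>2 / 2" by (simp add: power2_diff algebra_simps)
      then show "exp (\<epsilon> * Z) * exp (- (q\<^sup>2 / 2)) \<le> exp (\<epsilon> + \<epsilon>\<^sup>2 / 2) * exp (\<epsilon> * \<bar>x\<bar>)"
        by (simp add: exp_add[symmetric] Z_def algebra_simps)
    qed (use C0 in simp)
    also have "\<dots> = C * exp (\<epsilon> * \<bar>x\<bar>)" by (simp add: C_def)
    finally show "sqrt (u / (t0 * u + y * sqrt u)) ^ m * (1 + y\<^sup>2) * exp (- (x + a * (y * sqrt u / t0))\<^sup>2 / (2 * (t0 * u + y * sqrt u)))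
      \<le> C * exp (\<epsilon> * \<bar>x\<bar>)"
      by (simp add: s_def v_def)
  qed
qed

text \<open>The mean equals l_j s - \<alpha>_j v, so expanding the square leaves the tilt l_j x_j, a
  Gaussian exponent in x_j + \<alpha>_j v, and constants. With u times the sum of l_j \<alpha>_j
  these constants cancel by the balance \<open>bal\<close>, for all v.\<close>

lemma tilted_density_identity:
  fixes l \<alpha> \<mu> x :: "nat \<Rightarrow> real"
  assumes t0: "0 < t0" and s: "0 < s" "s = t0 * (u + v)"
    and l: "\<And>j. j \<in> {1..m} \<Longrightarrow> l j = \<alpha> j / t0 + \<mu> j"
    and bal: "(\<Sum>j=1..m. (\<alpha> j)\<^sup>2) = t0\<^sup>2 * (\<Sum>j=1..m. (\<mu> j)\<^sup>2)"
  shows "exp (u * (\<Sum>j=1..m. l j * \<alpha> j)) * (\<Prod>j=1..m. normal_density (\<alpha> j * u + \<mu> j * s) (sqrt s) (x j))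
    = (1 / sqrt (2 * pi * s)) ^ m * exp (\<Sum>j=1..m. l j * x j - (x j + \<alpha> j * v)\<^sup>2 / (2 * s))"
proof -
  have z: "(\<Sum>j=1..m. l j * \<alpha> j * (u + v) - (l j)\<^sup>2 * s / 2) = 0"
  proof -
    have "(\<Sum>j=1..m. l j * \<alpha> j * (u + v) - (l j)\<^sup>2 * s / 2) = (\<Sum>j=1..m. (s / 2) * ((\<alpha> j)\<^sup>2 / t0\<^sup>2 - (\<mu> j)\<^sup>2))"
    proof (rule sum.cong[OF refl])
      fix j assume j: "j \<in> {1..m}"
      have uv: "u + v = s / t0" using s t0 by simp
      show "l j * \<alpha> j * (u + v) - (l j)\<^sup>2 * s / 2 = (s / 2) * ((\<alpha> j)\<^sup>2 / t0\<^sup>2 - (\<mu> j)\<^sup>2)"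
        unfolding l[OF j] uv using t0 by (simp add: field_simps power2_eq_square)
    qed
    also have "\<dots> = (s / 2) * ((\<Sum>j=1..m. (\<alpha> j)\<^sup>2) / t0\<^sup>2 - (\<Sum>j=1..m. (\<mu> j)\<^sup>2))"
      unfolding sum_distrib_left[symmetric] sum_subtractf sum_divide_distrib[symmetric] ..
    also have "\<dots> = 0" using t0 by (simp add: bal)
    finally show ?thesis .
  qed
  have nd: "normal_density (\<alpha> j * u + \<mu> j * s) (sqrt s) (x j) =
      1 / sqrt (2 * pi * s) * exp (- (x j - (\<alpha> j * u + \<mu> j * s))\<^sup>2 / (2 * s))" for j
    using s by (simp add: normal_density_def)
  have e: "- (x j - (\<alpha> j * u + \<mu> j * s))\<^sup>2 / (2 * s) = (l j * x j - (x j + \<alpha> j * v)\<^sup>2 / (2 * s)) + (l j * \<alpha> j * v - (l j)\<^sup>2 * s / 2)"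
    if j: "j \<in> {1..m}" for j
  proof -
    have "\<alpha> j * u + \<mu> j * s = l j * s - \<alpha> j * v" unfolding l[OF j] using s t0 by (simp add: field_simps)
    then have "x j - (\<alpha> j * u + \<mu> j * s) = (x j + \<alpha> j * v) - l j * s" by simp
    then have "- (x j - (\<alpha> j * u + \<mu> j * s))\<^sup>2 / (2 * s) = - ((x j + \<alpha> j * v) - l j * s)\<^sup>2 / (2 * s)" by (simp only:)
    also have "\<dots> = (l j * x j - (x j + \<alpha> j * v)\<^sup>2 / (2 * s)) + (l j * \<alpha> j * v - (l j)\<^sup>2 * s / 2)"
      using s(1) by (simp add: power2_diff field_simps) (simp add: power2_eq_square algebra_simps)
    finally show ?thesis .
  qed
  have "exp (u * (\<Sum>j=1..m. l j * \<alpha> j)) * (\<Prod>j=1..m. normal_density (\<alpha> j * u + \<mu> j * s) (sqrt s) (x j))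
    = (1 / sqrt (2 * pi * s)) ^ m * exp (u * (\<Sum>j=1..m. l j * \<alpha> j) + (\<Sum>j=1..m. - (x j - (\<alpha> j * u + \<mu> j * s))\<^sup>2 / (2 * s)))"
    unfolding nd by (simp only: prod.distrib prod_constant exp_sum[OF finite_atLeastAtMost] exp_add card_atLeastAtMost) simp
  also have "u * (\<Sum>j=1..m. l j * \<alpha> j) + (\<Sum>j=1..m. - (x j - (\<alpha> j * u + \<mu> j * s))\<^sup>2 / (2 * s))
    = (\<Sum>j=1..m. l j * x j - (x j + \<alpha> j * v)\<^sup>2 / (2 * s)) + (\<Sum>j=1..m. l j * \<alpha> j * (u + v) - (l j)\<^sup>2 * s / 2)"
    unfolding sum_distrib_left sum.distrib[symmetric] by (rule sum.cong[OF refl], subst e, assumption) (simp add: algebra_simps)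
  finally show ?thesis unfolding z by simp
qed

section \<open>Asymptotics in a window of length T\<close>

lemma image_add_open_ray: "(+) s ` {a<..} = {s + (a::real)<..}"
proof (intro set_eqI iffI)
  fix x assume "x \<in> {s + a<..}"
  then have "x - s \<in> {a<..}" "x = s + (x - s)" by auto
  then show "x \<in> (+) s ` {a<..}" by blast
qed auto

text \<open>At time t0 u coordinate j of \<open>B\<close> has to exceed (\<alpha>_j + \<mu>_j t0) u.
  A positive value costs an exponential factor, the value 0 leaves a contest on the scale sqrt u and
  yields a factor \<open>Psi\<close>, and a negative value is met with probability tending to 1.
  Both cases of the theorem are instances.\<close>

locale ruin_setup = bm_vec M B d for M :: "'w measure" and B and d +
  fixes \<alpha> \<mu> :: "nat \<Rightarrow> real" and m :: nat and t0 :: real and K :: "nat set"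
  assumes m: "1 \<le> m" "m \<le> d" and t0: "0 < t0"
    and \<alpha>_pos: "\<And>j. j \<in> {1..d} \<Longrightarrow> 0 < \<alpha> j" and \<mu>1: "0 < \<mu> 1"
    and balance: "(\<Sum>j=1..m. (\<alpha> j)\<^sup>2) = t0\<^sup>2 * (\<Sum>j=1..m. (\<mu> j)\<^sup>2)"
    and active: "\<And>j. j \<in> {1..m} \<Longrightarrow> 0 < \<alpha> j / t0 + \<mu> j"
    and K: "K \<subseteq> {m + 1..d}" and K_critical: "\<And>j. j \<in> K \<Longrightarrow> \<alpha> j + \<mu> j * t0 = 0"
    and inactive: "\<And>j. j \<in> {m + 1..d} - K \<Longrightarrow> \<alpha> j + \<mu> j * t0 < 0"
begin

definition lam :: "nat \<Rightarrow> real" where "lam j = \<alpha> j / t0 + \<mu> j"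

sublocale C: tilted_bm M B m \<mu> lam
proof unfold_locales
  show "standard_BM_vec M m B"
    unfolding standard_BM_vec_def
  proof
    show "\<forall>j\<in>{1..m}. standard_BM M (\<lambda>t \<omega>. B t \<omega> j)" using BM_component m by auto
    have "indep_vars (\<lambda>_. Pi\<^sub>M {0..} (\<lambda>_. borel)) (\<lambda>j \<omega>. \<lambda>t\<in>{0..}. B t \<omega> j) {1..d}"
      using BM by (simp add: standard_BM_vec_def)
    then show "indep_vars (\<lambda>_. Pi\<^sub>M {0..} (\<lambda>_. borel)) (\<lambda>j \<omega>. \<lambda>t\<in>{0..}. B t \<omega> j) {1..m}"
      by (rule indep_vars_subset) (use m in auto)
  qed
  have "(\<Sum>j=1..m. (lam j)\<^sup>2) - 2 * (\<Sum>j=1..m. lam j * \<mu> j) = (\<Sum>j=1..m. (\<alpha> j)\<^sup>2 / t0\<^sup>2 - (\<mu> j)\<^sup>2)"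
    unfolding sum_distrib_left sum_subtractf[symmetric] lam_def
    by (rule sum.cong) (use t0 in \<open>auto simp: field_simps power2_eq_square\<close>)
  also have "\<dots> = (\<Sum>j=1..m. (\<alpha> j)\<^sup>2) / t0\<^sup>2 - (\<Sum>j=1..m. (\<mu> j)\<^sup>2)"
    by (simp add: sum_subtractf sum_divide_distrib)
  also have "\<dots> = 0" using t0 by (simp add: balance)
  finally show "(\<Sum>j=1..m. (lam j)\<^sup>2) = 2 * (\<Sum>j=1..m. lam j * \<mu> j)" by simp
qed (use m active in \<open>auto simp: lam_def\<close>)

text \<open>Later hits are excluded for the \<open>m\<close> leading coordinates alone. As a hit in
  all \<open>d\<close> coordinates is one in the first \<open>m\<close>, two final windows still
  cannot lie far apart, and the excluded event leads directly to the m-dimensional functional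
  \<open>V\<close>.\<close>

definition window_hit :: "bool \<Rightarrow> real \<Rightarrow> real \<Rightarrow> real \<Rightarrow> 'w \<Rightarrow> bool" where
  "window_hit final T u s \<omega> \<longleftrightarrow> (\<exists>t\<in>{s<..<s + T}. hit B d \<mu> (\<lambda>j. \<alpha> j * u) t \<omega>) \<and>
     (final \<longrightarrow> \<not> (\<exists>t\<in>{s + T<..}. hit B m \<mu> (\<lambda>j. \<alpha> j * u) t \<omega>))"

text \<open>The level still to be exceeded after a restart at \<open>s\<close>. For j > m the
  position at \<open>s\<close> is written as sqrt s times a standard normal, so that the measure
  \<open>tail_normal\<close> does not move with \<open>u\<close>.\<close>

definition threshold :: "real \<Rightarrow> real \<Rightarrow> (nat \<Rightarrow> real) \<Rightarrow> (nat \<Rightarrow> real) \<Rightarrow> nat \<Rightarrow> real" where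
  "threshold s u x \<zeta> j = (if j \<le> m then x j else \<alpha> j * u + \<mu> j * s - sqrt s * \<zeta> j)"

definition local_hit :: "bool \<Rightarrow> real \<Rightarrow> real \<Rightarrow> real \<Rightarrow> (nat \<Rightarrow> real) \<Rightarrow> (nat \<Rightarrow> real) \<Rightarrow> 'w \<Rightarrow> bool" where
  "local_hit final T s u x \<zeta> \<omega> \<longleftrightarrow> (\<exists>t\<in>{0<..<T}. hit B d \<mu> (threshold s u x \<zeta>) t \<omega>) \<and>
     (final \<longrightarrow> \<not> (\<exists>t\<in>{T<..}. hit B m \<mu> x t \<omega>))"

definition tail_normal :: "(nat \<Rightarrow> real) measure" where
  "tail_normal = Pi\<^sub>M {m + 1..d} (\<lambda>_. std_normal_distribution)"

definition local_prob :: "bool \<Rightarrow> real \<Rightarrow> real \<Rightarrow> real \<Rightarrow> (nat \<Rightarrow> real) \<Rightarrow> ennreal" where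
  "local_prob final T s u x = (\<integral>\<^sup>+\<zeta>. emeasure M {\<omega>\<in>space M. local_hit final T s u x \<zeta> \<omega>} \<partial>tail_normal)"

lemma prob_space_tail_normal: "prob_space tail_normal"
  unfolding tail_normal_def by (rule prob_space_PiM) (rule prob_space_normal_density, simp)

text \<open>The Markov property at \<open>s\<close>, with the leading coordinates parametrised by
  the remaining level x. This is the reflection c_j - w of the position, so x_j has law N(\<alpha>_j
  u + \<mu>_j s, s). The other coordinates are averaged out in \<open>local_prob\<close>.\<close>

lemma window_hit_formula:
  assumes s: "0 < s" and T: "0 < T"
  shows "emeasure M {\<omega>\<in>space M. window_hit final T u s \<omega>} =
      (\<integral>\<^sup>+x. ennreal (\<Prod>j=1..m. normal_density (\<alpha> j * u + \<mu> j * s) (sqrt s) (x j)) * local_prob final T s u x \<partial>C.LB)"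
    and "local_prob final T s u \<in> borel_measurable C.LB"
proof -
  define c where "c j = \<alpha> j * u + \<mu> j * s" for j
  define D where "D j = (if j \<le> m then density lborel (normal_density (c j) (sqrt s)) else std_normal_distribution)" for j
  define g where "g j = (if j \<le> m then (\<lambda>w. c j - w) else (\<lambda>w. sqrt s * w))" for j
  have pD: "prob_space (D j)" for j
    unfolding D_def using s by (auto intro!: prob_space_normal_density)
  interpret D: product_sigma_finite D
    unfolding product_sigma_finite_def using pD by (simp add: prob_space_imp_sigma_finite)
  have g: "g j \<in> borel_measurable (D j)" for j
    unfolding g_def D_def by auto
  have Dg: "distr (D j) borel (g j) = density lborel (normal_density 0 (sqrt s))" for j
  proof (cases "j \<le> m")
    case True
    then show ?thesis
      using distr_normal_affine[of "sqrt s" "-1" "c j" "c j"] s by (simp add: D_def g_def)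
  next
    case False
    then show ?thesis
      using distr_normal_affine[of 1 "sqrt s" 0 0] s by (simp add: D_def g_def)
  qed
  define E where "E = (if final then phits \<mu> d {0<..<T} d c - phits \<mu> d {T<..} m c else phits \<mu> d {0<..<T} d c)"
  have E: "E \<in> sets (paths_space d)"
    unfolding E_def using T m by (auto intro!: sets.Diff sets_phits)
  have U: "open {0<..<T}" "{0<..<T} \<subseteq> {0<..}" "open {T<..}" "{T<..} \<subseteq> {0<..}" using T by auto
  have "{\<omega>\<in>space M. window_hit final T u s \<omega>} = {\<omega>\<in>space M. (\<lambda>j\<in>{1..d}. \<lambda>t\<in>{0..}. B (s + t) \<omega> j) \<in> E}"
  proof (intro Collect_cong conj_cong refl)
    fix \<omega> assume \<omega>: "\<omega> \<in> space M"
    have ic: "(+) s ` {0<..<T} = {s<..<s + T}" "(+) s ` {T<..} = {s + T<..}"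
      by (simp_all add: image_add_open_interval image_add_open_ray)
    have cs: "(\<lambda>j. c j - \<mu> j * s) = (\<lambda>j. \<alpha> j * u)" by (simp add: c_def)
    show "window_hit final T u s \<omega> \<longleftrightarrow> (\<lambda>j\<in>{1..d}. \<lambda>t\<in>{0..}. B (s + t) \<omega> j) \<in> E"
      unfolding window_hit_def E_def
      using shifted_in_phits[OF \<omega> order_refl less_imp_le[OF s] U(1,2), of \<mu> c]
        shifted_in_phits[OF \<omega> m(2) less_imp_le[OF s] U(3,4), of \<mu> c]
      unfolding ic cs by auto
  qed
  also have "emeasure M \<dots> = (\<integral>\<^sup>+ w. emeasure M {\<omega>\<in>space M. (\<lambda>j\<in>{1..d}. \<lambda>t\<in>{0..}. g j (w j) + B t \<omega> j) \<in> E} \<partial>Pi\<^sub>M {1..d} D)"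
    by (rule Markov_emeasure[OF s pD g Dg E])
  finally have 1: "emeasure M {\<omega>\<in>space M. window_hit final T u s \<omega>} =
     (\<integral>\<^sup>+ w. emeasure M {\<omega>\<in>space M. (\<lambda>j\<in>{1..d}. \<lambda>t\<in>{0..}. g j (w j) + B t \<omega> j) \<in> E} \<partial>Pi\<^sub>M {1..d} D)" .
  define f where "f w = emeasure M {\<omega>\<in>space M. (\<lambda>j\<in>{1..d}. \<lambda>t\<in>{0..}. g j (w j) + B t \<omega> j) \<in> E}" for w
  have un: "{1..m} \<union> {m + 1..d} = {1..d}" using m by auto
  have f: "f \<in> borel_measurable (Pi\<^sub>M ({1..m} \<union> {m + 1..d}) D)"
    unfolding f_def un by (rule measurable_emeasure_translated[OF g E])
  have f_merge: "f (merge {1..m} {m + 1..d} (x, \<zeta>)) = emeasure M {\<omega>\<in>space M. local_hit final T s u x \<zeta> \<omega>}" for x \<zeta>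
    unfolding f_def
  proof (intro arg_cong[where f="emeasure M"] Collect_cong conj_cong refl)
    fix \<omega> assume \<omega>: "\<omega> \<in> space M"
    let ?w = "merge {1..m} {m + 1..d} (x, \<zeta>)"
    have thr: "hit B d \<mu> (\<lambda>j. c j - g j (?w j)) t \<omega> \<longleftrightarrow> hit B d \<mu> (threshold s u x \<zeta>) t \<omega>" for t
      unfolding hit_def
    proof (intro ball_cong refl)
      fix j assume "j \<in> {1..d}"
      then have "c j - g j (?w j) = threshold s u x \<zeta> j"
        by (auto simp: merge_def threshold_def c_def g_def)
      then show "(c j - g j (?w j) < B t \<omega> j - \<mu> j * t) = (threshold s u x \<zeta> j < B t \<omega> j - \<mu> j * t)" by simp
    qed
    have thr2: "hit B m \<mu> (\<lambda>j. c j - g j (?w j)) t \<omega> \<longleftrightarrow> hit B m \<mu> x t \<omega>" for t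
      by (auto simp: hit_def merge_def g_def)
    show "(\<lambda>j\<in>{1..d}. \<lambda>t\<in>{0..}. g j (?w j) + B t \<omega> j) \<in> E \<longleftrightarrow> local_hit final T s u x \<zeta> \<omega>"
      unfolding local_hit_def E_def
      using translated_in_phits[OF \<omega> order_refl U(1,2), of "\<lambda>j. g j (?w j)" \<mu> c]
        translated_in_phits[OF \<omega> m(2) U(3,4), of "\<lambda>j. g j (?w j)" \<mu> c]
      unfolding thr thr2 by auto
  qed
  have PN: "Pi\<^sub>M {m + 1..d} D = tail_normal"
    unfolding tail_normal_def by (rule PiM_cong) (auto simp: D_def)
  have lp: "local_prob final T s u x = (\<integral>\<^sup>+\<zeta>. f (merge {1..m} {m + 1..d} (x, \<zeta>)) \<partial>Pi\<^sub>M {m + 1..d} D)" for x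
    unfolding local_prob_def f_merge PN ..
  have LBm: "Pi\<^sub>M {1..m} D = density C.LB (\<lambda>x. \<Prod>j\<in>{1..m}. ennreal (normal_density (c j) (sqrt s) (x j)))"
  proof -
    have "Pi\<^sub>M {1..m} D = Pi\<^sub>M {1..m} (\<lambda>j. density lborel (\<lambda>x. ennreal (normal_density (c j) (sqrt s) x)))"
      by (rule PiM_cong) (auto simp: D_def)
    also have "\<dots> = density C.LB (\<lambda>x. \<Prod>j\<in>{1..m}. ennreal (normal_density (c j) (sqrt s) (x j)))"
      by (rule PiM_density_lborel) (use s in \<open>auto intro!: prob_space_normal_density\<close>)
    finally show ?thesis .
  qed
  interpret PN: prob_space "Pi\<^sub>M {m + 1..d} D" by (rule prob_space_PiM) (rule pD)
  have "local_prob final T s u \<in> borel_measurable (Pi\<^sub>M {1..m} D)"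
    unfolding lp
    by (rule PN.borel_measurable_nn_integral) (use measurable_compose[OF measurable_merge f] in \<open>simp add: case_prod_beta\<close>)
  then show mlp: "local_prob final T s u \<in> borel_measurable C.LB"
    unfolding LBm by simp
  have "emeasure M {\<omega>\<in>space M. window_hit final T u s \<omega>} = integral\<^sup>N (Pi\<^sub>M ({1..m} \<union> {m + 1..d}) D) f"
    unfolding 1 f_def un ..
  also have "\<dots> = (\<integral>\<^sup>+x. (\<integral>\<^sup>+\<zeta>. f (merge {1..m} {m + 1..d} (x, \<zeta>)) \<partial>Pi\<^sub>M {m + 1..d} D) \<partial>Pi\<^sub>M {1..m} D)"
    by (rule D.product_nn_integral_fold[OF _ _ _ f]) auto
  also have "\<dots> = (\<integral>\<^sup>+x. local_prob final T s u x \<partial>density C.LB (\<lambda>x. \<Prod>j\<in>{1..m}. ennreal (normal_density (c j) (sqrt s) (x j))))"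
    unfolding lp[symmetric] LBm ..
  also have "\<dots> = (\<integral>\<^sup>+x. (\<Prod>j\<in>{1..m}. ennreal (normal_density (c j) (sqrt s) (x j))) * local_prob final T s u x \<partial>C.LB)"
    by (rule nn_integral_density) (use mlp in measurable)
  also have "\<dots> = (\<integral>\<^sup>+x. ennreal (\<Prod>j=1..m. normal_density (\<alpha> j * u + \<mu> j * s) (sqrt s) (x j)) * local_prob final T s u x \<partial>C.LB)"
    by (simp add: prod_ennreal c_def)
  finally show "emeasure M {\<omega>\<in>space M. window_hit final T u s \<omega>} =
      (\<integral>\<^sup>+x. ennreal (\<Prod>j=1..m. normal_density (\<alpha> j * u + \<mu> j * s) (sqrt s) (x j)) * local_prob final T s u x \<partial>C.LB)" .
qed

end

section \<open>Convergence of the local hitting probability\<close>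

lemma nn_integral_dominated_convergence_at_top:
  fixes f :: "real \<Rightarrow> 'a \<Rightarrow> ennreal"
  assumes f: "\<And>u. f u \<in> borel_measurable M" "g \<in> borel_measurable M" "w \<in> borel_measurable M"
    and bound: "\<forall>\<^sub>F u in at_top. AE x in M. f u x \<le> w x"
    and w: "(\<integral>\<^sup>+x. w x \<partial>M) < \<infinity>"
    and lim: "AE x in M. ((\<lambda>u. f u x) \<longlongrightarrow> g x) at_top"
  shows "((\<lambda>u. \<integral>\<^sup>+x. f u x \<partial>M) \<longlongrightarrow> (\<integral>\<^sup>+x. g x \<partial>M)) at_top"
proof (rule tendsto_at_topI_sequentially)
  fix X :: "nat \<Rightarrow> real" assume X: "filterlim X at_top sequentially"
  from filterlim_iff[THEN iffD1, OF this, rule_format, OF bound]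
  obtain N where N: "\<And>n. N \<le> n \<Longrightarrow> AE x in M. f (X n) x \<le> w x"
    by (auto simp: eventually_sequentially)
  show "(\<lambda>n. \<integral>\<^sup>+x. f (X n) x \<partial>M) \<longlonglongrightarrow> (\<integral>\<^sup>+x. g x \<partial>M)"
  proof (rule LIMSEQ_offset, rule nn_integral_dominated_convergence[where w = w])
    show "AE x in M. f (X (n + N)) x \<le> w x" for n by (rule N) auto
    show "AE x in M. (\<lambda>n. f (X (n + N)) x) \<longlonglongrightarrow> g x"
      using lim
    proof eventually_elim
      fix x assume "((\<lambda>i. f i x) \<longlongrightarrow> g x) at_top"
      then show "(\<lambda>n. f (X (n + N)) x) \<longlonglongrightarrow> g x"
        by (intro LIMSEQ_ignore_initial_segment filterlim_compose[OF _ X])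
    qed
  qed (use f w in auto)
qed

lemma (in prob_space) emeasure_tendsto_pointwise:
  fixes A :: "real \<Rightarrow> 'a set"
  assumes A: "\<And>u. A u \<in> events" "A' \<in> events"
    and ev: "\<And>\<omega>. \<omega> \<in> space M \<Longrightarrow> \<forall>\<^sub>F u in at_top. \<omega> \<in> A u \<longleftrightarrow> \<omega> \<in> A'"
  shows "((\<lambda>u. emeasure M (A u)) \<longlongrightarrow> emeasure M A') at_top"
proof -
  have "((\<lambda>u. \<integral>\<^sup>+\<omega>. indicator (A u) \<omega> \<partial>M) \<longlongrightarrow> (\<integral>\<^sup>+\<omega>. indicator A' \<omega> \<partial>M)) at_top"
  proof (rule nn_integral_dominated_convergence_at_top[where w = "\<lambda>_. 1"])
    show "AE \<omega> in M. ((\<lambda>u. indicator (A u) \<omega> :: ennreal) \<longlongrightarrow> indicator A' \<omega>) at_top"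
    proof (rule AE_I2)
      fix \<omega> assume "\<omega> \<in> space M"
      from ev[OF this] have "\<forall>\<^sub>F u in at_top. (indicator A' \<omega> :: ennreal) = indicator (A u) \<omega>"
        by eventually_elim (auto simp: indicator_def)
      then show "((\<lambda>u. indicator (A u) \<omega> :: ennreal) \<longlongrightarrow> indicator A' \<omega>) at_top"
        by (rule Lim_transform_eventually[OF tendsto_const])
    qed
  qed (use A in \<open>auto simp: emeasure_space_1 indicator_def\<close>)
  then show ?thesis using A by simp
qed

lemma Psi_eq: "ennreal (Psi x) = emeasure std_normal_distribution {x<..}" and Psi_bounds: "0 \<le> Psi x" "Psi x \<le> 1"
proof -
  interpret real_distribution std_normal_distribution by (rule real_dist_normal_dist)
  have "prob ({x<..}) = 1 - prob (UNIV - {x<..})"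
    using prob_compl[of "{x<..}"] by simp
  also have "UNIV - {x<..} = {..x}" by auto
  finally have e: "Psi x = prob {x<..}" by (simp add: Psi_def cdf_def)
  show "ennreal (Psi x) = emeasure std_normal_distribution {x<..}" unfolding e emeasure_eq_measure ..
  show "0 \<le> Psi x" "Psi x \<le> 1" unfolding e by auto
qed

lemma Psi_measurable [measurable]: "Psi \<in> borel_measurable borel"
proof -
  interpret real_distribution std_normal_distribution by (rule real_dist_normal_dist)
  have "mono (cdf std_normal_distribution)" by (auto simp: mono_def intro: cdf_nondecreasing)
  then have [measurable]: "cdf std_normal_distribution \<in> borel_measurable borel" by (rule borel_measurable_mono)
  show ?thesis unfolding Psi_def[abs_def] by measurable
qed

context ruin_setup
begin

text \<open>Window starts on the fluctuation scale sqrt u around the most likely time t0 u.\<close>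

definition time :: "real \<Rightarrow> real \<Rightarrow> real" where "time y u = t0 * u + y * sqrt u"

lemma time_ratio: "((\<lambda>u. time y u / u) \<longlongrightarrow> t0) at_top"
proof -
  have "((\<lambda>u. t0 + y / sqrt u) \<longlongrightarrow> t0 + 0) at_top"
    by (intro tendsto_add tendsto_const real_tendsto_divide_at_top[OF tendsto_const] sqrt_at_top)
  then have "((\<lambda>u. t0 + y / sqrt u) \<longlongrightarrow> t0) at_top" by simp
  then show ?thesis
  proof (rule Lim_transform_eventually)
    show "\<forall>\<^sub>F u in at_top. t0 + y / sqrt u = time y u / u"
      using eventually_gt_at_top[of 0]
    proof eventually_elim
      case (elim u)
      then have "y * sqrt u / u = y * sqrt u / (sqrt u * sqrt u)" by simp
      also have "\<dots> = y / sqrt u" using elim by (simp del: real_sqrt_mult_self)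
      finally show ?case using elim by (simp add: time_def add_divide_distrib)
    qed
  qed
qed

lemma time_at_top: "filterlim (time y) at_top at_top"
proof -
  have "filterlim (\<lambda>u. time y u / u * u) at_top at_top"
    by (rule filterlim_tendsto_pos_mult_at_top[OF time_ratio t0 filterlim_ident])
  then show ?thesis
  proof (rule filterlim_mono_eventually[OF _ order_refl order_refl])
    show "\<forall>\<^sub>F u in at_top. time y u / u * u = time y u"
      using eventually_gt_at_top[of 0] by eventually_elim simp
  qed
qed

lemma sqrt_time_ratio: "((\<lambda>u. sqrt (time y u / u)) \<longlongrightarrow> sqrt t0) at_top"
  by (intro tendsto_real_sqrt time_ratio)

text \<open>The threshold is of order u with the negative coefficient \<alpha>_j + \<mu>_j t0; the
  Gaussian term is only of order sqrt u.\<close>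

lemma threshold_inactive:
  assumes j: "j \<in> {m + 1..d} - K"
  shows "filterlim (\<lambda>u. threshold (time y u) u x \<zeta> j) at_bot at_top"
proof -
  have "((\<lambda>u. \<alpha> j + \<mu> j * (time y u / u) - sqrt (time y u / u) * (\<zeta> j / sqrt u)) \<longlongrightarrow> \<alpha> j + \<mu> j * t0 - sqrt t0 * 0) at_top"
    by (intro tendsto_intros time_ratio sqrt_time_ratio real_tendsto_divide_at_top[OF tendsto_const] sqrt_at_top)
  then have 1: "((\<lambda>u. \<alpha> j + \<mu> j * (time y u / u) - sqrt (time y u / u) * (\<zeta> j / sqrt u)) \<longlongrightarrow> \<alpha> j + \<mu> j * t0) at_top" by simp
  have "filterlim (\<lambda>u. (\<alpha> j + \<mu> j * (time y u / u) - sqrt (time y u / u) * (\<zeta> j / sqrt u)) * u) at_bot at_top"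
    by (rule filterlim_tendsto_neg_mult_at_bot[OF 1 _ filterlim_ident]) (use inactive[OF j] in simp)
  then show ?thesis
  proof (rule filterlim_mono_eventually[OF _ order_refl order_refl])
    show "\<forall>\<^sub>F u in at_top. (\<alpha> j + \<mu> j * (time y u / u) - sqrt (time y u / u) * (\<zeta> j / sqrt u)) * u = threshold (time y u) u x \<zeta> j"
      using eventually_gt_at_top[of 0]
    proof eventually_elim
      case (elim u)
      have "sqrt (time y u / u) * (\<zeta> j / sqrt u) * u = sqrt (time y u) * \<zeta> j * (u / (sqrt u * sqrt u))"
        by (simp add: real_sqrt_divide)
      also have "\<dots> = sqrt (time y u) * \<zeta> j" using elim by simp
      finally show ?case using elim j by (simp add: threshold_def algebra_simps)
    qed
  qed
qed

text \<open>For j in \<open>K\<close> the terms of order u cancel. What is left is (\<mu>_j y - sqrt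
  t0 \<zeta>_j) sqrt u to leading order, and its sign decides; this comparison is the source of the
  factors \<open>Psi\<close>.\<close>

lemma threshold_critical:
  assumes j: "j \<in> K" and ne: "\<mu> j * y \<noteq> sqrt t0 * \<zeta> j"
  shows "\<mu> j * y < sqrt t0 * \<zeta> j \<Longrightarrow> filterlim (\<lambda>u. threshold (time y u) u x \<zeta> j) at_bot at_top"
    and "\<mu> j * y > sqrt t0 * \<zeta> j \<Longrightarrow> filterlim (\<lambda>u. threshold (time y u) u x \<zeta> j) at_top at_top"
proof -
  have 1: "((\<lambda>u. \<mu> j * y - sqrt (time y u / u) * \<zeta> j) \<longlongrightarrow> \<mu> j * y - sqrt t0 * \<zeta> j) at_top"
    by (intro tendsto_intros sqrt_time_ratio)
  have jm: "j \<in> {m + 1..d}" using j K by auto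
  have ev: "\<forall>\<^sub>F u in at_top. (\<mu> j * y - sqrt (time y u / u) * \<zeta> j) * sqrt u = threshold (time y u) u x \<zeta> j"
    using eventually_gt_at_top[of 0]
  proof eventually_elim
    case (elim u)
    have "\<alpha> j = - (\<mu> j * t0)" using K_critical[OF j] by simp
    then have "threshold (time y u) u x \<zeta> j = \<mu> j * y * sqrt u - sqrt (time y u) * \<zeta> j"
      using jm by (simp add: threshold_def time_def algebra_simps)
    also have "sqrt (time y u) = sqrt (time y u / u) * sqrt u" using elim by (simp add: real_sqrt_divide)
    finally show ?case by (simp add: algebra_simps)
  qed
  show "filterlim (\<lambda>u. threshold (time y u) u x \<zeta> j) at_bot at_top" if "\<mu> j * y < sqrt t0 * \<zeta> j"
    by (rule filterlim_mono_eventually[OF filterlim_tendsto_neg_mult_at_bot[OF 1 _ sqrt_at_top] order_refl order_refl ev])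
       (use that in simp)
  show "filterlim (\<lambda>u. threshold (time y u) u x \<zeta> j) at_top at_top" if "\<mu> j * y > sqrt t0 * \<zeta> j"
    by (rule filterlim_mono_eventually[OF filterlim_tendsto_pos_mult_at_top[OF 1 _ sqrt_at_top] order_refl order_refl ev])
       (use that in simp)
qed

lemma paths_bounded:
  assumes \<omega>: "\<omega> \<in> space M"
  obtains C where "\<And>j t. j \<in> {1..d} \<Longrightarrow> t \<in> {0..T} \<Longrightarrow> \<bar>B t \<omega> j - \<mu> j * t\<bar> \<le> C"
proof -
  have "bounded (\<Union>j\<in>{1..d}. (\<lambda>t. B t \<omega> j - \<mu> j * t) ` {0..T})"
  proof (rule bounded_UN)
    show "\<forall>j\<in>{1..d}. bounded ((\<lambda>t. B t \<omega> j - \<mu> j * t) ` {0..T})"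
    proof
      fix j assume j: "j \<in> {1..d}"
      have "continuous_on {0..T} (\<lambda>t. B t \<omega> j - \<mu> j * t)"
        by (intro continuous_intros continuous_on_subset[OF B_cont[OF \<omega> j]]) auto
      then show "bounded ((\<lambda>t. B t \<omega> j - \<mu> j * t) ` {0..T})"
        by (intro compact_imp_bounded compact_continuous_image) auto
    qed
  qed simp
  then obtain C where C: "\<forall>z\<in>(\<Union>j\<in>{1..d}. (\<lambda>t. B t \<omega> j - \<mu> j * t) ` {0..T}). norm z \<le> C"
    unfolding bounded_iff by blast
  have "\<bar>B t \<omega> j - \<mu> j * t\<bar> \<le> C" if "j \<in> {1..d}" "t \<in> {0..T}" for j t
  proof -
    have "B t \<omega> j - \<mu> j * t \<in> (\<Union>j\<in>{1..d}. (\<lambda>t. B t \<omega> j - \<mu> j * t) ` {0..T})" using that by blast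
    then show ?thesis using C by force
  qed
  then show ?thesis using that by blast
qed

definition limit_hit :: "bool \<Rightarrow> real \<Rightarrow> (nat \<Rightarrow> real) \<Rightarrow> 'w \<Rightarrow> bool" where
  "limit_hit final T x \<omega> \<longleftrightarrow> C.Hit {0<..<T} x \<omega> \<and> (final \<longrightarrow> \<not> C.Hit {T<..} x \<omega>)"

lemma hit_threshold_imp: "hit B d \<mu> (threshold s u x \<zeta>) t \<omega> \<Longrightarrow> hit B m \<mu> x t \<omega>"
  unfolding hit_def
proof (intro ballI)
  fix j assume h: "\<forall>j\<in>{1..d}. threshold s u x \<zeta> j < B t \<omega> j - \<mu> j * t" and j: "j \<in> {1..m}"
  then have "threshold s u x \<zeta> j < B t \<omega> j - \<mu> j * t" using m by auto
  then show "x j < B t \<omega> j - \<mu> j * t" using j by (simp add: threshold_def)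
qed

text \<open>On (0, T) each path is bounded, while the thresholds of the non-leading coordinates
  diverge. Those tending to minus infinity stop being a constraint, and a single one tending to plus
  infinity makes the hit impossible.\<close>

lemma local_hit_eventually:
  assumes \<omega>: "\<omega> \<in> space M" and ne: "\<And>j. j \<in> K \<Longrightarrow> \<mu> j * y \<noteq> sqrt t0 * \<zeta> j"
  shows "\<forall>\<^sub>F u in at_top. local_hit final T (time y u) u x \<zeta> \<omega> \<longleftrightarrow>
     limit_hit final T x \<omega> \<and> (\<forall>j\<in>K. \<mu> j * y < sqrt t0 * \<zeta> j)"
proof -
  obtain C where C: "\<And>j t. j \<in> {1..d} \<Longrightarrow> t \<in> {0..T} \<Longrightarrow> \<bar>B t \<omega> j - \<mu> j * t\<bar> \<le> C"
    using paths_bounded[OF \<omega>, of T] by blast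
  show ?thesis
  proof (cases "\<forall>j\<in>K. \<mu> j * y < sqrt t0 * \<zeta> j")
    case True
    have "\<forall>\<^sub>F u in at_top. \<forall>j\<in>{m + 1..d}. threshold (time y u) u x \<zeta> j < - C"
    proof (rule eventually_ball_finite)
      show "\<forall>j\<in>{m + 1..d}. \<forall>\<^sub>F u in at_top. threshold (time y u) u x \<zeta> j < - C"
      proof
        fix j assume j: "j \<in> {m + 1..d}"
        have "filterlim (\<lambda>u. threshold (time y u) u x \<zeta> j) at_bot at_top"
        proof (cases "j \<in> K")
          case jK: True
          show ?thesis by (rule threshold_critical(1)[where j = j and y = y and \<zeta> = \<zeta>, OF jK ne[OF jK]]) (use True jK in auto)
        qed (use threshold_inactive j in auto)
        then show "\<forall>\<^sub>F u in at_top. threshold (time y u) u x \<zeta> j < - C"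
          unfolding filterlim_at_bot_dense by blast
      qed
    qed simp
    then show ?thesis
    proof eventually_elim
      case (elim u)
      have "hit B d \<mu> (threshold (time y u) u x \<zeta>) t \<omega> \<longleftrightarrow> hit B m \<mu> x t \<omega>" if t: "t \<in> {0<..<T}" for t
      proof
        assume "hit B m \<mu> x t \<omega>"
        moreover have "threshold (time y u) u x \<zeta> j < B t \<omega> j - \<mu> j * t" if j: "j \<in> {m + 1..d}" for j
          using elim j C[of j t] t by force
        ultimately show "hit B d \<mu> (threshold (time y u) u x \<zeta>) t \<omega>"
          unfolding hit_def
        proof (intro ballI)
          fix j assume a: "\<forall>j\<in>{1..m}. x j < B t \<omega> j - \<mu> j * t"
            "\<And>j. j \<in> {m + 1..d} \<Longrightarrow> threshold (time y u) u x \<zeta> j < B t \<omega> j - \<mu> j * t" and j: "j \<in> {1..d}"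
          show "threshold (time y u) u x \<zeta> j < B t \<omega> j - \<mu> j * t"
          proof (cases "j \<le> m")
            case True
            then have "threshold (time y u) u x \<zeta> j = x j" by (simp add: threshold_def)
            then show ?thesis using a(1) True j by simp
          qed (use a(2) j in simp)
        qed
      next
        assume "hit B d \<mu> (threshold (time y u) u x \<zeta>) t \<omega>"
        then show "hit B m \<mu> x t \<omega>" by (rule hit_threshold_imp)
      qed
      then show ?case using True by (auto simp: local_hit_def limit_hit_def C.Hit_def)
    qed
  next
    case False
    then obtain j where j: "j \<in> K" "\<not> \<mu> j * y < sqrt t0 * \<zeta> j" by auto
    have jd: "j \<in> {1..d}" using j K by auto
    have "filterlim (\<lambda>u. threshold (time y u) u x \<zeta> j) at_top at_top"
      by (rule threshold_critical(2)[where j = j and y = y and \<zeta> = \<zeta>, OF j(1) ne[OF j(1)]]) (use j ne[OF j(1)] in linarith)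
    then have "\<forall>\<^sub>F u in at_top. C < threshold (time y u) u x \<zeta> j"
      unfolding filterlim_at_top_dense by blast
    then show ?thesis
    proof eventually_elim
      case (elim u)
      have "\<not> hit B d \<mu> (threshold (time y u) u x \<zeta>) t \<omega>" if t: "t \<in> {0<..<T}" for t
        using elim C[OF jd, of t] t jd by (force simp: hit_def)
      then show ?case using False by (auto simp: local_hit_def)
    qed
  qed
qed

lemma sets_limit_hit: "0 < T \<Longrightarrow> {\<omega>\<in>space M. limit_hit final T x \<omega>} \<in> sets M"
  unfolding limit_hit_def C.Hit_def
  by (intro sets.sets_Collect_conj sets.sets_Collect_imp sets.sets_Collect_neg sets.sets_Collect_const sets_hit m) auto

lemma sets_local_hit: "0 < T \<Longrightarrow> {\<omega>\<in>space M. local_hit final T s u x \<zeta> \<omega>} \<in> sets M"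
  unfolding local_hit_def
  by (intro sets.sets_Collect_conj sets.sets_Collect_imp sets.sets_Collect_neg sets.sets_Collect_const sets_hit m) auto

lemma local_prob_le:
  assumes T: "0 < T"
  shows "local_prob final T s u x \<le> emeasure M {\<omega>\<in>space M. C.Hit {0<..<T} x \<omega>}"
proof -
  interpret PN: prob_space tail_normal by (rule prob_space_tail_normal)
  have "local_prob final T s u x \<le> (\<integral>\<^sup>+\<zeta>. emeasure M {\<omega>\<in>space M. C.Hit {0<..<T} x \<omega>} \<partial>tail_normal)"
    unfolding local_prob_def
  proof (intro nn_integral_mono emeasure_mono)
    show "{\<omega>\<in>space M. C.Hit {0<..<T} x \<omega>} \<in> sets M"
      unfolding C.Hit_def by (rule sets_hit[OF m(2)]) (use T in auto)
    show "{\<omega>\<in>space M. local_hit final T s u x \<zeta> \<omega>} \<subseteq> {\<omega>\<in>space M. C.Hit {0<..<T} x \<omega>}" for \<zeta>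
      using hit_threshold_imp unfolding local_hit_def C.Hit_def by blast
  qed
  then show ?thesis by (simp add: PN.emeasure_space_1)
qed

lemma local_hit_measurable:
  assumes T: "0 < T"
  shows "(\<lambda>\<zeta>. emeasure M {\<omega>\<in>space M. local_hit final T s u x \<zeta> \<omega>}) \<in> borel_measurable tail_normal"
proof -
  let ?N = "tail_normal \<Otimes>\<^sub>M M"
  have comp: "(\<lambda>y. fst y j) \<in> borel_measurable ?N" if "j \<in> {m + 1..d}" for j
    unfolding tail_normal_def
    using that by (intro measurable_compose[OF measurable_fst]) (auto intro: measurable_component_singleton)
  have 1: "{y\<in>space ?N. \<exists>t\<in>{0<..<T}. hit B d \<mu> (threshold s u x (fst y)) t (snd y)} \<in> sets ?N"
  proof (rule hit_measurable)
    fix j assume j: "j \<in> {1..d}"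
    show "(\<lambda>y. threshold s u x (fst y) j) \<in> borel_measurable ?N"
    proof (cases "j \<le> m")
      case False
      then have [measurable]: "(\<lambda>y. fst y j) \<in> borel_measurable ?N" using comp j by auto
      show ?thesis unfolding threshold_def using False by simp
    qed (simp add: threshold_def)
  qed auto
  have 2: "{y\<in>space ?N. \<exists>t\<in>{T<..}. hit B m \<mu> x t (snd y)} \<in> sets ?N"
    by (rule hit_measurable) (use m T in auto)
  have "{y\<in>space ?N. local_hit final T s u x (fst y) (snd y)} \<in> sets ?N"
    unfolding local_hit_def
    by (intro sets.sets_Collect_conj sets.sets_Collect_imp sets.sets_Collect_neg sets.sets_Collect_const 1 2)
  then have "(\<lambda>\<zeta>. emeasure M (Pair \<zeta> -` {y\<in>space ?N. local_hit final T s u x (fst y) (snd y)})) \<in> borel_measurable tail_normal"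
    by (rule measurable_emeasure_Pair)
  also have "?this \<longleftrightarrow> ?thesis"
    by (rule measurable_cong) (auto intro!: arg_cong[where f="emeasure M"] simp: space_pair_measure)
  finally show ?thesis .
qed

lemma tail_normal_critical:
  "emeasure tail_normal {\<zeta>\<in>space tail_normal. \<forall>j\<in>K. \<mu> j * y < sqrt t0 * \<zeta> j} = ennreal (\<Prod>j\<in>K. Psi (\<mu> j / sqrt t0 * y))"
  and sets_tail_normal_critical: "{\<zeta>\<in>space tail_normal. \<forall>j\<in>K. \<mu> j * y < sqrt t0 * \<zeta> j} \<in> sets tail_normal"
proof -
  interpret N: product_sigma_finite "\<lambda>_::nat. std_normal_distribution"
    unfolding product_sigma_finite_def
    by (auto intro!: prob_space_imp_sigma_finite prob_space_normal_density)
  interpret N1: prob_space std_normal_distribution by (rule prob_space_normal_density) simp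
  define A where "A j = (if j \<in> K then {\<mu> j / sqrt t0 * y<..} else UNIV)" for j
  have eq: "{\<zeta>\<in>space tail_normal. \<forall>j\<in>K. \<mu> j * y < sqrt t0 * \<zeta> j} = Pi\<^sub>E {m + 1..d} A"
  proof -
    have "\<mu> j * y < sqrt t0 * z \<longleftrightarrow> \<mu> j / sqrt t0 * y < z" for j z
      using t0 by (simp add: pos_divide_less_eq mult.commute)
    then show ?thesis
      unfolding tail_normal_def space_PiM
      using K by (auto simp: PiE_iff A_def extensional_def split: if_splits)
  qed
  have A: "A j \<in> sets std_normal_distribution" for j by (simp add: A_def)
  show "{\<zeta>\<in>space tail_normal. \<forall>j\<in>K. \<mu> j * y < sqrt t0 * \<zeta> j} \<in> sets tail_normal"
    unfolding eq unfolding tail_normal_def using A by (intro sets_PiM_I_finite) auto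
  have "emeasure tail_normal (Pi\<^sub>E {m + 1..d} A) = (\<Prod>j\<in>{m + 1..d}. emeasure std_normal_distribution (A j))"
    unfolding tail_normal_def by (rule N.emeasure_PiM) (use A in auto)
  also have "\<dots> = (\<Prod>j\<in>K. emeasure std_normal_distribution (A j))"
    by (rule prod.mono_neutral_right) (use K N1.emeasure_space_1 in \<open>auto simp: A_def\<close>)
  also have "\<dots> = (\<Prod>j\<in>K. ennreal (Psi (\<mu> j / sqrt t0 * y)))"
    by (rule prod.cong) (auto simp: A_def Psi_eq)
  also have "\<dots> = ennreal (\<Prod>j\<in>K. Psi (\<mu> j / sqrt t0 * y))"
    by (rule prod_ennreal) (rule Psi_bounds)
  finally show "emeasure tail_normal {\<zeta>\<in>space tail_normal. \<forall>j\<in>K. \<mu> j * y < sqrt t0 * \<zeta> j} = ennreal (\<Prod>j\<in>K. Psi (\<mu> j / sqrt t0 * y))"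
    unfolding eq .
qed

text \<open>Ties, where the sign in \<open>threshold_critical\<close> is undecided, are
  null.\<close>

lemma tail_normal_ne: "AE \<zeta> in tail_normal. \<forall>j\<in>K. \<mu> j * y \<noteq> sqrt t0 * \<zeta> j"
proof (rule AE_finite_allI)
  show "finite K" using K finite_subset by blast
  fix j assume j: "j \<in> K"
  have "AE z in std_normal_distribution. z \<noteq> \<mu> j * y / sqrt t0"
    using AE_lborel_singleton[of "\<mu> j * y / sqrt t0"] by (subst AE_density) (auto elim: eventually_mono)
  then have "AE z in std_normal_distribution. \<mu> j * y \<noteq> sqrt t0 * z"
    by eventually_elim (use t0 in auto)
  then show "AE \<zeta> in tail_normal. \<mu> j * y \<noteq> sqrt t0 * \<zeta> j"
    unfolding tail_normal_def using j K
    by (intro AE_PiM_component) (auto intro!: prob_space_normal_density)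
qed

text \<open>For a fixed \<zeta> without ties the event becomes constant in u along every path, so
  its probability converges; the integral over \<zeta> is dominated by 1. The limit factors because
  path and \<zeta> enter separately.\<close>

lemma local_prob_limit:
  assumes T: "0 < T"
  shows "((\<lambda>u. local_prob final T (time y u) u x) \<longlongrightarrow>
     emeasure M {\<omega>\<in>space M. limit_hit final T x \<omega>} * ennreal (\<Prod>j\<in>K. Psi (\<mu> j / sqrt t0 * y))) at_top"
proof -
  interpret PN: prob_space tail_normal by (rule prob_space_tail_normal)
  let ?c = "{\<zeta>\<in>space tail_normal. \<forall>j\<in>K. \<mu> j * y < sqrt t0 * \<zeta> j}"
  note [measurable] = sets_tail_normal_critical
  have "((\<lambda>u. local_prob final T (time y u) u x) \<longlongrightarrow>
     (\<integral>\<^sup>+\<zeta>. emeasure M {\<omega>\<in>space M. limit_hit final T x \<omega>} * indicator ?c \<zeta> \<partial>tail_normal)) at_top"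
    unfolding local_prob_def
  proof (rule nn_integral_dominated_convergence_at_top[where w = "\<lambda>_. 1"])
    show "AE \<zeta> in tail_normal. ((\<lambda>u. emeasure M {\<omega>\<in>space M. local_hit final T (time y u) u x \<zeta> \<omega>}) \<longlongrightarrow>
       emeasure M {\<omega>\<in>space M. limit_hit final T x \<omega>} * indicator ?c \<zeta>) at_top"
      using tail_normal_ne[of y] AE_space
    proof eventually_elim
      case (elim \<zeta>)
      have "((\<lambda>u. emeasure M {\<omega>\<in>space M. local_hit final T (time y u) u x \<zeta> \<omega>}) \<longlongrightarrow>
        emeasure M {\<omega>\<in>space M. limit_hit final T x \<omega> \<and> (\<forall>j\<in>K. \<mu> j * y < sqrt t0 * \<zeta> j)}) at_top"
      proof (rule emeasure_tendsto_pointwise)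
        show "{\<omega>\<in>space M. limit_hit final T x \<omega> \<and> (\<forall>j\<in>K. \<mu> j * y < sqrt t0 * \<zeta> j)} \<in> sets M"
          using sets_limit_hit[OF T] by (cases "\<forall>j\<in>K. \<mu> j * y < sqrt t0 * \<zeta> j") auto
      next
        fix \<omega> assume \<omega>: "\<omega> \<in> space M"
        show "\<forall>\<^sub>F u in at_top. \<omega> \<in> {\<omega>\<in>space M. local_hit final T (time y u) u x \<zeta> \<omega>} \<longleftrightarrow>
          \<omega> \<in> {\<omega>\<in>space M. limit_hit final T x \<omega> \<and> (\<forall>j\<in>K. \<mu> j * y < sqrt t0 * \<zeta> j)}"
          using local_hit_eventually[OF \<omega>, of y \<zeta> final T x] elim \<omega> by auto
      qed (rule sets_local_hit[OF T])
      also have "emeasure M {\<omega>\<in>space M. limit_hit final T x \<omega> \<and> (\<forall>j\<in>K. \<mu> j * y < sqrt t0 * \<zeta> j)} =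
         emeasure M {\<omega>\<in>space M. limit_hit final T x \<omega>} * indicator ?c \<zeta>"
      proof (cases "\<forall>j\<in>K. \<mu> j * y < sqrt t0 * \<zeta> j")
        case False
        then have "{\<omega>\<in>space M. limit_hit final T x \<omega> \<and> (\<forall>j\<in>K. \<mu> j * y < sqrt t0 * \<zeta> j)} = {}" "\<zeta> \<notin> ?c" by auto
        moreover have "indicator ?c \<zeta> = (0 :: ennreal)" using \<open>\<zeta> \<notin> ?c\<close> by (rule indicator_simps(2))
        ultimately show ?thesis by (simp only: emeasure_empty mult_zero_right)
      qed (use elim in auto)
      finally show ?case .
    qed
    show "\<forall>\<^sub>F u in at_top. AE \<zeta> in tail_normal. emeasure M {\<omega>\<in>space M. local_hit final T (time y u) u x \<zeta> \<omega>} \<le> 1"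
      by (intro always_eventually allI AE_I2 emeasure_le_1)
  qed (auto simp: PN.emeasure_space_1 intro: local_hit_measurable[OF T])
  also have "(\<integral>\<^sup>+\<zeta>. emeasure M {\<omega>\<in>space M. limit_hit final T x \<omega>} * indicator ?c \<zeta> \<partial>tail_normal)
    = emeasure M {\<omega>\<in>space M. limit_hit final T x \<omega>} * ennreal (\<Prod>j\<in>K. Psi (\<mu> j / sqrt t0 * y))"
    by (subst nn_integral_cmult_indicator) (auto simp: tail_normal_critical)
  finally show ?thesis .
qed

end

section \<open>Convergence and domination of the window density\<close>

lemma nn_integral_Cauchy_kernel_finite: "(\<integral>\<^sup>+y. ennreal (C / (1 + y\<^sup>2)) \<partial>lborel) < \<infinity>"
proof -
  have "set_integrable lborel (einterval (-\<infinity>) \<infinity>) (\<lambda>x::real. inverse (1 + x\<^sup>2))"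
    by (rule integrable_inverse_1_plus_square)
  then have "integrable lborel (\<lambda>x::real. inverse (1 + x\<^sup>2))"
    by (simp add: set_integrable_def einterval_def)
  then have "integrable lborel (\<lambda>x::real. C * inverse (1 + x\<^sup>2))" by (rule integrable_mult_right) 
  then have "(\<integral>\<^sup>+y. ennreal (norm (C * inverse (1 + y\<^sup>2))) \<partial>lborel) < \<infinity>"
    unfolding integrable_iff_bounded by blast
  moreover have "(\<integral>\<^sup>+y. ennreal (C / (1 + y\<^sup>2)) \<partial>lborel) \<le> (\<integral>\<^sup>+y. ennreal (norm (C * inverse (1 + y\<^sup>2))) \<partial>lborel)"
    by (intro nn_integral_mono ennreal_leI) (simp add: divide_inverse)
  ultimately show ?thesis by (rule le_less_trans[rotated])
qed

context ruin_setup
begin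

text \<open>The inverse of the decay of a window probability: one factor sqrt u per active
  coordinate from the Gaussian density, and an exponent equal to u / (2 t0) times the sum of the
  (\<alpha>_j + \<mu>_j t0)^2.\<close>

definition norm_factor :: "real \<Rightarrow> real" where
  "norm_factor u = sqrt u ^ m * exp (u * (\<Sum>j=1..m. lam j * \<alpha> j))"

definition kern :: "real \<Rightarrow> real \<Rightarrow> (nat \<Rightarrow> real) \<Rightarrow> real" where
  "kern u y x = norm_factor u * (\<Prod>j=1..m. normal_density (\<alpha> j * u + \<mu> j * time y u) (sqrt (time y u)) (x j))"

definition curvature :: real where "curvature = (\<Sum>j=1..m. (\<alpha> j)\<^sup>2) / (2 * t0 ^ 3)"

lemma kern_eq:
  assumes u: "0 < u" and s: "0 < time y u"
  shows "kern u y x = (sqrt (u / time y u) / sqrt (2 * pi)) ^ m *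
    exp (\<Sum>j=1..m. lam j * x j - (x j + \<alpha> j * (y * sqrt u / t0))\<^sup>2 / (2 * time y u))"
proof -
  have tt: "time y u = t0 * (u + y * sqrt u / t0)" using t0 by (simp add: time_def field_simps)
  have "exp (u * (\<Sum>j=1..m. lam j * \<alpha> j)) * (\<Prod>j=1..m. normal_density (\<alpha> j * u + \<mu> j * time y u) (sqrt (time y u)) (x j))
    = (1 / sqrt (2 * pi * time y u)) ^ m * exp (\<Sum>j=1..m. lam j * x j - (x j + \<alpha> j * (y * sqrt u / t0))\<^sup>2 / (2 * time y u))"
    by (rule tilted_density_identity[OF t0 s tt _ balance]) (simp add: lam_def)
  then have "kern u y x = sqrt u ^ m * ((1 / sqrt (2 * pi * time y u)) ^ m * exp (\<Sum>j=1..m. lam j * x j - (x j + \<alpha> j * (y * sqrt u / t0))\<^sup>2 / (2 * time y u)))"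
    unfolding kern_def norm_factor_def by (simp only: mult.assoc)
  also have "\<dots> = (sqrt u * (1 / sqrt (2 * pi * time y u))) ^ m * exp (\<Sum>j=1..m. lam j * x j - (x j + \<alpha> j * (y * sqrt u / t0))\<^sup>2 / (2 * time y u))"
    by (simp only: power_mult_distrib mult.assoc)
  also have "sqrt u * (1 / sqrt (2 * pi * time y u)) = sqrt (u / time y u) / sqrt (2 * pi)"
    by (simp add: real_sqrt_mult real_sqrt_divide)
  finally show ?thesis .
qed

lemma kern_limit:
  "((\<lambda>u. kern u y x) \<longlongrightarrow> (1 / sqrt (2 * pi * t0)) ^ m * exp (- curvature * y\<^sup>2) * exp (\<Sum>j=1..m. lam j * x j)) at_top"
proof -
  have inv: "((\<lambda>u. u / time y u) \<longlongrightarrow> 1 / t0) at_top"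
    using tendsto_inverse[OF time_ratio[of y]] t0 by (simp add: inverse_eq_divide)
  have a: "((\<lambda>u. (x j + \<alpha> j * (y * sqrt u / t0))\<^sup>2 / (2 * time y u)) \<longlongrightarrow> (\<alpha> j)\<^sup>2 * y\<^sup>2 / (2 * t0 ^ 3)) at_top" for j
  proof -
    have "((\<lambda>u. (x j / sqrt u + \<alpha> j * (y / t0))\<^sup>2 * (1 / 2) * (u / time y u)) \<longlongrightarrow> (0 + \<alpha> j * (y / t0))\<^sup>2 * (1 / 2) * (1 / t0)) at_top"
      by (intro tendsto_intros inv real_tendsto_divide_at_top[OF tendsto_const] sqrt_at_top)
    also have "(0 + \<alpha> j * (y / t0))\<^sup>2 * (1 / 2) * (1 / t0) = (\<alpha> j)\<^sup>2 * y\<^sup>2 / (2 * t0 ^ 3)"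
      by (simp add: power_mult_distrib power_divide power3_eq_cube power2_eq_square mult_ac)
    finally show ?thesis
    proof (rule Lim_transform_eventually)
      show "\<forall>\<^sub>F u in at_top. (x j / sqrt u + \<alpha> j * (y / t0))\<^sup>2 * (1 / 2) * (u / time y u) = (x j + \<alpha> j * (y * sqrt u / t0))\<^sup>2 / (2 * time y u)"
        using eventually_gt_at_top[of 0]
      proof eventually_elim
        case (elim u)
        have "(x j + \<alpha> j * (y * sqrt u / t0)) = (x j / sqrt u + \<alpha> j * (y / t0)) * sqrt u"
          using elim by (simp add: distrib_right)
        then have "(x j + \<alpha> j * (y * sqrt u / t0))\<^sup>2 = (x j / sqrt u + \<alpha> j * (y / t0))\<^sup>2 * u"
          using elim by (simp only: power_mult_distrib) simp
        then show ?case by simp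
      qed
    qed
  qed
  have "((\<lambda>u. (sqrt (u / time y u) / sqrt (2 * pi)) ^ m *
    exp (\<Sum>j=1..m. lam j * x j - (x j + \<alpha> j * (y * sqrt u / t0))\<^sup>2 / (2 * time y u)))
    \<longlongrightarrow> (sqrt (1 / t0) / sqrt (2 * pi)) ^ m * exp (\<Sum>j=1..m. lam j * x j - (\<alpha> j)\<^sup>2 * y\<^sup>2 / (2 * t0 ^ 3))) at_top"
    by (intro tendsto_intros inv a) auto
  also have "sqrt (1 / t0) / sqrt (2 * pi) = 1 / sqrt (2 * pi * t0)" by (simp add: real_sqrt_mult real_sqrt_divide)
  also have "(\<Sum>j=1..m. lam j * x j - (\<alpha> j)\<^sup>2 * y\<^sup>2 / (2 * t0 ^ 3)) = - curvature * y\<^sup>2 + (\<Sum>j=1..m. lam j * x j)"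
    by (simp add: sum_subtractf curvature_def sum_distrib_right[symmetric] sum_divide_distrib[symmetric])
  finally have "((\<lambda>u. (sqrt (u / time y u) / sqrt (2 * pi)) ^ m *
    exp (\<Sum>j=1..m. lam j * x j - (x j + \<alpha> j * (y * sqrt u / t0))\<^sup>2 / (2 * time y u)))
    \<longlongrightarrow> (1 / sqrt (2 * pi * t0)) ^ m * exp (- curvature * y\<^sup>2) * exp (\<Sum>j=1..m. lam j * x j)) at_top"
    by (simp only: exp_add mult.assoc)
  then show ?thesis
  proof (rule Lim_transform_eventually)
    show "\<forall>\<^sub>F u in at_top. (sqrt (u / time y u) / sqrt (2 * pi)) ^ m *
      exp (\<Sum>j=1..m. lam j * x j - (x j + \<alpha> j * (y * sqrt u / t0))\<^sup>2 / (2 * time y u)) = kern u y x"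
      using eventually_gt_at_top[of 0] filterlim_at_top_dense[THEN iffD1, OF time_at_top, rule_format, of 0 y]
      by eventually_elim (rule kern_eq[symmetric])
  qed
qed

text \<open>Only the Gaussian factor of coordinate 1 is kept; the others are bounded by 1. One
  factor suffices, since \<open>kernel_domination\<close> lets it absorb the full power of u/s and
  the decay in y.\<close>

lemma kern_bound:
  assumes T: "0 < T" and \<epsilon>: "0 < \<epsilon>"
  obtains C where "0 < C" "\<And>u y x. 1 \<le> u \<Longrightarrow> T \<le> time y u \<Longrightarrow>
    kern u y x \<le> C / (1 + y\<^sup>2) * exp ((\<Sum>j=1..m. lam j * x j) + \<epsilon> * \<bar>x 1\<bar>)"
proof -
  have a1: "0 < \<alpha> 1" using \<alpha>_pos m by auto
  obtain C where C: "0 < C" "\<And>u y x. 1 \<le> u \<Longrightarrow> T \<le> t0 * u + y * sqrt u \<Longrightarrow>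
    sqrt (u / (t0 * u + y * sqrt u)) ^ m * (1 + y\<^sup>2) * exp (- (x + \<alpha> 1 * (y * sqrt u / t0))\<^sup>2 / (2 * (t0 * u + y * sqrt u)))
      \<le> C * exp (\<epsilon> * \<bar>x\<bar>)"
    using kernel_domination[OF T a1 t0 \<epsilon>, of m] by blast
  have "kern u y x \<le> C / (1 + y\<^sup>2) * exp ((\<Sum>j=1..m. lam j * x j) + \<epsilon> * \<bar>x 1\<bar>)" if u: "1 \<le> u" and s: "T \<le> time y u" for u y x
  proof -
    define s where "s = time y u"
    have s0: "0 < s" using s T by (simp add: s_def)
    let ?r = "\<lambda>j. (x j + \<alpha> j * (y * sqrt u / t0))\<^sup>2 / (2 * s)"
    have y1: "0 < 1 + y\<^sup>2" by (simp add: add_pos_nonneg)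
    have "kern u y x = (sqrt (u / s) / sqrt (2 * pi)) ^ m * exp (\<Sum>j=1..m. lam j * x j - ?r j)"
      unfolding s_def by (rule kern_eq) (use u s T in auto)
    also have "\<dots> \<le> sqrt (u / s) ^ m * (exp (\<Sum>j=1..m. lam j * x j) * exp (- ?r 1))"
    proof (rule mult_mono)
      have "sqrt (u / s) / sqrt (2 * pi) \<le> sqrt (u / s) / 1"
        using u s0 pi_ge_two by (intro divide_left_mono) auto
      then show "(sqrt (u / s) / sqrt (2 * pi)) ^ m \<le> sqrt (u / s) ^ m"
        using u s0 by (intro power_mono) auto
      have "?r 1 \<le> (\<Sum>j=1..m. ?r j)" using m s0 by (intro member_le_sum) auto
      then show "exp (\<Sum>j=1..m. lam j * x j - ?r j) \<le> exp (\<Sum>j=1..m. lam j * x j) * exp (- ?r 1)"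
        by (simp add: exp_add[symmetric] sum_subtractf)
    qed (use u s0 in auto)
    also have "\<dots> = (sqrt (u / s) ^ m * (1 + y\<^sup>2) * exp (- (x 1 + \<alpha> 1 * (y * sqrt u / t0))\<^sup>2 / (2 * s))) * (exp (\<Sum>j=1..m. lam j * x j) / (1 + y\<^sup>2))"
      using y1 by simp
    also have "\<dots> \<le> (C * exp (\<epsilon> * \<bar>x 1\<bar>)) * (exp (\<Sum>j=1..m. lam j * x j) / (1 + y\<^sup>2))"
      using C(2)[OF u, of y "x 1"] s y1 by (intro mult_right_mono) (auto simp: s_def time_def)
    also have "\<dots> = C / (1 + y\<^sup>2) * exp ((\<Sum>j=1..m. lam j * x j) + \<epsilon> * \<bar>x 1\<bar>)"
      by (simp add: exp_add)
    finally show ?thesis .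
  qed
  then show ?thesis using that C(1) by blast
qed

text \<open>Pays for the extra factor of \<open>kern_bound\<close>. In coordinate 1 the exponent
  becomes (lam 1 / 2) x_1 + lam 1 max(0, x_1): integrable on the left, and on the right dominated by
  \<open>hit_tail\<close>, whose rate is at choice.\<close>

lemma weighted_Hit_finite:
  assumes T: "0 < T"
  shows "(\<integral>\<^sup>+x. ennreal (exp ((\<Sum>j=1..m. lam j * x j) + lam 1 / 2 * \<bar>x 1\<bar>)) * emeasure M {\<omega>\<in>space M. C.Hit {0<..<T} x \<omega>} \<partial>C.LB) < \<infinity>"
proof -
  have one: "1 \<in> {1..m}" using m by simp
  have lam1: "0 < lam 1" by (rule C.l_pos[OF one])
  define g where "g j = (if j = 1 then lam 1 / 2 else lam j)" for j
  define b' where "b' = (\<Sum>j=1..m. lam j) + 1"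
  \<comment> \<open>\<open>b'\<close> beats the tilt in each coordinate, and the additional
    \<open>lam 1\<close> cancels the growth added for positive x_1.\<close>
  define b where "b = b' + lam 1"
  have lamb: "lam j < b'" if "j \<in> {1..m}" for j
    using member_le_sum[of j "{1..m}" lam] C.l_pos that by (force simp: b'_def less_imp_le)
  have gb: "0 < g j \<and> g j < b'" if "j \<in> {1..m}" for j
    using lamb[OF that] lamb[OF one] C.l_pos[OF that] lam1 by (auto simp: g_def)
  have b0: "0 \<le> b" using lamb[OF one] lam1 by (simp add: b_def)
  obtain C where C: "0 < C" "\<And>x. prob {\<omega>\<in>space M. \<exists>t\<in>{0<..<T}. hit B m \<mu> x t \<omega>} \<le> C * exp (- b * (\<Sum>j=1..m. max 0 (x j)))"
    using hit_tail[OF m T b0, of \<mu>] by blast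
  have "(\<integral>\<^sup>+x. ennreal (exp ((\<Sum>j=1..m. lam j * x j) + lam 1 / 2 * \<bar>x 1\<bar>)) * emeasure M {\<omega>\<in>space M. C.Hit {0<..<T} x \<omega>} \<partial>C.LB)
    \<le> (\<integral>\<^sup>+x. ennreal C * ennreal (exp (\<Sum>j\<in>{1..m}. g j * x j - b' * max 0 (x j))) \<partial>C.LB)"
  proof (rule nn_integral_mono)
    fix x :: "nat \<Rightarrow> real"
    have e: "(\<Sum>j=1..m. lam j * x j) + lam 1 / 2 * \<bar>x 1\<bar> + - b * (\<Sum>j=1..m. max 0 (x j)) \<le> (\<Sum>j\<in>{1..m}. g j * x j - b' * max 0 (x j))"
    proof -
      have "(\<Sum>j=1..m. lam j * x j) = (\<Sum>j=1..m. g j * x j + (if j = 1 then lam 1 / 2 * x 1 else 0))"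
        by (rule sum.cong) (auto simp: g_def)
      also have "\<dots> = (\<Sum>j=1..m. g j * x j) + lam 1 / 2 * x 1" using m by (simp add: sum.distrib)
      finally have 1: "(\<Sum>j=1..m. lam j * x j) = (\<Sum>j=1..m. g j * x j) + lam 1 / 2 * x 1" .
      have "max 0 (x 1) \<le> (\<Sum>j=1..m. max 0 (x j))" by (rule member_le_sum[OF one]) auto
      then have 2: "lam 1 * max 0 (x 1) \<le> lam 1 * (\<Sum>j=1..m. max 0 (x j))" using lam1 by (intro mult_left_mono) auto
      have 3: "lam 1 / 2 * x 1 + lam 1 / 2 * \<bar>x 1\<bar> = lam 1 * max 0 (x 1)" by (auto simp: max_def)
      show ?thesis
        using 2 3 unfolding 1 by (simp add: sum_subtractf sum_distrib_left[symmetric] b_def algebra_simps)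
    qed
    have "ennreal (exp ((\<Sum>j=1..m. lam j * x j) + lam 1 / 2 * \<bar>x 1\<bar>)) * emeasure M {\<omega>\<in>space M. C.Hit {0<..<T} x \<omega>}
      \<le> ennreal (exp ((\<Sum>j=1..m. lam j * x j) + lam 1 / 2 * \<bar>x 1\<bar>)) * ennreal (C * exp (- b * (\<Sum>j=1..m. max 0 (x j))))"
      by (intro mult_left_mono) (use C(2)[of x] in \<open>auto simp: emeasure_eq_measure C.Hit_def intro!: ennreal_leI\<close>)
    also have "\<dots> = ennreal (C * exp ((\<Sum>j=1..m. lam j * x j) + lam 1 / 2 * \<bar>x 1\<bar> + - b * (\<Sum>j=1..m. max 0 (x j))))"
      using C(1) unfolding exp_add by (simp add: ennreal_mult[symmetric] mult_ac)
    also have "\<dots> \<le> ennreal (C * exp (\<Sum>j\<in>{1..m}. g j * x j - b' * max 0 (x j)))"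
      using C(1) e by (intro ennreal_leI mult_left_mono) auto
    also have "\<dots> = ennreal C * ennreal (exp (\<Sum>j\<in>{1..m}. g j * x j - b' * max 0 (x j)))"
      using C(1) by (simp add: ennreal_mult)
    finally show "ennreal (exp ((\<Sum>j=1..m. lam j * x j) + lam 1 / 2 * \<bar>x 1\<bar>)) * emeasure M {\<omega>\<in>space M. C.Hit {0<..<T} x \<omega>} \<le> \<dots>" .
  qed
  also have "\<dots> = ennreal C * (\<integral>\<^sup>+x. ennreal (exp (\<Sum>j\<in>{1..m}. g j * x j - b' * max 0 (x j))) \<partial>C.LB)"
    by (rule nn_integral_cmult) measurable
  also have "\<dots> < \<infinity>"
    using nn_integral_prod_exp_finite[of "{1..m}" g b'] gb by (auto simp: ennreal_mult_less_top)
  finally show ?thesis .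
qed

text \<open>Windows starting before T are cut off, since the Gaussian law at s degenerates as s
  tends to 0 and the uniform bound needs s at least T. The hits lost in this way are treated in
  \<open>early_hit_negligible\<close>.\<close>

definition window_density :: "bool \<Rightarrow> real \<Rightarrow> real \<Rightarrow> real \<Rightarrow> ennreal" where
  "window_density final T u y = (if 0 < u \<and> T \<le> time y u
     then ennreal (norm_factor u) * emeasure M {\<omega>\<in>space M. window_hit final T u (time y u) \<omega>} else 0)"

definition limit_density :: "real \<Rightarrow> real" where
  "limit_density y = (1 / sqrt (2 * pi * t0)) ^ m * exp (- curvature * y\<^sup>2) * (\<Prod>j\<in>K. Psi (\<mu> j / sqrt t0 * y))"

lemma limit_density_nonneg: "0 \<le> limit_density y"
  unfolding limit_density_def using t0 by (intro mult_nonneg_nonneg prod_nonneg) (auto simp: Psi_bounds)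

lemma limit_density_measurable [measurable]: "limit_density \<in> borel_measurable borel"
  unfolding limit_density_def[abs_def] by measurable

lemma window_density_eq:
  assumes "0 < u" "T \<le> time y u" "0 < T"
  shows "window_density final T u y = (\<integral>\<^sup>+x. ennreal (kern u y x) * local_prob final T (time y u) u x \<partial>C.LB)"
proof -
  have s: "0 < time y u" using assms by simp
  note [measurable] = window_hit_formula(2)[OF s assms(3)]
  have nf: "0 \<le> norm_factor u" using assms by (simp add: norm_factor_def)
  have "window_density final T u y = ennreal (norm_factor u) *
     (\<integral>\<^sup>+x. ennreal (\<Prod>j=1..m. normal_density (\<alpha> j * u + \<mu> j * time y u) (sqrt (time y u)) (x j)) * local_prob final T (time y u) u x \<partial>C.LB)"
    using assms by (simp add: window_density_def window_hit_formula(1)[OF s assms(3)])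
  also have "\<dots> = (\<integral>\<^sup>+x. ennreal (norm_factor u) *
     (ennreal (\<Prod>j=1..m. normal_density (\<alpha> j * u + \<mu> j * time y u) (sqrt (time y u)) (x j)) * local_prob final T (time y u) u x) \<partial>C.LB)"
    by (rule nn_integral_cmult[symmetric]) measurable
  also have "\<dots> = (\<integral>\<^sup>+x. ennreal (kern u y x) * local_prob final T (time y u) u x \<partial>C.LB)"
    unfolding kern_def using nf
    by (intro nn_integral_cong) (subst ennreal_mult, auto intro!: prod_nonneg simp: mult.assoc)
  finally show ?thesis .
qed

lemma limit_hit_meas: "0 < T \<Longrightarrow> C.meas (limit_hit final T)"
proof -
  assume T: "0 < T"
  have "C.meas (\<lambda>x \<omega>. C.Hit {0<..<T} x \<omega> \<and> (final \<longrightarrow> \<not> C.Hit {T<..} x \<omega>))"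
  proof (cases final)
    case True
    then show ?thesis using T by (auto intro!: C.meas_conj C.meas_not C.meas_Hit_intervals)
  next
    case False
    then show ?thesis using T by (auto intro!: C.meas_Hit_intervals)
  qed
  then show "C.meas (limit_hit final T)" by (simp add: limit_hit_def[abs_def])
qed

lemma window_density_bound:
  assumes T: "0 < T"
  obtains D where "\<And>u y. 1 \<le> u \<Longrightarrow> window_density final T u y \<le> ennreal (D / (1 + y\<^sup>2))"
proof -
  have lam1: "0 < lam 1 / 2" using C.l_pos[of 1] m by simp
  obtain C where C: "0 < C" "\<And>u y x. 1 \<le> u \<Longrightarrow> T \<le> time y u \<Longrightarrow>
    kern u y x \<le> C / (1 + y\<^sup>2) * exp ((\<Sum>j=1..m. lam j * x j) + lam 1 / 2 * \<bar>x 1\<bar>)"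
    using kern_bound[OF T lam1] by blast
  let ?f = "\<lambda>x. ennreal (exp ((\<Sum>j=1..m. lam j * x j) + lam 1 / 2 * \<bar>x 1\<bar>)) * emeasure M {\<omega>\<in>space M. C.Hit {0<..<T} x \<omega>}"
  have "C.meas (C.Hit {0<..<T})" by (rule C.meas_Hit_intervals) simp
  note [measurable] = C.meas_emeasure[OF this]
  have one[measurable]: "1 \<in> {1..m}" using m by simp
  define I where "I = enn2real (\<integral>\<^sup>+x. ?f x \<partial>C.LB)"
  have I: "(\<integral>\<^sup>+x. ?f x \<partial>C.LB) = ennreal I" unfolding I_def using weighted_Hit_finite[OF T] by simp
  have "window_density final T u y \<le> ennreal (C * I / (1 + y\<^sup>2))" if u: "1 \<le> u" for u y
  proof (cases "T \<le> time y u")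
    case False
    then show ?thesis by (simp add: window_density_def)
  next
    case True
    have y1: "0 < 1 + y\<^sup>2" by (simp add: add_pos_nonneg)
    have "window_density final T u y \<le> (\<integral>\<^sup>+x. ennreal (C / (1 + y\<^sup>2)) * ?f x \<partial>C.LB)"
    proof -
      have "ennreal (kern u y x) * local_prob final T (time y u) u x \<le> ennreal (C / (1 + y\<^sup>2)) * ?f x" for x
      proof -
        have "ennreal (kern u y x) * local_prob final T (time y u) u x \<le>
          ennreal (C / (1 + y\<^sup>2) * exp ((\<Sum>j=1..m. lam j * x j) + lam 1 / 2 * \<bar>x 1\<bar>)) * emeasure M {\<omega>\<in>space M. C.Hit {0<..<T} x \<omega>}"
          by (intro mult_mono ennreal_leI C(2) u True local_prob_le T) auto
        also have "\<dots> = ennreal (C / (1 + y\<^sup>2)) * ?f x"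
          using C(1) y1 by (subst ennreal_mult) (auto simp: mult.assoc)
        finally show ?thesis .
      qed
      then show ?thesis using u True T by (subst window_density_eq) (auto intro!: nn_integral_mono)
    qed
    also have "\<dots> = ennreal (C / (1 + y\<^sup>2)) * ennreal I"
      unfolding I[symmetric] by (rule nn_integral_cmult) measurable
    also have "\<dots> = ennreal (C * I / (1 + y\<^sup>2))"
      using C(1) y1 by (subst ennreal_mult[symmetric]) (auto simp: I_def)
    finally show ?thesis .
  qed
  then show ?thesis by (rule that)
qed

text \<open>Kernel and local probability converge separately at each x, under the majorant of
  \<open>weighted_Hit_finite\<close>. The tilt left over by the kernel turns the integral in x into
  \<open>V\<close>; everything depending on y collects in \<open>limit_density\<close>.\<close>

lemma window_density_limit:
  assumes T: "0 < T"
  shows "((\<lambda>u. window_density final T u y) \<longlongrightarrow> C.V (limit_hit final T) * ennreal (limit_density y)) at_top"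
proof -
  have lam1: "0 < lam 1 / 2" using C.l_pos[of 1] m by simp
  obtain C where C: "0 < C" "\<And>u y x. 1 \<le> u \<Longrightarrow> T \<le> time y u \<Longrightarrow>
    kern u y x \<le> C / (1 + y\<^sup>2) * exp ((\<Sum>j=1..m. lam j * x j) + lam 1 / 2 * \<bar>x 1\<bar>)"
    using kern_bound[OF T lam1] by blast
  let ?f = "\<lambda>x. ennreal (exp ((\<Sum>j=1..m. lam j * x j) + lam 1 / 2 * \<bar>x 1\<bar>)) * emeasure M {\<omega>\<in>space M. C.Hit {0<..<T} x \<omega>}"
  have "C.meas (C.Hit {0<..<T})" by (rule C.meas_Hit_intervals) simp
  note [measurable] = C.meas_emeasure[OF this] C.meas_emeasure[OF limit_hit_meas[OF T]]
  have one[measurable]: "1 \<in> {1..m}" using m by simp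
  have y1: "0 < 1 + y\<^sup>2" by (simp add: add_pos_nonneg)
  have kmeas[measurable]: "kern u y \<in> borel_measurable C.LB" for u
    unfolding kern_def[abs_def] by measurable
  let ?p = "\<Prod>j\<in>K. Psi (\<mu> j / sqrt t0 * y)"
  let ?k = "(1 / sqrt (2 * pi * t0)) ^ m * exp (- curvature * y\<^sup>2)"
  let ?e = "\<lambda>x. \<Sum>j=1..m. lam j * x j"
  have p0: "0 \<le> ?p" by (intro prod_nonneg) (auto simp: Psi_bounds)
  have k0: "0 \<le> ?k" using t0 by auto
  have ev: "\<forall>\<^sub>F u in at_top. 1 \<le> u \<and> T \<le> time y u"
    using eventually_ge_at_top[of 1] filterlim_at_top[THEN iffD1, OF time_at_top, rule_format, of T y]
    by eventually_elim auto
  \<comment> \<open>The case distinction makes integrands measurable and dominated for every u; it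
    disappears for large u.\<close>
  have "((\<lambda>u. \<integral>\<^sup>+x. (if 1 \<le> u \<and> T \<le> time y u then ennreal (kern u y x) * local_prob final T (time y u) u x else 0) \<partial>C.LB)
     \<longlongrightarrow> (\<integral>\<^sup>+x. ennreal (?k * exp (?e x)) * (emeasure M {\<omega>\<in>space M. limit_hit final T x \<omega>} * ennreal ?p) \<partial>C.LB)) at_top"
  proof (rule nn_integral_dominated_convergence_at_top[where w = "\<lambda>x. ennreal (C / (1 + y\<^sup>2)) * ?f x"])
    show "(\<lambda>x. if 1 \<le> u \<and> T \<le> time y u then ennreal (kern u y x) * local_prob final T (time y u) u x else 0) \<in> borel_measurable C.LB" for u
    proof (cases "1 \<le> u \<and> T \<le> time y u")
      case True
      then have "0 < time y u" using T by simp
      note [measurable] = window_hit_formula(2)[OF this T]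
      show ?thesis using True by simp
    qed auto
    show "\<forall>\<^sub>F u in at_top. AE x in C.LB. (if 1 \<le> u \<and> T \<le> time y u then ennreal (kern u y x) * local_prob final T (time y u) u x else 0)
       \<le> ennreal (C / (1 + y\<^sup>2)) * ?f x"
    proof (intro always_eventually allI AE_I2)
      fix u x
      show "(if 1 \<le> u \<and> T \<le> time y u then ennreal (kern u y x) * local_prob final T (time y u) u x else 0)
       \<le> ennreal (C / (1 + y\<^sup>2)) * ?f x"
      proof (cases "1 \<le> u \<and> T \<le> time y u")
        case True
        have "ennreal (kern u y x) * local_prob final T (time y u) u x \<le>
          ennreal (C / (1 + y\<^sup>2) * exp (?e x + lam 1 / 2 * \<bar>x 1\<bar>)) * emeasure M {\<omega>\<in>space M. C.Hit {0<..<T} x \<omega>}"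
          using True by (intro mult_mono ennreal_leI C(2) local_prob_le T) auto
        also have "\<dots> = ennreal (C / (1 + y\<^sup>2)) * ?f x"
          using C(1) y1 by (subst ennreal_mult) (auto simp: mult.assoc)
        finally show ?thesis using True by simp
      qed auto
    qed
    show "AE x in C.LB. ((\<lambda>u. if 1 \<le> u \<and> T \<le> time y u then ennreal (kern u y x) * local_prob final T (time y u) u x else 0)
      \<longlongrightarrow> ennreal (?k * exp (?e x)) * (emeasure M {\<omega>\<in>space M. limit_hit final T x \<omega>} * ennreal ?p)) at_top"
    proof (rule AE_I2)
      fix x
      have "((\<lambda>u. ennreal (kern u y x) * local_prob final T (time y u) u x)
        \<longlongrightarrow> ennreal (?k * exp (?e x)) * (emeasure M {\<omega>\<in>space M. limit_hit final T x \<omega>} * ennreal ?p)) at_top"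
        by (intro tendsto_mult_ennreal tendsto_ennrealI kern_limit local_prob_limit T)
           (auto simp: emeasure_eq_measure ennreal_mult_eq_top_iff)
      then show "((\<lambda>u. if 1 \<le> u \<and> T \<le> time y u then ennreal (kern u y x) * local_prob final T (time y u) u x else 0)
        \<longlongrightarrow> ennreal (?k * exp (?e x)) * (emeasure M {\<omega>\<in>space M. limit_hit final T x \<omega>} * ennreal ?p)) at_top"
        by (rule Lim_transform_eventually) (use ev in \<open>eventually_elim, simp\<close>)
    qed
    show "(\<integral>\<^sup>+x. ennreal (C / (1 + y\<^sup>2)) * ?f x \<partial>C.LB) < \<infinity>"
      using weighted_Hit_finite[OF T] by (subst nn_integral_cmult) (auto simp: ennreal_mult_less_top)
  qed measurable
  also have "(\<integral>\<^sup>+x. ennreal (?k * exp (?e x)) * (emeasure M {\<omega>\<in>space M. limit_hit final T x \<omega>} * ennreal ?p) \<partial>C.LB)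
    = (\<integral>\<^sup>+x. (ennreal ?k * ennreal ?p) * (ennreal (exp (?e x)) * emeasure M {\<omega>\<in>space M. limit_hit final T x \<omega>}) \<partial>C.LB)"
  proof (rule nn_integral_cong)
    fix x
    have "ennreal (?k * exp (?e x)) = ennreal ?k * ennreal (exp (?e x))" by (rule ennreal_mult[OF k0]) simp
    then show "ennreal (?k * exp (?e x)) * (emeasure M {\<omega>\<in>space M. limit_hit final T x \<omega>} * ennreal ?p)
      = (ennreal ?k * ennreal ?p) * (ennreal (exp (?e x)) * emeasure M {\<omega>\<in>space M. limit_hit final T x \<omega>})"
      by (simp only: mult_ac)
  qed
  also have "\<dots> = (ennreal ?k * ennreal ?p) * C.V (limit_hit final T)"
    unfolding C.V_def by (rule nn_integral_cmult) measurable
  also have "\<dots> = C.V (limit_hit final T) * ennreal (limit_density y)"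
    unfolding limit_density_def using k0 p0 by (simp add: ennreal_mult ac_simps)
  finally show ?thesis
  proof (rule Lim_transform_eventually)
    show "\<forall>\<^sub>F u in at_top. (\<integral>\<^sup>+x. (if 1 \<le> u \<and> T \<le> time y u then ennreal (kern u y x) * local_prob final T (time y u) u x else 0) \<partial>C.LB)
      = window_density final T u y"
      using ev
    proof eventually_elim
      case (elim u)
      then show ?case using T by (simp add: window_density_eq)
    qed
  qed
qed

section \<open>From windows to ruin\<close>

text \<open>The truncation \<open>max 0 s\<close> only serves joint measurability on the whole line, as \<open>B\<close> is
  unspecified at negative times; all windows in use start after time \<open>T\<close>.\<close>

lemma window_hit_joint:
  assumes T: "0 < T"
  shows "{y\<in>space (lborel \<Otimes>\<^sub>M M). window_hit final T u (max 0 (fst y)) (snd y)} \<in> sets (lborel \<Otimes>\<^sub>M M)"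
proof -
  let ?N = "(lborel :: real measure) \<Otimes>\<^sub>M M"
  have 1: "{y\<in>space ?N. \<exists>t\<in>{max 0 (fst y)<..<max 0 (fst y) + T}. hit B d \<mu> (\<lambda>j. \<alpha> j * u) t (snd y)} \<in> sets ?N"
  proof (rule hit_measurable)
    show "{y\<in>space ?N. q \<in> {max 0 (fst y)<..<max 0 (fst y) + T}} \<in> sets ?N" for q
      unfolding greaterThanLessThan_iff by measurable
  qed auto
  have 2: "{y\<in>space ?N. \<exists>t\<in>{max 0 (fst y) + T<..}. hit B m \<mu> (\<lambda>j. \<alpha> j * u) t (snd y)} \<in> sets ?N"
  proof (rule hit_measurable)
    show "{y\<in>space ?N. q \<in> {max 0 (fst y) + T<..}} \<in> sets ?N" for q
      unfolding greaterThan_iff by measurable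
  qed (use T m in auto)
  show ?thesis unfolding window_hit_def
    by (intro sets.sets_Collect_conj sets.sets_Collect_imp sets.sets_Collect_neg sets.sets_Collect_const 1 2)
qed

lemma window_hit_emeasure_measurable:
  assumes T: "0 < T"
  shows "(\<lambda>s. emeasure M {\<omega>\<in>space M. window_hit final T u (max 0 s) \<omega>}) \<in> borel_measurable borel"
proof -
  have "(\<lambda>s. emeasure M (Pair s -` {y\<in>space (lborel \<Otimes>\<^sub>M M). window_hit final T u (max 0 (fst y)) (snd y)})) \<in> borel_measurable lborel"
    by (rule measurable_emeasure_Pair[OF window_hit_joint[OF T]])
  also have "?this \<longleftrightarrow> (\<lambda>s. emeasure M {\<omega>\<in>space M. window_hit final T u (max 0 s) \<omega>}) \<in> borel_measurable lborel"
    by (rule measurable_cong) (auto intro!: arg_cong[where f="emeasure M"] simp: space_pair_measure)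
  finally show ?thesis by simp
qed

lemma window_density_measurable:
  assumes T: "0 < T"
  shows "window_density final T u \<in> borel_measurable borel"
proof -
  note [measurable] = window_hit_emeasure_measurable[OF T]
  have t[measurable]: "(\<lambda>y. time y u) \<in> borel_measurable borel" unfolding time_def by measurable
  have "window_density final T u = (\<lambda>y. if 0 < u \<and> T \<le> time y u
     then ennreal (norm_factor u) * emeasure M {\<omega>\<in>space M. window_hit final T u (max 0 (time y u)) \<omega>} else 0)"
    using T by (auto simp: window_density_def fun_eq_iff)
  also have "\<dots> \<in> borel_measurable borel" by measurable
  finally show ?thesis .
qed

text \<open>The domain may move with \<open>u\<close>; dominated convergence only needs membership
  to stabilise at almost every y, which leaves out the boundary of the limiting domain.\<close>

lemma window_integral_limit:
  assumes T: "0 < T" and S: "\<And>u. S u \<in> sets borel" "S' \<in> sets borel"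
    and ev: "AE y in lborel. \<forall>\<^sub>F u in at_top. y \<in> S u \<longleftrightarrow> y \<in> S'"
  shows "((\<lambda>u. \<integral>\<^sup>+y. window_density final T u y * indicator (S u) y \<partial>lborel) \<longlongrightarrow>
     C.V (limit_hit final T) * (\<integral>\<^sup>+y. ennreal (limit_density y) * indicator S' y \<partial>lborel)) at_top"
proof -
  obtain D where D: "\<And>u y. 1 \<le> u \<Longrightarrow> window_density final T u y \<le> ennreal (D / (1 + y\<^sup>2))"
    using window_density_bound[OF T] by blast
  note [measurable] = window_density_measurable[OF T] S
  have "((\<lambda>u. \<integral>\<^sup>+y. window_density final T u y * indicator (S u) y \<partial>lborel) \<longlongrightarrow>
     (\<integral>\<^sup>+y. C.V (limit_hit final T) * ennreal (limit_density y) * indicator S' y \<partial>lborel)) at_top"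
  proof (rule nn_integral_dominated_convergence_at_top[where w = "\<lambda>y. ennreal (D / (1 + y\<^sup>2))"])
    show "\<forall>\<^sub>F u in at_top. AE y in lborel. window_density final T u y * indicator (S u) y \<le> ennreal (D / (1 + y\<^sup>2))"
      using eventually_ge_at_top[of 1]
    proof eventually_elim
      case (elim u)
      then show ?case using D[OF elim] by (intro AE_I2) (auto simp: indicator_def)
    qed
    show "AE y in lborel. ((\<lambda>u. window_density final T u y * indicator (S u) y) \<longlongrightarrow>
       C.V (limit_hit final T) * ennreal (limit_density y) * indicator S' y) at_top"
      using ev
    proof eventually_elim
      case (elim y)
      have "((\<lambda>u. window_density final T u y * indicator S' y) \<longlongrightarrow>
       C.V (limit_hit final T) * ennreal (limit_density y) * indicator S' y) at_top"
        using window_density_limit[OF T] by (cases "y \<in> S'") auto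
      then show ?case
        by (rule Lim_transform_eventually) (use elim in eventually_elim, simp add: indicator_def)
    qed
  qed (use nn_integral_Cauchy_kernel_finite in auto)
  also have "(\<integral>\<^sup>+y. C.V (limit_hit final T) * ennreal (limit_density y) * indicator S' y \<partial>lborel)
    = C.V (limit_hit final T) * (\<integral>\<^sup>+y. ennreal (limit_density y) * indicator S' y \<partial>lborel)"
    unfolding mult.assoc by (rule nn_integral_cmult) measurable
  finally show ?thesis .
qed

text \<open>The substitution s = t0 u + y sqrt u; its Jacobian turns \<open>norm_factor u\<close>
  into the normalisation \<open>norm_factor u / sqrt u\<close> of the ruin probability.\<close>

lemma window_integral_time:
  assumes T: "0 < T" and u: "0 < u" and S: "S \<in> sets borel"
  shows "(\<integral>\<^sup>+y. window_density final T u y * indicator {y. time y u \<in> S} y \<partial>lborel) =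
    ennreal (norm_factor u / sqrt u) *
      (\<integral>\<^sup>+s. emeasure M {\<omega>\<in>space M. window_hit final T u (max 0 s) \<omega>} * indicator ({T..} \<inter> S) s \<partial>lborel)"
proof -
  note [measurable] = window_hit_emeasure_measurable[OF T] S
  let ?F = "\<lambda>s. emeasure M {\<omega>\<in>space M. window_hit final T u (max 0 s) \<omega>} * indicator ({T..} \<inter> S) s"
  have t[measurable]: "(\<lambda>y. time y u) \<in> borel_measurable borel" unfolding time_def by measurable
  have nf: "0 \<le> norm_factor u" using u by (simp add: norm_factor_def)
  have "(\<integral>\<^sup>+s. ?F s \<partial>lborel) = ennreal (sqrt u) * (\<integral>\<^sup>+y. ?F (time y u) \<partial>lborel)"
    using nn_integral_real_affine[where c = "sqrt u" and t = "t0 * u" and f = ?F] u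
    by (simp add: time_def mult.commute)
  then have "ennreal (norm_factor u / sqrt u) * (\<integral>\<^sup>+s. ?F s \<partial>lborel)
    = (ennreal (norm_factor u / sqrt u) * ennreal (sqrt u)) * (\<integral>\<^sup>+y. ?F (time y u) \<partial>lborel)"
    by (simp only: mult.assoc)
  also have "ennreal (norm_factor u / sqrt u) * ennreal (sqrt u) = ennreal (norm_factor u)"
    using u nf by (simp add: ennreal_mult[symmetric])
  also have "ennreal (norm_factor u) * (\<integral>\<^sup>+y. ?F (time y u) \<partial>lborel) = (\<integral>\<^sup>+y. ennreal (norm_factor u) * ?F (time y u) \<partial>lborel)"
    by (rule nn_integral_cmult[symmetric]) measurable
  also have "\<dots> = (\<integral>\<^sup>+y. window_density final T u y * indicator {y. time y u \<in> S} y \<partial>lborel)"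
    using T u by (intro nn_integral_cong) (auto simp: window_density_def indicator_def)
  finally show ?thesis ..
qed

text \<open>The cutoff is an \<open>ereal\<close> so that infinity gives ruin itself and finite
  values give the ruin time. The open time set provides measurability; omitting time 0 is harmless,
  as no hit occurs there for u > 0.\<close>

definition hit_before :: "ereal \<Rightarrow> real \<Rightarrow> 'w set" where
  "hit_before c u = {\<omega>\<in>space M. \<exists>t\<in>{t. 0 < t \<and> ereal t < c}. hit B d \<mu> (\<lambda>j. \<alpha> j * u) t \<omega>}"

lemma open_before: "open {t::real. 0 < t \<and> ereal t < c}"
proof -
  have "open {t::real. ereal t < c}" by (cases c) (auto simp: open_lessThan[unfolded lessThan_def])
  then have "open ({0<..} \<inter> {t::real. ereal t < c})" by (intro open_Int) auto
  moreover have "{0<..} \<inter> {t::real. ereal t < c} = {t. 0 < t \<and> ereal t < c}" by auto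
  ultimately show ?thesis by simp
qed

lemma sets_hit_before [measurable]: "hit_before c u \<in> sets M"
  unfolding hit_before_def by (rule sets_hit[OF order_refl open_before]) auto

lemma Fubini_window:
  assumes T: "0 < T" and S: "S \<in> sets borel"
  shows "(\<integral>\<^sup>+s. emeasure M {\<omega>\<in>space M. window_hit final T u (max 0 s) \<omega>} * indicator S s \<partial>lborel)
    = (\<integral>\<^sup>+\<omega>. (\<integral>\<^sup>+s. indicator {s. s \<in> S \<and> window_hit final T u (max 0 s) \<omega>} s \<partial>lborel) \<partial>M)"
proof -
  interpret P: pair_sigma_finite "lborel :: real measure" M ..
  let ?Q = "{y\<in>space (lborel \<Otimes>\<^sub>M M). window_hit final T u (max 0 (fst y)) (snd y)}"
  note [measurable] = window_hit_joint[OF T, of final u] S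
  have eq: "(\<integral>\<^sup>+\<omega>. indicator ?Q (s, \<omega>) * indicator S s \<partial>M) = emeasure M {\<omega>\<in>space M. window_hit final T u (max 0 s) \<omega>} * indicator S s" for s :: real
  proof -
    have Qs: "Pair s -` ?Q = {\<omega>\<in>space M. window_hit final T u (max 0 s) \<omega>}" by (auto simp: space_pair_measure)
    have "Pair s -` ?Q \<in> sets M" by (rule sets_Pair1) measurable
    then have [measurable]: "{\<omega>\<in>space M. window_hit final T u (max 0 s) \<omega>} \<in> sets M" unfolding Qs .
    have "(\<integral>\<^sup>+\<omega>. indicator ?Q (s, \<omega>) * indicator S s \<partial>M) = (\<integral>\<^sup>+\<omega>. indicator S s * indicator {\<omega>\<in>space M. window_hit final T u (max 0 s) \<omega>} \<omega> \<partial>M)"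
      by (intro nn_integral_cong) (auto simp: indicator_def space_pair_measure)
    also have "\<dots> = indicator S s * emeasure M {\<omega>\<in>space M. window_hit final T u (max 0 s) \<omega>}"
      by (rule nn_integral_cmult_indicator) measurable
    finally show ?thesis by (simp add: mult.commute)
  qed
  have "(\<integral>\<^sup>+s. emeasure M {\<omega>\<in>space M. window_hit final T u (max 0 s) \<omega>} * indicator S s \<partial>lborel)
    = (\<integral>\<^sup>+s. (\<integral>\<^sup>+\<omega>. indicator ?Q (s, \<omega>) * indicator S s \<partial>M) \<partial>lborel)" by (simp only: eq)
  also have "\<dots> = (\<integral>\<^sup>+\<omega>. (\<integral>\<^sup>+s. indicator ?Q (s, \<omega>) * indicator S s \<partial>lborel) \<partial>M)"
    by (rule P.Fubini'[symmetric]) measurable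
  also have "\<dots> = (\<integral>\<^sup>+\<omega>. (\<integral>\<^sup>+s. indicator {s. s \<in> S \<and> window_hit final T u (max 0 s) \<omega>} s \<partial>lborel) \<partial>M)"
    by (intro nn_integral_cong) (auto simp: indicator_def space_pair_measure)
  finally show ?thesis .
qed

text \<open>A hit at t lies in every window that starts in (t - T, t), a set of length T. Averaging
  over the starts therefore counts it T times, unless it comes before 2 T + 1.\<close>

lemma hit_before_upper:
  assumes T: "0 < T"
  shows "ennreal T * emeasure M (hit_before c u) \<le> ennreal T * emeasure M (hit_before (ereal (2 * T + 1)) u) +
     (\<integral>\<^sup>+s. emeasure M {\<omega>\<in>space M. window_hit False T u (max 0 s) \<omega>} * indicator ({T..} \<inter> {s. ereal s < c}) s \<partial>lborel)"
proof -
  have Sc: "{s::real. ereal s < c} \<in> sets borel"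
    by (cases c) (auto simp: lessThan_def[symmetric])
  have mS: "{T..} \<inter> {s::real. ereal s < c} \<in> sets borel" using Sc by auto
  let ?I = "\<lambda>\<omega>. (\<integral>\<^sup>+s. indicator {s. s \<in> {T..} \<inter> {s. ereal s < c} \<and> window_hit False T u (max 0 s) \<omega>} s \<partial>lborel)"
  have "ennreal T * emeasure M (hit_before c u) = (\<integral>\<^sup>+\<omega>. ennreal T * indicator (hit_before c u) \<omega> \<partial>M)"
    by (simp add: nn_integral_cmult_indicator)
  also have "\<dots> \<le> (\<integral>\<^sup>+\<omega>. ennreal T * indicator (hit_before (ereal (2 * T + 1)) u) \<omega> + ?I \<omega> \<partial>M)"
  proof (rule nn_integral_mono)
    fix \<omega> assume \<omega>: "\<omega> \<in> space M"
    show "ennreal T * indicator (hit_before c u) \<omega> \<le> ennreal T * indicator (hit_before (ereal (2 * T + 1)) u) \<omega> + ?I \<omega>"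
    proof (cases "\<omega> \<in> hit_before c u \<and> \<omega> \<notin> hit_before (ereal (2 * T + 1)) u")
      case True
      then obtain t where t: "0 < t" "ereal t < c" "hit B d \<mu> (\<lambda>j. \<alpha> j * u) t \<omega>" by (auto simp: hit_before_def)
      have t2: "2 * T + 1 \<le> t"
        using True t \<omega> by (auto simp: hit_before_def) (meson not_less)
      \<comment> \<open>As t is at least 2 T + 1, all these starts exceed T, and they precede c
        because t does.\<close>
      have "{t - T<..<t} \<subseteq> {s. s \<in> {T..} \<inter> {s. ereal s < c} \<and> window_hit False T u (max 0 s) \<omega>}"
      proof
        fix s assume s: "s \<in> {t - T<..<t}"
        then have sT: "T \<le> s" "0 < s" using t2 T by auto
        have "ereal s < c" using s t(2) by (cases c) auto
        moreover have "window_hit False T u (max 0 s) \<omega>"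
          unfolding window_hit_def using s sT t(3) by (intro conjI bexI[of _ t]) auto
        ultimately show "s \<in> {s. s \<in> {T..} \<inter> {s. ereal s < c} \<and> window_hit False T u (max 0 s) \<omega>}" using sT by simp
      qed
      then have "(\<integral>\<^sup>+s. indicator {t - T<..<t} s \<partial>lborel) \<le> ?I \<omega>"
        by (intro nn_integral_mono) (auto simp: indicator_def)
      then have "ennreal T \<le> ?I \<omega>" using T by simp
      then show ?thesis using True by simp
    qed (auto simp: indicator_def)
  qed
  also have "\<dots> = ennreal T * emeasure M (hit_before (ereal (2 * T + 1)) u) + (\<integral>\<^sup>+\<omega>. ?I \<omega> \<partial>M)"
  proof (subst nn_integral_add)
    have [measurable]: "{T..} \<inter> {s::real. ereal s < c} \<in> sets borel" by (rule mS)
    note [measurable] = window_hit_joint[OF T, of False u]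
    let ?Q = "{y\<in>space (lborel \<Otimes>\<^sub>M M). window_hit False T u (max 0 (fst y)) (snd y)}"
    have "(\<lambda>\<omega>. \<integral>\<^sup>+s. indicator ?Q (s, \<omega>) * indicator ({T..} \<inter> {s. ereal s < c}) s \<partial>lborel) \<in> borel_measurable M" by measurable
    also have "?this \<longleftrightarrow> ?I \<in> borel_measurable M"
      by (intro measurable_cong nn_integral_cong) (auto simp: indicator_def space_pair_measure)
    finally show "?I \<in> borel_measurable M" .
  qed (auto simp: nn_integral_cmult_indicator)
  also have "(\<integral>\<^sup>+\<omega>. ?I \<omega> \<partial>M) = (\<integral>\<^sup>+s. emeasure M {\<omega>\<in>space M. window_hit False T u (max 0 s) \<omega>} * indicator ({T..} \<inter> {s. ereal s < c}) s \<partial>lborel)"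
    by (rule Fubini_window[OF T mS, symmetric])
  finally show ?thesis .
qed

text \<open>The starts of final windows have diameter at most T: a start beyond s + T would bring a
  hit after the end of the window at s, contrary to finality. The condition s + T < c places the hit
  itself before c.\<close>

lemma hit_before_lower:
  assumes T: "0 < T"
  shows "(\<integral>\<^sup>+s. emeasure M {\<omega>\<in>space M. window_hit True T u (max 0 s) \<omega>} * indicator ({T..} \<inter> {s. ereal (s + T) < c}) s \<partial>lborel)
    \<le> ennreal T * emeasure M (hit_before c u)"
proof -
  have Sc: "{s::real. ereal (s + T) < c} \<in> sets borel"
  proof (cases c)
    case (real r)
    then have "{s::real. ereal (s + T) < c} = {..<r - T}" by auto
    then show ?thesis by simp
  qed auto
  have mS: "{T..} \<inter> {s::real. ereal (s + T) < c} \<in> sets borel" using Sc by auto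
  have "(\<integral>\<^sup>+s. emeasure M {\<omega>\<in>space M. window_hit True T u (max 0 s) \<omega>} * indicator ({T..} \<inter> {s. ereal (s + T) < c}) s \<partial>lborel)
    = (\<integral>\<^sup>+\<omega>. (\<integral>\<^sup>+s. indicator {s. s \<in> {T..} \<inter> {s. ereal (s + T) < c} \<and> window_hit True T u (max 0 s) \<omega>} s \<partial>lborel) \<partial>M)"
    by (rule Fubini_window[OF T mS])
  also have "\<dots> \<le> (\<integral>\<^sup>+\<omega>. ennreal T * indicator (hit_before c u) \<omega> \<partial>M)"
  proof (rule nn_integral_mono)
    fix \<omega> assume \<omega>: "\<omega> \<in> space M"
    define A where "A = {s. s \<in> {T..} \<inter> {s. ereal (s + T) < c} \<and> window_hit True T u (max 0 s) \<omega>}"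
    show "(\<integral>\<^sup>+s. indicator A s \<partial>lborel) \<le> ennreal T * indicator (hit_before c u) \<omega>"
    proof (cases "A = {}")
      case False
      have A: "T \<le> s" "ereal (s + T) < c" "\<exists>t\<in>{s<..<s + T}. hit B d \<mu> (\<lambda>j. \<alpha> j * u) t \<omega>"
        "\<not> (\<exists>t\<in>{s + T<..}. hit B m \<mu> (\<lambda>j. \<alpha> j * u) t \<omega>)" if "s \<in> A" for s
        using that T by (auto simp: A_def window_hit_def max_def)
      obtain s0 where s0: "s0 \<in> A" using False by auto
      obtain t where t: "t \<in> {s0<..<s0 + T}" "hit B d \<mu> (\<lambda>j. \<alpha> j * u) t \<omega>" using A(3)[OF s0] by auto
      have "ereal t < c" using t A(2)[OF s0] by (cases c) auto
      then have hb: "\<omega> \<in> hit_before c u"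
        unfolding hit_before_def using t \<omega> A(1)[OF s0] T by (auto intro!: exI[of _ t])
      have diam: "s' \<le> s + T" if sA: "s \<in> A" and s'A: "s' \<in> A" for s s'
      proof (rule ccontr)
        assume n: "\<not> s' \<le> s + T"
        obtain t where t: "t \<in> {s'<..<s' + T}" "hit B d \<mu> (\<lambda>j. \<alpha> j * u) t \<omega>" using A(3)[OF s'A] by auto
        have "hit B m \<mu> (\<lambda>j. \<alpha> j * u) t \<omega>" using t(2) m by (auto simp: hit_def)
        moreover have "t \<in> {s + T<..}" using t(1) n by auto
        ultimately show False using A(4)[OF sA] by blast
      qed
      \<comment> \<open>The measure of \<open>A\<close> is bounded through an enclosing interval,
        without asking whether its infimum is attained.\<close>
      have "A \<subseteq> {Inf A..Inf A + T}"
      proof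
        fix s assume s: "s \<in> A"
        have "bdd_below A" by (rule bdd_belowI[of _ T]) (rule A(1))
        then have "Inf A \<le> s" using s by (rule cInf_lower[rotated])
        moreover have "s - T \<le> Inf A" 
        proof (rule cInf_greatest[OF False])
          fix x assume "x \<in> A"
          then show "s - T \<le> x" using diam[OF _ s, of x] by simp
        qed
        ultimately show "s \<in> {Inf A..Inf A + T}" by auto
      qed
      then have "(\<integral>\<^sup>+s. indicator A s \<partial>lborel) \<le> (\<integral>\<^sup>+s. indicator {Inf A..Inf A + T} s \<partial>lborel)"
        by (intro nn_integral_mono) (auto simp: indicator_def)
      also have "\<dots> = ennreal T" using T by simp
      finally show ?thesis using hb by simp
    qed simp
  qed
  also have "\<dots> = ennreal T * emeasure M (hit_before c u)"
    by (simp add: nn_integral_cmult_indicator)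
  finally show ?thesis .
qed

text \<open>Reaching levels of order u in bounded time has a probability smaller than any
  exponential in u, so it loses against the exponential growth of
  \<open>norm_factor\<close>.\<close>

lemma early_hit_negligible:
  assumes T: "0 < T"
  shows "((\<lambda>u. ennreal (norm_factor u / sqrt u) * emeasure M (hit_before (ereal T) u)) \<longlongrightarrow> 0) at_top"
proof -
  have one: "1 \<in> {1..m}" using m by simp
  have a1: "0 < \<alpha> 1" using \<alpha>_pos m by auto
  have \<alpha>0: "0 < \<alpha> j" if "j \<in> {1..m}" for j using \<alpha>_pos that m by auto
  define L where "L = (\<Sum>j=1..m. lam j)"
  have L: "lam j \<le> L" if "j \<in> {1..m}" for j
    unfolding L_def using member_le_sum[of j "{1..m}" lam] C.l_pos that by (force simp: less_imp_le)
  have L0: "0 \<le> L" using L[OF one] C.l_pos[OF one] by simp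
  \<comment> \<open>L dominates all \<open>lam j\<close> and thus compensates
    \<open>norm_factor\<close>; the term 1 / \<alpha>_1 leaves a surplus of exp(- u), since the sum
    of the \<alpha>_j is at least \<alpha>_1.\<close>
  define b where "b = L + 1 / \<alpha> 1"
  have b: "0 \<le> b" using L0 a1 by (simp add: b_def)
  obtain C where C: "0 < C" "\<And>x. prob {\<omega>\<in>space M. \<exists>t\<in>{0<..<T}. hit B m \<mu> x t \<omega>} \<le> C * exp (- b * (\<Sum>j=1..m. max 0 (x j)))"
    using hit_tail[OF m T b, of \<mu>] by blast
  have bound: "ennreal (norm_factor u / sqrt u) * emeasure M (hit_before (ereal T) u) \<le> ennreal (C * (u ^ m / exp u))" if u: "1 \<le> u" for u
  proof -
    have "emeasure M (hit_before (ereal T) u) \<le> emeasure M {\<omega>\<in>space M. \<exists>t\<in>{0<..<T}. hit B m \<mu> (\<lambda>j. \<alpha> j * u) t \<omega>}"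
    proof (rule emeasure_mono)
      show "hit_before (ereal T) u \<subseteq> {\<omega>\<in>space M. \<exists>t\<in>{0<..<T}. hit B m \<mu> (\<lambda>j. \<alpha> j * u) t \<omega>}"
        unfolding hit_before_def hit_def using m by fastforce
    qed (rule sets_hit[OF m(2)], auto)
    also have "\<dots> \<le> ennreal (C * exp (- b * (\<Sum>j=1..m. max 0 (\<alpha> j * u))))"
      using C(2)[of "\<lambda>j. \<alpha> j * u"] by (simp add: emeasure_eq_measure ennreal_leI)
    also have "(\<Sum>j=1..m. max 0 (\<alpha> j * u)) = (\<Sum>j=1..m. \<alpha> j) * u"
      unfolding sum_distrib_right by (rule sum.cong) (use \<alpha>0 u in \<open>auto simp: max_def less_imp_le mult_nonneg_nonneg\<close>)
    finally have 1: "emeasure M (hit_before (ereal T) u) \<le> ennreal (C * exp (- b * ((\<Sum>j=1..m. \<alpha> j) * u)))" .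
    have nf: "norm_factor u / sqrt u \<le> u ^ m * exp (u * (\<Sum>j=1..m. lam j * \<alpha> j))"
    proof -
      have s1: "1 \<le> sqrt u" using u by simp
      have su: "sqrt u \<le> u" using u real_sqrt_le_mono[of u "u\<^sup>2"] by (simp add: power2_eq_square)
      have "norm_factor u / sqrt u \<le> norm_factor u / 1"
        using s1 u by (intro divide_left_mono) (auto simp: norm_factor_def)
      also have "\<dots> \<le> u ^ m * exp (u * (\<Sum>j=1..m. lam j * \<alpha> j))"
        unfolding norm_factor_def using su u by (simp add: power_mono)
      finally show ?thesis .
    qed
    have ex: "u * (\<Sum>j=1..m. lam j * \<alpha> j) + - b * ((\<Sum>j=1..m. \<alpha> j) * u) \<le> - u"
    proof -
      have "(\<Sum>j=1..m. lam j * \<alpha> j) \<le> (\<Sum>j=1..m. L * \<alpha> j)"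
        by (intro sum_mono mult_right_mono L) (use \<alpha>0 in \<open>auto intro: less_imp_le\<close>)
      then have 2: "(\<Sum>j=1..m. lam j * \<alpha> j) \<le> L * (\<Sum>j=1..m. \<alpha> j)" by (simp add: sum_distrib_left)
      have "\<alpha> 1 \<le> (\<Sum>j=1..m. \<alpha> j)" by (rule member_le_sum[OF one]) (use \<alpha>0 in \<open>auto intro: less_imp_le\<close>)
      then have 3: "1 \<le> (1 / \<alpha> 1) * (\<Sum>j=1..m. \<alpha> j)" using a1 by (simp add: field_simps)
      have "(\<Sum>j=1..m. lam j * \<alpha> j) - b * (\<Sum>j=1..m. \<alpha> j) \<le> - 1"
        using 2 3 by (simp add: b_def distrib_right)
      then have "u * ((\<Sum>j=1..m. lam j * \<alpha> j) - b * (\<Sum>j=1..m. \<alpha> j)) \<le> u * (- 1)" using u by (intro mult_left_mono) auto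
      then show ?thesis by (simp add: algebra_simps)
    qed
    have "ennreal (norm_factor u / sqrt u) * emeasure M (hit_before (ereal T) u) \<le>
      ennreal (u ^ m * exp (u * (\<Sum>j=1..m. lam j * \<alpha> j))) * ennreal (C * exp (- b * ((\<Sum>j=1..m. \<alpha> j) * u)))"
      by (intro mult_mono ennreal_leI nf 1) auto
    also have "\<dots> = ennreal (C * (u ^ m * exp (u * (\<Sum>j=1..m. lam j * \<alpha> j) + - b * ((\<Sum>j=1..m. \<alpha> j) * u))))"
      using C(1) u unfolding exp_add by (subst ennreal_mult[symmetric]) (auto simp: mult_ac)
    also have "\<dots> \<le> ennreal (C * (u ^ m * exp (- u)))"
      using C(1) u ex by (intro ennreal_leI mult_left_mono) auto
    finally show ?thesis by (simp add: exp_minus divide_inverse)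
  qed
  have "((\<lambda>u. C * (u ^ m / exp u)) \<longlongrightarrow> C * 0) at_top"
    by (intro tendsto_mult tendsto_const tendsto_power_div_exp_0)
  then have lim: "((\<lambda>u. ennreal (C * (u ^ m / exp u))) \<longlongrightarrow> 0) at_top"
    using tendsto_ennrealI by fastforce
  show ?thesis
  proof (rule tendsto_sandwich[OF _ _ tendsto_const lim])
    show "\<forall>\<^sub>F u in at_top. ennreal (norm_factor u / sqrt u) * emeasure M (hit_before (ereal T) u) \<le> ennreal (C * (u ^ m / exp u))"
      using eventually_ge_at_top[of 1] by eventually_elim (rule bound)
  qed simp
qed

end

section \<open>Limits of the ruin probability and of the ruin time\<close>

lemma Psi_pos: "0 < Psi x"
proof (rule ccontr)
  assume "\<not> 0 < Psi x"
  then have "Psi x = 0" using Psi_bounds(1)[of x] by simp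
  then have "emeasure std_normal_distribution {x<..} = 0" using Psi_eq[of x] by simp
  then have "(\<integral>\<^sup>+z. ennreal (std_normal_density z) * indicator {x<..} z \<partial>lborel) = 0"
    by (simp add: emeasure_density)
  then have "AE z in lborel. ennreal (std_normal_density z) * indicator {x<..} z = 0"
    by (subst (asm) nn_integral_0_iff_AE) auto
  then have "AE z in lborel. z \<notin> {x<..}"
  proof eventually_elim
    case (elim z)
    have "0 < std_normal_density z" by (rule normal_density_pos) simp
    then show ?case using elim by (auto simp: indicator_def ennreal_eq_0_iff split: if_splits)
  qed
  then have "emeasure lborel {x<..} = 0"
    by (subst (asm) AE_iff_measurable[where N = "{x<..}"]) auto
  moreover have "emeasure lborel {x<..x + 1} \<le> emeasure lborel {x<..}" by (rule emeasure_mono) auto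
  ultimately show False by simp
qed

context ruin_setup
begin

lemma sum_\<alpha>_pos: "0 < (\<Sum>j=1..m. (\<alpha> j)\<^sup>2)"
proof -
  have "(\<alpha> 1)\<^sup>2 \<le> (\<Sum>j=1..m. (\<alpha> j)\<^sup>2)" using m by (intro member_le_sum) auto
  moreover have "0 < (\<alpha> 1)\<^sup>2" using \<alpha>_pos[of 1] m by simp
  ultimately show ?thesis by linarith
qed

lemma curvature_pos: "0 < curvature"
  unfolding curvature_def using sum_\<alpha>_pos t0 by simp

lemma limit_density_pos: "0 < limit_density y"
  unfolding limit_density_def using t0 by (intro mult_pos_pos prod_pos) (auto simp: Psi_pos)

text \<open>The \<open>Psi\<close> factors are at most 1, and the rest is a multiple of the centred
  normal density with variance 1 / (2 curvature).\<close>

lemma limit_density_integrable: "integrable lborel limit_density"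
proof -
  define \<sigma> where "\<sigma> = 1 / sqrt (2 * curvature)"
  have \<sigma>: "0 < \<sigma>" "\<sigma>\<^sup>2 = 1 / (2 * curvature)" using curvature_pos by (auto simp: \<sigma>_def power_divide)
  have "integrable lborel (\<lambda>y. (1 / sqrt (2 * pi * t0)) ^ m * (sqrt (2 * pi * \<sigma>\<^sup>2) * normal_density 0 \<sigma> y))"
    using \<sigma> by (intro integrable_mult_right integrable_normal_density) auto
  then show ?thesis
  proof (rule Bochner_Integration.integrable_bound)
    show "AE y in lborel. norm (limit_density y) \<le> norm ((1 / sqrt (2 * pi * t0)) ^ m * (sqrt (2 * pi * \<sigma>\<^sup>2) * normal_density 0 \<sigma> y))"
    proof (rule AE_I2)
      fix y
      have e: "sqrt (2 * pi * \<sigma>\<^sup>2) * normal_density 0 \<sigma> y = exp (- curvature * y\<^sup>2)"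
        using \<sigma> curvature_pos by (simp add: normal_density_def)
      have p: "0 \<le> (\<Prod>j\<in>K. Psi (\<mu> j / sqrt t0 * y))" "(\<Prod>j\<in>K. Psi (\<mu> j / sqrt t0 * y)) \<le> 1"
        by (auto intro!: prod_nonneg prod_le_1 Psi_bounds)
      have k0: "0 \<le> (1 / sqrt (2 * pi * t0)) ^ m * exp (- curvature * y\<^sup>2)" using t0 by auto
      have "norm (limit_density y) = limit_density y" using limit_density_nonneg by simp
      also have "\<dots> \<le> (1 / sqrt (2 * pi * t0)) ^ m * exp (- curvature * y\<^sup>2)"
        unfolding limit_density_def using mult_left_mono[OF p(2) k0] by simp
      also have "\<dots> \<le> norm ((1 / sqrt (2 * pi * t0)) ^ m * exp (- curvature * y\<^sup>2))"
        unfolding real_norm_def by (rule abs_ge_self)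
      finally show "norm (limit_density y) \<le> norm ((1 / sqrt (2 * pi * t0)) ^ m * (sqrt (2 * pi * \<sigma>\<^sup>2) * normal_density 0 \<sigma> y))"
        unfolding e .
    qed
  qed simp
qed

definition mass :: "real set \<Rightarrow> real" where
  "mass S = (LBINT y:S. limit_density y)"

lemma nn_mass:
  assumes "S \<in> sets borel"
  shows "(\<integral>\<^sup>+y. ennreal (limit_density y) * indicator S y \<partial>lborel) = ennreal (mass S)"
proof -
  have "(\<integral>\<^sup>+y. ennreal (limit_density y) * indicator S y \<partial>lborel) = (\<integral>\<^sup>+y. ennreal (indicator S y *\<^sub>R limit_density y) \<partial>lborel)"
    by (intro nn_integral_cong) (auto simp: indicator_def)
  also have "\<dots> = ennreal (\<integral>y. indicator S y *\<^sub>R limit_density y \<partial>lborel)"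
  proof (rule nn_integral_eq_integral)
    show "integrable lborel (\<lambda>y. indicator S y *\<^sub>R limit_density y)"
      by (rule integrable_mult_indicator[OF _ limit_density_integrable]) (use assms in simp)
  qed (auto simp: limit_density_nonneg)
  finally show ?thesis by (simp add: mass_def set_lebesgue_integral_def)
qed

lemma mass_nonneg: "0 \<le> mass S"
  unfolding mass_def set_lebesgue_integral_def by (intro integral_nonneg_AE) (auto simp: limit_density_nonneg)

lemma mass_UNIV_pos: "0 < mass UNIV"
proof (rule ccontr)
  assume "\<not> 0 < mass UNIV"
  then have "ennreal (mass UNIV) = 0" by (simp add: ennreal_eq_0_iff)
  then have "(\<integral>\<^sup>+y. ennreal (limit_density y) \<partial>lborel) = 0" using nn_mass[of UNIV] by simp
  then have "AE y in lborel. ennreal (limit_density y) = 0" by (subst (asm) nn_integral_0_iff_AE) auto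
  then have "AE y in lborel. y \<notin> (UNIV :: real set)"
  proof (rule eventually_mono)
    fix y assume "ennreal (limit_density y) = 0"
    then show "y \<notin> UNIV" using limit_density_pos[of y] by (simp add: ennreal_eq_0_iff)
  qed
  then have "emeasure lborel (UNIV :: real set) = 0"
    by (subst (asm) AE_iff_measurable[where N = UNIV]) auto
  moreover have "emeasure lborel {0..1::real} \<le> emeasure lborel (UNIV :: real set)" by (rule emeasure_mono) auto
  ultimately show False by simp
qed

definition scaled :: "real \<Rightarrow> 'w set \<Rightarrow> real" where
  "scaled u A = norm_factor u / sqrt u * prob A"

lemma scaled_nonneg: "0 \<le> u \<Longrightarrow> 0 \<le> scaled u A"
  by (simp add: scaled_def norm_factor_def)

lemma ennreal_scaled: "0 \<le> u \<Longrightarrow> ennreal (scaled u A) = ennreal (norm_factor u / sqrt u) * emeasure M A"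
  unfolding scaled_def emeasure_eq_measure by (rule ennreal_mult) (auto simp: norm_factor_def)

text \<open>The two window averages are integrals of \<open>window_density\<close> and converge for
  fixed T. \<open>ev\<close> is asked for every constant \<open>e\<close> because the lower bound
  compares the cutoff with the end of a window (e = 1) and the upper bound with its start (e =
  0).\<close>

lemma hit_before_limit:
  fixes c :: "real \<Rightarrow> ereal"
  assumes S': "S' \<in> sets borel"
    and ev: "\<And>e. AE y in lborel. \<forall>\<^sub>F u in at_top. ereal (time y u + e) < c u \<longleftrightarrow> y \<in> S'"
  shows "((\<lambda>u. scaled u (hit_before (c u) u)) \<longlongrightarrow> C.H * mass S') at_top"
proof -
  have mc: "{s::real. ereal (s + e) < c u} \<in> sets borel" for u e
  proof (cases "c u")
    case (real r)
    then have "{s::real. ereal (s + e) < c u} = {..<r - e}" by auto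
    then show ?thesis by simp
  qed auto
  have tm[measurable]: "(\<lambda>y. time y u) \<in> borel_measurable borel" for u unfolding time_def by measurable
  have mS: "{y. ereal (time y u + e) < c u} \<in> sets borel" for u e
    using measurable_sets[OF tm[of u] mc[of e u]] by (simp add: vimage_def)
  have lim: "((\<lambda>u. \<integral>\<^sup>+y. window_density final T u y * indicator {y. ereal (time y u + e) < c u} y \<partial>lborel) \<longlongrightarrow>
     C.V (limit_hit final T) * ennreal (mass S')) at_top" if T: "0 < T" for final T e
    unfolding nn_mass[OF S', symmetric] by (rule window_integral_limit[OF T mS S']) (use ev[of e] in simp)
  have subst: "(\<integral>\<^sup>+y. window_density final T u y * indicator {y. ereal (time y u + e) < c u} y \<partial>lborel) =
    ennreal (norm_factor u / sqrt u) *
      (\<integral>\<^sup>+s. emeasure M {\<omega>\<in>space M. window_hit final T u (max 0 s) \<omega>} * indicator ({T..} \<inter> {s. ereal (s + e) < c u}) s \<partial>lborel)"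
    if "0 < T" "0 < u" for final T e u
    using window_integral_time[OF that mc[of e u], of final] by simp
  show ?thesis
  proof (rule order_tendstoI)
    fix b assume b: "b < C.H * mass S'"
    \<comment> \<open>Length 1 suffices from below, since \<open>G\<close> is by definition the mass
      of a hit in (0, 1) without a later one.\<close>
    have V: "C.V (limit_hit True 1) = ennreal C.H"
      using C.G_eq_H by (simp add: C.G_def limit_hit_def[abs_def])
    have "((\<lambda>u. \<integral>\<^sup>+y. window_density True 1 u y * indicator {y. ereal (time y u + 1) < c u} y \<partial>lborel) \<longlongrightarrow> ennreal (C.H * mass S')) at_top"
      using lim[of 1 True 1] unfolding V by (simp add: ennreal_mult mass_nonneg C.H_def)
    moreover have low: "(\<integral>\<^sup>+y. window_density True 1 u y * indicator {y. ereal (time y u + 1) < c u} y \<partial>lborel) \<le> ennreal (scaled u (hit_before (c u) u))" if "0 < u" for u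
      unfolding subst[OF zero_less_one that] ennreal_scaled[OF less_imp_le[OF that]]
      using hit_before_lower[OF zero_less_one, of u "c u"] by (intro mult_left_mono) auto
    show "\<forall>\<^sub>F u in at_top. b < scaled u (hit_before (c u) u)"
    proof (cases "b < 0")
      case True
      show ?thesis using eventually_ge_at_top[of 0]
      proof eventually_elim
        case (elim u)
        then show ?case using True scaled_nonneg[of u "hit_before (c u) u"] by simp
      qed
    next
      case False
      then have "ennreal b < ennreal (C.H * mass S')" using b by (intro ennreal_lessI) auto
      with \<open>((\<lambda>u. \<integral>\<^sup>+y. window_density True 1 u y * indicator {y. ereal (time y u + 1) < c u} y \<partial>lborel) \<longlongrightarrow> ennreal (C.H * mass S')) at_top\<close>
      have "\<forall>\<^sub>F u in at_top. ennreal b < (\<integral>\<^sup>+y. window_density True 1 u y * indicator {y. ereal (time y u + 1) < c u} y \<partial>lborel)"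
        by (rule order_tendstoD)
      then show ?thesis using eventually_gt_at_top[of 0]
      proof eventually_elim
        case (elim u)
        have "ennreal b < ennreal (scaled u (hit_before (c u) u))" using elim low by (auto intro: less_le_trans)
        then show ?case using False by (simp add: ennreal_less_iff)
      qed
    qed
  next
    fix b assume b: "C.H * mass S' < b"
    \<comment> \<open>T is fixed before u grows, so large that R T / T times the mass is already
      below b.\<close>
    have "((\<lambda>T. C.R T / T * mass S') \<longlongrightarrow> C.H * mass S') at_top"
      by (intro tendsto_mult C.R_limit tendsto_const)
    then have "\<forall>\<^sub>F T in at_top. C.R T / T * mass S' < b" by (rule order_tendstoD) fact
    then have "\<forall>\<^sub>F T in at_top. C.R T / T * mass S' < b \<and> 0 < T"
      using eventually_gt_at_top[of 0] by eventually_elim auto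
    then obtain T where T: "C.R T / T * mass S' < b" "0 < T"
      using eventually_happens'[OF trivial_limit_at_top_linorder] by blast
    have R0: "0 \<le> C.R T" by (simp add: C.R_def)
    have V: "C.V (limit_hit False T) = ennreal (C.R T)"
      using C.V_Hit_R[OF T(2)] by (simp add: limit_hit_def[abs_def])
    have w: "((\<lambda>u. \<integral>\<^sup>+y. window_density False T u y * indicator {y. ereal (time y u + 0) < c u} y \<partial>lborel) \<longlongrightarrow> ennreal (C.R T * mass S')) at_top"
      using lim[OF T(2), of False 0] unfolding V by (simp add: ennreal_mult mass_nonneg R0)
    have T21: "0 < 2 * T + 1" using T by simp
    \<comment> \<open>Everything is kept multiplied by T, the common factor in
      \<open>hit_before_upper\<close>; it is cancelled at the very end.\<close>
    have "((\<lambda>u. ennreal T * (ennreal (norm_factor u / sqrt u) * emeasure M (hit_before (ereal (2 * T + 1)) u)) +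
       (\<integral>\<^sup>+y. window_density False T u y * indicator {y. ereal (time y u + 0) < c u} y \<partial>lborel)) \<longlongrightarrow> ennreal T * 0 + ennreal (C.R T * mass S')) at_top"
      by (intro tendsto_add ennreal_tendsto_cmult early_hit_negligible[OF T21] w) simp
    moreover have "ennreal T * 0 + ennreal (C.R T * mass S') < ennreal (T * b)"
      using T R0 mass_nonneg by (simp add: ennreal_less_iff field_simps)
    ultimately have "\<forall>\<^sub>F u in at_top. ennreal T * (ennreal (norm_factor u / sqrt u) * emeasure M (hit_before (ereal (2 * T + 1)) u)) +
       (\<integral>\<^sup>+y. window_density False T u y * indicator {y. ereal (time y u + 0) < c u} y \<partial>lborel) < ennreal (T * b)"
      by (rule order_tendstoD)
    then show "\<forall>\<^sub>F u in at_top. scaled u (hit_before (c u) u) < b"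
      using eventually_gt_at_top[of 0]
    proof eventually_elim
      case (elim u)
      have u0: "0 \<le> u" using elim by simp
      have "ennreal (T * scaled u (hit_before (c u) u)) = ennreal (norm_factor u / sqrt u) * (ennreal T * emeasure M (hit_before (c u) u))"
        using T by (simp add: ennreal_mult scaled_nonneg[OF u0] ennreal_scaled[OF u0] mult.left_commute)
      also have "\<dots> \<le> ennreal (norm_factor u / sqrt u) * (ennreal T * emeasure M (hit_before (ereal (2 * T + 1)) u) +
        (\<integral>\<^sup>+s. emeasure M {\<omega>\<in>space M. window_hit False T u (max 0 s) \<omega>} * indicator ({T..} \<inter> {s. ereal s < c u}) s \<partial>lborel))"
        by (intro mult_left_mono hit_before_upper T) simp
      also have "\<dots> = ennreal T * (ennreal (norm_factor u / sqrt u) * emeasure M (hit_before (ereal (2 * T + 1)) u)) +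
       (\<integral>\<^sup>+y. window_density False T u y * indicator {y. ereal (time y u + 0) < c u} y \<partial>lborel)"
        unfolding subst[OF T(2) elim(2)] by (simp add: distrib_left mult.left_commute)
      also have "\<dots> < ennreal (T * b)" by (rule elim(1))
      finally have "T * scaled u (hit_before (c u) u) < T * b"
        using T scaled_nonneg[OF u0] by (simp add: ennreal_less_iff)
      then show ?case using T by simp
    qed
  qed
qed

lemma ruin_limit: "((\<lambda>u. scaled u (hit_before \<infinity> u)) \<longlongrightarrow> C.H * mass UNIV) at_top"
  by (rule hit_before_limit) auto

text \<open>A constant \<open>e\<close> in the cutoff is negligible against sqrt u. This freedom
  allows the closed event for the ruin time to be enclosed between two open cutoffs.\<close>

lemma ruin_time_limit: "((\<lambda>u. scaled u (hit_before (ereal (t0 * u + Y * sqrt u + e)) u)) \<longlongrightarrow> C.H * mass {..Y}) at_top"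
proof (rule hit_before_limit)
  fix e' :: real
  show "AE y in lborel. \<forall>\<^sub>F u in at_top. ereal (time y u + e') < ereal (t0 * u + Y * sqrt u + e) \<longleftrightarrow> y \<in> {..Y}"
    using AE_lborel_singleton[of Y]
  proof eventually_elim
    case (elim y)
    have iff: "ereal (time y u + e') < ereal (t0 * u + Y * sqrt u + e) \<longleftrightarrow> e' - e < (Y - y) * sqrt u" for u
      by (simp add: time_def algebra_simps)
    show ?case
    proof (cases "y < Y")
      case True
      have "filterlim (\<lambda>u. (Y - y) * sqrt u) at_top at_top"
        by (rule filterlim_tendsto_pos_mult_at_top[OF tendsto_const _ sqrt_at_top]) (use True in simp)
      then have "\<forall>\<^sub>F u in at_top. e' - e < (Y - y) * sqrt u" unfolding filterlim_at_top_dense by blast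
      then show ?thesis unfolding iff by eventually_elim (use True in auto)
    next
      case False
      have "filterlim (\<lambda>u. (Y - y) * sqrt u) at_bot at_top"
        by (rule filterlim_tendsto_neg_mult_at_bot[OF tendsto_const _ sqrt_at_top]) (use False elim in simp)
      then have "\<forall>\<^sub>F u in at_top. (Y - y) * sqrt u < e' - e" unfolding filterlim_at_bot_dense by blast
      then show ?thesis unfolding iff by eventually_elim (use False elim in auto)
    qed
  qed
qed simp

lemma hit_at_0: "0 < u \<Longrightarrow> \<omega> \<in> space M \<Longrightarrow> \<not> hit B d \<mu> (\<lambda>j. \<alpha> j * u) 0 \<omega>"
proof
  assume u: "0 < u" and \<omega>: "\<omega> \<in> space M" and h: "hit B d \<mu> (\<lambda>j. \<alpha> j * u) 0 \<omega>"
  have one: "1 \<in> {1..d}" using d1 by simp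
  have "\<alpha> 1 * u < B 0 \<omega> 1 - \<mu> 1 * 0" using h one unfolding hit_def by blast
  then show False using mult_pos_pos[OF \<alpha>_pos[OF one] u] B_0[OF \<omega> one] by simp
qed

lemma ruin_prob_eq: "0 < u \<Longrightarrow> ruin_prob M B d \<alpha> \<mu> u = prob (hit_before \<infinity> u)"
  unfolding ruin_prob_def hit_before_def using hit_at_0
  by (intro arg_cong[where f=prob] Collect_cong conj_cong refl) (auto simp: order_le_less)

text \<open>The balance turns (1 / (2 t0)) times the sum of the (\<alpha>_j + \<mu>_j t0)^2 into the
  sum of the \<open>lam j * \<alpha> j\<close>, and the constant (2 pi t0)^(- m/2) is already part
  of \<open>limit_density\<close>.\<close>

lemma ruin_approx_eq:
  assumes u: "0 < u"
  shows "ruin_approx C.H \<alpha> \<mu> t0 m K u = C.H * mass UNIV / (norm_factor u / sqrt u)"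
proof -
  define I where "I = (LBINT x. exp (- ((\<Sum>j=1..m. (\<alpha> j)\<^sup>2) / (2 * t0 ^ 3)) * x\<^sup>2) * (\<Prod>i\<in>K. Psi (\<mu> i / sqrt t0 * x)))"
  have mass: "mass UNIV = (1 / sqrt (2 * pi * t0)) ^ m * I"
    unfolding mass_def limit_density_def I_def curvature_def set_lebesgue_integral_def
    by (simp add: mult.assoc)
  have p: "(1 / sqrt (2 * pi * t0)) ^ m = 1 / sqrt ((2 * pi * t0) ^ m)"
    by (simp only: power_one_over real_sqrt_power)
  have ex: "(1 / (2 * t0)) * (\<Sum>j=1..m. (\<alpha> j + \<mu> j * t0)\<^sup>2) = (\<Sum>j=1..m. lam j * \<alpha> j)"
  proof -
    have "(\<Sum>j=1..m. (\<alpha> j + \<mu> j * t0)\<^sup>2) = (\<Sum>j=1..m. (\<alpha> j)\<^sup>2) + (2 * t0) * (\<Sum>j=1..m. \<alpha> j * \<mu> j) + t0\<^sup>2 * (\<Sum>j=1..m. (\<mu> j)\<^sup>2)"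
      unfolding sum_distrib_left sum.distrib[symmetric] by (rule sum.cong) (auto simp: power2_eq_square algebra_simps)
    also have "\<dots> = 2 * (\<Sum>j=1..m. (\<alpha> j)\<^sup>2) + (2 * t0) * (\<Sum>j=1..m. \<alpha> j * \<mu> j)" unfolding balance[symmetric] by simp
    also have "(1 / (2 * t0)) * \<dots> = (\<Sum>j=1..m. (\<alpha> j)\<^sup>2) / t0 + (\<Sum>j=1..m. \<alpha> j * \<mu> j)"
      using t0 by (simp add: field_simps)
    also have "\<dots> = (\<Sum>j=1..m. lam j * \<alpha> j)"
      unfolding sum_divide_distrib sum.distrib[symmetric] lam_def
      by (rule sum.cong) (auto simp: algebra_simps power2_eq_square)
    finally show ?thesis .
  qed
  have pw: "u powr ((1 - real m) / 2) = sqrt u / sqrt u ^ m"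
  proof -
    have "u powr ((1 - real m) / 2) = u powr (1 / 2) / u powr (1 / 2 * real m)"
      by (simp add: powr_diff[symmetric] diff_divide_distrib)
    also have "u powr (1 / 2 * real m) = (u powr (1 / 2)) powr real m" by (simp add: powr_powr)
    also have "\<dots> = sqrt u ^ m" using u by (simp add: powr_half_sqrt powr_realpow)
    finally show ?thesis using u by (simp add: powr_half_sqrt)
  qed
  have ex2: "exp (- (1 / (2 * t0)) * (\<Sum>j=1..m. (\<alpha> j + \<mu> j * t0)\<^sup>2) * u) = 1 / exp (u * (\<Sum>j=1..m. lam j * \<alpha> j))"
  proof -
    have "- (1 / (2 * t0)) * (\<Sum>j=1..m. (\<alpha> j + \<mu> j * t0)\<^sup>2) * u = - (u * (\<Sum>j=1..m. lam j * \<alpha> j))"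
      unfolding ex[symmetric] by (simp only: mult_minus_left mult.commute[of u])
    then show ?thesis by (simp only: exp_minus inverse_eq_divide)
  qed
  show ?thesis
    unfolding ruin_approx_def I_def[symmetric] mass p pw ex2 norm_factor_def by (simp add: mult_ac)
qed

lemma ruin_asymptotics_main: "ruin_asymptotics M B d \<alpha> \<mu> t0 m K"
proof -
  have l: "\<And>j. j \<in> {1..m} \<Longrightarrow> lam j = \<alpha> j / t0 + \<mu> j" by (simp add: lam_def)
  have Hc: "H_const M B \<alpha> \<mu> t0 m = C.H" by (rule C.H_quot_limit(2)[OF l])
  have Hpos: "0 < C.H" by (rule C.H_pos[OF \<mu>1])
  have HJ: "0 < C.H * mass UNIV" using Hpos mass_UNIV_pos by simp
  have "ruin_prob M B d \<alpha> \<mu> \<sim>[at_top] ruin_approx C.H \<alpha> \<mu> t0 m K"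
  proof (rule asymp_equivI')
    have "((\<lambda>u. scaled u (hit_before \<infinity> u) / (C.H * mass UNIV)) \<longlongrightarrow> (C.H * mass UNIV) / (C.H * mass UNIV)) at_top"
      by (intro tendsto_divide ruin_limit tendsto_const) (use Hpos mass_UNIV_pos in simp)
    then have "((\<lambda>u. scaled u (hit_before \<infinity> u) / (C.H * mass UNIV)) \<longlongrightarrow> 1) at_top" using Hpos mass_UNIV_pos by simp
    then show "((\<lambda>u. ruin_prob M B d \<alpha> \<mu> u / ruin_approx C.H \<alpha> \<mu> t0 m K u) \<longlongrightarrow> 1) at_top"
    proof (rule Lim_transform_eventually)
      show "\<forall>\<^sub>F u in at_top. scaled u (hit_before \<infinity> u) / (C.H * mass UNIV) = ruin_prob M B d \<alpha> \<mu> u / ruin_approx C.H \<alpha> \<mu> t0 m K u"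
        using eventually_gt_at_top[of 0]
        by eventually_elim (simp add: ruin_prob_eq ruin_approx_eq scaled_def mult_ac)
    qed
  qed
  then show ?thesis
    unfolding ruin_asymptotics_def Hc using Hpos C.H_quot_limit(1)[OF l] by simp
qed

text \<open>\<open>hit_before c\<close> is exactly the event that the infimum lies strictly below c.
  As the infimum need not be a hitting time, the weak inequality is the intersection over slightly
  larger cutoffs.\<close>

lemma ruin_time_le_iff:
  assumes u: "0 < u" and \<omega>: "\<omega> \<in> space M"
  shows "ruin_time B d \<alpha> \<mu> u \<omega> \<le> ereal c \<longleftrightarrow> (\<forall>n. \<omega> \<in> hit_before (ereal (c + 1 / real (Suc n))) u)"
    and "ruin_time B d \<alpha> \<mu> u \<omega> < \<infinity> \<longleftrightarrow> \<omega> \<in> hit_before \<infinity> u"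
    and "0 \<le> ruin_time B d \<alpha> \<mu> u \<omega>"
proof -
  have less: "ruin_time B d \<alpha> \<mu> u \<omega> < c' \<longleftrightarrow> \<omega> \<in> hit_before c' u" for c'
  proof -
    have "t \<noteq> 0" if "hit B d \<mu> (\<lambda>j. \<alpha> j * u) t \<omega>" for t using hit_at_0[OF u \<omega>] that by metis
    then show ?thesis unfolding ruin_time_def hit_before_def Inf_less_iff
      using \<omega> by (auto simp: order_le_less)
  qed
  show "ruin_time B d \<alpha> \<mu> u \<omega> < \<infinity> \<longleftrightarrow> \<omega> \<in> hit_before \<infinity> u" by (rule less)
  show nonneg: "0 \<le> ruin_time B d \<alpha> \<mu> u \<omega>" unfolding ruin_time_def by (rule Inf_greatest) auto
  show "ruin_time B d \<alpha> \<mu> u \<omega> \<le> ereal c \<longleftrightarrow> (\<forall>n. \<omega> \<in> hit_before (ereal (c + 1 / real (Suc n))) u)"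
    unfolding less[symmetric]
  proof
    assume a: "ruin_time B d \<alpha> \<mu> u \<omega> \<le> ereal c"
    show "\<forall>n. ruin_time B d \<alpha> \<mu> u \<omega> < ereal (c + 1 / real (Suc n))"
    proof
      fix n
      have "ereal c < ereal (c + 1 / real (Suc n))" by simp
      with a show "ruin_time B d \<alpha> \<mu> u \<omega> < ereal (c + 1 / real (Suc n))" by (rule le_less_trans)
    qed
  next
    assume a: "\<forall>n. ruin_time B d \<alpha> \<mu> u \<omega> < ereal (c + 1 / real (Suc n))"
    then have "ruin_time B d \<alpha> \<mu> u \<omega> \<noteq> \<infinity>" by force
    then obtain r where r: "ruin_time B d \<alpha> \<mu> u \<omega> = ereal r" using nonneg by (cases "ruin_time B d \<alpha> \<mu> u \<omega>") auto
    have "r \<le> c"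
    proof (rule ccontr)
      assume "\<not> r \<le> c"
      then obtain n where "inverse (real (Suc n)) < r - c" using reals_Archimedean[of "r - c"] by auto
      moreover have "r < c + 1 / real (Suc n)" using a[rule_format, of n] by (simp add: r)
      ultimately show False by (simp add: inverse_eq_divide)
    qed
    then show "ruin_time B d \<alpha> \<mu> u \<omega> \<le> ereal c" by (simp add: r)
  qed
qed

lemma hit_before_mono: "c \<le> c' \<Longrightarrow> hit_before c u \<subseteq> hit_before c' u"
  unfolding hit_before_def by (blast intro: less_le_trans)

text \<open>Equal to 1 / sqrt (2 curvature), the standard deviation of the Gaussian factor of
  \<open>limit_density\<close>; dividing by it gives the exponent x^2 / 2 of
  \<open>limit_weight\<close>.\<close>

definition scale :: real where "scale = sqrt (t0 ^ 3 / (\<Sum>j=1..m. (\<alpha> j)\<^sup>2))"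

lemma scale_pos: "0 < scale" unfolding scale_def using sum_\<alpha>_pos t0 by simp

lemma mass_scaled:
  assumes S: "S \<in> sets borel"
  shows "mass S = (1 / sqrt (2 * pi * t0)) ^ m * scale * (LBINT x:{x. scale * x \<in> S}. limit_weight \<alpha> \<mu> t0 m K x)"
proof -
  let ?A = "\<Sum>j=1..m. (\<alpha> j)\<^sup>2"
  have s2: "scale\<^sup>2 = t0 ^ 3 / ?A" unfolding scale_def using sum_\<alpha>_pos t0 by simp
  have ld: "limit_density (scale * x) = (1 / sqrt (2 * pi * t0)) ^ m * limit_weight \<alpha> \<mu> t0 m K x" for x
  proof -
    have "curvature * (scale * x)\<^sup>2 = x\<^sup>2 / 2"
      using sum_\<alpha>_pos t0 by (simp add: power_mult_distrib s2 curvature_def)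
    moreover have "\<mu> j / sqrt t0 * (scale * x) = \<mu> j * t0 / sqrt ?A * x" for j
    proof -
      have "scale = t0 * sqrt t0 / sqrt ?A"
        unfolding scale_def using t0 by (simp add: real_sqrt_divide power3_eq_cube real_sqrt_mult)
      then show ?thesis using t0 by simp
    qed
    ultimately show ?thesis by (simp add: limit_density_def limit_weight_def)
  qed
  have "mass S = \<bar>scale\<bar> *\<^sub>R (\<integral>x. indicator S (0 + scale * x) *\<^sub>R limit_density (0 + scale * x) \<partial>lborel)"
    unfolding mass_def set_lebesgue_integral_def
    by (rule lborel_integral_real_affine) (use scale_pos in simp)
  also have "(\<integral>x. indicator S (0 + scale * x) *\<^sub>R limit_density (0 + scale * x) \<partial>lborel)
    = (\<integral>x. (1 / sqrt (2 * pi * t0)) ^ m * (indicator {x. scale * x \<in> S} x *\<^sub>R limit_weight \<alpha> \<mu> t0 m K x) \<partial>lborel)"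
    by (intro Bochner_Integration.integral_cong) (auto simp: ld indicator_def)
  also have "\<dots> = (1 / sqrt (2 * pi * t0)) ^ m * (LBINT x:{x. scale * x \<in> S}. limit_weight \<alpha> \<mu> t0 m K x)"
    by (simp add: set_lebesgue_integral_def)
  finally show ?thesis using scale_pos by simp
qed

lemma limit_cdf_eq: "limit_cdf \<alpha> \<mu> t0 m K s = mass {..s * scale} / mass UNIV"
proof -
  have "{x. scale * x \<in> {..s * scale}} = {..s}" using scale_pos by (auto simp: mult.commute)
  moreover have "0 < (1 / sqrt (2 * pi * t0)) ^ m" using t0 by simp
  ultimately show ?thesis
    using scale_pos t0 by (simp add: limit_cdf_def mass_scaled set_lebesgue_integral_def)
qed

text \<open>For u > 0 the conditioned event is that of a ruin time at most t0 u + s scale sqrt u.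
  Numerator and denominator have the same normalisation, so their quotient tends to a quotient of
  masses in which H cancels.\<close>

lemma ruin_time_cdf_main: "(scaled_ruin_time_cdf M B d \<alpha> \<mu> t0 m s \<longlongrightarrow> limit_cdf \<alpha> \<mu> t0 m K s) at_top"
proof -
  define c where "c u = t0 * u + s * scale * sqrt u" for u
  define N where "N u = {\<omega>\<in>space M. ruin_time B d \<alpha> \<mu> u \<omega> \<le> ereal (c u)}" for u
  have N_eq: "N u = (\<Inter>n. hit_before (ereal (c u + 1 / real (Suc n))) u)" if "0 < u" for u
  proof -
    have "\<omega> \<in> N u \<longleftrightarrow> \<omega> \<in> (\<Inter>n. hit_before (ereal (c u + 1 / real (Suc n))) u)" if \<omega>: "\<omega> \<in> space M" for \<omega>
      using \<omega> by (simp only: N_def ruin_time_le_iff(1)[OF \<open>0 < u\<close> \<omega>] mem_Collect_eq INT_iff UNIV_I) simp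
    moreover have "\<omega> \<in> space M" if "\<omega> \<in> N u \<or> \<omega> \<in> (\<Inter>n. hit_before (ereal (c u + 1 / real (Suc n))) u)" for \<omega>
      using that by (auto simp: N_def hit_before_def)
    ultimately show ?thesis by (intro set_eqI) metis
  qed
  have N_sets: "N u \<in> sets M" if "0 < u" for u
    unfolding N_eq[OF that] by (intro sets.countable_INT') auto
  have lower: "scaled u (hit_before (ereal (c u + 0)) u) \<le> scaled u (N u)"
    and upper: "scaled u (N u) \<le> scaled u (hit_before (ereal (c u + 1)) u)" if u: "0 < u" for u
  proof -
    have nf: "0 \<le> norm_factor u / sqrt u" using u by (simp add: norm_factor_def)
    have "hit_before (ereal (c u + 0)) u \<subseteq> N u"
      unfolding N_eq[OF u]
    proof (rule INT_greatest)
      fix n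
      show "hit_before (ereal (c u + 0)) u \<subseteq> hit_before (ereal (c u + 1 / real (Suc n))) u"
        by (rule hit_before_mono) simp
    qed
    then show "scaled u (hit_before (ereal (c u + 0)) u) \<le> scaled u (N u)"
      unfolding scaled_def using N_sets[OF u] nf by (intro mult_left_mono finite_measure_mono)
    \<comment> \<open>The member n = 0 of the intersection has the cutoff c u + 1.\<close>
    have "N u \<subseteq> hit_before (ereal (c u + 1)) u"
      unfolding N_eq[OF u] by (intro INF_lower2[of 0]) auto
    then show "scaled u (N u) \<le> scaled u (hit_before (ereal (c u + 1)) u)"
      unfolding scaled_def using nf by (intro mult_left_mono finite_measure_mono) auto
  qed
  have limN: "((\<lambda>u. scaled u (N u)) \<longlongrightarrow> C.H * mass {..s * scale}) at_top"
  proof (rule tendsto_sandwich)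
    show "((\<lambda>u. scaled u (hit_before (ereal (c u + 0)) u)) \<longlongrightarrow> C.H * mass {..s * scale}) at_top"
      unfolding c_def by (rule ruin_time_limit)
    show "((\<lambda>u. scaled u (hit_before (ereal (c u + 1)) u)) \<longlongrightarrow> C.H * mass {..s * scale}) at_top"
      unfolding c_def by (rule ruin_time_limit)
    show "\<forall>\<^sub>F u in at_top. scaled u (hit_before (ereal (c u + 0)) u) \<le> scaled u (N u)"
      using eventually_gt_at_top[of 0] by eventually_elim (rule lower)
    show "\<forall>\<^sub>F u in at_top. scaled u (N u) \<le> scaled u (hit_before (ereal (c u + 1)) u)"
      using eventually_gt_at_top[of 0] by eventually_elim (rule upper)
  qed
  have Hpos: "0 < C.H" by (rule C.H_pos[OF \<mu>1])
  have HJ: "0 < C.H * mass UNIV" using Hpos mass_UNIV_pos by simp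
  have "((\<lambda>u. scaled u (N u) / scaled u (hit_before \<infinity> u)) \<longlongrightarrow> (C.H * mass {..s * scale}) / (C.H * mass UNIV)) at_top"
    by (intro tendsto_divide limN ruin_limit) (use Hpos mass_UNIV_pos in simp)
  also have "(C.H * mass {..s * scale}) / (C.H * mass UNIV) = limit_cdf \<alpha> \<mu> t0 m K s"
    using Hpos by (simp add: limit_cdf_eq)
  finally show ?thesis
  proof (rule Lim_transform_eventually)
    show "\<forall>\<^sub>F u in at_top. scaled u (N u) / scaled u (hit_before \<infinity> u) = scaled_ruin_time_cdf M B d \<alpha> \<mu> t0 m s u"
      using eventually_gt_at_top[of 0]
    proof eventually_elim
      case (elim u)
      have nf: "0 < norm_factor u / sqrt u" using elim by (simp add: norm_factor_def)
      have sq: "sqrt (t0 ^ 3 / (\<Sum>j=1..m. (\<alpha> j)\<^sup>2) * u) = scale * sqrt u"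
        unfolding scale_def real_sqrt_mult ..
      have sp: "0 < scale * sqrt u" using scale_pos elim by simp
      have iff: "((ruin_time B d \<alpha> \<mu> u \<omega> - ereal (t0 * u)) / ereal (scale * sqrt u) \<le> ereal s \<and> ruin_time B d \<alpha> \<mu> u \<omega> < \<infinity>)
        \<longleftrightarrow> ruin_time B d \<alpha> \<mu> u \<omega> \<le> ereal (c u)" if \<omega>: "\<omega> \<in> space M" for \<omega>
      proof (cases "ruin_time B d \<alpha> \<mu> u \<omega>")
        case (real r)
        define w where "w = scale * sqrt u"
        have w: "0 < w" using sp by (simp add: w_def)
        then have "(ereal r - ereal (t0 * u)) / ereal w = ereal ((r - t0 * u) / w)" by (simp add: divide_ereal_def divide_inverse)
        moreover have "(r - t0 * u) / w \<le> s \<longleftrightarrow> r \<le> t0 * u + s * w" using w by (simp add: pos_divide_le_eq algebra_simps)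
        ultimately show ?thesis unfolding w_def[symmetric] real c_def by (simp add: w_def mult.assoc)
      next
        case MInf
        then show ?thesis using ruin_time_le_iff(3)[OF elim \<omega>] by simp
      qed simp
      have num: "{\<omega>\<in>space M. (ruin_time B d \<alpha> \<mu> u \<omega> - ereal (t0 * u)) / ereal (scale * sqrt u) \<le> ereal s \<and> ruin_time B d \<alpha> \<mu> u \<omega> < \<infinity>} = N u"
        unfolding N_def using iff by blast
      have den: "{\<omega>\<in>space M. ruin_time B d \<alpha> \<mu> u \<omega> < \<infinity>} = hit_before \<infinity> u"
        using ruin_time_le_iff(2)[OF elim] by (auto simp: hit_before_def)
      have "scaled_ruin_time_cdf M B d \<alpha> \<mu> t0 m s u = prob (N u) / prob (hit_before \<infinity> u)"
        unfolding scaled_ruin_time_cdf_def cond_prob_def sq num den ..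
      moreover have nz: "norm_factor u / sqrt u \<noteq> 0" using nf by (rule less_imp_neq[THEN not_sym])
      ultimately show ?case by (simp only: scaled_def mult_divide_mult_cancel_left[OF nz])
    qed
  qed
qed

end

section \<open>The index selected by the blocks\<close>

lemma ratio_blocks_antimono:
  assumes "ratio_blocks n d \<alpha> \<mu> l k"
  shows "1 \<le> i \<Longrightarrow> i \<le> j \<Longrightarrow> j \<le> l + 1 \<Longrightarrow> k j \<le> k i"
    and "1 \<le> i \<Longrightarrow> i \<le> j \<Longrightarrow> j \<le> l \<Longrightarrow> \<bar>\<mu> (k j)\<bar> / \<alpha> (k j) \<le> \<bar>\<mu> (k i)\<bar> / \<alpha> (k i)"
    and "1 \<le> i \<Longrightarrow> i < j \<Longrightarrow> j \<le> l \<Longrightarrow> \<bar>\<mu> (k j)\<bar> / \<alpha> (k j) < \<bar>\<mu> (k i)\<bar> / \<alpha> (k i)"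
proof -
  have kstep: "k (j + 1) < k j" if "j \<in> {1..l}" for j
    using assms that by (auto simp: ratio_blocks_def)
  have rstep: "\<bar>\<mu> (k (j + 1))\<bar> / \<alpha> (k (j + 1)) < \<bar>\<mu> (k j)\<bar> / \<alpha> (k j)" if "j \<in> {1..<l}" for j
    using assms that by (simp add: ratio_blocks_def)
  show "k j \<le> k i" if "1 \<le> i" "i \<le> j" "j \<le> l + 1"
    using that(2,3)
  proof (induction j rule: dec_induct)
    case (step j)
    then show ?case using kstep[of j] that(1) by (simp add: Suc_eq_plus1)
  qed simp
  show mono: "\<bar>\<mu> (k j)\<bar> / \<alpha> (k j) \<le> \<bar>\<mu> (k i)\<bar> / \<alpha> (k i)" if "1 \<le> i" "i \<le> j" "j \<le> l" for i
    using that(2,3)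
  proof (induction j rule: dec_induct)
    case (step j)
    then show ?case using rstep[of j] that(1) by (simp add: Suc_eq_plus1)
  qed simp
  show "\<bar>\<mu> (k j)\<bar> / \<alpha> (k j) < \<bar>\<mu> (k i)\<bar> / \<alpha> (k i)" if "1 \<le> i" "i < j" "j \<le> l"
    using mono[of "i + 1"] rstep[of i] that by simp
qed

lemma ratio_blocks_const:
  assumes "ratio_blocks n d \<alpha> \<mu> l k" "i \<in> {1..l}" "k (i + 1) < j" "j \<le> k i"
  shows "\<bar>\<mu> j\<bar> / \<alpha> j = \<bar>\<mu> (k i)\<bar> / \<alpha> (k i)"
proof -
  have "\<forall>i\<in>{1..l}. \<forall>j\<in>{k (i + 1)<..k i}. \<bar>\<mu> j\<bar> / \<alpha> j = \<bar>\<mu> (k i)\<bar> / \<alpha> (k i)"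
    using assms(1) unfolding ratio_blocks_def by blast
  moreover have "j \<in> {k (i + 1)<..k i}" using assms by simp
  ultimately show ?thesis using assms(2) by blast
qed

text \<open>The block of j is given by the largest index i with j at most k i; that index is not l +
  1, because k (l + 1) = n.\<close>

lemma ratio_blocks_member:
  assumes rb: "ratio_blocks n d \<alpha> \<mu> l k" and j: "j \<in> {n + 1..d}"
  obtains i where "i \<in> {1..l}" "k (i + 1) < j" "j \<le> k i"
proof -
  have k: "1 \<le> l" "k 1 = d" "k (l + 1) = n" using rb by (auto simp: ratio_blocks_def)
  define S where "S = {i \<in> {1..l + 1}. j \<le> k i}"
  have S: "finite S" "S \<noteq> {}"
  proof -
    have "1 \<in> S" using k j by (simp add: S_def)
    then show "S \<noteq> {}" by auto
  qed (simp add: S_def)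
  define i where "i = Max S"
  have iS: "i \<in> S" unfolding i_def using S by (rule Max_in)
  have "i \<noteq> l + 1" using iS k j by (auto simp: S_def)
  then have il: "i \<in> {1..l}" using iS by (auto simp: S_def)
  have "i + 1 \<notin> S"
  proof
    assume "i + 1 \<in> S"
    then have "i + 1 \<le> i" unfolding i_def using S by (intro Max_ge) auto
    then show False by simp
  qed
  then have "k (i + 1) < j" using il by (auto simp: S_def)
  then show ?thesis using that[OF il] iS by (auto simp: S_def)
qed

lemma t_opt_props:
  assumes m: "1 \<le> m" and \<alpha>: "\<And>j. j \<in> {1..m} \<Longrightarrow> 0 < \<alpha> j" and \<mu>1: "0 < \<mu> (1::nat)"
  shows "0 < t_opt \<alpha> \<mu> m"
    and "(\<Sum>j=1..m. (\<alpha> j)\<^sup>2) = (t_opt \<alpha> \<mu> m)\<^sup>2 * (\<Sum>j=1..m. (\<mu> j)\<^sup>2)"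
    and "0 < (\<Sum>j=1..m. (\<mu> j)\<^sup>2)"
proof -
  have one: "1 \<in> {1..m}" using m by simp
  have "(\<alpha> 1)\<^sup>2 \<le> (\<Sum>j=1..m. (\<alpha> j)\<^sup>2)" by (rule member_le_sum[OF one]) auto
  moreover have "0 < (\<alpha> 1)\<^sup>2" using \<alpha>[OF one] by simp
  ultimately have A: "0 < (\<Sum>j=1..m. (\<alpha> j)\<^sup>2)" by linarith
  have "(\<mu> 1)\<^sup>2 \<le> (\<Sum>j=1..m. (\<mu> j)\<^sup>2)" by (rule member_le_sum[OF one]) auto
  moreover have "0 < (\<mu> 1)\<^sup>2" using \<mu>1 by simp
  ultimately show M: "0 < (\<Sum>j=1..m. (\<mu> j)\<^sup>2)" by linarith
  show "0 < t_opt \<alpha> \<mu> m" unfolding t_opt_def using A M by simp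
  show "(\<Sum>j=1..m. (\<alpha> j)\<^sup>2) = (t_opt \<alpha> \<mu> m)\<^sup>2 * (\<Sum>j=1..m. (\<mu> j)\<^sup>2)"
    unfolding t_opt_def using A M by simp
qed

text \<open>If the optimal time of block \<open>q\<close> is too late for block \<open>q\<close>, then dropping that block
  leaves the optimal time of the remaining coordinates above the same critical time; hence the
  first block whose optimal time precedes its critical time is the one selected.\<close>

lemma p_idx_exists:
  assumes rb: "ratio_blocks n d \<alpha> \<mu> l k" and n: "1 \<le> n"
    and \<alpha>: "\<And>j. j \<in> {1..d} \<Longrightarrow> 0 < \<alpha> j" and \<mu>1: "0 < \<mu> 1"
  shows "\<exists>i\<in>{1..l + 1}. t_crit \<alpha> \<mu> l k (i - 1) \<le> ereal (t_opt \<alpha> \<mu> (k i)) \<and>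
            ereal (t_opt \<alpha> \<mu> (k i)) < t_crit \<alpha> \<mu> l k i"
proof -
  have k: "1 \<le> l" "k 1 = d" "k (l + 1) = n" using rb by (auto simp: ratio_blocks_def)
  have kn: "n \<le> k i" "k i \<le> d" if "i \<in> {1..l + 1}" for i
    using ratio_blocks_antimono(1)[OF rb, of i "l + 1"] ratio_blocks_antimono(1)[OF rb, of 1 i] that k by auto
  have opt: "0 < t_opt \<alpha> \<mu> (k i)"
    "(\<Sum>j=1..k i. (\<alpha> j)\<^sup>2) = (t_opt \<alpha> \<mu> (k i))\<^sup>2 * (\<Sum>j=1..k i. (\<mu> j)\<^sup>2)"
    "0 < (\<Sum>j=1..k i. (\<mu> j)\<^sup>2)" if "i \<in> {1..l + 1}" for i
    using t_opt_props[of "k i" \<alpha> \<mu>] kn[OF that] n \<alpha> \<mu>1 by auto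
  define P where "P i \<longleftrightarrow> i \<in> {1..l + 1} \<and> ereal (t_opt \<alpha> \<mu> (k i)) < t_crit \<alpha> \<mu> l k i" for i
  \<comment> \<open>\<open>P\<close> records the upper inequality alone, which holds at l + 1 since
    \<open>t_crit\<close> is infinite there. The lower inequality is derived from
    minimality.\<close>
  have "P (l + 1)" by (simp add: P_def t_crit_def)
  then have Pp: "P (LEAST i. P i)" by (rule LeastI)
  define p where "p = (LEAST i. P i)"
  have p: "p \<in> {1..l + 1}" "ereal (t_opt \<alpha> \<mu> (k p)) < t_crit \<alpha> \<mu> l k p"
    using Pp by (auto simp: P_def p_def)
  have "t_crit \<alpha> \<mu> l k (p - 1) \<le> ereal (t_opt \<alpha> \<mu> (k p))"
  proof (cases "p = 1")
    case True
    then show ?thesis using opt(1)[OF p(1)] by (simp add: t_crit_def)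
  next
    case False
    define q where "q = p - 1"
    have q: "q \<in> {1..l}" "p = q + 1" using False p(1) by (auto simp: q_def)
    have q1: "q \<in> {1..l + 1}" using q by simp
    have "\<not> P q" using not_less_Least[of q P] q by (simp add: p_def)
    then have "t_crit \<alpha> \<mu> l k q \<le> ereal (t_opt \<alpha> \<mu> (k q))" using q1 by (simp add: P_def not_less)
    then have \<mu>q: "\<mu> (k q) \<noteq> 0" and le: "\<alpha> (k q) / \<bar>\<mu> (k q)\<bar> \<le> t_opt \<alpha> \<mu> (k q)"
      using q by (auto simp: t_crit_def split: if_splits)
    define \<tau> where "\<tau> = \<alpha> (k q) / \<bar>\<mu> (k q)\<bar>"
    have \<alpha>q: "0 < \<alpha> (k q)" using \<alpha> kn[OF q1] n by auto
    have \<tau>: "0 < \<tau>" using \<alpha>q \<mu>q by (simp add: \<tau>_def)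
    \<comment> \<open>The ratio is constant on the block, so the block contributes to the sum of
      \<alpha>_j^2 exactly \<tau>^2 times its contribution to the sum of \<mu>_j^2. The inequality
      for k q thus survives when the block is dropped.\<close>
    have blk: "(\<alpha> j)\<^sup>2 = \<tau>\<^sup>2 * (\<mu> j)\<^sup>2" if j: "j \<in> {k p + 1..k q}" for j
    proof -
      have "\<bar>\<mu> j\<bar> / \<alpha> j = \<bar>\<mu> (k q)\<bar> / \<alpha> (k q)" 
        by (rule ratio_blocks_const[OF rb q(1)]) (use j q in auto)
      moreover have "0 < \<alpha> j" using \<alpha>[of j] j kn[OF q1] by auto
      ultimately have "\<alpha> j = \<tau> * \<bar>\<mu> j\<bar>" using \<alpha>q \<mu>q by (simp add: \<tau>_def field_simps)
      then show ?thesis by (simp add: power_mult_distrib)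
    qed
    have split: "(\<Sum>j=1..k q. f j) = (\<Sum>j=1..k p. f j) + (\<Sum>j=k p + 1..k q. f j)" for f :: "nat \<Rightarrow> real"
    proof -
      have "k p \<le> k q" using q p(1) by (intro ratio_blocks_antimono(1)[OF rb]) auto
      then have "{1..k q} = {1..k p} \<union> {k p + 1..k q}" by auto
      then show ?thesis by (simp add: sum.union_disjoint)
    qed
    have "\<tau>\<^sup>2 * (\<Sum>j=1..k q. (\<mu> j)\<^sup>2) \<le> (t_opt \<alpha> \<mu> (k q))\<^sup>2 * (\<Sum>j=1..k q. (\<mu> j)\<^sup>2)"
      using le \<tau> \<alpha>q opt(3)[OF q1] by (intro mult_right_mono power_mono) (auto simp: \<tau>_def)
    also have "\<dots> = (\<Sum>j=1..k q. (\<alpha> j)\<^sup>2)" by (rule opt(2)[OF q1, symmetric])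
    finally have "\<tau>\<^sup>2 * (\<Sum>j=1..k p. (\<mu> j)\<^sup>2) + \<tau>\<^sup>2 * (\<Sum>j=k p + 1..k q. (\<mu> j)\<^sup>2) \<le>
        (\<Sum>j=1..k p. (\<alpha> j)\<^sup>2) + (\<Sum>j=k p + 1..k q. (\<alpha> j)\<^sup>2)"
      unfolding split by (simp add: distrib_left)
    moreover have "(\<Sum>j=k p + 1..k q. (\<alpha> j)\<^sup>2) = \<tau>\<^sup>2 * (\<Sum>j=k p + 1..k q. (\<mu> j)\<^sup>2)"
      unfolding sum_distrib_left by (rule sum.cong[OF refl blk])
    ultimately have "\<tau>\<^sup>2 * (\<Sum>j=1..k p. (\<mu> j)\<^sup>2) \<le> (t_opt \<alpha> \<mu> (k p))\<^sup>2 * (\<Sum>j=1..k p. (\<mu> j)\<^sup>2)"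
      unfolding opt(2)[OF p(1), symmetric] by linarith
    then have "\<tau>\<^sup>2 \<le> (t_opt \<alpha> \<mu> (k p))\<^sup>2" using opt(3)[OF p(1)] by simp
    then have "\<tau> \<le> t_opt \<alpha> \<mu> (k p)" using opt(1)[OF p(1)] by (rule power2_le_imp_le[OF _ less_imp_le])
    then show ?thesis using q \<mu>q by (simp add: t_crit_def \<tau>_def)
  qed
  then show ?thesis using p by blast
qed

text \<open>For j > n the sign of \<alpha>_j + \<mu>_j t0 is that of 1 - (|\<mu>_j| / \<alpha>_j)
  t0, and the ratios increase towards the first block. The upper inequality for p makes all blocks
  from p on active; the lower one makes the earlier blocks at most critical.\<close>

lemma ruin_setup_blocks:
  assumes d: "1 \<le> n" "n < d" and B: "standard_BM_vec M d B"
    and \<alpha>: "\<And>j. j \<in> {1..d} \<Longrightarrow> 0 < \<alpha> j"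
    and \<mu>p: "\<And>j. j \<in> {1..n} \<Longrightarrow> 0 < \<mu> j"
    and \<mu>n: "\<And>j. j \<in> {n + 1..d} \<Longrightarrow> \<mu> j \<le> 0"
    and rb: "ratio_blocks n d \<alpha> \<mu> l k"
  shows "ruin_setup M B d \<alpha> \<mu> (k (p_idx \<alpha> \<mu> l k)) (t_opt \<alpha> \<mu> (k (p_idx \<alpha> \<mu> l k))) (K_set \<alpha> \<mu> l k)"
proof -
  have k: "1 \<le> l" "k 1 = d" "k (l + 1) = n" using rb by (auto simp: ratio_blocks_def)
  have kn: "n \<le> k i" "k i \<le> d" if "i \<in> {1..l + 1}" for i
    using ratio_blocks_antimono(1)[OF rb, of i "l + 1"] ratio_blocks_antimono(1)[OF rb, of 1 i] that k by auto
  have \<mu>1: "0 < \<mu> 1" using \<mu>p d by simp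
  let ?S = "{i \<in> {1..l + 1}. t_crit \<alpha> \<mu> l k (i - 1) \<le> ereal (t_opt \<alpha> \<mu> (k i)) \<and>
            ereal (t_opt \<alpha> \<mu> (k i)) < t_crit \<alpha> \<mu> l k i}"
  define p where "p = p_idx \<alpha> \<mu> l k"
  have "?S \<noteq> {}" using p_idx_exists[OF rb d(1) \<alpha> \<mu>1] by auto
  then have "p \<in> ?S" unfolding p_def p_idx_def by (intro Min_in) auto
  then have p: "p \<in> {1..l + 1}" and lo: "t_crit \<alpha> \<mu> l k (p - 1) \<le> ereal (t_opt \<alpha> \<mu> (k p))"
    and hi: "ereal (t_opt \<alpha> \<mu> (k p)) < t_crit \<alpha> \<mu> l k p" by auto
  define m where "m = k p"
  define t0 where "t0 = t_opt \<alpha> \<mu> m"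
  have m: "1 \<le> m" "m \<le> d" "n \<le> m" using kn[OF p] d by (auto simp: m_def)
  have opt: "0 < t0" "(\<Sum>j=1..m. (\<alpha> j)\<^sup>2) = t0\<^sup>2 * (\<Sum>j=1..m. (\<mu> j)\<^sup>2)"
    using t_opt_props[of m \<alpha> \<mu>] m \<alpha> \<mu>1 by (auto simp: t0_def)
  have \<alpha>k: "0 < \<alpha> (k i)" if "i \<in> {1..l + 1}" for i using \<alpha> kn[OF that] d by auto
  have ratio: "\<bar>\<mu> j\<bar> / \<alpha> j = \<bar>\<mu> (k i)\<bar> / \<alpha> (k i)" if "i \<in> {1..l}" "k (i + 1) < j" "j \<le> k i" for i j
    by (rule ratio_blocks_const[OF rb that])
  have active: "0 < \<alpha> j / t0 + \<mu> j" if j: "j \<in> {1..m}" for j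
  proof (cases "j \<le> n")
    case True
    then show ?thesis using \<mu>p[of j] \<alpha>[of j] j m opt(1) by (auto intro!: add_pos_pos)
  next
    case False
    then have jn: "j \<in> {n + 1..d}" using j m by auto
    obtain i where i: "i \<in> {1..l}" "k (i + 1) < j" "j \<le> k i" by (rule ratio_blocks_member[OF rb jn])
    have "p \<le> i"
    proof (rule ccontr)
      assume "\<not> p \<le> i"
      then have "k p \<le> k (i + 1)" using i p by (intro ratio_blocks_antimono(1)[OF rb]) auto
      then show False using i j by (simp add: m_def)
    qed
    then have r: "\<bar>\<mu> j\<bar> / \<alpha> j \<le> \<bar>\<mu> (k p)\<bar> / \<alpha> (k p)"
      unfolding ratio[OF i] using ratio_blocks_antimono(2)[OF rb, of p i] p i by auto
    have pl: "p \<le> l" "1 \<le> p" using \<open>p \<le> i\<close> i p by auto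
    have "\<bar>\<mu> (k p)\<bar> / \<alpha> (k p) * t0 < 1"
    proof (cases "\<mu> (k p) = 0")
      case False
      then have "t0 < \<alpha> (k p) / \<bar>\<mu> (k p)\<bar>" using hi pl by (simp add: t_crit_def t0_def m_def)
      then show ?thesis using False \<alpha>k[OF p] by (simp add: field_simps)
    qed simp
    moreover have "\<bar>\<mu> j\<bar> / \<alpha> j * t0 \<le> \<bar>\<mu> (k p)\<bar> / \<alpha> (k p) * t0" using r opt(1) by (intro mult_right_mono) auto
    ultimately have "\<bar>\<mu> j\<bar> / \<alpha> j * t0 < 1" by simp
    then have "\<bar>\<mu> j\<bar> < \<alpha> j / t0" using opt(1) \<alpha>[of j] jn by (simp add: field_simps)
    then show ?thesis by linarith
  qed
  \<comment> \<open>Equality can occur only in block p - 1, as still earlier blocks have strictly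
    larger ratios; there it means that \<open>t0\<close> is the critical time, as in
    \<open>K_set\<close>.\<close>
  have inact: "\<alpha> j + \<mu> j * t0 \<le> 0 \<and> (\<alpha> j + \<mu> j * t0 = 0 \<longleftrightarrow> j \<in> K_set \<alpha> \<mu> l k)" if j: "j \<in> {m + 1..d}" for j
  proof -
    have jn: "j \<in> {n + 1..d}" using j m by auto
    obtain i where i: "i \<in> {1..l}" "k (i + 1) < j" "j \<le> k i" by (rule ratio_blocks_member[OF rb jn])
    have ip: "i < p"
    proof (rule ccontr)
      assume "\<not> i < p"
      then have "k i \<le> k p" using i p by (intro ratio_blocks_antimono(1)[OF rb]) auto
      then show False using i j by (simp add: m_def)
    qed
    define q where "q = p - 1"
    have q: "q \<in> {1..l}" "p = q + 1" "i \<le> q" using ip p i by (auto simp: q_def)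
    have \<alpha>q: "0 < \<alpha> (k q)" using \<alpha>k q by simp
    have "t_crit \<alpha> \<mu> l k q \<le> ereal t0" using lo by (simp add: q_def t0_def m_def)
    then have \<mu>q: "\<mu> (k q) \<noteq> 0" and qle: "\<alpha> (k q) / \<bar>\<mu> (k q)\<bar> \<le> t0"
      using q by (auto simp: t_crit_def split: if_splits)
    have r1: "1 \<le> \<bar>\<mu> (k q)\<bar> / \<alpha> (k q) * t0" using qle \<alpha>q \<mu>q by (simp add: field_simps)
    have r2: "\<bar>\<mu> (k q)\<bar> / \<alpha> (k q) \<le> \<bar>\<mu> j\<bar> / \<alpha> j"
      unfolding ratio[OF i] using ratio_blocks_antimono(2)[OF rb, of i q] i q by auto
    have r3: "\<bar>\<mu> (k q)\<bar> / \<alpha> (k q) * t0 \<le> \<bar>\<mu> j\<bar> / \<alpha> j * t0" using r2 opt(1) by (intro mult_right_mono) auto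
    have aj: "0 < \<alpha> j" using \<alpha> jn by auto
    have "\<mu> j = - \<bar>\<mu> j\<bar>" using \<mu>n[OF jn] by simp
    then have eq: "\<alpha> j + \<mu> j * t0 = \<alpha> j * (1 - \<bar>\<mu> j\<bar> / \<alpha> j * t0)" using aj by (simp add: field_simps)
    have "1 - \<bar>\<mu> j\<bar> / \<alpha> j * t0 \<le> 0" using r1 r3 by linarith
    then have le: "\<alpha> j + \<mu> j * t0 \<le> 0" unfolding eq by (rule mult_nonneg_nonpos[OF less_imp_le[OF aj]])
    have crit: "t_crit \<alpha> \<mu> l k (p - 1) = ereal t0 \<longleftrightarrow> \<bar>\<mu> (k q)\<bar> / \<alpha> (k q) * t0 = 1"
      using q \<mu>q \<alpha>q by (auto simp: t_crit_def field_simps)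
    have "\<alpha> j + \<mu> j * t0 = 0 \<longleftrightarrow> \<bar>\<mu> j\<bar> / \<alpha> j * t0 = 1" unfolding eq using aj by auto
    also have "\<dots> \<longleftrightarrow> \<bar>\<mu> (k q)\<bar> / \<alpha> (k q) * t0 = 1 \<and> i = q"
    proof
      assume a: "\<bar>\<mu> j\<bar> / \<alpha> j * t0 = 1"
      have "i = q"
      proof (rule ccontr)
        assume "i \<noteq> q"
        then have "\<bar>\<mu> (k q)\<bar> / \<alpha> (k q) < \<bar>\<mu> (k i)\<bar> / \<alpha> (k i)" using q i by (intro ratio_blocks_antimono(3)[OF rb]) auto
        then have "\<bar>\<mu> (k q)\<bar> / \<alpha> (k q) * t0 < \<bar>\<mu> j\<bar> / \<alpha> j * t0" unfolding ratio[OF i] using opt(1) by (intro mult_strict_right_mono)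
        then show False using a r1 by linarith
      qed
      then show "\<bar>\<mu> (k q)\<bar> / \<alpha> (k q) * t0 = 1 \<and> i = q" using a r1 r3 by linarith
    next
      assume a: "\<bar>\<mu> (k q)\<bar> / \<alpha> (k q) * t0 = 1 \<and> i = q"
      then have iq: "i = q" by (rule conjunct2)
      show "\<bar>\<mu> j\<bar> / \<alpha> j * t0 = 1" unfolding ratio[OF i] unfolding iq using a by (rule conjunct1)
    qed
    also have "i = q \<longleftrightarrow> j \<in> {k p + 1..k (p - 1)}"
    proof
      assume "i = q" then show "j \<in> {k p + 1..k (p - 1)}" using i q by simp
    next
      assume a: "j \<in> {k p + 1..k (p - 1)}"
      show "i = q"
      proof (rule ccontr)
        assume "i \<noteq> q"
        then have "k q \<le> k (i + 1)" using q i by (intro ratio_blocks_antimono(1)[OF rb]) auto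
        then show False using a i q by simp
      qed
    qed
    finally have "\<alpha> j + \<mu> j * t0 = 0 \<longleftrightarrow> t_crit \<alpha> \<mu> l k (p - 1) = ereal t0 \<and> j \<in> {k p + 1..k (p - 1)}"
      unfolding crit .
    then have "\<alpha> j + \<mu> j * t0 = 0 \<longleftrightarrow> j \<in> K_set \<alpha> \<mu> l k"
      by (simp add: K_set_def p_def[symmetric] t0_def m_def)
    then show ?thesis using le by simp
  qed
  have Ksub: "K_set \<alpha> \<mu> l k \<subseteq> {m + 1..d}"
  proof
    fix j assume "j \<in> K_set \<alpha> \<mu> l k"
    then have crit: "t_crit \<alpha> \<mu> l k (p - 1) = ereal t0" and j: "j \<in> {k p + 1..k (p - 1)}"
      by (auto simp: K_set_def p_def[symmetric] t0_def m_def Let_def split: if_splits)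
    \<comment> \<open>\<open>t_crit\<close> at 0 is 0, which differs from the positive
      \<open>t0\<close>; so the unspecified value \<open>k 0\<close> never enters
      \<open>K_set\<close>.\<close>
    have "p - 1 \<noteq> 0" using crit opt(1) by (auto simp: t_crit_def)
    then have "k (p - 1) \<le> d" using p by (intro kn(2)) auto
    then show "j \<in> {m + 1..d}" using j by (simp add: m_def)
  qed
  have "ruin_setup M B d \<alpha> \<mu> m t0 (K_set \<alpha> \<mu> l k)"
  proof -
    have "1 \<in> {1..d}" using d by simp
    then have "prob_space M" using B standard_BM_D(1) unfolding standard_BM_vec_def by blast
    then interpret prob_space M .
    show ?thesis
      by unfold_locales (use B d m \<alpha> \<mu>1 opt active Ksub inact in \<open>auto simp: subset_iff order_less_le\<close>)
  qed
  then show ?thesis by (simp add: t0_def m_def p_def)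
qed

lemma ruin_setup_positive_drift:
  assumes d: "1 \<le> d" and B: "standard_BM_vec M d B"
    and \<alpha>: "\<And>j. j \<in> {1..d} \<Longrightarrow> 0 < \<alpha> j"
    and \<mu>: "\<And>j. j \<in> {1..d} \<Longrightarrow> 0 < \<mu> j"
  shows "ruin_setup M B d \<alpha> \<mu> d (t_opt \<alpha> \<mu> d) {}"
proof -
  have one: "1 \<in> {1..d}" using d by simp
  then have "prob_space M" using B standard_BM_D(1) unfolding standard_BM_vec_def by blast
  then interpret prob_space M .
  note opt = t_opt_props[where m = d and \<alpha> = \<alpha> and \<mu> = \<mu>, OF d \<alpha> \<mu>[OF one]]
  show ?thesis
    by unfold_locales (use B d \<alpha> \<mu> opt in \<open>auto intro!: add_pos_pos\<close>)
qed

theorem corollary3p5: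
  fixes M :: "'w measure"
    and B :: "real \<Rightarrow> 'w \<Rightarrow> nat \<Rightarrow> real"
    and \<alpha> \<mu> :: "nat \<Rightarrow> real"
    and n d :: nat
  assumes "2 \<le> d" and "1 \<le> n" and "n \<le> d"
    and "standard_BM_vec M d B"
    and "\<And>j. j \<in> {1..d} \<Longrightarrow> 0 < \<alpha> j"
    and "\<And>j. j \<in> {1..n} \<Longrightarrow> 0 < \<mu> j"
    and "\<And>j. j \<in> {n + 1..d} \<Longrightarrow> \<mu> j \<le> 0"
  shows "(n < d \<and> (\<forall>j\<in>{n + 1..<d}. \<bar>\<mu> j\<bar> / \<alpha> j \<le> \<bar>\<mu> (j + 1)\<bar> / \<alpha> (j + 1)) \<longrightarrow>
           (\<forall>l k. ratio_blocks n d \<alpha> \<mu> l k \<longrightarrow>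
             (let k\<^sub>p = k (p_idx \<alpha> \<mu> l k);
                  t\<^sub>0 = t_opt \<alpha> \<mu> k\<^sub>p;
                  K = K_set \<alpha> \<mu> l k
              in ruin_asymptotics M B d \<alpha> \<mu> t\<^sub>0 k\<^sub>p K \<and>
                 (\<forall>s. (scaled_ruin_time_cdf M B d \<alpha> \<mu> t\<^sub>0 k\<^sub>p s
                        \<longlongrightarrow> limit_cdf \<alpha> \<mu> t\<^sub>0 k\<^sub>p K s) at_top)))) \<and>
         (n = d \<longrightarrow>
             (let t\<^sub>0 = t_opt \<alpha> \<mu> d
              in ruin_asymptotics M B d \<alpha> \<mu> t\<^sub>0 d {} \<and>
                 (\<forall>s. (scaled_ruin_time_cdf M B d \<alpha> \<mu> t\<^sub>0 d s
                        \<longlongrightarrow> limit_cdf \<alpha> \<mu> t\<^sub>0 d {} s) at_top)))"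
proof (intro conjI impI allI)
  fix l k assume nd: "n < d \<and> (\<forall>j\<in>{n + 1..<d}. \<bar>\<mu> j\<bar> / \<alpha> j \<le> \<bar>\<mu> (j + 1)\<bar> / \<alpha> (j + 1))"
    and rb: "ratio_blocks n d \<alpha> \<mu> l k"
  have "ruin_setup M B d \<alpha> \<mu> (k (p_idx \<alpha> \<mu> l k)) (t_opt \<alpha> \<mu> (k (p_idx \<alpha> \<mu> l k))) (K_set \<alpha> \<mu> l k)"
    by (rule ruin_setup_blocks) (use assms nd rb in auto)
  then show "let k\<^sub>p = k (p_idx \<alpha> \<mu> l k); t\<^sub>0 = t_opt \<alpha> \<mu> k\<^sub>p; K = K_set \<alpha> \<mu> l k
      in ruin_asymptotics M B d \<alpha> \<mu> t\<^sub>0 k\<^sub>p K \<and>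
         (\<forall>s. (scaled_ruin_time_cdf M B d \<alpha> \<mu> t\<^sub>0 k\<^sub>p s \<longlongrightarrow> limit_cdf \<alpha> \<mu> t\<^sub>0 k\<^sub>p K s) at_top)"
    unfolding Let_def using ruin_setup.ruin_asymptotics_main ruin_setup.ruin_time_cdf_main by blast
next
  assume nd: "n = d"
  have "ruin_setup M B d \<alpha> \<mu> d (t_opt \<alpha> \<mu> d) {}"
    by (rule ruin_setup_positive_drift) (use assms nd in auto)
  then show "let t\<^sub>0 = t_opt \<alpha> \<mu> d
      in ruin_asymptotics M B d \<alpha> \<mu> t\<^sub>0 d {} \<and>
         (\<forall>s. (scaled_ruin_time_cdf M B d \<alpha> \<mu> t\<^sub>0 d s \<longlongrightarrow> limit_cdf \<alpha> \<mu> t\<^sub>0 d {} s) at_top)"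
    unfolding Let_def using ruin_setup.ruin_asymptotics_main ruin_setup.ruin_time_cdf_main by blast
qed

end
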